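(* Let $p,l\ge3$ be integers and consider the $p$-spin model on a random $l$-regular hypergraph on $N$ spins at temperature $T=1/\beta>0$, with heat-bath Glauber dynamics, and let $\tau_i(\varepsilon)$, $0<\varepsilon<1$, be the correlation time of spin $\sigma_i$. Let $T^{\rm fast}_{p,l}=\big(\operatorname{arctanh}(1/(l(p-1)))\big)^{-1}$, and let $T^{\rm barr}_{p,l}$, $T^{\rm ann}_{p,l}$ be the temperatures defined in the context. (1) If $T>T^{\rm fast}_{p,l}$, then $\tau_i(\varepsilon)\le\frac1\kappa\log\frac{1}{\kappa\varepsilon}$, where $\kappa=1-l(p-1)\tanh\beta$. (2) If $T^{\rm ann}_{p,l}<T<T^{\rm barr}_{p,l}$, then there exist constants $q_*>0$ and $\Upsilon>0$ such that, for any $0<\delta<1/4$, with high probability $\tau_i(\varepsilon)\ge e^{N[\Upsilon-\delta]}$ for at least $N(q_*-\delta-\varepsilon)$ of the spins $\sigma_i$.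
   Context: Model: spins $\sigma=(\sigma_1,\dots,\sigma_N)\in\{+1,-1\}^N$, $\mu(\sigma)=\frac{1}{Z(\beta)}e^{-\beta E(\sigma)}$, $E(\sigma)=-\sum_{a=1}^M J_a\prod_{i\in\partial a}\sigma_i$. The $J_a$ are i.i.d. uniform in $\{+1,-1\}$. The bipartite factor graph with variable nodes $1,\dots,N$ and function nodes $1,\dots,M$ ($\partial a$ = set of variable nodes adjacent to $a$, $\partial i$ = set of function nodes adjacent to $i$) is random, independent of the $J_a$, drawn from the configuration model: $Nl=Mp$; each variable node has $l$ sockets, each function node $p$ sockets, the sockets on the two sides are matched by a uniformly random permutation of $Nl$ elements, and a multiple edge is removed if its multiplicity is even and replaced by a single edge if it is odd. "With high probability" means with probability (over graph and couplings) tending to $1$ as $N\to\infty$. Dynamics: each spin has an independent rate-one Poisson clock; when the clock of $i$ rings, with current configuration $\sigma$, spin $i$ is set to $s\in\{\pm1\}$ with probability $\frac12(1+s\tanh\beta h_i(\sigma))$, $h_i(\sigma)=\sum_{a\in\partial i}J_a\prod_{j\in\partial a\setminus i}\sigma_j$. $\langle\cdot\rangle$ is expectation for the stationary process, $\sigma(0)\sim\mu$, for given graph and couplings. $C_i(t)=\langle\sigma_i(0)\sigma_i(t)\rangle-\langle\sigma_i\rangle^2$ and $\tau_i(\varepsilon)=\inf\{\tau\ge0: C_i(t)\le\varepsilon\ \forall t\ge\tau\}$. Temperatures: $\phi(\beta)=\log2+\frac lp\log\cosh\beta$. With $p_\pm(x)=\frac{(1+x)^p\pm(1-x)^p}{2}$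 and $h(x)=-x\log x-(1-x)\log(1-x)$, for $q\in[-1,1]$ let $$\phi(q;\beta)=\log2-(l-1)h\!\left(\tfrac{1-q}{2}\right)+\tfrac lp\log\big((\cosh2\beta)p_+(z_q)+p_-(z_q)\big)-l\,\tfrac{1-q}{2}\log z_q,$$ where $z_q$ is the unique non-negative solution of $z_q\frac{(\cosh2\beta)p_+'(z_q)+p_-'(z_q)}{(\cosh2\beta)p_+(z_q)+p_-(z_q)}=p\,\frac{1-q}{2}$ (values at $q=\pm1$ by continuity; $\phi(1;\beta)=\phi(2\beta)$). $\beta^{\rm ann}_{p,l}\in(0,\infty]$ is the largest $\beta$ such that for every $\beta'<\beta$ the function $q\mapsto\phi(q;\beta')$ achieves its global maximum at $q=0$; $T^{\rm ann}_{p,l}=1/\beta^{\rm ann}_{p,l}$ ($=0$ if $\beta^{\rm ann}_{p,l}=\infty$). Let $U(q;\beta)=\phi(1;\beta)-\phi(q;\beta)$, $\Upsilon_0(\beta)=\sup_{q\in(0,1]}U(q;\beta)$, $\widehat\phi(\beta,\alpha)=\alpha\phi((2-\alpha^{-1})\beta)+(1-\alpha)\phi(2\beta)-\phi(\beta)$, and $\Upsilon(\beta)=\sup_{\alpha\in(1/2,1)}[(1-\alpha)\Upsilon_0(\beta)-\widehat\phi(\beta,\alpha)]$. $\beta^{\rm barr}_{p,l}$ is the smallest $\beta$ such that $\Upsilon(\beta')>0$ for all $\beta'>\beta$, and $T^{\rm barr}_{p,l}=1/\beta^{\rm barr}_{p,l}$. *)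

theory Defs
  imports "HOL-Probability.Probability" "HOL-Probability.Product_PMF"
begin

section \<open>The spin model on a factor graph\<close>

text \<open>
  Variable nodes are \<open>0, \<dots>, N - 1\<close>, function nodes are \<open>0, \<dots>, M - 1\<close>. A factor graph \<open>G\<close> is its
  set of edges \<open>(i, a)\<close>, with \<open>i\<close> a variable node and \<open>a\<close> a function node.
\<close>

type_synonym factor_graph = "(nat \<times> nat) set"
type_synonym config = "nat \<Rightarrow> real"

definition fun_nbrs :: "factor_graph \<Rightarrow> nat \<Rightarrow> nat set" where
  "fun_nbrs G a = {i. (i, a) \<in> G}"

definition var_nbrs :: "factor_graph \<Rightarrow> nat \<Rightarrow> nat set" where
  "var_nbrs G i = {a. (i, a) \<in> G}"

definition configs :: "nat \<Rightarrow> config set" where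
  "configs N = {..<N} \<rightarrow>\<^sub>E {-1, 1}"

definition energy :: "nat \<Rightarrow> factor_graph \<Rightarrow> (nat \<Rightarrow> real) \<Rightarrow> config \<Rightarrow> real" where
  "energy M G J \<sigma> = - (\<Sum>a<M. J a * (\<Prod>i\<in>fun_nbrs G a. \<sigma> i))"

definition partition_function ::
  "real \<Rightarrow> nat \<Rightarrow> nat \<Rightarrow> factor_graph \<Rightarrow> (nat \<Rightarrow> real) \<Rightarrow> real" where
  "partition_function \<beta> N M G J = (\<Sum>\<sigma>\<in>configs N. exp (- \<beta> * energy M G J \<sigma>))"

definition gibbs ::
  "real \<Rightarrow> nat \<Rightarrow> nat \<Rightarrow> factor_graph \<Rightarrow> (nat \<Rightarrow> real) \<Rightarrow> config measure" where
  "gibbs \<beta> N M G J =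
     point_measure (configs N)
       (\<lambda>\<sigma>. ennreal (exp (- \<beta> * energy M G J \<sigma>) / partition_function \<beta> N M G J))"


section \<open>Heat-bath Glauber dynamics\<close>

definition local_field :: "factor_graph \<Rightarrow> (nat \<Rightarrow> real) \<Rightarrow> nat \<Rightarrow> config \<Rightarrow> real" where
  "local_field G J i \<sigma> = (\<Sum>a\<in>var_nbrs G i. J a * (\<Prod>j\<in>fun_nbrs G a - {i}. \<sigma> j))"

text \<open>
  The sources of randomness of the dynamics: \<open>w (i, k) = (x, v)\<close>, where \<open>x\<close> is the waiting time
  before ring number \<open>k\<close> (counted from \<open>0\<close>) of the clock of spin \<open>i\<close>, which is exponential of
  rate one, and \<open>v\<close> is a uniform variable in \<open>[0, 1]\<close> deciding the value of the spin at that ring.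
  All of them are independent.
\<close>

type_synonym clocks = "nat \<times> nat \<Rightarrow> real \<times> real"

definition clock_space :: "nat \<Rightarrow> clocks measure" where
  "clock_space N =
     (\<Pi>\<^sub>M ik\<in>{..<N} \<times> UNIV.
        density lborel (\<lambda>x. ennreal (exponential_density 1 x)) \<Otimes>\<^sub>M uniform_measure lborel {0..1})"

definition ring_time :: "clocks \<Rightarrow> nat \<Rightarrow> nat \<Rightarrow> real" where
  "ring_time w i k = (\<Sum>j\<le>k. fst (w (i, j)))"

definition ring_count :: "clocks \<Rightarrow> real \<Rightarrow> nat \<Rightarrow> nat" where
  "ring_count w t i = card {k. ring_time w i k \<le> t}"

text \<open>
  The rings \<open>(i, k)\<close> that occur up to time \<open>t\<close>, in chronological order. Almost surely the counts are
  finite and there are no simultaneous rings, so the values of \<open>card\<close> on infinite sets and the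
  order of simultaneous rings are irrelevant.
\<close>

definition rings :: "nat \<Rightarrow> clocks \<Rightarrow> real \<Rightarrow> (nat \<times> nat) list" where
  "rings N w t =
     sort_key (\<lambda>(i, k). ring_time w i k)
       (concat (map (\<lambda>i. map (\<lambda>k. (i, k)) [0..<ring_count w t i]) [0..<N]))"

definition heat_bath_update ::
  "real \<Rightarrow> factor_graph \<Rightarrow> (nat \<Rightarrow> real) \<Rightarrow> clocks \<Rightarrow> nat \<times> nat \<Rightarrow> config \<Rightarrow> config" where
  "heat_bath_update \<beta> G J w = (\<lambda>(i, k) \<sigma>.
     \<sigma>(i := if snd (w (i, k)) \<le> (1 + tanh (\<beta> * local_field G J i \<sigma>)) / 2 then 1 else -1))"

definition glauber_space ::
  "real \<Rightarrow> nat \<Rightarrow> nat \<Rightarrow> factor_graph \<Rightarrow> (nat \<Rightarrow> real) \<Rightarrow> (config \<times> clocks) measure" where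
  "glauber_space \<beta> N M G J = gibbs \<beta> N M G J \<Otimes>\<^sub>M clock_space N"

definition glauber ::
  "real \<Rightarrow> nat \<Rightarrow> factor_graph \<Rightarrow> (nat \<Rightarrow> real) \<Rightarrow> real \<Rightarrow> config \<times> clocks \<Rightarrow> config" where
  "glauber \<beta> N G J t = (\<lambda>(\<sigma>, w). fold (heat_bath_update \<beta> G J w) (rings N w t) \<sigma>)"

definition correlation ::
  "real \<Rightarrow> nat \<Rightarrow> nat \<Rightarrow> factor_graph \<Rightarrow> (nat \<Rightarrow> real) \<Rightarrow> nat \<Rightarrow> real \<Rightarrow> real" where
  "correlation \<beta> N M G J i t =
     (\<integral>\<omega>. glauber \<beta> N G J 0 \<omega> i * glauber \<beta> N G J t \<omega> i \<partial>glauber_space \<beta> N M G J)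
     - (\<integral>\<sigma>. \<sigma> i \<partial>gibbs \<beta> N M G J)\<^sup>2"

text \<open>Extended reals, so that the infimum of the empty set is \<open>\<infinity>\<close>.\<close>

definition correlation_time ::
  "real \<Rightarrow> nat \<Rightarrow> nat \<Rightarrow> factor_graph \<Rightarrow> (nat \<Rightarrow> real) \<Rightarrow> nat \<Rightarrow> real \<Rightarrow> ereal" where
  "correlation_time \<beta> N M G J i \<epsilon> =
     Inf {ereal \<tau> | \<tau>. 0 \<le> \<tau> \<and> (\<forall>t\<ge>\<tau>. correlation \<beta> N M G J i t \<le> \<epsilon>)}"


section \<open>The random graph and the random couplings\<close>

text \<open>
  Variable node \<open>i\<close> owns the sockets \<open>s\<close> with \<open>s div l = i\<close>, function node \<open>a\<close> owns the sockets \<open>s'\<close>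
  with \<open>s' div p = a\<close>, and socket \<open>s\<close> on the variable side is matched with socket \<open>\<pi> s\<close> on the
  function side. An edge survives if and only if its multiplicity is odd.
\<close>

definition num_funs :: "nat \<Rightarrow> nat \<Rightarrow> nat \<Rightarrow> nat" where
  "num_funs p l N = N * l div p"

definition edge_multiplicity :: "nat \<Rightarrow> nat \<Rightarrow> nat \<Rightarrow> (nat \<Rightarrow> nat) \<Rightarrow> nat \<Rightarrow> nat \<Rightarrow> nat" where
  "edge_multiplicity p l N \<pi> i a = card {s \<in> {..<N * l}. s div l = i \<and> \<pi> s div p = a}"

definition config_graph :: "nat \<Rightarrow> nat \<Rightarrow> nat \<Rightarrow> (nat \<Rightarrow> nat) \<Rightarrow> factor_graph" where
  "config_graph p l N \<pi> =
     {(i, a). i < N \<and> a < num_funs p l N \<and> odd (edge_multiplicity p l N \<pi> i a)}"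

definition graph_pmf :: "nat \<Rightarrow> nat \<Rightarrow> nat \<Rightarrow> factor_graph pmf" where
  "graph_pmf p l N = map_pmf (config_graph p l N) (pmf_of_set {\<pi>. \<pi> permutes {..<N * l}})"

definition couplings_pmf :: "nat \<Rightarrow> (nat \<Rightarrow> real) pmf" where
  "couplings_pmf M = Pi_pmf {..<M} 0 (\<lambda>_. pmf_of_set {-1, 1})"

definition disorder_pmf :: "nat \<Rightarrow> nat \<Rightarrow> nat \<Rightarrow> (factor_graph \<times> (nat \<Rightarrow> real)) pmf" where
  "disorder_pmf p l N = pair_pmf (graph_pmf p l N) (couplings_pmf (num_funs p l N))"

text \<open>
  Convergence to one of the probability, along the sizes \<open>N\<close> for which \<open>N l\<close> is a multiple of \<open>p\<close>.
\<close>

definition with_high_prob ::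
  "nat \<Rightarrow> nat \<Rightarrow> (nat \<Rightarrow> factor_graph \<Rightarrow> (nat \<Rightarrow> real) \<Rightarrow> bool) \<Rightarrow> bool" where
  "with_high_prob p l P \<longleftrightarrow>
     ((\<lambda>N. measure_pmf.prob (disorder_pmf p l N) {(G, J). P N G J}) \<longlongrightarrow> 1)
       (inf sequentially (principal {N. p dvd N * l}))"


section \<open>The characteristic temperatures\<close>

definition phi :: "nat \<Rightarrow> nat \<Rightarrow> real \<Rightarrow> real" where
  "phi p l \<beta> = ln 2 + real l / real p * ln (cosh \<beta>)"

definition p_plus :: "nat \<Rightarrow> real \<Rightarrow> real" where
  "p_plus p x = ((1 + x) ^ p + (1 - x) ^ p) / 2"

definition p_minus :: "nat \<Rightarrow> real \<Rightarrow> real" where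
  "p_minus p x = ((1 + x) ^ p - (1 - x) ^ p) / 2"

definition entropy_fun :: "real \<Rightarrow> real" where
  "entropy_fun x = - x * ln x - (1 - x) * ln (1 - x)"

definition z_overlap :: "nat \<Rightarrow> real \<Rightarrow> real \<Rightarrow> real" where
  "z_overlap p \<beta> q = (THE z. 0 \<le> z \<and>
     z * ((cosh (2 * \<beta>) * deriv (p_plus p) z + deriv (p_minus p) z)
          / (cosh (2 * \<beta>) * p_plus p z + p_minus p z))
     = real p * ((1 - q) / 2))"

definition phi_overlap_open :: "nat \<Rightarrow> nat \<Rightarrow> real \<Rightarrow> real \<Rightarrow> real" where
  "phi_overlap_open p l q \<beta> =
     (let z = z_overlap p \<beta> q in
        ln 2 - (real l - 1) * entropy_fun ((1 - q) / 2)
        + real l / real p * ln (cosh (2 * \<beta>) * p_plus p z + p_minus p z)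
        - real l * ((1 - q) / 2) * ln z)"

definition phi_overlap :: "nat \<Rightarrow> nat \<Rightarrow> real \<Rightarrow> real \<Rightarrow> real" where
  "phi_overlap p l q \<beta> =
     (if q = 1 then Lim (at_left 1) (\<lambda>r. phi_overlap_open p l r \<beta>)
      else if q = -1 then Lim (at_right (-1)) (\<lambda>r. phi_overlap_open p l r \<beta>)
      else phi_overlap_open p l q \<beta>)"

definition beta_ann :: "nat \<Rightarrow> nat \<Rightarrow> ereal" where
  "beta_ann p l = (GREATEST b. 0 < b \<and>
     (\<forall>\<beta>'>0. ereal \<beta>' < b \<longrightarrow> (\<forall>q\<in>{-1..1}. phi_overlap p l q \<beta>' \<le> phi_overlap p l 0 \<beta>')))"

text \<open>In the extended reals \<open>1 / \<infinity> = 0\<close>.\<close>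

definition T_ann :: "nat \<Rightarrow> nat \<Rightarrow> ereal" where
  "T_ann p l = 1 / beta_ann p l"

definition U_overlap :: "nat \<Rightarrow> nat \<Rightarrow> real \<Rightarrow> real \<Rightarrow> real" where
  "U_overlap p l q \<beta> = phi_overlap p l 1 \<beta> - phi_overlap p l q \<beta>"

definition Upsilon0 :: "nat \<Rightarrow> nat \<Rightarrow> real \<Rightarrow> real" where
  "Upsilon0 p l \<beta> = (SUP q\<in>{0<..1}. U_overlap p l q \<beta>)"

definition phi_hat :: "nat \<Rightarrow> nat \<Rightarrow> real \<Rightarrow> real \<Rightarrow> real" where
  "phi_hat p l \<beta> \<alpha> =
     \<alpha> * phi p l ((2 - 1 / \<alpha>) * \<beta>) + (1 - \<alpha>) * phi p l (2 * \<beta>) - phi p l \<beta>"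

definition Upsilon :: "nat \<Rightarrow> nat \<Rightarrow> real \<Rightarrow> real" where
  "Upsilon p l \<beta> = (SUP \<alpha>\<in>{1/2<..<1}. (1 - \<alpha>) * Upsilon0 p l \<beta> - phi_hat p l \<beta> \<alpha>)"

definition beta_barr :: "nat \<Rightarrow> nat \<Rightarrow> real" where
  "beta_barr p l = (LEAST b. 0 \<le> b \<and> (\<forall>\<beta>'>b. 0 < Upsilon p l \<beta>'))"

definition T_barr :: "nat \<Rightarrow> nat \<Rightarrow> ereal" where
  "T_barr p l = 1 / ereal (beta_barr p l)"

definition T_fast :: "nat \<Rightarrow> nat \<Rightarrow> real" where
  "T_fast p l = inverse (artanh (1 / (real l * (real p - 1))))"

end

theory Submission
  imports Defs "HOL-Real_Asymp.Real_Asymp"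
begin

text \<open>
  Conditioning on the first ring shows that, given \<open>n\<close> rings before time \<open>t\<close> (a Poisson number), the
  law of the configuration is that of \<open>n\<close> steps of the discrete chain, so that \<open>C_i(t)\<close> is a
  Poisson average of correlations of the discrete chain, which is reversible for \<open>\<mu>\<close>.

  High temperature: the sum over the spins of the single-spin averages multiplies the total oscillation
  of an observable by at most \<open>N - 1 + l (p - 1) tanh \<beta>\<close>, hence \<open>C_i(t) \<le> exp (- \<kappa> t)\<close>.

  Low temperature: to decorrelate, a configuration \<open>\<sigma>\<close> has to cross the sphere of overlap \<open>q\<close> around
  it. By stationarity the probability to do so before time \<open>t\<close> is at most
  \<open>N t Z_q(\<sigma>) / exp (- \<beta> E(\<sigma>))\<close>, where \<open>Z_q(\<sigma>)\<close> is the weight of that sphere. The mean of the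
  \<open>(1 - \<alpha>)\<close>-th power of this bound is controlled by Hoelder's inequality from the first moment of
  the pair partition function at overlap \<open>q\<close> and of \<open>Z((2 - 1 / \<alpha>) \<beta>)\<close>; this produces
  \<open>(1 - \<alpha>) U(q) - \<phi>^(\<alpha>) > 0\<close> as escape rate. Above the annealed temperature a second moment bound
  gives both \<open>Z \<approx> exp (N \<phi>(\<beta>))\<close> and the absence of positive overlap between two independent
  configurations, hence \<open>\<Sum>_i \<langle>\<sigma>_i\<rangle>^2 = o(N)\<close>.
\<close>

section \<open>The first ring of the clocks\<close>

text \<open>All chain estimates use \<open>flip_sum\<close>, which is N times the transition
  operator of the discrete chain. Keeping the factor N inside makes the Poisson weights exp (- N t)
  t^n / n! and avoids any division by N. Two quotients shape the low-temperature part: the escape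
  bound is divided by the weight of the starting configuration, and the Gibbs average by Z. Neither
  can be averaged over the disorder directly. A probability y also satisfies y \<le> y^(1 -
  \<alpha>), and with w the weight and \<rho> the shell ratio one has w \<rho>^(1 - \<alpha>) = (w^2
  \<rho>)^(1 - \<alpha>) (w^(2 - 1 / \<alpha>))^\<alpha>. Both factors have computable means, which
  is where the inverse temperature (2 - 1 / \<alpha>) \<beta> comes from. The division by Z is
  removed by a lower bound on Z valid with high probability. The annealed condition only says that q
  = 0 is a maximum, not a strict one. Strictness at positive overlap is gained by comparing \<beta>
  with a slightly larger \<beta>' that still satisfies the condition.\<close>

definition clock_measure :: "(real \<times> real) measure" where
  "clock_measure =
     density lborel (\<lambda>x. ennreal (exponential_density 1 x)) \<Otimes>\<^sub>M uniform_measure lborel {0..1}"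

lemma clock_space_eq: "clock_space N = (\<Pi>\<^sub>M ik\<in>{..<N} \<times> UNIV. clock_measure)"
  unfolding clock_space_def clock_measure_def ..

lemma prob_space_exp: "prob_space (density lborel (\<lambda>x. ennreal (exponential_density 1 x)))"
  by (rule prob_space_exponential_density) simp

lemma prob_space_unit: "prob_space (uniform_measure lborel {0..1::real})"
  by (rule prob_space_uniform_measure) auto

interpretation clk: prob_space clock_measure
proof -
  interpret a: prob_space "density lborel (\<lambda>x. ennreal (exponential_density 1 x))" by (rule prob_space_exp)
  interpret b: prob_space "uniform_measure lborel {0..1::real}" by (rule prob_space_unit)
  interpret pair_prob_space "density lborel (\<lambda>x. ennreal (exponential_density 1 x))"
      "uniform_measure lborel {0..1::real}" ..
  show "prob_space clock_measure" unfolding clock_measure_def by unfold_locales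
qed

lemma sets_clock_measure [measurable_cong]: "sets clock_measure = sets (borel \<Otimes>\<^sub>M borel)"
  unfolding clock_measure_def by (intro sets_pair_measure_cong) auto

lemma space_clock_measure [simp]: "space clock_measure = UNIV"
  using sets_eq_imp_space_eq[OF sets_clock_measure] by (simp add: space_pair_measure)

lemma prob_space_clock_space: "prob_space (clock_space N)"
  unfolding clock_space_eq by (intro prob_space_PiM clk.prob_space_axioms)

lemma space_clock_space: "space (clock_space N) = ({..<N} \<times> UNIV) \<rightarrow>\<^sub>E UNIV"
  unfolding clock_space_eq by (simp add: space_PiM)

lemma nn_integral_clock_measure:
  assumes [measurable]: "g \<in> borel_measurable (borel \<Otimes>\<^sub>M borel)"
  shows "(\<integral>\<^sup>+a. g a \<partial>clock_measure) =
    (\<integral>\<^sup>+x. ennreal (exponential_density 1 x) * (\<integral>\<^sup>+v. g (x, v) \<partial>uniform_measure lborel {0..1}) \<partial>lborel)"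
proof -
  interpret b: prob_space "uniform_measure lborel {0..1::real}" by (rule prob_space_unit)
  show ?thesis
    unfolding clock_measure_def
    by (subst b.nn_integral_fst[symmetric]) (auto simp: nn_integral_density)
qed

text \<open>Lack of memory of the exponential law in integral form: the density at s + x is exp (-
  s) times the density at x, and the uniform variable is carried along unchanged.\<close>

lemma nn_integral_clock_measure_shift:
  assumes [measurable]: "g \<in> borel_measurable (borel \<Otimes>\<^sub>M borel)" and s: "0 \<le> s"
  shows "(\<integral>\<^sup>+a. indicator {s..} (fst a) * g (fst a - s, snd a) \<partial>clock_measure)
    = ennreal (exp (- s)) * (\<integral>\<^sup>+a. g a \<partial>clock_measure)"
proof -
  interpret b: prob_space "uniform_measure lborel {0..1::real}" by (rule prob_space_unit)
  define G where "G x = (\<integral>\<^sup>+v. g (x, v) \<partial>uniform_measure lborel {0..1})" for x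
  have [measurable]: "G \<in> borel_measurable borel" unfolding G_def by measurable
  have "(\<integral>\<^sup>+a. indicator {s..} (fst a) * g (fst a - s, snd a) \<partial>clock_measure)
    = (\<integral>\<^sup>+x. ennreal (exponential_density 1 x) * (indicator {s..} x * G (x - s)) \<partial>lborel)"
    by (subst nn_integral_clock_measure) (auto simp: G_def nn_integral_cmult)
  also have "\<dots> = (\<integral>\<^sup>+x. ennreal (exponential_density 1 (s + 1 * x)) * (indicator {s..} (s + 1 * x) * G (s + 1 * x - s)) \<partial>lborel)"
    by (subst nn_integral_real_affine[where c = 1 and t = s]) auto
  also have "\<dots> = (\<integral>\<^sup>+x. ennreal (exp (- s)) * (ennreal (exponential_density 1 x) * G x) \<partial>lborel)"
  proof (intro nn_integral_cong)
    fix x :: real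
    have "ennreal (exponential_density 1 (s + x)) = ennreal (exp (- s)) * ennreal (exponential_density 1 x)" if "0 \<le> x"
      using s that by (simp add: exponential_density_def ennreal_mult'[symmetric] mult_exp_exp)
    moreover have "exponential_density 1 x = 0" if "x < 0"
      using that by (simp add: exponential_density_def)
    ultimately show "ennreal (exponential_density 1 (s + 1 * x)) * (indicator {s..} (s + 1 * x) * G (s + 1 * x - s))
      = ennreal (exp (- s)) * (ennreal (exponential_density 1 x) * G x)"
      by (cases "0 \<le> x") (auto simp: indicator_def mult.assoc)
  qed
  also have "\<dots> = ennreal (exp (- s)) * (\<integral>\<^sup>+a. g a \<partial>clock_measure)"
    by (subst nn_integral_cmult) (auto simp: nn_integral_clock_measure G_def)
  finally show ?thesis .
qed

lemma measurable_clock_upd: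
  assumes "c \<in> {..<N} \<times> UNIV" "f \<in> M \<rightarrow>\<^sub>M clock_space N" "h \<in> M \<rightarrow>\<^sub>M clock_measure"
  shows "(\<lambda>x. (f x)(c := h x)) \<in> M \<rightarrow>\<^sub>M clock_space N"
proof -
  have "{..<N} \<times> UNIV = ({..<N} \<times> UNIV) \<union> {c}" using assms by auto
  from measurable_fun_upd[OF this] assms(2,3) show ?thesis unfolding clock_space_eq by blast
qed

text \<open>Overwriting one coordinate of a product measure by an independent copy preserves the
  law. This isolates a single waiting time without changing the index set of the product.\<close>

lemma nn_integral_clock_space_resample:
  assumes [measurable]: "g \<in> borel_measurable (clock_space N)" and i: "c \<in> {..<N} \<times> UNIV"
  shows "(\<integral>\<^sup>+y. g y \<partial>clock_space N) = (\<integral>\<^sup>+a. (\<integral>\<^sup>+y. g (y(c := a)) \<partial>clock_space N) \<partial>clock_measure)"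
proof -
  interpret C: prob_space "clock_space N" by (rule prob_space_clock_space)
  have ins: "insert c ({..<N} \<times> UNIV) = {..<N} \<times> UNIV" using i by auto
  have m: "(\<lambda>(x, X). X(c := x)) \<in> clock_measure \<Otimes>\<^sub>M clock_space N \<rightarrow>\<^sub>M clock_space N"
    unfolding case_prod_unfold by (rule measurable_clock_upd[OF i]) measurable
  have "clock_space N = distr (clock_measure \<Otimes>\<^sub>M clock_space N) (clock_space N) (\<lambda>(x, X). X(c := x))"
    using distr_pair_PiM_eq_PiM[of "{..<N} \<times> UNIV" "\<lambda>_. clock_measure" c] clk.prob_space_axioms
    unfolding clock_space_eq ins by simp
  then have "(\<integral>\<^sup>+y. g y \<partial>clock_space N) = (\<integral>\<^sup>+z. g ((\<lambda>(x, X). X(c := x)) z) \<partial>(clock_measure \<Otimes>\<^sub>M clock_space N))"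
    using m by (metis nn_integral_distr assms(1))
  also have "\<dots> = (\<integral>\<^sup>+a. (\<integral>\<^sup>+y. g (y(c := a)) \<partial>clock_space N) \<partial>clock_measure)"
    using m by (subst C.nn_integral_fst[symmetric]) auto
  finally show ?thesis .
qed

text \<open>When the clock of spin \<open>i\<close> rings first, at time \<open>s\<close>, the lack of memory of the waiting times
  makes \<open>shift_clocks N i s y\<close> a fresh set of clocks for the time after \<open>s\<close>.\<close>

definition sub_first :: "nat set \<Rightarrow> real \<Rightarrow> clocks \<Rightarrow> clocks" where
  "sub_first A s y = (\<lambda>(j, k). if j \<in> A \<and> k = 0 then (fst (y (j, 0)) - s, snd (y (j, 0))) else y (j, k))"

text \<open>Maps the label of a ring in the clocks after the first ring to its label in the original
  clocks; only spin i has used up a ring.\<close>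

definition skip_ring :: "nat \<Rightarrow> nat \<times> nat \<Rightarrow> nat \<times> nat" where
  "skip_ring i = (\<lambda>(j, k). if j = i then (j, Suc k) else (j, k))"

definition shift_clocks :: "nat \<Rightarrow> nat \<Rightarrow> real \<Rightarrow> clocks \<Rightarrow> clocks" where
  "shift_clocks N i s y = (\<lambda>c\<in>{..<N} \<times> UNIV. sub_first ({..<N} - {i}) s y (skip_ring i c))"

lemma measurable_clocks_component:
  assumes "f \<in> M \<rightarrow>\<^sub>M clock_space N" "c \<in> {..<N} \<times> UNIV"
  shows "(\<lambda>x. f x c) \<in> M \<rightarrow>\<^sub>M borel \<Otimes>\<^sub>M borel"
  using measurable_compose[OF assms(1), of "\<lambda>y. y c" "borel \<Otimes>\<^sub>M borel"] assms(2)
  unfolding clock_space_eq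
  by (metis measurable_component_singleton measurable_cong_sets sets_clock_measure)

lemma measurable_into_clock_space:
  assumes "\<And>c. c \<in> {..<N} \<times> UNIV \<Longrightarrow> (\<lambda>x. f x c) \<in> M \<rightarrow>\<^sub>M borel \<Otimes>\<^sub>M borel"
    and "\<And>x c. x \<in> space M \<Longrightarrow> c \<notin> {..<N} \<times> UNIV \<Longrightarrow> f x c = undefined"
  shows "f \<in> M \<rightarrow>\<^sub>M clock_space N"
  unfolding clock_space_eq
proof (rule measurable_PiM_single')
  show "(\<lambda>x. f x c) \<in> M \<rightarrow>\<^sub>M clock_measure" if "c \<in> {..<N} \<times> UNIV" for c
    using assms(1)[OF that] by (metis measurable_cong_sets sets_clock_measure)
  show "f \<in> space M \<rightarrow> ({..<N} \<times> UNIV) \<rightarrow>\<^sub>E space clock_measure"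
    using assms(2) by (auto simp: PiE_def extensional_def)
qed

lemma measurable_sub_first [measurable]:
  assumes [measurable]: "s \<in> borel_measurable M" "f \<in> M \<rightarrow>\<^sub>M clock_space N" and A: "A \<subseteq> {..<N}"
  shows "(\<lambda>x. sub_first A (s x) (f x)) \<in> M \<rightarrow>\<^sub>M clock_space N"
proof (rule measurable_into_clock_space)
  note [measurable] = measurable_clocks_component[OF assms(2)]
  show "(\<lambda>x. sub_first A (s x) (f x) c) \<in> M \<rightarrow>\<^sub>M borel \<Otimes>\<^sub>M borel" if "c \<in> {..<N} \<times> UNIV" for c
  proof (cases c)
    case (Pair j k)
    then show ?thesis using that A by (cases "j \<in> A \<and> k = 0") (auto simp: sub_first_def intro!: measurable_Pair)
  qed
  show "sub_first A (s x) (f x) c = undefined" if "x \<in> space M" "c \<notin> {..<N} \<times> UNIV" for x c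
    using that A measurable_space[OF assms(2) that(1)]
    by (cases c) (auto simp: sub_first_def space_clock_space PiE_def extensional_def)
qed

lemma measurable_shift_clocks [measurable]:
  assumes [measurable]: "s \<in> borel_measurable M" "f \<in> M \<rightarrow>\<^sub>M clock_space N"
  shows "(\<lambda>x. shift_clocks N i (s x) (f x)) \<in> M \<rightarrow>\<^sub>M clock_space N"
proof (rule measurable_into_clock_space)
  have "(\<lambda>x. sub_first ({..<N} - {i}) (s x) (f x)) \<in> M \<rightarrow>\<^sub>M clock_space N" by measurable
  note 1 = measurable_clocks_component[OF this]
  show "(\<lambda>x. shift_clocks N i (s x) (f x) c) \<in> M \<rightarrow>\<^sub>M borel \<Otimes>\<^sub>M borel" if "c \<in> {..<N} \<times> UNIV" for c
    using that 1[of "skip_ring i c"] by (auto simp: shift_clocks_def skip_ring_def)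
  show "shift_clocks N i (s x) (f x) c = undefined" if "x \<in> space M" "c \<notin> {..<N} \<times> UNIV" for x c
    using that by (auto simp: shift_clocks_def)
qed

text \<open>Lack of memory, applied to the clocks in \<open>A\<close> one after the other. The
  coordinate (j, 0) is resampled, its wait shortened by s at the price of a factor exp (- s), and
  the resampling is then undone.\<close>

lemma nn_integral_sub_first:
  assumes g: "g \<in> borel_measurable (clock_space N)" and A: "finite A" "A \<subseteq> {..<N}" and s: "0 \<le> s"
  shows "(\<integral>\<^sup>+y. indicator {y. \<forall>j\<in>A. s \<le> fst (y (j, 0))} y * g (sub_first A s y) \<partial>clock_space N)
    = ennreal (exp (- s * card A)) * (\<integral>\<^sup>+y. g y \<partial>clock_space N)"
  using A
proof (induction A rule: finite_induct)
  case empty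
  have "sub_first {} s y = y" for y by (auto simp: sub_first_def)
  then show ?case by simp
next
  case (insert j A)
  note [measurable] = g measurable_clocks_component[OF measurable_ident_sets[OF refl], unfolded id_def]
  interpret C: prob_space "clock_space N" by (rule prob_space_clock_space)
  have j: "(j, 0) \<in> {..<N} \<times> UNIV" using insert.prems by auto
  have mu: "(\<lambda>(x, X). X((j,0) := x)) \<in> clock_measure \<Otimes>\<^sub>M clock_space N \<rightarrow>\<^sub>M clock_space N"
    unfolding case_prod_unfold by (rule measurable_clock_upd[OF j]) measurable
  have fin: "finite A" using insert by auto
  let ?h = "\<lambda>y. indicator {y. \<forall>j\<in>A. s \<le> fst (y (j, 0))} y * g (sub_first A s y) :: ennreal"
  have hm[measurable]: "?h \<in> borel_measurable (clock_space N)"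
  proof -
    have *: "(\<lambda>y. y (j, 0)) \<in> clock_space N \<rightarrow>\<^sub>M borel \<Otimes>\<^sub>M borel" if "j \<in> A" for j
      using measurable_clocks_component[OF measurable_ident_sets[OF refl], of "(j,0)" N] insert.prems that by auto
    have "Measurable.pred (clock_space N) (\<lambda>y. \<forall>j\<in>A. s \<le> fst (y (j, 0)))"
      using fin * by (intro pred_intros_finite) auto
    moreover have "(\<lambda>y. sub_first A s y) \<in> clock_space N \<rightarrow>\<^sub>M clock_space N"
      using insert.prems by (intro measurable_sub_first) auto
    ultimately show ?thesis by measurable
  qed
  have "(\<integral>\<^sup>+y. indicator {y. \<forall>j\<in>insert j A. s \<le> fst (y (j, 0))} y * g (sub_first (insert j A) s y) \<partial>clock_space N)
    = (\<integral>\<^sup>+y. indicator {s..} (fst (y (j,0))) * ?h (y((j,0) := (fst (y (j,0)) - s, snd (y (j,0))))) \<partial>clock_space N)"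
  proof (intro nn_integral_cong)
    fix y :: clocks
    have "sub_first (insert j A) s y = sub_first A s (y((j,0) := (fst (y (j,0)) - s, snd (y (j,0)))))"
      using insert.hyps by (auto simp: sub_first_def fun_eq_iff)
    moreover have "(\<forall>i\<in>A. s \<le> fst ((y((j,0) := (fst (y (j,0)) - s, snd (y (j,0))))) (i,0))) = (\<forall>i\<in>A. s \<le> fst (y (i,0)))"
      using insert.hyps by auto
    ultimately show "indicator {y. \<forall>j\<in>insert j A. s \<le> fst (y (j, 0))} y * g (sub_first (insert j A) s y)
      = indicator {s..} (fst (y (j,0))) * ?h (y((j,0) := (fst (y (j,0)) - s, snd (y (j,0)))))"
      by (auto simp: indicator_def)
  qed
  also have "\<dots> = (\<integral>\<^sup>+a. (\<integral>\<^sup>+y. indicator {s..} (fst a) * ?h (y((j,0) := (fst a - s, snd a))) \<partial>clock_space N) \<partial>clock_measure)"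
  proof (subst nn_integral_clock_space_resample[OF _ j], goal_cases)
    case 1
    have "(\<lambda>y. (\<lambda>(x, X). X((j,0) := x)) ((fst (y (j,0)) - s, snd (y (j,0))), y)) \<in> clock_space N \<rightarrow>\<^sub>M clock_space N"
    proof (rule measurable_compose[OF _ mu])
      have "(\<lambda>y. y (j, 0)) \<in> clock_space N \<rightarrow>\<^sub>M borel \<Otimes>\<^sub>M borel"
        using measurable_clocks_component[OF measurable_ident_sets[OF refl] j] by simp
      then show "(\<lambda>y. ((fst (y (j, 0)) - s, snd (y (j, 0))), y)) \<in> clock_space N \<rightarrow>\<^sub>M clock_measure \<Otimes>\<^sub>M clock_space N"
        by measurable
    qed
    moreover have "(\<lambda>y. y (j, 0)) \<in> clock_space N \<rightarrow>\<^sub>M borel \<Otimes>\<^sub>M borel"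
      using measurable_clocks_component[OF measurable_ident_sets[OF refl] j] by simp
    ultimately show ?case using hm by simp
  qed simp
  also have "\<dots> = (\<integral>\<^sup>+a. indicator {s..} (fst a) * (\<integral>\<^sup>+y. ?h (y((j,0) := (fst a - s, snd a))) \<partial>clock_space N) \<partial>clock_measure)"
    by (intro nn_integral_cong nn_integral_cmult measurable_compose[OF _ hm] measurable_compose[OF _ mu, simplified])
      (auto simp: case_prod_unfold intro!: measurable_compose[OF _ mu[unfolded case_prod_unfold], of "\<lambda>y. (_, y)", simplified])
  also have "\<dots> = ennreal (exp (- s)) * (\<integral>\<^sup>+a. (\<integral>\<^sup>+y. ?h (y((j,0) := a)) \<partial>clock_space N) \<partial>clock_measure)"
  proof (rule nn_integral_clock_measure_shift[OF _ s, where g = "\<lambda>a. \<integral>\<^sup>+y. ?h (y((j,0) := a)) \<partial>clock_space N"])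
    have "(\<lambda>a. \<integral>\<^sup>+y. ?h (y((j,0) := a)) \<partial>clock_space N) \<in> borel_measurable clock_measure"
      using measurable_compose[OF mu hm] by (intro C.borel_measurable_nn_integral) (auto simp: case_prod_unfold)
    then show "(\<lambda>a. \<integral>\<^sup>+y. ?h (y((j,0) := a)) \<partial>clock_space N) \<in> borel_measurable (borel \<Otimes>\<^sub>M borel)"
      by (simp add: measurable_cong_sets[OF sets_clock_measure refl])
  qed
  also have "(\<integral>\<^sup>+a. (\<integral>\<^sup>+y. ?h (y((j,0) := a)) \<partial>clock_space N) \<partial>clock_measure) = (\<integral>\<^sup>+y. ?h y \<partial>clock_space N)"
    by (rule nn_integral_clock_space_resample[symmetric, OF hm j])
  also have "\<dots> = ennreal (exp (- s * card A)) * (\<integral>\<^sup>+y. g y \<partial>clock_space N)"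
    using insert by auto
  finally show ?case using insert.hyps
    by (simp add: mult.assoc[symmetric] ennreal_mult'[symmetric] exp_add[symmetric] algebra_simps)
qed

text \<open>Relabelling by the injective \<open>skip_ring i\<close> keeps the product law, so what
  is lost is one factor exp (- s) for each of the N - 1 clocks that must wait at least until
  s.\<close>

lemma nn_integral_shift_clocks:
  assumes g: "g \<in> borel_measurable (clock_space N)" and i: "i < N" and s: "0 \<le> s"
  shows "(\<integral>\<^sup>+y. indicator {y. \<forall>j\<in>{..<N} - {i}. s \<le> fst (y (j, 0))} y * g (shift_clocks N i s y) \<partial>clock_space N)
    = ennreal (exp (- s * (real N - 1))) * (\<integral>\<^sup>+y. g y \<partial>clock_space N)"
proof -
  let ?r = "\<lambda>y. \<lambda>c\<in>{..<N} \<times> UNIV. y (skip_ring i c)"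
  have d: "distr (clock_space N) (clock_space N) ?r = clock_space N"
    unfolding clock_space_eq
    by (rule distr_PiM_reindex) (auto simp: clk.prob_space_axioms skip_ring_def inj_on_def split: if_splits)
  have rm: "?r \<in> clock_space N \<rightarrow>\<^sub>M clock_space N"
  proof (rule measurable_into_clock_space)
    show "(\<lambda>x. (\<lambda>c\<in>{..<N} \<times> UNIV. x (skip_ring i c)) c) \<in> clock_space N \<rightarrow>\<^sub>M borel \<Otimes>\<^sub>M borel" if "c \<in> {..<N} \<times> UNIV" for c
      using that measurable_clocks_component[OF measurable_ident_sets[OF refl], of "skip_ring i c" N]
      by (auto simp: skip_ring_def split: if_splits)
  qed auto
  have "(\<integral>\<^sup>+y. indicator {y. \<forall>j\<in>{..<N} - {i}. s \<le> fst (y (j, 0))} y * g (shift_clocks N i s y) \<partial>clock_space N)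
    = (\<integral>\<^sup>+y. indicator {y. \<forall>j\<in>{..<N} - {i}. s \<le> fst (y (j, 0))} y * g (?r (sub_first ({..<N}-{i}) s y)) \<partial>clock_space N)"
    by (simp add: shift_clocks_def)
  also have "\<dots> = ennreal (exp (- s * card ({..<N} - {i}))) * (\<integral>\<^sup>+y. g (?r y) \<partial>clock_space N)"
    by (rule nn_integral_sub_first[OF measurable_compose[OF rm g] _ _ s]) auto
  also have "(\<integral>\<^sup>+y. g (?r y) \<partial>clock_space N) = (\<integral>\<^sup>+y. g y \<partial>clock_space N)"
    using nn_integral_distr[OF rm, of g] g by (simp add: d)
  also have "real (card ({..<N} - {i})) = real N - 1"
    using i by simp
  finally show ?thesis .
qed

section \<open>Chronological order of the rings and its recursion at the first ring\<close>

text \<open>The almost sure event on which the conventions about \<open>card\<close> of infinite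
  sets and about ties in the sorting have no effect.\<close>

definition regular_clocks :: "nat \<Rightarrow> clocks \<Rightarrow> bool" where
  "regular_clocks N y \<longleftrightarrow>
     (\<forall>i<N. strict_mono (ring_time y i)) \<and>
     (\<forall>i<N. \<forall>j<N. \<forall>k m. i \<noteq> j \<longrightarrow> ring_time y i k \<noteq> ring_time y j m) \<and>
     (\<forall>i<N. \<forall>t. finite {k. ring_time y i k \<le> t})"

definition ring_key :: "clocks \<Rightarrow> nat \<times> nat \<Rightarrow> real" where
  "ring_key y = (\<lambda>(i, k). ring_time y i k)"

lemma downward_closed_eq_lessThan_card:
  fixes S :: "nat set"
  assumes "finite S" "\<And>a b. b \<in> S \<Longrightarrow> a \<le> b \<Longrightarrow> a \<in> S"
  shows "S = {..<card S}"
proof (cases "S = {}")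
  case False
  then have "S = {..Max S}" using assms(1) by (auto intro: assms(2)[OF Max_in])
  then show ?thesis by (metis card_atMost lessThan_Suc_atMost)
qed auto

lemma ring_count_regular:
  assumes "regular_clocks N y" "i < N"
  shows "{k. ring_time y i k \<le> t} = {..<ring_count y t i}"
  unfolding ring_count_def
proof (rule downward_closed_eq_lessThan_card)
  show "finite {k. ring_time y i k \<le> t}" using assms by (auto simp: regular_clocks_def)
  have "mono (ring_time y i)" using assms by (auto simp: regular_clocks_def strict_mono_mono)
  then show "a \<in> {k. ring_time y i k \<le> t}" if "b \<in> {k. ring_time y i k \<le> t}" "a \<le> b" for a b
    using that by (auto dest: monoD)
qed

lemma set_rings_regular:
  assumes "regular_clocks N y"
  shows "set (rings N y t) = {(i, k). i < N \<and> ring_time y i k \<le> t}"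
proof -
  have "set (rings N y t) = {(i, k). i < N \<and> k \<in> {..<ring_count y t i}}"
    by (auto simp: rings_def)
  also have "\<dots> = {(i, k). i < N \<and> ring_time y i k \<le> t}"
    using ring_count_regular[OF assms, of _ t] by (auto simp: set_eq_iff)
  finally show ?thesis .
qed

lemma set_rings_subset: "set (rings N y t) \<subseteq> {..<N} \<times> UNIV"
  by (auto simp: rings_def)

lemma distinct_rings: "distinct (rings N y t)"
proof -
  have "distinct (concat (map (\<lambda>i. map (\<lambda>k. (i, k)) [0..<ring_count y t i]) is))" if "distinct is" for "is"
    using that by (induction "is") (auto simp: distinct_map inj_on_def)
  then show ?thesis by (simp add: rings_def)
qed

lemma sorted_rings: "sorted (map (ring_key y) (rings N y t))"
  unfolding rings_def ring_key_def by simp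

lemma inj_on_ring_key:
  assumes "regular_clocks N y"
  shows "inj_on (ring_key y) ({..<N} \<times> UNIV)"
proof (rule inj_onI, clarify)
  fix i k j m assume a: "i < N" "j < N" "ring_key y (i, k) = ring_key y (j, m)"
  then have "ring_time y i k = ring_time y j m" by (simp add: ring_key_def)
  then have "i = j" using assms a(1,2) unfolding regular_clocks_def by blast
  moreover have "strict_mono (ring_time y i)" using assms a by (auto simp: regular_clocks_def)
  ultimately show "i = j \<and> k = m" using a by (auto simp: ring_key_def strict_mono_eq)
qed

lemma ring_time_0 [simp]: "ring_time y i 0 = fst (y (i, 0))"
  by (simp add: ring_time_def)

text \<open>The time origin moves to the first ring. For spin i the first wait drops out of the sum,
  for the other spins it is shortened, and both subtract the same amount.\<close>

lemma ring_time_shift: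
  assumes "i < N" "j < N"
  shows "ring_time (shift_clocks N i (fst (y (i, 0))) y) j k = ring_key y (skip_ring i (j, k)) - fst (y (i, 0))"
proof (cases "j = i")
  case True
  have "ring_time (shift_clocks N i (fst (y (i, 0))) y) i k = (\<Sum>m\<le>k. fst (y (i, Suc m)))"
    using assms by (auto simp: ring_time_def shift_clocks_def sub_first_def skip_ring_def)
  also have "\<dots> = (\<Sum>m\<le>Suc k. fst (y (i, m))) - fst (y (i, 0))"
    by (simp add: sum.atMost_Suc_shift del: sum.atMost_Suc)
  finally show ?thesis using True by (simp add: ring_time_def ring_key_def skip_ring_def)
next
  case False
  have "ring_time (shift_clocks N i (fst (y (i, 0))) y) j k
    = (\<Sum>m\<le>k. fst (y (j, m)) - (if m = 0 then fst (y (i, 0)) else 0))"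
    unfolding ring_time_def using assms False
    by (intro sum.cong) (auto simp: shift_clocks_def sub_first_def skip_ring_def)
  also have "\<dots> = (\<Sum>m\<le>k. fst (y (j, m))) - fst (y (i, 0))"
    by (simp add: sum_subtractf)
  finally show ?thesis using False by (simp add: ring_time_def ring_key_def skip_ring_def)
qed

lemma inj_skip_ring: "inj (skip_ring i)"
  by (auto simp: inj_def skip_ring_def split: if_splits)

lemma regular_shift:
  assumes r: "regular_clocks N y" and i: "i < N"
  shows "regular_clocks N (shift_clocks N i (fst (y (i, 0))) y)"
  unfolding regular_clocks_def
proof (intro conjI allI impI)
  note rt = ring_time_shift[OF i, of _ y]
  fix j assume j: "j < N"
  have sm: "strict_mono (ring_time y j)" using r j by (auto simp: regular_clocks_def)
  show "strict_mono (ring_time (shift_clocks N i (fst (y (i, 0))) y) j)"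
    using sm by (auto simp: strict_mono_def rt[OF j] skip_ring_def ring_key_def)
  show "finite {k. ring_time (shift_clocks N i (fst (y (i, 0))) y) j k \<le> t}" for t
  proof -
    have f: "finite {k. ring_time y j k \<le> t + fst (y (i, 0))}" using r j by (auto simp: regular_clocks_def)
    have "ring_time (shift_clocks N i (fst (y (i, 0))) y) j k \<ge> ring_time y j k - fst (y (i, 0))" for k
      using sm by (auto simp: rt[OF j] skip_ring_def ring_key_def strict_mono_less_eq)
    then have "{k. ring_time (shift_clocks N i (fst (y (i, 0))) y) j k \<le> t} \<subseteq> {k. ring_time y j k \<le> t + fst (y (i, 0))}"
      by (smt (verit) Collect_mono)
    then show ?thesis using f finite_subset by blast
  qed
  fix j' k m assume j': "j' < N" "j \<noteq> j'"
  show "ring_time (shift_clocks N i (fst (y (i, 0))) y) j k \<noteq> ring_time (shift_clocks N i (fst (y (i, 0))) y) j' m"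
    using r j j' by (auto simp: rt skip_ring_def ring_key_def regular_clocks_def)
qed

text \<open>A sorted list is determined by its set of elements when the key is injective on it, and
  regular clocks have no ties. It is thus enough to compare the two sets of rings and to see that
  the right-hand side is sorted.\<close>

lemma rings_first_step:
  assumes r: "regular_clocks N y" and i: "i < N"
    and mn: "\<And>j. j < N \<Longrightarrow> fst (y (i, 0)) \<le> fst (y (j, 0))" and t: "fst (y (i, 0)) \<le> t"
  shows "rings N y t = (i, 0) # map (skip_ring i) (rings N (shift_clocks N i (fst (y (i, 0))) y) (t - fst (y (i, 0))))"
    (is "_ = _ # map _ (rings N ?y' ?t')")
proof (rule map_sorted_distinct_set_unique[where f = "ring_key y"])
  have s': "set (rings N ?y' ?t') = {(j, k). j < N \<and> ring_key y (skip_ring i (j, k)) \<le> t}"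
    by (auto simp: set_rings_regular[OF regular_shift[OF r i]] ring_time_shift[OF i])
  have ge: "fst (y (i, 0)) \<le> ring_time y j k" if "j < N" for j k
  proof -
    have "mono (ring_time y j)" using r that by (auto simp: regular_clocks_def strict_mono_mono)
    then have "ring_time y j 0 \<le> ring_time y j k" by (rule monoD) simp
    then show ?thesis using mn[OF that] by simp
  qed
  show st: "set (rings N y t) = set ((i, 0) # map (skip_ring i) (rings N ?y' ?t'))"
  proof -
    have "(j, k) \<in> insert (i, 0) (skip_ring i ` {(j, k). j < N \<and> ring_key y (skip_ring i (j, k)) \<le> t})
       \<longleftrightarrow> j < N \<and> ring_time y j k \<le> t" for j k
    proof (cases "j = i")
      case True
      then show ?thesis using i t
        by (cases k) (auto simp: skip_ring_def ring_key_def image_iff)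
    next
      case False
      then show ?thesis by (auto simp: skip_ring_def ring_key_def image_iff split: if_splits)
    qed
    then show ?thesis by (auto simp: set_rings_regular[OF r] s')
  qed
  show inj: "inj_on (ring_key y) (set (rings N y t) \<union> set ((i, 0) # map (skip_ring i) (rings N ?y' ?t')))"
    unfolding st[symmetric] Un_absorb by (rule inj_on_subset[OF inj_on_ring_key[OF r] set_rings_subset])
  show "sorted (map (ring_key y) (rings N y t))" by (rule sorted_rings)
  show "distinct (map (ring_key y) (rings N y t))"
    using inj by (auto simp: distinct_map distinct_rings intro: inj_on_subset)
  have "distinct ((i, 0) # map (skip_ring i) (rings N ?y' ?t'))"
    using inj_skip_ring by (auto simp: distinct_map distinct_rings skip_ring_def split: if_splits intro: inj_on_subset)
  then show "distinct (map (ring_key y) ((i, 0) # map (skip_ring i) (rings N ?y' ?t')))"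
    unfolding distinct_map using inj[unfolded st Un_absorb] by blast
  have eq: "map (ring_key y) (map (skip_ring i) (rings N ?y' ?t')) = map (\<lambda>c. ring_key ?y' c + fst (y (i, 0))) (rings N ?y' ?t')"
  proof -
    have "ring_key y (skip_ring i c) = ring_key ?y' c + fst (y (i, 0))" if "c \<in> set (rings N ?y' ?t')" for c
      using that set_rings_subset[of N ?y' ?t'] ring_time_shift[OF i, of "fst c" y "snd c"]
      by (cases c) (auto simp: ring_key_def)
    then show ?thesis by auto
  qed
  have so: "sorted (map (\<lambda>c. ring_key ?y' c + fst (y (i, 0))) (rings N ?y' ?t'))"
    using sorted_rings[of ?y' N ?t'] by (simp add: sorted_iff_nth_mono)
  have ge': "\<forall>c\<in>set (rings N ?y' ?t'). ring_key y (i, 0) \<le> ring_key y (skip_ring i c)"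
    using s' by (auto simp: ring_key_def skip_ring_def split: if_splits intro!: ge)
  show "sorted (map (ring_key y) ((i, 0) # map (skip_ring i) (rings N ?y' ?t')))"
  proof -
    have "sorted (map (ring_key y) (map (skip_ring i) (rings N ?y' ?t')))"
      unfolding eq by (rule so)
    then show ?thesis using ge' by simp
  qed
qed

section \<open>The law of the dynamics\<close>

text \<open>The update with the uniform variable as an explicit argument, so that this variable can
  be integrated out.\<close>

definition heat_bath :: "real \<Rightarrow> factor_graph \<Rightarrow> (nat \<Rightarrow> real) \<Rightarrow> nat \<Rightarrow> real \<Rightarrow> config \<Rightarrow> config" where
  "heat_bath \<beta> G J i v \<sigma> = \<sigma>(i := if v \<le> (1 + tanh (\<beta> * local_field G J i \<sigma>)) / 2 then 1 else -1)"

lemma heat_bath_update_eq: "heat_bath_update \<beta> G J y c = heat_bath \<beta> G J (fst c) (snd (y c))"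
  by (cases c) (auto simp: heat_bath_update_def heat_bath_def fun_eq_iff)

text \<open>Shifting the clocks changes waiting times only. The uniform variables stay attached to
  their rings, so both lists perform the same updates.\<close>

lemma fold_map_skip:
  assumes i: "i < N" and "set L \<subseteq> {..<N} \<times> UNIV"
  shows "fold (heat_bath_update \<beta> G J y) (map (skip_ring i) L) \<sigma>
    = fold (heat_bath_update \<beta> G J (shift_clocks N i s y)) L \<sigma>"
  using assms(2)
proof (induction L arbitrary: \<sigma>)
  case (Cons c L)
  have "heat_bath_update \<beta> G J y (skip_ring i c) \<sigma> = heat_bath_update \<beta> G J (shift_clocks N i s y) c \<sigma>"
    using Cons.prems i
    by (cases c) (auto simp: heat_bath_update_eq shift_clocks_def sub_first_def skip_ring_def)
  then show ?case using Cons by simp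
qed simp

text \<open>Restricts the run to exactly n rings before t, so that its mean can be computed by
  induction on n.\<close>

definition run_with_count ::
  "real \<Rightarrow> nat \<Rightarrow> factor_graph \<Rightarrow> (nat \<Rightarrow> real) \<Rightarrow> (config \<Rightarrow> real) \<Rightarrow> nat \<Rightarrow> real \<Rightarrow> config \<Rightarrow> clocks \<Rightarrow> ennreal" where
  "run_with_count \<beta> N G J F n t \<sigma> y =
     (if length (rings N y t) = n then ennreal (F (fold (heat_bath_update \<beta> G J y) (rings N y t) \<sigma>)) else 0)"

lemma rings_eq_Nil_iff:
  assumes r: "regular_clocks N y"
  shows "rings N y t = [] \<longleftrightarrow> (\<forall>i<N. t < fst (y (i, 0)))"
proof -
  have m: "ring_time y i 0 \<le> ring_time y i k" if "i < N" for i k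
    using r that by (auto simp: regular_clocks_def strict_mono_less_eq simp del: ring_time_0)
  have "rings N y t = [] \<longleftrightarrow> {(i, k). i < N \<and> ring_time y i k \<le> t} = {}"
    by (metis set_empty set_rings_regular[OF r])
  also have "\<dots> \<longleftrightarrow> (\<forall>i<N. t < ring_time y i 0)"
  proof
    assume "{(i, k). i < N \<and> ring_time y i k \<le> t} = {}"
    then have "(i, 0) \<notin> {(i, k). i < N \<and> ring_time y i k \<le> t}" for i by blast
    then show "\<forall>i<N. t < ring_time y i 0" by (auto simp: not_le)
  next
    assume a: "\<forall>i<N. t < ring_time y i 0"
    have "\<not> ring_time y i k \<le> t" if "i < N" for i k
      using a m[OF that, of k] that by (meson leD order_trans)
    then show "{(i, k). i < N \<and> ring_time y i k \<le> t} = {}" by auto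
  qed
  finally show ?thesis by simp
qed

text \<open>Decomposition according to the spin whose clock rings first. Since first waits of
  distinct spins differ, at most one summand is nonzero, and by \<open>rings_first_step\<close> it
  is the run with one ring fewer started after the first update.\<close>

lemma run_with_count_Suc:
  assumes r: "regular_clocks N y"
  shows "run_with_count \<beta> N G J F (Suc n) t \<sigma> y =
    (\<Sum>i<N. indicator {y. \<forall>j\<in>{..<N} - {i}. fst (y (i, 0)) \<le> fst (y (j, 0))} y * indicator {..t} (fst (y (i, 0))) *
       run_with_count \<beta> N G J F n (t - fst (y (i, 0))) (heat_bath \<beta> G J i (snd (y (i, 0))) \<sigma>)
         (shift_clocks N i (fst (y (i, 0))) y))"
    (is "_ = (\<Sum>i<N. ?g i)")
proof (cases "\<exists>i<N. fst (y (i, 0)) \<le> t")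
  case False
  then have "rings N y t = []" using rings_eq_Nil_iff[OF r] by auto
  then show ?thesis using False by (auto simp: run_with_count_def not_le)
next
  case True
  then have ne: "{..<N} \<noteq> {}" by auto
  define i where "i = arg_min_on (\<lambda>i. fst (y (i, 0))) {..<N}"
  have i: "i < N" and mn: "\<And>j. j < N \<Longrightarrow> fst (y (i, 0)) \<le> fst (y (j, 0))"
    using arg_min_if_finite(1)[OF _ ne, of "\<lambda>i. fst (y (i, 0))"]
      arg_min_least[OF _ ne, of _ "\<lambda>i. fst (y (i, 0))"] by (auto simp: i_def)
  then have t: "fst (y (i, 0)) \<le> t" using True order_trans by blast
  have uniq: "j = i" if "j < N" "\<forall>j'\<in>{..<N} - {j}. fst (y (j, 0)) \<le> fst (y (j', 0))" for j
  proof (rule ccontr)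
    assume "j \<noteq> i"
    then have "fst (y (j, 0)) \<le> fst (y (i, 0))" using that(2) i by auto
    then have "fst (y (j, 0)) = fst (y (i, 0))" using mn[OF that(1)] by simp
    then have "ring_time y j 0 = ring_time y i 0" by simp
    then show False using r \<open>j \<noteq> i\<close> i that(1) unfolding regular_clocks_def by blast
  qed
  have "(\<Sum>j<N. ?g j) = ?g i"
  proof (subst sum.remove[of _ i])
    have "?g j = 0" if "j \<in> {..<N} - {i}" for j
      using uniq[of j] that by (auto simp: indicator_def)
    then show "?g i + sum ?g ({..<N} - {i}) = ?g i" by simp
  qed (use i in auto)
  moreover have "?g i = run_with_count \<beta> N G J F n (t - fst (y (i, 0))) (heat_bath \<beta> G J i (snd (y (i, 0))) \<sigma>)
         (shift_clocks N i (fst (y (i, 0))) y)"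
    using mn t by (simp add: indicator_def)
  moreover have "run_with_count \<beta> N G J F (Suc n) t \<sigma> y = \<dots>"
  proof -
    have st: "rings N y t = (i, 0) # map (skip_ring i)
        (rings N (shift_clocks N i (fst (y (i, 0))) y) (t - fst (y (i, 0))))"
      by (rule rings_first_step[OF r i _ t]) (rule mn)
    show ?thesis
      unfolding run_with_count_def st by (simp add: fold_map_skip[OF i set_rings_subset, where s = "fst (y (i, 0))"] heat_bath_update_eq)
  qed
  ultimately show ?thesis by simp
qed

section \<open>Measurability of the ring list and of the dynamics\<close>

lemma measurable_ring_time:
  assumes "f \<in> M \<rightarrow>\<^sub>M clock_space N" "i < N"
  shows "(\<lambda>x. ring_time (f x) i k) \<in> borel_measurable M"
  unfolding ring_time_def
  by (intro borel_measurable_sum measurable_compose[OF measurable_clocks_component[OF assms(1)]]) (use assms in auto)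

lemma measurable_ring_count:
  assumes "f \<in> M \<rightarrow>\<^sub>M clock_space N" "i < N" and [measurable]: "t \<in> borel_measurable M"
  shows "(\<lambda>x. ring_count (f x) (t x) i) \<in> M \<rightarrow>\<^sub>M count_space UNIV"
proof -
  note [measurable] = measurable_ring_time[OF assms(1,2)]
  show ?thesis unfolding ring_count_def by (rule measurable_card) simp
qed

lemma measurable_insort_key:
  assumes [measurable]: "\<And>c. c \<in> set (x # xs) \<Longrightarrow> (\<lambda>z. key z c :: real) \<in> borel_measurable M"
  shows "(\<lambda>z. insort_key (key z) x xs :: 'a::countable list) \<in> M \<rightarrow>\<^sub>M count_space UNIV"
  using assms
proof (induction xs)
  case (Cons c xs)
  have [measurable]: "(\<lambda>z. insort_key (key z) x xs) \<in> M \<rightarrow>\<^sub>M count_space UNIV"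
    using Cons by auto
  have [measurable]: "(\<lambda>z. key z x) \<in> borel_measurable M" "(\<lambda>z. key z c) \<in> borel_measurable M"
    using Cons.prems by auto
  have "(\<lambda>z. c # insort_key (key z) x xs) \<in> M \<rightarrow>\<^sub>M count_space UNIV"
    by (rule measurable_compose[of "\<lambda>z. insort_key (key z) x xs" M "count_space UNIV" "\<lambda>l. c # l"]) auto
  then show ?case by simp
qed simp

text \<open>The key is random, so the sorted tail is treated as a random variable with countably
  many values. Its range is restricted to lists over \<open>set xs\<close>, because only there the
  keys are known to be measurable.\<close>

lemma measurable_sort_key:
  assumes "\<And>c. c \<in> set xs \<Longrightarrow> (\<lambda>z. key z c :: real) \<in> borel_measurable M"
  shows "(\<lambda>z. sort_key (key z) xs :: 'a::countable list) \<in> M \<rightarrow>\<^sub>M count_space UNIV"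
  using assms
proof (induction xs)
  case (Cons x xs)
  have 1: "(\<lambda>z. sort_key (key z) xs) \<in> M \<rightarrow>\<^sub>M count_space {ys. set ys \<subseteq> set xs}"
  proof -
    have "(\<lambda>z. sort_key (key z) xs) \<in> M \<rightarrow>\<^sub>M count_space UNIV" using Cons by auto
    then show ?thesis
      by (auto simp: measurable_def)
  qed
  have "(\<lambda>z. (\<lambda>ys z. insort_key (key z) x ys) (sort_key (key z) xs) z) \<in> M \<rightarrow>\<^sub>M count_space UNIV"
    by (rule measurable_compose_countable'[OF _ 1]) (use Cons.prems in \<open>auto intro!: measurable_insort_key simp: subset_iff\<close>)
  then show ?case by simp
qed simp

lemma measurable_append_count_space:
  fixes f g :: "'b \<Rightarrow> 'a::countable list"
  assumes "f \<in> M \<rightarrow>\<^sub>M count_space UNIV" "g \<in> M \<rightarrow>\<^sub>M count_space UNIV"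
  shows "(\<lambda>x. f x @ g x) \<in> M \<rightarrow>\<^sub>M count_space UNIV"
  by (rule measurable_compose_countable[where f = "\<lambda>l x. l @ g x" and g = f])
    (auto intro!: measurable_compose[OF assms(2)] assms(1))

text \<open>The list that gets sorted has random length through the ring counts, so measurability is
  glued from the countably many possible unsorted lists.\<close>

lemma measurable_rings:
  assumes f: "f \<in> M \<rightarrow>\<^sub>M clock_space N" and t: "t \<in> borel_measurable M"
  shows "(\<lambda>x. rings N (f x) (t x)) \<in> M \<rightarrow>\<^sub>M count_space UNIV"
proof -
  have *: "(\<lambda>x. concat (map (\<lambda>i. map (\<lambda>k. (i, k)) [0..<ring_count (f x) (t x) i]) is)) \<in> M \<rightarrow>\<^sub>M count_space UNIV"
    if "set is \<subseteq> {..<N}" for "is"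
    using that
  proof (induction "is")
    case (Cons i "is")
    have "(\<lambda>x. map (\<lambda>k. (i, k)) [0..<ring_count (f x) (t x) i]) \<in> M \<rightarrow>\<^sub>M count_space UNIV"
      by (rule measurable_compose[OF measurable_ring_count[OF f _ t]]) (use Cons.prems in auto)
    then show ?case using measurable_append_count_space Cons by simp
  qed simp
  let ?xs = "\<lambda>x. concat (map (\<lambda>i. map (\<lambda>k. (i, k)) [0..<ring_count (f x) (t x) i]) [0..<N])"
  have 1: "?xs \<in> M \<rightarrow>\<^sub>M count_space {xs. set xs \<subseteq> {..<N} \<times> UNIV}"
    using *[of "[0..<N]"] by (auto simp: measurable_def atLeast0LessThan)
  have "(\<lambda>x. (\<lambda>xs x. sort_key (\<lambda>(i, k). ring_time (f x) i k) xs) (?xs x) x) \<in> M \<rightarrow>\<^sub>M count_space UNIV"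
    by (rule measurable_compose_countable'[OF _ 1])
      (auto intro!: measurable_sort_key measurable_ring_time[OF f] simp: case_prod_unfold)
  then show ?thesis unfolding rings_def by simp
qed

lemma measurable_fold_heat_bath:
  assumes f: "f \<in> M \<rightarrow>\<^sub>M clock_space N" and "set L \<subseteq> {..<N} \<times> UNIV"
  shows "(\<lambda>x. F (fold (heat_bath_update \<beta> G J (f x)) L \<sigma>) :: real) \<in> borel_measurable M"
  using assms(2)
proof (induction L arbitrary: \<sigma>)
  case (Cons c L)
  obtain i k where c: "c = (i, k)" by (cases c)
  have [measurable]: "(\<lambda>x. snd (f x (i, k))) \<in> borel_measurable M"
    by (rule measurable_compose[OF measurable_clocks_component[OF f, of "(i, k)"]]) (use Cons.prems c in auto)
  have [measurable]: "(\<lambda>x. F (fold (heat_bath_update \<beta> G J (f x)) L (\<sigma>(i := s)))) \<in> borel_measurable M" for s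
    using Cons by auto
  have "(\<lambda>x. F (fold (heat_bath_update \<beta> G J (f x)) (c # L) \<sigma>)) =
    (\<lambda>x. if snd (f x (i, k)) \<le> (1 + tanh (\<beta> * local_field G J i \<sigma>)) / 2
      then F (fold (heat_bath_update \<beta> G J (f x)) L (\<sigma>(i := 1)))
      else F (fold (heat_bath_update \<beta> G J (f x)) L (\<sigma>(i := - 1))))"
    by (auto simp: heat_bath_update_eq heat_bath_def c)
  then show ?case by simp
qed simp

lemma measurable_glauber:
  assumes f: "f \<in> M \<rightarrow>\<^sub>M clock_space N" and t: "t \<in> borel_measurable M"
  shows "(\<lambda>x. F (fold (heat_bath_update \<beta> G J (f x)) (rings N (f x) (t x)) \<sigma>) :: real) \<in> borel_measurable M"
proof -
  have 1: "(\<lambda>x. rings N (f x) (t x)) \<in> M \<rightarrow>\<^sub>M count_space {xs. set xs \<subseteq> {..<N} \<times> UNIV}"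
    using measurable_rings[OF f t] set_rings_subset by (fastforce simp: measurable_def)
  have "(\<lambda>x. (\<lambda>L x. F (fold (heat_bath_update \<beta> G J (f x)) L \<sigma>)) (rings N (f x) (t x)) x) \<in> borel_measurable M"
    by (rule measurable_compose_countable'[OF _ 1]) (auto intro!: measurable_fold_heat_bath[OF f])
  then show ?thesis .
qed

lemma measurable_run_with_count:
  assumes f: "f \<in> M \<rightarrow>\<^sub>M clock_space N" and t: "t \<in> borel_measurable M"
  shows "(\<lambda>x. run_with_count \<beta> N G J F n (t x) \<sigma> (f x)) \<in> borel_measurable M"
proof -
  note [measurable] = measurable_glauber[OF f t]
  have [measurable]: "(\<lambda>x. length (rings N (f x) (t x))) \<in> M \<rightarrow>\<^sub>M count_space UNIV"
    by (rule measurable_compose[OF measurable_rings[OF f t]]) auto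
  show ?thesis unfolding run_with_count_def by measurable
qed

lemma measurable_run_with_count_heat_bath:
  assumes f: "f \<in> M \<rightarrow>\<^sub>M clock_space N" and t: "t \<in> borel_measurable M" and [measurable]: "v \<in> borel_measurable M"
  shows "(\<lambda>x. run_with_count \<beta> N G J F n (t x) (heat_bath \<beta> G J i (v x) \<sigma>) (f x)) \<in> borel_measurable M"
proof -
  note [measurable] = measurable_run_with_count[OF f t]
  have "(\<lambda>x. run_with_count \<beta> N G J F n (t x) (heat_bath \<beta> G J i (v x) \<sigma>) (f x)) =
    (\<lambda>x. if v x \<le> (1 + tanh (\<beta> * local_field G J i \<sigma>)) / 2
      then run_with_count \<beta> N G J F n (t x) (\<sigma>(i := 1)) (f x)
      else run_with_count \<beta> N G J F n (t x) (\<sigma>(i := - 1)) (f x))"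
    by (auto simp: heat_bath_def)
  then show ?thesis by simp
qed

section \<open>Almost sure regularity of the clocks\<close>

lemma AE_clock_measure_fst:
  assumes "AE x in lborel. P x" and [measurable]: "Measurable.pred borel P"
  shows "AE a in clock_measure. 0 \<le> fst a \<and> P (fst a)"
proof -
  let ?S = "{a :: real \<times> real. \<not> (0 \<le> fst a \<and> P (fst a))}"
  have Sm[measurable]: "?S \<in> sets (borel \<Otimes>\<^sub>M borel)"
  proof -
    have "{a \<in> space (borel \<Otimes>\<^sub>M borel :: (real \<times> real) measure). \<not> (0 \<le> fst a \<and> P (fst a))} \<in> sets (borel \<Otimes>\<^sub>M borel)"
      by measurable
    moreover have "?S = {a \<in> space (borel \<Otimes>\<^sub>M borel :: (real \<times> real) measure). \<not> (0 \<le> fst a \<and> P (fst a))}"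
      by (simp add: space_pair_measure)
    ultimately show ?thesis by (simp only:)
  qed
  interpret b: prob_space "uniform_measure lborel {0..1::real}" by (rule prob_space_unit)
  have "emeasure clock_measure ?S = (\<integral>\<^sup>+a. indicator ?S a \<partial>clock_measure)"
    using Sm by (subst nn_integral_indicator) (simp_all add: sets_clock_measure)
  also have "\<dots> = (\<integral>\<^sup>+x. ennreal (exponential_density 1 x) * (\<integral>\<^sup>+v. indicator ?S (x, v) \<partial>uniform_measure lborel {0..1}) \<partial>lborel)"
    by (rule nn_integral_clock_measure) measurable
  also have "\<dots> = (\<integral>\<^sup>+x. 0 \<partial>(lborel :: real measure))"
  proof (rule nn_integral_cong_AE, use assms(1) in eventually_elim)
    case (elim x)
    then show ?case by (cases "x < 0") (auto simp: exponential_density_def indicator_def)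
  qed
  finally have "?S \<in> null_sets clock_measure" using Sm by (simp add: null_sets_def sets_clock_measure)
  then show ?thesis by (rule AE_I'[where P = "\<lambda>a. 0 \<le> fst a \<and> P (fst a)"]) auto
qed

lemma AE_clock_measure_pos: "AE a in clock_measure. 0 < fst a"
proof -
  have "AE a in clock_measure. 0 \<le> fst a \<and> fst a \<noteq> 0"
    by (rule AE_clock_measure_fst) (auto intro: AE_lborel_singleton)
  then show ?thesis by eventually_elim auto
qed

lemma AE_clock_space_component:
  assumes "AE a in clock_measure. P a" "c \<in> {..<N} \<times> UNIV"
  shows "AE y in clock_space N. P (y c)"
proof -
  interpret product_prob_space "\<lambda>_. clock_measure" "{..<N} \<times> (UNIV :: nat set)" by unfold_locales
  show ?thesis unfolding clock_space_eq by (rule AE_component) (use assms in auto)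
qed

text \<open>Fubini: a property holds almost surely if it holds for almost every value of one waiting
  time, all other coordinates being frozen.\<close>

lemma AE_clock_space_resample:
  assumes c: "c \<in> {..<N} \<times> UNIV" and Q[measurable]: "Measurable.pred (clock_space N) Q"
    and ae: "\<And>y. y \<in> space (clock_space N) \<Longrightarrow> AE a in clock_measure. Q (y(c := a))"
  shows "AE y in clock_space N. Q y"
proof -
  interpret C: prob_space "clock_space N" by (rule prob_space_clock_space)
  interpret P: pair_sigma_finite clock_measure "clock_space N" ..
  have mu: "(\<lambda>z. (snd z)(c := fst z)) \<in> clock_measure \<Otimes>\<^sub>M clock_space N \<rightarrow>\<^sub>M clock_space N"
    by (rule measurable_clock_upd[OF c]) measurable
  let ?I = "\<lambda>y. indicator {y \<in> space (clock_space N). \<not> Q y} y :: ennreal"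
  have m[measurable]: "?I \<in> borel_measurable (clock_space N)" by measurable
  have "emeasure (clock_space N) {y \<in> space (clock_space N). \<not> Q y} = (\<integral>\<^sup>+y. ?I y \<partial>clock_space N)"
    by (subst nn_integral_indicator) auto
  also have "\<dots> = (\<integral>\<^sup>+a. (\<integral>\<^sup>+y. ?I (y(c := a)) \<partial>clock_space N) \<partial>clock_measure)"
    by (rule nn_integral_clock_space_resample[OF m c])
  also have "\<dots> = (\<integral>\<^sup>+y. (\<integral>\<^sup>+a. ?I (y(c := a)) \<partial>clock_measure) \<partial>clock_space N)"
    by (rule P.Fubini'[symmetric]) (use measurable_compose[OF mu m] in \<open>simp add: case_prod_unfold\<close>)
  also have "\<dots> = (\<integral>\<^sup>+y. 0 \<partial>clock_space N)"
  proof (rule nn_integral_cong)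
    fix y assume y: "y \<in> space (clock_space N)"
    have "(\<integral>\<^sup>+a. ?I (y(c := a)) \<partial>clock_measure) = (\<integral>\<^sup>+a. 0 \<partial>clock_measure)"
      by (rule nn_integral_cong_AE, use ae[OF y] in eventually_elim) auto
    then show "(\<integral>\<^sup>+a. ?I (y(c := a)) \<partial>clock_measure) = 0" by simp
  qed
  finally have "{y \<in> space (clock_space N). \<not> Q y} \<in> null_sets (clock_space N)" by (auto simp: null_sets_def)
  then show ?thesis by (rule AE_I') auto
qed

lemma emeasure_clock_fst_ge: "0 \<le> s \<Longrightarrow> emeasure clock_measure {a. s \<le> fst a} = ennreal (exp (- s))"
proof -
  assume s: "0 \<le> s"
  have "{a \<in> space (borel \<Otimes>\<^sub>M borel :: (real \<times> real) measure). s \<le> fst a} \<in> sets (borel \<Otimes>\<^sub>M borel)"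
    by measurable
  then have m: "{a. s \<le> fst a} \<in> sets clock_measure" by (simp add: space_pair_measure sets_clock_measure)
  have "emeasure clock_measure {a. s \<le> fst a} = (\<integral>\<^sup>+a. indicator {a. s \<le> fst a} a \<partial>clock_measure)"
    using m by (subst nn_integral_indicator) auto
  also have "\<dots> = (\<integral>\<^sup>+a. indicator {s..} (fst a) * (\<lambda>_. 1) (fst a - s, snd a) \<partial>clock_measure)"
    by (intro nn_integral_cong) (auto simp: indicator_def)
  also have "\<dots> = ennreal (exp (- s)) * (\<integral>\<^sup>+a. (\<lambda>_. 1) (a :: real \<times> real) \<partial>clock_measure)"
    by (rule nn_integral_clock_measure_shift[OF _ s]) auto
  finally show ?thesis by (simp add: clk.emeasure_space_1[simplified])
qed

text \<open>The first m waits all stay below n with probability (1 - exp (- n))^m, which tends to 0.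
  Unbounded waits already force the ring times to infinity, so no law of large numbers is called
  for.\<close>

lemma AE_exists_large_wait:
  assumes i: "i < N"
  shows "AE y in clock_space N. \<exists>k. real n \<le> fst (y (i, k))"
proof -
  interpret product_prob_space "\<lambda>_. clock_measure" "{..<N} \<times> (UNIV :: nat set)" by unfold_locales
  define A where "A = {a :: real \<times> real. \<not> real n \<le> fst a}"
  have "{a \<in> space (borel \<Otimes>\<^sub>M borel :: (real \<times> real) measure). real n \<le> fst a} \<in> sets (borel \<Otimes>\<^sub>M borel)"
    by measurable
  then have A': "{a. real n \<le> fst a} \<in> sets clock_measure" by (simp add: space_pair_measure sets_clock_measure)
  have Aeq: "A = space clock_measure - {a. real n \<le> fst a}" by (auto simp: A_def)
  have Am: "A \<in> sets clock_measure" unfolding Aeq by (rule sets.compl_sets[OF A'])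
  define r where "r = 1 - exp (- real n)"
  have r: "0 \<le> r" "r < 1" by (auto simp: r_def)
  have "measure clock_measure {a. real n \<le> fst a} = exp (- real n)"
    using emeasure_clock_fst_ge[of "real n"] by (simp add: measure_def)
  then have "measure clock_measure A = r"
    unfolding Aeq using clk.prob_compl[OF A'] by (simp add: r_def)
  then have eA: "emeasure clock_measure A = ennreal r" by (simp add: clk.emeasure_eq_measure)
  let ?B = "{y \<in> space (clock_space N). \<not> (\<exists>k. real n \<le> fst (y (i, k)))}"
  let ?B' = "\<lambda>m. {y \<in> space (clock_space N). \<forall>c\<in>{i} \<times> {..<m}. y c \<in> A}"
  have le: "emeasure (clock_space N) ?B \<le> ennreal (r ^ m)" for m
  proof -
    have "emeasure (clock_space N) (?B' m) = (\<Prod>c\<in>{i} \<times> {..<m}. emeasure clock_measure A)"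
      unfolding clock_space_eq by (rule emeasure_PiM_Collect) (use i Am in auto)
    also have "\<dots> = ennreal (r ^ m)" using r by (simp add: eA ennreal_power)
    finally have e: "emeasure (clock_space N) (?B' m) = ennreal (r ^ m)" .
    have "?B' m \<in> sets (clock_space N)"
      unfolding clock_space_eq by measurable (use i Am in auto)
    then have "emeasure (clock_space N) ?B \<le> emeasure (clock_space N) (?B' m)"
      by (intro emeasure_mono) (auto simp: A_def)
    then show ?thesis using e by simp
  qed
  have lim: "(\<lambda>m. ennreal (r ^ m)) \<longlonglongrightarrow> ennreal 0"
    using r by (intro tendsto_ennrealI LIMSEQ_realpow_zero) auto
  have "emeasure (clock_space N) ?B \<le> 0"
    using LIMSEQ_le_const[OF lim, of "emeasure (clock_space N) ?B"] le by auto
  moreover have "?B \<in> sets (clock_space N)"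
  proof -
    have [measurable]: "(\<lambda>y. y (i, k)) \<in> clock_space N \<rightarrow>\<^sub>M borel \<Otimes>\<^sub>M borel" for k
      using measurable_clocks_component[OF measurable_ident_sets[OF refl], of "(i, k)" N] i by auto
    show ?thesis by measurable
  qed
  ultimately have "?B \<in> null_sets (clock_space N)" by (auto simp: null_sets_def)
  then show ?thesis by (rule AE_I') auto
qed

text \<open>The last conjunct puts every ring after time 0, so that the dynamics at time 0 is still
  in its initial configuration.\<close>

lemma AE_regular_clocks:
  "AE y in clock_space N. regular_clocks N y \<and> (\<forall>i<N. 0 < fst (y (i, 0)))"
proof -
  have pos: "AE y in clock_space N. \<forall>c\<in>{..<N} \<times> UNIV. 0 < fst (y c)"
    by (rule AE_ball_countable') (auto intro!: AE_clock_space_component AE_clock_measure_pos)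
  have large: "AE y in clock_space N. \<forall>i\<in>{..<N}. \<forall>n::nat. \<exists>k. real n \<le> fst (y (i, k))"
    by (intro AE_ball_countable' AE_all_countable[THEN iffD2] allI AE_exists_large_wait) auto
  \<comment> \<open>Resampling the first wait of i translates all ring times of i by a variable with
    a density and leaves those of j fixed, so a tie has probability 0.\<close>
  have dis1: "AE y in clock_space N. ring_time y i k \<noteq> ring_time y j m" if "i < N" "j < N" "i \<noteq> j" for i j k m
  proof (rule AE_clock_space_resample[of "(i, 0)"])
    show "(i, 0) \<in> {..<N} \<times> UNIV" using that by auto
    have rm: "(\<lambda>y. ring_time y a b) \<in> borel_measurable (clock_space N)" if "a < N" for a b
      using that by (intro measurable_ring_time measurable_ident_sets) auto
    show "Measurable.pred (clock_space N) (\<lambda>y. ring_time y i k \<noteq> ring_time y j m)"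
      unfolding pred_def by (rule borel_measurable_neq) (use rm that in auto)
    fix y :: clocks
    have 1: "ring_time (y((i, 0) := a)) i k = fst a + (\<Sum>b\<in>{..k} - {0}. fst (y (i, b)))" for a
      unfolding ring_time_def by (subst sum.remove[of _ 0]) auto
    have 2: "ring_time (y((i, 0) := a)) j m = ring_time y j m" for a
      using that by (auto simp: ring_time_def)
    have "AE a in clock_measure. 0 \<le> fst a \<and> fst a \<noteq> ring_time y j m - (\<Sum>b\<in>{..k} - {0}. fst (y (i, b)))"
      by (rule AE_clock_measure_fst) (auto intro: AE_lborel_singleton)
    then show "AE a in clock_measure. ring_time (y((i, 0) := a)) i k \<noteq> ring_time (y((i, 0) := a)) j m"
      by eventually_elim (auto simp: 1 2)
  qed
  have dis: "AE y in clock_space N. \<forall>i\<in>{..<N}. \<forall>j\<in>{..<N}. \<forall>k m. i \<noteq> j \<longrightarrow> ring_time y i k \<noteq> ring_time y j m"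
    by (intro AE_ball_countable' AE_all_countable[THEN iffD2] allI) (auto intro: dis1)
  show ?thesis
    using pos large dis
  proof eventually_elim
    case (elim y)
    have sm: "strict_mono (ring_time y i)" if "i < N" for i
      unfolding strict_mono_Suc_iff using elim(1) that by (auto simp: ring_time_def)
    have "finite {k. ring_time y i k \<le> t}" if i: "i < N" for i t
    proof -
      obtain n :: nat where n: "t < real n" using reals_Archimedean2 by blast
      obtain k where k: "real n \<le> fst (y (i, k))" using elim(2) i by blast
      have "fst (y (i, k)) \<le> ring_time y i k"
        unfolding ring_time_def using elim(1) i by (intro member_le_sum) (auto simp: less_imp_le)
      then have kt: "t < ring_time y i k" using n k by simp
      have "m < k" if "ring_time y i m \<le> t" for m
        using sm[OF i] kt that by (meson leD le_less_trans linorder_not_less strict_mono_less_eq)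
      then have "{k. ring_time y i k \<le> t} \<subseteq> {..<k}" by auto
      then show ?thesis using finite_subset by blast
    qed
    then show ?case using sm elim by (auto simp: regular_clocks_def)
  qed
qed

section \<open>Single-spin averages and the Poisson mixture\<close>

text \<open>The conditional mean of f after a heat-bath update at i, as an operator on functions of
  arbitrary configurations.\<close>

definition flip_avg :: "real \<Rightarrow> factor_graph \<Rightarrow> (nat \<Rightarrow> real) \<Rightarrow> nat \<Rightarrow> (config \<Rightarrow> real) \<Rightarrow> config \<Rightarrow> real" where
  "flip_avg \<beta> G J i f \<sigma> =
     (1 + tanh (\<beta> * local_field G J i \<sigma>)) / 2 * f (\<sigma>(i := 1))
     + (1 - tanh (\<beta> * local_field G J i \<sigma>)) / 2 * f (\<sigma>(i := -1))"

text \<open>N times the transition operator of the chain that updates a uniformly chosen spin; the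
  generator of the continuous-time dynamics is this operator minus N.\<close>

definition flip_sum :: "real \<Rightarrow> nat \<Rightarrow> factor_graph \<Rightarrow> (nat \<Rightarrow> real) \<Rightarrow> (config \<Rightarrow> real) \<Rightarrow> config \<Rightarrow> real" where
  "flip_sum \<beta> N G J f \<sigma> = (\<Sum>i<N. flip_avg \<beta> G J i f \<sigma>)"

lemma flip_avg_nonneg: "(\<And>\<sigma>. 0 \<le> f \<sigma>) \<Longrightarrow> 0 \<le> flip_avg \<beta> G J i f \<sigma>"
  using tanh_real_lt_1[of "\<beta> * local_field G J i \<sigma>"] tanh_real_gt_neg1[of "\<beta> * local_field G J i \<sigma>"]
  by (auto simp: flip_avg_def intro!: add_nonneg_nonneg mult_nonneg_nonneg)

lemma flip_sum_pow_nonneg: "(\<And>\<sigma>. 0 \<le> f \<sigma>) \<Longrightarrow> 0 \<le> (flip_sum \<beta> N G J ^^ n) f \<sigma>"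
  by (induction n arbitrary: \<sigma>) (auto simp: flip_sum_def intro!: sum_nonneg flip_avg_nonneg)

lemma nn_integral_heat_bath:
  assumes "\<And>\<sigma>. 0 \<le> f \<sigma>"
  shows "(\<integral>\<^sup>+v. ennreal (f (heat_bath \<beta> G J i v \<sigma>)) \<partial>uniform_measure lborel {0..1}) = ennreal (flip_avg \<beta> G J i f \<sigma>)"
proof -
  define r where "r = (1 + tanh (\<beta> * local_field G J i \<sigma>)) / 2"
  have r: "0 \<le> r" "r \<le> 1"
    using tanh_real_lt_1[of "\<beta> * local_field G J i \<sigma>"] tanh_real_gt_neg1[of "\<beta> * local_field G J i \<sigma>"]
    by (auto simp: r_def)
  have r': "1 - r = (1 - tanh (\<beta> * local_field G J i \<sigma>)) / 2" by (simp add: r_def field_simps)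
  have hb: "heat_bath \<beta> G J i v \<sigma> = (if v \<le> r then \<sigma>(i := 1) else \<sigma>(i := -1))" for v
    by (simp add: heat_bath_def r_def)
  have "(\<integral>\<^sup>+v. ennreal (f (heat_bath \<beta> G J i v \<sigma>)) \<partial>uniform_measure lborel {0..1})
    = (\<integral>\<^sup>+v. ennreal (if v \<le> r then f (\<sigma>(i := 1)) else f (\<sigma>(i := -1))) * indicator {0..1} v \<partial>lborel)"
    unfolding hb by (subst nn_integral_uniform_measure) (auto simp: if_distrib divide_ennreal_def cong: if_cong)
  also have "\<dots> = (\<integral>\<^sup>+v. ennreal (f (\<sigma>(i := 1))) * indicator {0..r} v + ennreal (f (\<sigma>(i := -1))) * indicator {r<..1} v \<partial>lborel)"
    using r by (intro nn_integral_cong) (auto simp: indicator_def)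
  also have "\<dots> = ennreal (f (\<sigma>(i := 1))) * ennreal r + ennreal (f (\<sigma>(i := -1))) * ennreal (1 - r)"
    using r by (subst nn_integral_add) (auto simp: nn_integral_cmult)
  also have "\<dots> = ennreal (flip_avg \<beta> G J i f \<sigma>)"
    using r assms by (simp add: flip_avg_def r'[symmetric] r_def[symmetric] ennreal_mult[symmetric] ennreal_plus[symmetric] mult.commute del: ennreal_plus)
  finally show ?thesis .
qed

text \<open>The first ring of i has left the shifted clocks, which are therefore independent of
  it.\<close>

lemma shift_clocks_upd: "shift_clocks N i s (y((i, 0) := a)) = shift_clocks N i s y"
  by (auto simp: shift_clocks_def sub_first_def skip_ring_def fun_eq_iff)

lemma nn_integral_power_diff:
  assumes "0 \<le> t" "0 \<le> c"
  shows "(\<integral>\<^sup>+x. ennreal (c * ((t - x) ^ n / fact n)) * indicator {0..t} x \<partial>lborel) = ennreal (c * (t ^ Suc n / fact (Suc n)))"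
proof -
  have d: "((\<lambda>x. - c * ((t - x) ^ Suc n / fact (Suc n))) has_real_derivative c * ((t - x) ^ n / fact n)) (at x)" for x
    by (rule derivative_eq_intros refl | simp)+
  have "(\<integral>\<^sup>+x. ennreal (c * ((t - x) ^ n / fact n)) * indicator {0..t} x \<partial>lborel)
    = ennreal ((- c * ((t - t) ^ Suc n / fact (Suc n))) - (- c * ((t - 0) ^ Suc n / fact (Suc n))))"
    by (rule nn_integral_FTC_Icc) (use assms d in \<open>auto intro: has_field_derivative_at_within\<close>)
  then show ?thesis by simp
qed

text \<open>With the first ring at time x, the factors exp (- x), exp (- x (N - 1)) and exp (- N (t
  - x)) multiply to exp (- N t), free of x. Only (t - x)^n / n! remains to be integrated over x, and
  the update at the first ring adds one application of the operator.\<close>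

lemma nn_integral_run_with_count:
  assumes F: "\<And>\<sigma>. 0 \<le> F \<sigma>" and "0 \<le> t"
  shows "(\<integral>\<^sup>+y. run_with_count \<beta> N G J F n t \<sigma> y \<partial>clock_space N)
    = ennreal (exp (- (N * t)) * (t ^ n / fact n) * (flip_sum \<beta> N G J ^^ n) F \<sigma>)"
  using assms(2)
proof (induction n arbitrary: t \<sigma>)
  case 0
  \<comment> \<open>No ring up to t means waits strictly above t, while lack of memory is stated
    with a weak inequality; the difference is a null event.\<close>
  have ne: "AE y in clock_space N. \<forall>c\<in>{..<N} \<times> UNIV. fst (y c) \<noteq> t"
  proof (rule AE_ball_countable', rule AE_clock_space_component)
    have "AE a in clock_measure. 0 \<le> fst a \<and> fst a \<noteq> t"
      by (rule AE_clock_measure_fst) (auto intro: AE_lborel_singleton)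
    then show "AE a in clock_measure. fst a \<noteq> t" by eventually_elim auto
  qed auto
  have "(\<integral>\<^sup>+y. run_with_count \<beta> N G J F 0 t \<sigma> y \<partial>clock_space N)
    = (\<integral>\<^sup>+y. indicator {y. \<forall>j\<in>{..<N}. t \<le> fst (y (j, 0))} y * (\<lambda>_. ennreal (F \<sigma>)) (sub_first {..<N} t y) \<partial>clock_space N)"
  proof (rule nn_integral_cong_AE, use AE_regular_clocks ne in eventually_elim)
    case (elim y)
    have "rings N y t = [] \<longleftrightarrow> (\<forall>j\<in>{..<N}. t \<le> fst (y (j, 0)))"
      using rings_eq_Nil_iff[of N y t] elim by (auto simp: less_le)
    then show ?case by (auto simp: run_with_count_def indicator_def)
  qed
  also have "\<dots> = ennreal (exp (- t * card {..<N})) * (\<integral>\<^sup>+y. (\<lambda>_. ennreal (F \<sigma>)) y \<partial>clock_space N)"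
    by (rule nn_integral_sub_first) (use 0 in auto)
  also have "\<dots> = ennreal (exp (- (N * t)) * F \<sigma>)"
    using F by (simp add: prob_space.emeasure_space_1[OF prob_space_clock_space] ennreal_mult mult.commute)
  finally show ?case by simp
next
  case (Suc n)
  let ?R = "run_with_count \<beta> N G J F n" and ?A = "flip_sum \<beta> N G J ^^ n"
  let ?U = "\<lambda>i y. indicator {y. \<forall>j\<in>{..<N} - {i}. fst (y (i, 0)) \<le> fst (y (j, 0))} y * indicator {..t} (fst (y (i, 0))) *
       ?R (t - fst (y (i, 0))) (heat_bath \<beta> G J i (snd (y (i, 0))) \<sigma>) (shift_clocks N i (fst (y (i, 0))) y)"
  have comp[measurable]: "(\<lambda>y. y (j, 0)) \<in> clock_space N \<rightarrow>\<^sub>M borel \<Otimes>\<^sub>M borel" if "j < N" for j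
    using measurable_clocks_component[OF measurable_ident_sets[OF refl], of "(j, 0)" N] that by auto
  have mU: "?U i \<in> borel_measurable (clock_space N)" if i: "i < N" for i
  proof -
    have c[measurable]: "(\<lambda>y. fst (y (j, 0))) \<in> borel_measurable (clock_space N)"
        "(\<lambda>y. snd (y (j, 0))) \<in> borel_measurable (clock_space N)" if "j < N" for j
      using comp[OF that] by measurable
    have [measurable]: "Measurable.pred (clock_space N) (\<lambda>y. \<forall>j\<in>{..<N} - {i}. fst (y (i, 0)) \<le> fst (y (j, 0)))"
    proof (intro pred_intros_finite)
      show "Measurable.pred (clock_space N) (\<lambda>y. fst (y (i, 0)) \<le> fst (y (j, 0)))" if "j \<in> {..<N} - {i}" for j
        unfolding pred_def by (rule borel_measurable_le) (use c(1)[of i] c(1)[of j] i that in auto)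
    qed simp
    have [measurable]: "(\<lambda>y. ?R (t - fst (y (i, 0))) (heat_bath \<beta> G J i (snd (y (i, 0))) \<sigma>) (shift_clocks N i (fst (y (i, 0))) y))
       \<in> borel_measurable (clock_space N)"
      using c[OF i] by (intro measurable_run_with_count_heat_bath measurable_shift_clocks measurable_ident_sets) auto
    show ?thesis using c[OF i] by measurable
  qed
  have Ui: "(\<integral>\<^sup>+y. ?U i y \<partial>clock_space N)
      = ennreal (exp (- (N * t)) * (t ^ Suc n / fact (Suc n)) * flip_avg \<beta> G J i (?A F) \<sigma>)" if i: "i < N" for i
  proof -
    let ?c = "\<lambda>x. exp (- x * (real N - 1)) * (exp (- (N * (t - x))) * ((t - x) ^ n / fact n))"
    let ?hb = "\<lambda>v. heat_bath \<beta> G J i v \<sigma>"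
    have AF: "0 \<le> ?A F \<tau>" for \<tau> using F by (rule flip_sum_pow_nonneg)
    have [measurable]: "(\<lambda>v. ?A F (?hb v)) \<in> borel_measurable borel"
    proof -
      have "(\<lambda>v. ?A F (?hb v)) = (\<lambda>v. if v \<le> (1 + tanh (\<beta> * local_field G J i \<sigma>)) / 2 then ?A F (\<sigma>(i := 1)) else ?A F (\<sigma>(i := -1)))"
        by (auto simp: heat_bath_def)
      then show ?thesis by simp
    qed
    have "(\<integral>\<^sup>+y. ?U i y \<partial>clock_space N) = (\<integral>\<^sup>+a. (\<integral>\<^sup>+y. ?U i (y((i, 0) := a)) \<partial>clock_space N) \<partial>clock_measure)"
      by (rule nn_integral_clock_space_resample[OF mU[OF i]]) (use i in auto)
    also have "\<dots> = (\<integral>\<^sup>+a. indicator {0..t} (fst a) * ennreal (?c (fst a)) * ennreal (?A F (?hb (snd a))) \<partial>clock_measure)"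
    proof (rule nn_integral_cong_AE, use AE_clock_measure_pos in eventually_elim)
      case (elim a)
      show ?case
      proof (cases "fst a \<le> t")
        case True
        have "(\<integral>\<^sup>+y. ?U i (y((i, 0) := a)) \<partial>clock_space N)
          = (\<integral>\<^sup>+y. indicator {y. \<forall>j\<in>{..<N} - {i}. fst a \<le> fst (y (j, 0))} y * ?R (t - fst a) (?hb (snd a)) (shift_clocks N i (fst a) y) \<partial>clock_space N)"
          using True by (intro nn_integral_cong) (auto simp: shift_clocks_upd indicator_def)
        also have "\<dots> = ennreal (exp (- fst a * (real N - 1))) * (\<integral>\<^sup>+y. ?R (t - fst a) (?hb (snd a)) y \<partial>clock_space N)"
          by (rule nn_integral_shift_clocks[OF _ i])
            (use elim in \<open>auto intro!: measurable_run_with_count measurable_ident_sets\<close>)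
        also have "(\<integral>\<^sup>+y. ?R (t - fst a) (?hb (snd a)) y \<partial>clock_space N)
          = ennreal (exp (- (N * (t - fst a))) * ((t - fst a) ^ n / fact n) * ?A F (?hb (snd a)))"
          by (rule Suc.IH) (use True in auto)
        finally have e: "(\<integral>\<^sup>+y. ?U i (y((i, 0) := a)) \<partial>clock_space N) = ennreal (exp (- fst a * (real N - 1))) *
            ennreal (exp (- (N * (t - fst a))) * ((t - fst a) ^ n / fact n) * ?A F (?hb (snd a)))" .
        have assoc: "ennreal x * ennreal (y * z) = ennreal (x * y) * ennreal z" if "0 \<le> x" "0 \<le> y" "0 \<le> z" for x y z
          using that by (simp add: ennreal_mult mult.assoc)
        show ?thesis unfolding e using True elim AF
          by (subst assoc) auto
      qed (auto simp: indicator_def)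
    qed
    also have "\<dots> = (\<integral>\<^sup>+x. ennreal (exponential_density 1 x) *
        (\<integral>\<^sup>+v. indicator {0..t} x * ennreal (?c x) * ennreal (?A F (?hb v)) \<partial>uniform_measure lborel {0..1}) \<partial>lborel)"
      by (subst nn_integral_clock_measure) auto
    also have "\<dots> = (\<integral>\<^sup>+x. ennreal (flip_avg \<beta> G J i (?A F) \<sigma>) *
         (ennreal (exp (- (N * t)) * ((t - x) ^ n / fact n)) * indicator {0..t} x) \<partial>lborel)"
    proof (rule nn_integral_cong)
      fix x :: real
      have 1: "(\<integral>\<^sup>+v. indicator {0..t} x * ennreal (?c x) * ennreal (?A F (?hb v)) \<partial>uniform_measure lborel {0..1})
        = indicator {0..t} x * ennreal (?c x) * ennreal (flip_avg \<beta> G J i (?A F) \<sigma>)"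
        using nn_integral_heat_bath[of "?A F" \<beta> G J i \<sigma>, OF AF] by (subst nn_integral_cmult) auto
      have 2: "ennreal (exponential_density 1 x) * ennreal (?c x) = ennreal (exp (- (N * t)) * ((t - x) ^ n / fact n))"
        if "0 \<le> x" "x \<le> t"
      proof -
        have "exponential_density 1 x * ?c x = exp (- x) * exp (- x * (real N - 1)) * exp (- (N * (t - x))) * ((t - x) ^ n / fact n)"
          using that by (simp add: exponential_density_def)
        also have "exp (- x) * exp (- x * (real N - 1)) * exp (- (N * (t - x))) = exp (- (N * t))"
          by (simp add: mult_exp_exp algebra_simps)
        finally show ?thesis using that by (simp add: ennreal_mult[symmetric])
      qed
      show "ennreal (exponential_density 1 x) *
        (\<integral>\<^sup>+v. indicator {0..t} x * ennreal (?c x) * ennreal (?A F (?hb v)) \<partial>uniform_measure lborel {0..1})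
        = ennreal (flip_avg \<beta> G J i (?A F) \<sigma>) *
         (ennreal (exp (- (N * t)) * ((t - x) ^ n / fact n)) * indicator {0..t} x)"
      proof (cases "x \<in> {0..t}")
        case True
        have "ennreal (exponential_density 1 x) * (ennreal (?c x) * ennreal (flip_avg \<beta> G J i (?A F) \<sigma>))
          = ennreal (flip_avg \<beta> G J i (?A F) \<sigma>) * (ennreal (exponential_density 1 x) * ennreal (?c x))"
          by (simp only: mult_ac)
        then show ?thesis unfolding 1 using 2 True by simp
      qed (simp add: 1)
    qed
    also have "\<dots> = ennreal (flip_avg \<beta> G J i (?A F) \<sigma>) * ennreal (exp (- (N * t)) * (t ^ Suc n / fact (Suc n)))"
      using Suc.prems by (subst nn_integral_cmult, measurable, subst nn_integral_power_diff) auto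
    also have "\<dots> = ennreal (exp (- (N * t)) * (t ^ Suc n / fact (Suc n)) * flip_avg \<beta> G J i (?A F) \<sigma>)"
      using Suc.prems flip_avg_nonneg[of "?A F" \<beta> G J i \<sigma>, OF AF] by (subst ennreal_mult[symmetric]) (auto simp: mult.commute)
    finally show ?thesis .
  qed
  have "(\<integral>\<^sup>+y. run_with_count \<beta> N G J F (Suc n) t \<sigma> y \<partial>clock_space N) = (\<integral>\<^sup>+y. (\<Sum>i<N. ?U i y) \<partial>clock_space N)"
    by (rule nn_integral_cong_AE, use AE_regular_clocks in eventually_elim) (simp add: run_with_count_Suc)
  also have "\<dots> = (\<Sum>i<N. \<integral>\<^sup>+y. ?U i y \<partial>clock_space N)"
    by (rule nn_integral_sum) (use mU in auto)
  also have "\<dots> = (\<Sum>i<N. ennreal (exp (- (N * t)) * (t ^ Suc n / fact (Suc n)) * flip_avg \<beta> G J i (?A F) \<sigma>))"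
    by (intro sum.cong refl Ui) auto
  also have "\<dots> = ennreal (\<Sum>i<N. exp (- (N * t)) * (t ^ Suc n / fact (Suc n)) * flip_avg \<beta> G J i (?A F) \<sigma>)"
    using Suc.prems F by (intro sum_ennreal mult_nonneg_nonneg flip_avg_nonneg flip_sum_pow_nonneg) auto
  also have "(\<Sum>i<N. exp (- (N * t)) * (t ^ Suc n / fact (Suc n)) * flip_avg \<beta> G J i (?A F) \<sigma>)
    = exp (- (N * t)) * (t ^ Suc n / fact (Suc n)) * (flip_sum \<beta> N G J ^^ Suc n) F \<sigma>"
    unfolding funpow.simps(2) o_apply flip_sum_def[of \<beta> N G J "?A F" \<sigma>] sum_distrib_left ..
  finally show ?case .
qed

lemma flip_sum_add:
  "flip_sum \<beta> N G J (\<lambda>\<tau>. f \<tau> + g \<tau>) = (\<lambda>\<sigma>. flip_sum \<beta> N G J f \<sigma> + flip_sum \<beta> N G J g \<sigma>)"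
proof
  fix \<sigma>
  have "flip_avg \<beta> G J i (\<lambda>\<tau>. f \<tau> + g \<tau>) \<sigma> = flip_avg \<beta> G J i f \<sigma> + flip_avg \<beta> G J i g \<sigma>" for i
    by (simp add: flip_avg_def distrib_left)
  then show "flip_sum \<beta> N G J (\<lambda>\<tau>. f \<tau> + g \<tau>) \<sigma> = flip_sum \<beta> N G J f \<sigma> + flip_sum \<beta> N G J g \<sigma>"
    by (simp add: flip_sum_def sum.distrib)
qed

lemma flip_sum_cmult: "flip_sum \<beta> N G J (\<lambda>\<tau>. c * f \<tau>) = (\<lambda>\<sigma>. c * flip_sum \<beta> N G J f \<sigma>)"
proof
  fix \<sigma>
  have "flip_avg \<beta> G J i (\<lambda>\<tau>. c * f \<tau>) \<sigma> = c * flip_avg \<beta> G J i f \<sigma>" for i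
    by (simp add: flip_avg_def distrib_left mult.left_commute)
  then show "flip_sum \<beta> N G J (\<lambda>\<tau>. c * f \<tau>) \<sigma> = c * flip_sum \<beta> N G J f \<sigma>"
    by (simp add: flip_sum_def sum_distrib_left)
qed

lemma flip_sum_const: "flip_sum \<beta> N G J (\<lambda>_. c) = (\<lambda>_. real N * c)"
proof
  fix \<sigma>
  have "flip_avg \<beta> G J i (\<lambda>_. c) \<sigma> = c" for i
    by (simp add: flip_avg_def field_simps)
  then show "flip_sum \<beta> N G J (\<lambda>_. c) \<sigma> = real N * c" by (simp add: flip_sum_def)
qed

lemma flip_sum_pow_add:
  "(flip_sum \<beta> N G J ^^ n) (\<lambda>\<tau>. f \<tau> + g \<tau>) = (\<lambda>\<sigma>. (flip_sum \<beta> N G J ^^ n) f \<sigma> + (flip_sum \<beta> N G J ^^ n) g \<sigma>)"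
  by (induction n) (simp_all add: flip_sum_add)

lemma flip_sum_pow_cmult:
  "(flip_sum \<beta> N G J ^^ n) (\<lambda>\<tau>. c * f \<tau>) = (\<lambda>\<sigma>. c * (flip_sum \<beta> N G J ^^ n) f \<sigma>)"
  by (induction n) (simp_all add: flip_sum_cmult)

lemma flip_sum_pow_const: "(flip_sum \<beta> N G J ^^ n) (\<lambda>_. c) = (\<lambda>_. real N ^ n * c)"
  by (induction n) (simp_all add: flip_sum_const mult.assoc)

lemma flip_avg_mono:
  assumes "\<And>\<tau>. f \<tau> \<le> g \<tau>" shows "flip_avg \<beta> G J i f \<sigma> \<le> flip_avg \<beta> G J i g \<sigma>"
  using tanh_real_lt_1[of "\<beta> * local_field G J i \<sigma>"] tanh_real_gt_neg1[of "\<beta> * local_field G J i \<sigma>"]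
  by (auto simp: flip_avg_def intro!: add_mono mult_left_mono assms)

lemma flip_sum_pow_mono:
  assumes "\<And>\<tau>. f \<tau> \<le> g \<tau>" shows "(flip_sum \<beta> N G J ^^ n) f \<sigma> \<le> (flip_sum \<beta> N G J ^^ n) g \<sigma>"
  using assms by (induction n arbitrary: \<sigma>) (auto simp: flip_sum_def intro!: sum_mono flip_avg_mono)

lemma sums_poisson: "(\<lambda>n. exp (- (N * t)) * (t ^ n / fact n) * ((N :: real) ^ n * c)) sums c"
proof -
  have "(\<lambda>n. (exp (- (N * t)) * c) * ((N * t) ^ n /\<^sub>R fact n)) sums ((exp (- (N * t)) * c) * exp (N * t))"
    by (intro sums_mult exp_converges)
  then show ?thesis by (simp add: power_mult_distrib mult_exp_exp divide_inverse mult_ac flip: exp_add)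
qed

lemma expectation_run_nonneg:
  assumes F: "\<And>\<sigma>. 0 \<le> F \<sigma>" "\<And>\<sigma>. F \<sigma> \<le> B" and t: "0 \<le> t"
  shows "(\<lambda>n. exp (- (N * t)) * (t ^ n / fact n) * (flip_sum \<beta> N G J ^^ n) F \<sigma>)
    sums (\<integral>y. F (glauber \<beta> N G J t (\<sigma>, y)) \<partial>clock_space N)"
proof -
  let ?a = "\<lambda>n. exp (- (N * t)) * (t ^ n / fact n) * (flip_sum \<beta> N G J ^^ n) F \<sigma>"
  have a0: "0 \<le> ?a n" for n
    using t F(1) by (intro mult_nonneg_nonneg flip_sum_pow_nonneg) auto
  have sm: "summable ?a"
  proof (rule summable_comparison_test')
    show "summable (\<lambda>n. exp (- (N * t)) * (t ^ n / fact n) * (real N ^ n * B))"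
      by (rule sums_summable[OF sums_poisson])
    fix n
    have "(flip_sum \<beta> N G J ^^ n) F \<sigma> \<le> (flip_sum \<beta> N G J ^^ n) (\<lambda>_. B) \<sigma>"
      by (rule flip_sum_pow_mono) (rule F)
    then have "?a n \<le> exp (- (N * t)) * (t ^ n / fact n) * (real N ^ n * B)"
      using t by (intro mult_left_mono) (auto simp: flip_sum_pow_const)
    then show "norm (?a n) \<le> exp (- (N * t)) * (t ^ n / fact n) * (real N ^ n * B)"
      using a0[of n] by (simp only: real_norm_def abs_of_nonneg)
  qed
  have gl: "glauber \<beta> N G J t (\<sigma>, y) = fold (heat_bath_update \<beta> G J y) (rings N y t) \<sigma>" for y
    by (simp add: glauber_def)
  have m: "(\<lambda>y. F (glauber \<beta> N G J t (\<sigma>, y))) \<in> borel_measurable (clock_space N)"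
    unfolding gl by (rule measurable_glauber[of "\<lambda>y. y" _ N "\<lambda>_. t"]) auto
  have "(\<integral>\<^sup>+y. ennreal (F (glauber \<beta> N G J t (\<sigma>, y))) \<partial>clock_space N)
    = (\<integral>\<^sup>+y. (\<Sum>n. run_with_count \<beta> N G J F n t \<sigma> y) \<partial>clock_space N)"
  proof (rule nn_integral_cong)
    fix y
    have "(\<Sum>n. run_with_count \<beta> N G J F n t \<sigma> y) = (\<Sum>n\<in>{length (rings N y t)}. run_with_count \<beta> N G J F n t \<sigma> y)"
      by (rule suminf_finite) (auto simp: run_with_count_def)
    then show "ennreal (F (glauber \<beta> N G J t (\<sigma>, y))) = (\<Sum>n. run_with_count \<beta> N G J F n t \<sigma> y)"
      by (simp add: run_with_count_def gl)
  qed
  also have "\<dots> = (\<Sum>n. \<integral>\<^sup>+y. run_with_count \<beta> N G J F n t \<sigma> y \<partial>clock_space N)"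
    by (rule nn_integral_suminf) (auto intro!: measurable_run_with_count measurable_ident_sets)
  also have "\<dots> = (\<Sum>n. ennreal (?a n))"
    by (simp only: nn_integral_run_with_count[OF F(1) t])
  also have "\<dots> = ennreal (\<Sum>n. ?a n)"
    by (rule suminf_ennreal2[OF a0 sm])
  finally have "(\<integral>y. F (glauber \<beta> N G J t (\<sigma>, y)) \<partial>clock_space N) = (\<Sum>n. ?a n)"
    using m F(1) suminf_nonneg[OF sm a0] by (subst integral_eq_nn_integral) (auto simp only: enn2real_ennreal intro!: AE_I2)
  then show ?thesis using summable_sums[OF sm] by simp
qed

text \<open>Adding the constant B reduces to the nonnegative case, since constants pass through the
  operator and through the Poisson sum exactly.\<close>

lemma expectation_run:
  assumes F: "\<And>\<sigma>. \<bar>F \<sigma>\<bar> \<le> B" and t: "0 \<le> t"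
  shows "(\<lambda>n. exp (- (N * t)) * (t ^ n / fact n) * (flip_sum \<beta> N G J ^^ n) F \<sigma>)
    sums (\<integral>y. F (glauber \<beta> N G J t (\<sigma>, y)) \<partial>clock_space N)"
proof -
  interpret C: prob_space "clock_space N" by (rule prob_space_clock_space)
  let ?p = "\<lambda>n. exp (- (N * t)) * (t ^ n / fact n)"
  have m: "(\<lambda>y. F (glauber \<beta> N G J t (\<sigma>, y))) \<in> borel_measurable (clock_space N)"
    unfolding glauber_def prod.case by (rule measurable_glauber[of "\<lambda>y. y" _ N "\<lambda>_. t"]) auto
  have int: "integrable (clock_space N) (\<lambda>y. F (glauber \<beta> N G J t (\<sigma>, y)))"
    by (rule C.integrable_const_bound[OF _ m, where B = B]) (use F in auto)
  have FB: "0 \<le> F \<sigma> + B" "F \<sigma> + B \<le> 2 * B" for \<sigma>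
    using F[of \<sigma>] by auto
  have "(\<lambda>n. ?p n * (flip_sum \<beta> N G J ^^ n) (\<lambda>\<sigma>. F \<sigma> + B) \<sigma> - ?p n * (real N ^ n * B))
      sums ((\<integral>y. F (glauber \<beta> N G J t (\<sigma>, y)) + B \<partial>clock_space N) - B)"
    by (intro sums_diff expectation_run_nonneg[where B = "2 * B", OF _ _ t] sums_poisson) (use FB in auto)
  moreover have "(\<integral>y. F (glauber \<beta> N G J t (\<sigma>, y)) + B \<partial>clock_space N) - B = (\<integral>y. F (glauber \<beta> N G J t (\<sigma>, y)) \<partial>clock_space N)"
    using int by (simp add: C.prob_space)
  ultimately show ?thesis
    by (simp add: flip_sum_pow_add flip_sum_pow_const algebra_simps)
qed

section \<open>The Gibbs measure and the correlation function\<close>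

lemma finite_configs: "finite (configs N)"
  unfolding configs_def by (intro finite_PiE) auto

lemma configs_ne: "configs N \<noteq> {}"
  unfolding configs_def by (auto simp: PiE_eq_empty_iff)

lemma configs_upd: "\<sigma> \<in> configs N \<Longrightarrow> i < N \<Longrightarrow> s = 1 \<or> s = -1 \<Longrightarrow> \<sigma>(i := s) \<in> configs N"
  by (auto simp: configs_def PiE_def Pi_def extensional_def)

lemma configs_val: "\<sigma> \<in> configs N \<Longrightarrow> i < N \<Longrightarrow> \<sigma> i = 1 \<or> \<sigma> i = -1"
  by (auto simp: configs_def PiE_def Pi_def)

lemma partition_function_pos: "0 < partition_function \<beta> N M G J"
  unfolding partition_function_def using configs_ne by (intro sum_pos finite_configs) auto

definition gibbs_weight :: "real \<Rightarrow> nat \<Rightarrow> nat \<Rightarrow> factor_graph \<Rightarrow> (nat \<Rightarrow> real) \<Rightarrow> config \<Rightarrow> real" where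
  "gibbs_weight \<beta> N M G J \<sigma> = exp (- \<beta> * energy M G J \<sigma>) / partition_function \<beta> N M G J"

lemma gibbs_weight_pos: "0 < gibbs_weight \<beta> N M G J \<sigma>"
  by (simp add: gibbs_weight_def partition_function_pos)

lemma sum_gibbs_weight: "(\<Sum>\<sigma>\<in>configs N. gibbs_weight \<beta> N M G J \<sigma>) = 1"
  using partition_function_pos[of \<beta> N M G J]
  unfolding gibbs_weight_def sum_divide_distrib[symmetric]
  by (simp only: partition_function_def[symmetric]) simp

lemma gibbs_eq: "gibbs \<beta> N M G J = point_measure (configs N) (\<lambda>\<sigma>. ennreal (gibbs_weight \<beta> N M G J \<sigma>))"
  by (simp add: gibbs_def gibbs_weight_def)

lemma integral_gibbs:
  fixes f :: "config \<Rightarrow> real"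
  shows "(\<integral>\<sigma>. f \<sigma> \<partial>gibbs \<beta> N M G J) = (\<Sum>\<sigma>\<in>configs N. gibbs_weight \<beta> N M G J \<sigma> * f \<sigma>)"
  unfolding gibbs_eq using gibbs_weight_pos[of \<beta> N M G J] finite_configs
  by (subst lebesgue_integral_point_measure_finite) (auto simp: less_imp_le)

lemma prob_space_gibbs: "prob_space (gibbs \<beta> N M G J)"
proof
  have "emeasure (gibbs \<beta> N M G J) (configs N) = (\<Sum>\<sigma>\<in>configs N. ennreal (gibbs_weight \<beta> N M G J \<sigma>))"
    unfolding gibbs_eq by (rule emeasure_point_measure_finite) (auto simp: finite_configs)
  also have "\<dots> = 1"
    using gibbs_weight_pos[of \<beta> N M G J] by (subst sum_ennreal) (auto simp: sum_gibbs_weight less_imp_le)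
  finally show "emeasure (gibbs \<beta> N M G J) (space (gibbs \<beta> N M G J)) = 1"
    by (simp add: gibbs_eq space_point_measure)
qed

lemma fold_heat_bath_configs:
  "set L \<subseteq> {..<N} \<times> UNIV \<Longrightarrow> \<sigma> \<in> configs N \<Longrightarrow> fold (heat_bath_update \<beta> G J y) L \<sigma> \<in> configs N"
proof (induction L arbitrary: \<sigma>)
  case (Cons c L)
  have "heat_bath_update \<beta> G J y c \<sigma> \<in> configs N"
    using Cons.prems by (auto simp: heat_bath_update_eq heat_bath_def intro!: configs_upd)
  then show ?case using Cons by auto
qed simp

lemma glauber_configs: "\<sigma> \<in> configs N \<Longrightarrow> glauber \<beta> N G J t (\<sigma>, y) \<in> configs N"
  unfolding glauber_def prod.case by (rule fold_heat_bath_configs[OF set_rings_subset])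

text \<open>A bounded extension of the evaluation at i to all functions, so that monotonicity and
  boundedness of the operator can be used without restricting to \<open>configs N\<close>.\<close>

definition spin_sign :: "nat \<Rightarrow> config \<Rightarrow> real" where
  "spin_sign i \<tau> = (if \<tau> i = 1 then 1 else -1)"

lemma spin_sign_configs: "\<tau> \<in> configs N \<Longrightarrow> i < N \<Longrightarrow> spin_sign i \<tau> = \<tau> i"
  using configs_val[of \<tau> N i] by (auto simp: spin_sign_def)

text \<open>Fubini over the initial configuration, then \<open>expectation_run\<close> for the spin
  at i. The squared mean is moved to the side of the correlation so that the Poisson sum is that of
  the plain two-time average.\<close>

lemma correlation_sums:
  assumes i: "i < N" and t: "0 \<le> t"
  shows "(\<lambda>n. exp (- (N * t)) * (t ^ n / fact n) *
      (\<Sum>\<sigma>\<in>configs N. gibbs_weight \<beta> N M G J \<sigma> * (\<sigma> i * (flip_sum \<beta> N G J ^^ n) (spin_sign i) \<sigma>)))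
    sums (correlation \<beta> N M G J i t + (\<Sum>\<sigma>\<in>configs N. gibbs_weight \<beta> N M G J \<sigma> * \<sigma> i)\<^sup>2)"
proof -
  interpret C: prob_space "clock_space N" by (rule prob_space_clock_space)
  interpret g: prob_space "gibbs \<beta> N M G J" by (rule prob_space_gibbs)
  interpret P: pair_prob_space "gibbs \<beta> N M G J" "clock_space N" ..
  let ?\<mu> = "gibbs_weight \<beta> N M G J"
  let ?f = "\<lambda>\<omega>. glauber \<beta> N G J 0 \<omega> i * glauber \<beta> N G J t \<omega> i"
  have mg: "(\<lambda>y. glauber \<beta> N G J s (\<sigma>, y) i) \<in> borel_measurable (clock_space N)" for s \<sigma>
    unfolding glauber_def prod.case
    by (rule measurable_glauber[of "\<lambda>y. y" _ N "\<lambda>_. s" "\<lambda>\<tau>. \<tau> i"]) auto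
  have m: "?f \<in> borel_measurable (gibbs \<beta> N M G J \<Otimes>\<^sub>M clock_space N)"
  proof -
    have "?f \<in> borel_measurable (count_space (configs N) \<Otimes>\<^sub>M clock_space N)"
      by (rule measurable_pair_measure_countable1)
        (auto intro!: borel_measurable_times mg countable_finite finite_configs)
    moreover have st: "sets (count_space (configs N) \<Otimes>\<^sub>M clock_space N) = sets (gibbs \<beta> N M G J \<Otimes>\<^sub>M clock_space N)"
      by (intro sets_pair_measure_cong) (auto simp: gibbs_eq sets_point_measure)
    ultimately show ?thesis by (simp only: measurable_cong_sets[OF st refl])
  qed
  have int: "integrable (gibbs \<beta> N M G J \<Otimes>\<^sub>M clock_space N) ?f"
  proof (rule P.integrable_const_bound[OF _ m, where B = 1], rule AE_I2)
    fix \<omega> assume "\<omega> \<in> space (gibbs \<beta> N M G J \<Otimes>\<^sub>M clock_space N)"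
    then obtain \<sigma> y where w: "\<omega> = (\<sigma>, y)" and s: "\<sigma> \<in> configs N"
      by (auto simp: space_pair_measure gibbs_eq space_point_measure)
    show "norm (?f \<omega>) \<le> 1"
      using configs_val[OF glauber_configs[OF s] i, of \<beta> G J 0 y] configs_val[OF glauber_configs[OF s] i, of \<beta> G J t y]
      by (auto simp: w)
  qed
  have "(\<integral>\<omega>. ?f \<omega> \<partial>glauber_space \<beta> N M G J) = (\<integral>\<sigma>. (\<integral>y. ?f (\<sigma>, y) \<partial>clock_space N) \<partial>gibbs \<beta> N M G J)"
    unfolding glauber_space_def by (rule P.integral_fst'[OF int, symmetric])
  also have "\<dots> = (\<Sum>\<sigma>\<in>configs N. ?\<mu> \<sigma> * (\<integral>y. ?f (\<sigma>, y) \<partial>clock_space N))"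
    by (rule integral_gibbs)
  also have "\<dots> = (\<Sum>\<sigma>\<in>configs N. ?\<mu> \<sigma> * (\<sigma> i * (\<integral>y. spin_sign i (glauber \<beta> N G J t (\<sigma>, y)) \<partial>clock_space N)))"
  proof (rule sum.cong[OF refl])
    fix \<sigma> assume s: "\<sigma> \<in> configs N"
    have "(\<integral>y. ?f (\<sigma>, y) \<partial>clock_space N) = (\<integral>y. \<sigma> i * spin_sign i (glauber \<beta> N G J t (\<sigma>, y)) \<partial>clock_space N)"
    proof (rule integral_cong_AE)
      show "(\<lambda>y. ?f (\<sigma>, y)) \<in> borel_measurable (clock_space N)" by (intro borel_measurable_times mg)
      show "(\<lambda>y. \<sigma> i * spin_sign i (glauber \<beta> N G J t (\<sigma>, y))) \<in> borel_measurable (clock_space N)"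
        unfolding glauber_def prod.case
        by (intro borel_measurable_times borel_measurable_const measurable_glauber[of "\<lambda>y. y" _ N "\<lambda>_. t"]) auto
      show "AE y in clock_space N. ?f (\<sigma>, y) = \<sigma> i * spin_sign i (glauber \<beta> N G J t (\<sigma>, y))"
        using AE_regular_clocks
      proof eventually_elim
        case (elim y)
        then have "glauber \<beta> N G J 0 (\<sigma>, y) = \<sigma>"
          using rings_eq_Nil_iff[of N y 0] by (simp add: glauber_def)
        then show ?case using spin_sign_configs[OF glauber_configs[OF s] i] by simp
      qed
    qed
    then show "?\<mu> \<sigma> * (\<integral>y. ?f (\<sigma>, y) \<partial>clock_space N) = ?\<mu> \<sigma> * (\<sigma> i * (\<integral>y. spin_sign i (glauber \<beta> N G J t (\<sigma>, y)) \<partial>clock_space N))"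
      by simp
  qed
  finally have eq: "correlation \<beta> N M G J i t + (\<Sum>\<sigma>\<in>configs N. ?\<mu> \<sigma> * \<sigma> i)\<^sup>2
    = (\<Sum>\<sigma>\<in>configs N. ?\<mu> \<sigma> * (\<sigma> i * (\<integral>y. spin_sign i (glauber \<beta> N G J t (\<sigma>, y)) \<partial>clock_space N)))"
    by (simp add: correlation_def integral_gibbs)
  have sm: "(\<lambda>n. \<Sum>\<sigma>\<in>configs N. ?\<mu> \<sigma> * (\<sigma> i * (exp (- (N * t)) * (t ^ n / fact n) * (flip_sum \<beta> N G J ^^ n) (spin_sign i) \<sigma>)))
    sums (\<Sum>\<sigma>\<in>configs N. ?\<mu> \<sigma> * (\<sigma> i * (\<integral>y. spin_sign i (glauber \<beta> N G J t (\<sigma>, y)) \<partial>clock_space N)))"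
    by (intro sums_sum sums_mult expectation_run[where B = 1] t) (auto simp: spin_sign_def)
  have "(\<Sum>\<sigma>\<in>configs N. ?\<mu> \<sigma> * (\<sigma> i * (c * (flip_sum \<beta> N G J ^^ n) (spin_sign i) \<sigma>)))
    = c * (\<Sum>\<sigma>\<in>configs N. ?\<mu> \<sigma> * (\<sigma> i * (flip_sum \<beta> N G J ^^ n) (spin_sign i) \<sigma>))" for c n
    unfolding sum_distrib_left by (intro sum.cong refl) (simp only: mult_ac)
  with sm show ?thesis unfolding eq by (simp only:)
qed

section \<open>Contraction at high temperature\<close>

text \<open>What holds for every sample of graph and couplings. No assumption mentions \<beta>, so
  the exported predicate takes four arguments, and each exported constant takes only the parameters
  that occur in it.\<close>

locale factor_model =
  fixes N M :: nat and G :: factor_graph and J :: "nat \<Rightarrow> real" and \<beta> :: real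
  assumes edges: "G \<subseteq> {..<N} \<times> {..<M}" and couplings: "a < M \<Longrightarrow> J a = 1 \<or> J a = -1"
begin

lemma finite_fun_nbrs [simp]: "finite (fun_nbrs G a)"
  by (rule finite_subset[of _ "{..<N}"]) (use edges in \<open>auto simp: fun_nbrs_def\<close>)

lemma finite_var_nbrs [simp]: "finite (var_nbrs G i)"
  by (rule finite_subset[of _ "{..<M}"]) (use edges in \<open>auto simp: var_nbrs_def\<close>)

lemma var_nbrs_subset: "var_nbrs G i \<subseteq> {..<M}"
  using edges by (auto simp: var_nbrs_def)

lemma fun_nbrs_subset: "fun_nbrs G a \<subseteq> {..<N}"
  using edges by (auto simp: fun_nbrs_def)

lemma nbrs_iff: "a \<in> var_nbrs G i \<longleftrightarrow> i \<in> fun_nbrs G a"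
  by (auto simp: var_nbrs_def fun_nbrs_def)

section \<open>Stationarity of the Gibbs weights\<close>

definition bweight :: "config \<Rightarrow> real" where
  "bweight \<sigma> = exp (- \<beta> * energy M G J \<sigma>)"

definition part :: real where "part = partition_function \<beta> N M G J"

lemma part_pos: "0 < part"
  by (simp add: part_def partition_function_pos)

lemma gibbs_weight_eq: "gibbs_weight \<beta> N M G J \<sigma> = bweight \<sigma> / part"
  by (simp add: gibbs_weight_def bweight_def part_def)

lemma bweight_pos: "0 < bweight \<sigma>" by (simp add: bweight_def)

lemma local_field_upd: "local_field G J i (\<sigma>(i := s)) = local_field G J i \<sigma>"
  unfolding local_field_def by (intro sum.cong prod.cong arg_cong2[where f = "(*)"] refl) auto

text \<open>The energy is affine in each single spin, with slope minus the local field; the constant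
  C collects the function nodes not adjacent to i.\<close>

lemma bweight_upd:
  "\<exists>C. \<forall>s. bweight (\<sigma>(i := s)) = exp (C + \<beta> * (s * local_field G J i \<sigma>))"
proof -
  let ?C = "\<Sum>a\<in>{..<M} - var_nbrs G i. J a * (\<Prod>j\<in>fun_nbrs G a. \<sigma> j)"
  have "- energy M G J (\<sigma>(i := s)) = ?C + s * local_field G J i \<sigma>" for s
  proof -
    have "- energy M G J (\<sigma>(i := s)) = (\<Sum>a<M. J a * (\<Prod>j\<in>fun_nbrs G a. (\<sigma>(i := s)) j))"
      by (simp add: energy_def)
    also have "\<dots> = (\<Sum>a\<in>{..<M} - var_nbrs G i. J a * (\<Prod>j\<in>fun_nbrs G a. (\<sigma>(i := s)) j))
      + (\<Sum>a\<in>var_nbrs G i. J a * (\<Prod>j\<in>fun_nbrs G a. (\<sigma>(i := s)) j))"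
      by (rule sum.subset_diff[OF var_nbrs_subset]) simp
    also have "(\<Sum>a\<in>{..<M} - var_nbrs G i. J a * (\<Prod>j\<in>fun_nbrs G a. (\<sigma>(i := s)) j)) = ?C"
      by (intro sum.cong prod.cong arg_cong2[where f = "(*)"] refl) (auto simp: nbrs_iff)
    also have "(\<Sum>a\<in>var_nbrs G i. J a * (\<Prod>j\<in>fun_nbrs G a. (\<sigma>(i := s)) j))
      = (\<Sum>a\<in>var_nbrs G i. s * (J a * (\<Prod>j\<in>fun_nbrs G a - {i}. \<sigma> j)))"
    proof (rule sum.cong[OF refl])
      fix a assume "a \<in> var_nbrs G i"
      then have "i \<in> fun_nbrs G a" by (simp add: nbrs_iff)
      then have "(\<Prod>j\<in>fun_nbrs G a. (\<sigma>(i := s)) j) = (\<sigma>(i := s)) i * (\<Prod>j\<in>fun_nbrs G a - {i}. (\<sigma>(i := s)) j)"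
        by (intro prod.remove) auto
      also have "(\<Prod>j\<in>fun_nbrs G a - {i}. (\<sigma>(i := s)) j) = (\<Prod>j\<in>fun_nbrs G a - {i}. \<sigma> j)"
        by (intro prod.cong) auto
      finally show "J a * (\<Prod>j\<in>fun_nbrs G a. (\<sigma>(i := s)) j) = s * (J a * (\<Prod>j\<in>fun_nbrs G a - {i}. \<sigma> j))"
        by simp
    qed
    finally show ?thesis by (simp only: local_field_def[of G J i \<sigma>] sum_distrib_left)
  qed
  moreover have "bweight \<tau> = exp (\<beta> * (- energy M G J \<tau>))" for \<tau>
    by (simp add: bweight_def)
  ultimately have "bweight (\<sigma>(i := s)) = exp (\<beta> * ?C + \<beta> * (s * local_field G J i \<sigma>))" for s
    by (simp only: distrib_left)
  then show ?thesis by blast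
qed

lemma sum_configs_flip:
  fixes F :: "config \<Rightarrow> real"
  assumes i: "i < N"
  shows "(\<Sum>\<sigma>\<in>configs N. F (\<sigma>(i := 1)) + F (\<sigma>(i := -1))) = 2 * (\<Sum>\<sigma>\<in>configs N. F \<sigma>)"
proof -
  have bij: "(\<Sum>\<sigma>\<in>configs N. F (\<sigma>(i := - \<sigma> i))) = (\<Sum>\<sigma>\<in>configs N. F \<sigma>)"
    by (rule sum.reindex_bij_witness[of _ "\<lambda>\<sigma>. \<sigma>(i := - \<sigma> i)" "\<lambda>\<sigma>. \<sigma>(i := - \<sigma> i)"])
      (use i configs_val in \<open>fastforce intro: configs_upd\<close>)+
  have "(\<Sum>\<sigma>\<in>configs N. F (\<sigma>(i := 1)) + F (\<sigma>(i := -1))) = (\<Sum>\<sigma>\<in>configs N. F \<sigma> + F (\<sigma>(i := - \<sigma> i)))"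
  proof (rule sum.cong[OF refl])
    fix \<sigma> assume "\<sigma> \<in> configs N"
    then have "\<sigma> i = 1 \<or> \<sigma> i = -1" using configs_val i by blast
    then show "F (\<sigma>(i := 1)) + F (\<sigma>(i := -1)) = F \<sigma> + F (\<sigma>(i := - \<sigma> i))"
      by (metis (no_types, lifting) add.commute add.inverse_inverse fun_upd_triv)
  qed
  then show ?thesis using bij by (simp add: sum.distrib)
qed

text \<open>On each pair of configurations that differ at i only, the update resamples the spin from
  its conditional Gibbs law: with x = \<beta> h_i, the probability r of the value 1 is exp x / (exp
  x + exp (- x)). Summing over pairs gives the identity.\<close>

lemma flip_avg_stationary:
  assumes i: "i < N"
  shows "(\<Sum>\<sigma>\<in>configs N. bweight \<sigma> * flip_avg \<beta> G J i f \<sigma>) = (\<Sum>\<sigma>\<in>configs N. bweight \<sigma> * f \<sigma>)"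
proof -
  have "bweight (\<sigma>(i := 1)) * flip_avg \<beta> G J i f (\<sigma>(i := 1)) + bweight (\<sigma>(i := -1)) * flip_avg \<beta> G J i f (\<sigma>(i := -1))
    = bweight (\<sigma>(i := 1)) * f (\<sigma>(i := 1)) + bweight (\<sigma>(i := -1)) * f (\<sigma>(i := -1))" for \<sigma>
  proof -
    obtain C where C: "\<And>s. bweight (\<sigma>(i := s)) = exp (C + \<beta> * (s * local_field G J i \<sigma>))"
      using bweight_upd by blast
    define x where "x = \<beta> * local_field G J i \<sigma>"
    define r where "r = (1 + tanh x) / 2"
    have w: "bweight (\<sigma>(i := 1)) = exp C * exp x" "bweight (\<sigma>(i := -1)) = exp C * exp (- x)"
      using C[of 1] C[of "-1"] by (simp_all add: x_def exp_add[symmetric])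
    have pos: "exp x + exp (- x) > 0" by (simp add: add_pos_pos)
    have "r * (exp x + exp (- x)) = exp x"
      using pos unfolding r_def tanh_altdef by (simp add: field_simps)
    then have r: "r * (bweight (\<sigma>(i := 1)) + bweight (\<sigma>(i := -1))) = bweight (\<sigma>(i := 1))"
      unfolding w by (simp add: distrib_left[symmetric] mult.left_commute)
    have fl: "flip_avg \<beta> G J i f (\<sigma>(i := s)) = r * f (\<sigma>(i := 1)) + (1 - r) * f (\<sigma>(i := -1))" for s
      by (simp add: flip_avg_def local_field_upd r_def x_def field_simps)
    have "bweight (\<sigma>(i := 1)) * flip_avg \<beta> G J i f (\<sigma>(i := 1)) + bweight (\<sigma>(i := -1)) * flip_avg \<beta> G J i f (\<sigma>(i := -1))
      = r * (bweight (\<sigma>(i := 1)) + bweight (\<sigma>(i := -1))) * (f (\<sigma>(i := 1)) - f (\<sigma>(i := -1)))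
        + (bweight (\<sigma>(i := 1)) + bweight (\<sigma>(i := -1))) * f (\<sigma>(i := -1))"
      unfolding fl by (simp add: algebra_simps)
    then show ?thesis unfolding r by (simp add: algebra_simps)
  qed
  then show ?thesis
    using sum_configs_flip[OF i, of "\<lambda>\<sigma>. bweight \<sigma> * flip_avg \<beta> G J i f \<sigma>"]
      sum_configs_flip[OF i, of "\<lambda>\<sigma>. bweight \<sigma> * f \<sigma>"] by simp
qed

lemma flip_sum_stationary:
  "(\<Sum>\<sigma>\<in>configs N. bweight \<sigma> * flip_sum \<beta> N G J f \<sigma>) = N * (\<Sum>\<sigma>\<in>configs N. bweight \<sigma> * f \<sigma>)"
proof -
  have "(\<Sum>\<sigma>\<in>configs N. bweight \<sigma> * flip_sum \<beta> N G J f \<sigma>)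
    = (\<Sum>i<N. \<Sum>\<sigma>\<in>configs N. bweight \<sigma> * flip_avg \<beta> G J i f \<sigma>)"
    unfolding flip_sum_def sum_distrib_left by (rule sum.swap)
  then show ?thesis by (simp add: flip_avg_stationary)
qed

lemma flip_sum_pow_stationary:
  "(\<Sum>\<sigma>\<in>configs N. bweight \<sigma> * (flip_sum \<beta> N G J ^^ n) f \<sigma>) = N ^ n * (\<Sum>\<sigma>\<in>configs N. bweight \<sigma> * f \<sigma>)"
  by (induction n) (simp_all add: flip_sum_stationary mult.assoc)

section \<open>Oscillations of observables\<close>

definition shared :: "nat \<Rightarrow> nat \<Rightarrow> nat" where
  "shared i j = card {a \<in> var_nbrs G i. j \<in> fun_nbrs G a}"

text \<open>Coordinate-wise oscillations as in Dobrushin's method. The whole vector is carried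
  along, since one application of the operator mixes its coordinates.\<close>

definition osc_bound :: "(config \<Rightarrow> real) \<Rightarrow> (nat \<Rightarrow> real) \<Rightarrow> bool" where
  "osc_bound f d \<longleftrightarrow> (\<forall>j<N. \<forall>\<sigma>\<in>configs N. \<bar>f (\<sigma>(j := 1)) - f (\<sigma>(j := -1))\<bar> \<le> d j)"

text \<open>The local field at i is affine in the spin j, and each function node containing both
  contributes at most 1 to the slope.\<close>

lemma local_field_split:
  assumes "i < N" "j < N" "j \<noteq> i" "\<sigma> \<in> configs N"
  obtains B D where "\<And>s. local_field G J i (\<sigma>(j := s)) = B + s * D" "\<bar>D\<bar> \<le> real (shared i j)"
proof -
  let ?S = "{a \<in> var_nbrs G i. j \<in> fun_nbrs G a}"
  let ?B = "\<Sum>a\<in>var_nbrs G i - ?S. J a * (\<Prod>k\<in>fun_nbrs G a - {i}. \<sigma> k)"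
  let ?D = "\<Sum>a\<in>?S. J a * (\<Prod>k\<in>fun_nbrs G a - {i} - {j}. \<sigma> k)"
  have "local_field G J i (\<sigma>(j := s)) = ?B + s * ?D" for s
  proof -
    have "local_field G J i (\<sigma>(j := s)) = (\<Sum>a\<in>var_nbrs G i - ?S. J a * (\<Prod>k\<in>fun_nbrs G a - {i}. (\<sigma>(j := s)) k))
       + (\<Sum>a\<in>?S. J a * (\<Prod>k\<in>fun_nbrs G a - {i}. (\<sigma>(j := s)) k))"
      unfolding local_field_def by (rule sum.subset_diff) auto
    also have "(\<Sum>a\<in>var_nbrs G i - ?S. J a * (\<Prod>k\<in>fun_nbrs G a - {i}. (\<sigma>(j := s)) k)) = ?B"
      by (intro sum.cong prod.cong arg_cong2[where f = "(*)"] refl) auto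
    also have "(\<Sum>a\<in>?S. J a * (\<Prod>k\<in>fun_nbrs G a - {i}. (\<sigma>(j := s)) k)) = (\<Sum>a\<in>?S. s * (J a * (\<Prod>k\<in>fun_nbrs G a - {i} - {j}. \<sigma> k)))"
    proof (rule sum.cong[OF refl])
      fix a assume "a \<in> ?S"
      then have "(\<Prod>k\<in>fun_nbrs G a - {i}. (\<sigma>(j := s)) k) = (\<sigma>(j := s)) j * (\<Prod>k\<in>fun_nbrs G a - {i} - {j}. (\<sigma>(j := s)) k)"
        using assms by (intro prod.remove) auto
      also have "(\<Prod>k\<in>fun_nbrs G a - {i} - {j}. (\<sigma>(j := s)) k) = (\<Prod>k\<in>fun_nbrs G a - {i} - {j}. \<sigma> k)"
        by (intro prod.cong) auto
      finally show "J a * (\<Prod>k\<in>fun_nbrs G a - {i}. (\<sigma>(j := s)) k) = s * (J a * (\<Prod>k\<in>fun_nbrs G a - {i} - {j}. \<sigma> k))"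
        by simp
    qed
    finally show ?thesis by (simp only: sum_distrib_left)
  qed
  moreover have "\<bar>?D\<bar> \<le> real (shared i j)"
  proof -
    have "\<bar>?D\<bar> \<le> (\<Sum>a\<in>?S. \<bar>J a * (\<Prod>k\<in>fun_nbrs G a - {i} - {j}. \<sigma> k)\<bar>)" by (rule sum_abs)
    also have "\<dots> \<le> (\<Sum>a\<in>?S. 1)"
    proof (rule sum_mono)
      fix a assume a: "a \<in> ?S"
      have "\<bar>\<Prod>k\<in>fun_nbrs G a - {i} - {j}. \<sigma> k\<bar> = (\<Prod>k\<in>fun_nbrs G a - {i} - {j}. \<bar>\<sigma> k\<bar>)" by (rule abs_prod)
      also have "\<dots> = 1"
        using configs_val[OF assms(4)] fun_nbrs_subset[of a] by (intro prod.neutral) fastforce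
      finally show "\<bar>J a * (\<Prod>k\<in>fun_nbrs G a - {i} - {j}. \<sigma> k)\<bar> \<le> 1"
        using couplings[of a] a var_nbrs_subset[of i] by (force simp: abs_mult)
    qed
    finally show ?thesis by (simp add: shared_def)
  qed
  ultimately show ?thesis using that by blast
qed

end

text \<open>The difference is sinh (2 y) / (cosh (x + y) cosh (x - y)), and the denominator (cosh
  x)^2 + (sinh y)^2 is smallest at x = 0. A background field thus only weakens the influence of a
  neighbour.\<close>

lemma tanh_diff_le:
  fixes x y :: real
  assumes "0 \<le> y"
  shows "\<bar>tanh (x + y) - tanh (x - y)\<bar> \<le> 2 * tanh y"
proof -
  have c: "cosh (x + y) * cosh (x - y) = (cosh x)\<^sup>2 + (sinh y)\<^sup>2"
  proof -
    have "cosh (x + y) * cosh (x - y) = (cosh x * cosh y)\<^sup>2 - (sinh x * sinh y)\<^sup>2"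
      by (simp add: cosh_add cosh_diff power2_eq_square algebra_simps)
    also have "\<dots> = (cosh x)\<^sup>2 * ((sinh y)\<^sup>2 + 1) - ((cosh x)\<^sup>2 - 1) * (sinh y)\<^sup>2"
      using cosh_square_eq[of y] cosh_square_eq[of x] by (simp add: power_mult_distrib)
    finally show ?thesis by (simp add: algebra_simps)
  qed
  have cx: "1 \<le> cosh x" by (rule cosh_real_ge_1)
  have "1 \<le> (cosh x)\<^sup>2" using cx by (simp add: one_le_power)
  then have ge: "(cosh y)\<^sup>2 \<le> cosh (x + y) * cosh (x - y)"
    unfolding c using cosh_square_eq[of y] by simp
  have "tanh (x + y) - tanh (x - y) = sinh ((x + y) - (x - y)) / (cosh (x + y) * cosh (x - y))"
    unfolding sinh_diff tanh_def by (simp add: field_simps)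
  also have "\<dots> = 2 * sinh y * cosh y / (cosh (x + y) * cosh (x - y))"
    using sinh_double[of y] by simp
  finally have eq: "tanh (x + y) - tanh (x - y) = 2 * sinh y * cosh y / (cosh (x + y) * cosh (x - y))" .
  have sy: "0 \<le> sinh y" using assms by simp
  have "2 * sinh y * cosh y / (cosh (x + y) * cosh (x - y)) \<le> 2 * sinh y * cosh y / (cosh y)\<^sup>2"
    using ge sy by (intro divide_left_mono) (auto intro!: mult_nonneg_nonneg mult_pos_pos cosh_real_pos)
  also have "\<dots> = 2 * tanh y" by (simp add: tanh_def power2_eq_square)
  finally have "tanh (x + y) - tanh (x - y) \<le> 2 * tanh y" using eq by simp
  moreover have "0 \<le> tanh (x + y) - tanh (x - y)" using assms by simp
  ultimately show ?thesis by simp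
qed

text \<open>Subadditivity of tanh. It makes the influence linear in the number of shared function
  nodes, so that influences add up to a degree count.\<close>

lemma tanh_nat_mult_le:
  fixes \<beta> :: real
  assumes "0 \<le> \<beta>"
  shows "tanh (\<beta> * real c) \<le> real c * tanh \<beta>"
proof (induction c)
  case (Suc c)
  have "tanh (\<beta> * real (Suc c)) = (tanh \<beta> + tanh (\<beta> * real c)) / (1 + tanh \<beta> * tanh (\<beta> * real c))"
    using tanh_add[of \<beta> "\<beta> * real c"] by (simp add: algebra_simps)
  also have "\<dots> \<le> (tanh \<beta> + tanh (\<beta> * real c)) / 1"
    using assms by (intro divide_left_mono) (auto intro!: add_nonneg_nonneg mult_nonneg_nonneg add_pos_nonneg)
  also have "\<dots> \<le> real (Suc c) * tanh \<beta>" using Suc by (simp add: algebra_simps)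
  finally show ?case .
qed simp

context factor_model
begin

lemma flip_avg_osc:
  assumes \<beta>: "0 \<le> \<beta>" and f: "osc_bound f d" and i: "i < N" and j: "j < N" "j \<noteq> i" and \<sigma>: "\<sigma> \<in> configs N"
  shows "\<bar>flip_avg \<beta> G J i f (\<sigma>(j := 1)) - flip_avg \<beta> G J i f (\<sigma>(j := -1))\<bar> \<le> d j + shared i j * tanh \<beta> * d i"
proof -
  obtain B D where lf: "\<And>s. local_field G J i (\<sigma>(j := s)) = B + s * D" and D: "\<bar>D\<bar> \<le> real (shared i j)"
    using local_field_split[OF i j \<sigma>] by blast
  define p where "p s = (1 + tanh (\<beta> * (B + s * D))) / 2" for s
  have p: "0 \<le> p s" "p s \<le> 1" for s
    using tanh_real_lt_1[of "\<beta> * (B + s * D)"] tanh_real_gt_neg1[of "\<beta> * (B + s * D)"] by (auto simp: p_def)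
  have pd: "\<bar>p 1 - p (-1)\<bar> \<le> shared i j * tanh \<beta>"
  proof -
    have "\<bar>p 1 - p (-1)\<bar> = \<bar>tanh (\<beta> * B + \<beta> * \<bar>D\<bar>) - tanh (\<beta> * B - \<beta> * \<bar>D\<bar>)\<bar> / 2"
      by (cases "0 \<le> D") (auto simp: p_def algebra_simps abs_minus_commute simp flip: diff_divide_distrib)
    also have "\<dots> \<le> tanh (\<beta> * \<bar>D\<bar>)" using tanh_diff_le[of "\<beta> * \<bar>D\<bar>" "\<beta> * B"] \<beta> by simp
    also have "\<dots> \<le> tanh (\<beta> * real (shared i j))" using D \<beta> by (simp add: mult_left_mono)
    also have "\<dots> \<le> shared i j * tanh \<beta>" by (rule tanh_nat_mult_le[OF \<beta>])
    finally show ?thesis .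
  qed
  let ?f = "\<lambda>s u. f (\<sigma>(j := s, i := u))"
  have K: "flip_avg \<beta> G J i f (\<sigma>(j := s)) = p s * ?f s 1 + (1 - p s) * ?f s (-1)" for s
    unfolding flip_avg_def lf p_def by (simp add: field_simps)
  have fj: "\<bar>?f 1 u - ?f (-1) u\<bar> \<le> d j" if "u = 1 \<or> u = -1" for u
  proof -
    have "\<sigma>(i := u) \<in> configs N" by (rule configs_upd[OF \<sigma> i that])
    then have "\<bar>f ((\<sigma>(i := u))(j := 1)) - f ((\<sigma>(i := u))(j := -1))\<bar> \<le> d j"
      using f j(1) unfolding osc_bound_def by blast
    then show ?thesis by (simp only: fun_upd_twist[OF j(2)])
  qed
  have fi: "\<bar>?f (-1) 1 - ?f (-1) (-1)\<bar> \<le> d i"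
    using f i configs_upd[OF \<sigma> j(1), of "-1"] unfolding osc_bound_def by auto
  \<comment> \<open>Two effects of flipping j: with the same new value at i, f itself changes
    (\<open>?a\<close>, \<open>?b\<close>); and the probability of the value 1 at i changes
    (\<open>?c\<close>), which costs an oscillation of f at i.\<close>
  let ?a = "p 1 * (?f 1 1 - ?f (-1) 1)" and ?b = "(1 - p 1) * (?f 1 (-1) - ?f (-1) (-1))"
    and ?c = "(p 1 - p (-1)) * (?f (-1) 1 - ?f (-1) (-1))"
  have e: "flip_avg \<beta> G J i f (\<sigma>(j := 1)) - flip_avg \<beta> G J i f (\<sigma>(j := -1)) = ?a + ?b + ?c"
    unfolding K by (simp add: algebra_simps)
  have "\<bar>?a\<bar> \<le> p 1 * d j"
    using mult_left_mono[OF fj[of 1] p(1)[of 1]] p(1)[of 1] by (simp add: abs_mult)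
  moreover have "\<bar>?b\<bar> \<le> (1 - p 1) * d j"
    using mult_left_mono[OF fj[of "-1"], of "1 - p 1"] p(2)[of 1] by (simp add: abs_mult)
  moreover have "\<bar>?c\<bar> \<le> (shared i j * tanh \<beta>) * d i"
    unfolding abs_mult using \<beta> by (intro mult_mono[OF pd fi]) auto
  moreover have "p 1 * d j + (1 - p 1) * d j = d j" by (simp add: algebra_simps)
  ultimately have "\<bar>?a + ?b + ?c\<bar> \<le> d j + shared i j * tanh \<beta> * d i"
    using abs_triangle_ineq[of "?a + ?b" ?c] abs_triangle_ineq[of ?a ?b] by linarith
  then show ?thesis unfolding e .
qed

lemma flip_sum_osc:
  assumes \<beta>: "0 \<le> \<beta>" and f: "osc_bound f d"
  shows "osc_bound (flip_sum \<beta> N G J f) (\<lambda>j. \<Sum>i\<in>{..<N} - {j}. d j + shared i j * tanh \<beta> * d i)"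
  unfolding osc_bound_def
proof (intro allI impI ballI)
  fix j \<sigma> assume j: "j < N" and \<sigma>: "\<sigma> \<in> configs N"
  \<comment> \<open>Resampling j forgets its old value. This missing term turns N into N - 1 in the
    contraction factor.\<close>
  have "flip_avg \<beta> G J j f (\<sigma>(j := 1)) = flip_avg \<beta> G J j f (\<sigma>(j := -1))"
    by (simp add: flip_avg_def local_field_upd)
  then have eq: "flip_sum \<beta> N G J f (\<sigma>(j := 1)) - flip_sum \<beta> N G J f (\<sigma>(j := -1))
    = (\<Sum>i\<in>{..<N} - {j}. flip_avg \<beta> G J i f (\<sigma>(j := 1)) - flip_avg \<beta> G J i f (\<sigma>(j := -1)))"
    unfolding flip_sum_def sum_subtractf[symmetric] using j by (subst sum.remove[of _ j]) auto
  have "\<bar>\<Sum>i\<in>{..<N} - {j}. flip_avg \<beta> G J i f (\<sigma>(j := 1)) - flip_avg \<beta> G J i f (\<sigma>(j := -1))\<bar>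
    \<le> (\<Sum>i\<in>{..<N} - {j}. \<bar>flip_avg \<beta> G J i f (\<sigma>(j := 1)) - flip_avg \<beta> G J i f (\<sigma>(j := -1))\<bar>)"
    by (rule sum_abs)
  also have "\<dots> \<le> (\<Sum>i\<in>{..<N} - {j}. d j + shared i j * tanh \<beta> * d i)"
    by (intro sum_mono flip_avg_osc[OF \<beta> f _ j _ \<sigma>]) auto
  finally show "\<bar>flip_sum \<beta> N G J f (\<sigma>(j := 1)) - flip_sum \<beta> N G J f (\<sigma>(j := -1))\<bar>
     \<le> (\<Sum>i\<in>{..<N} - {j}. d j + shared i j * tanh \<beta> * d i)" unfolding eq .
qed

text \<open>Interpolates from \<sigma> to \<tau> by changing one coordinate at a time.\<close>

lemma osc_bound_total:
  assumes f: "osc_bound f d" and d: "\<And>j. 0 \<le> d j" and \<sigma>: "\<sigma> \<in> configs N" and \<tau>: "\<tau> \<in> configs N"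
  shows "\<bar>f \<sigma> - f \<tau>\<bar> \<le> (\<Sum>j<N. d j)"
proof -
  define mix where "mix m = (\<lambda>j. if j < m then \<tau> j else \<sigma> j)" for m :: nat
  have mixc: "mix m \<in> configs N" for m
    using \<sigma> \<tau> by (auto simp: mix_def configs_def PiE_def Pi_def extensional_def)
  have "\<bar>f \<sigma> - f (mix m)\<bar> \<le> (\<Sum>j<m. d j)" if "m \<le> N" for m
    using that
  proof (induction m)
    case 0
    have "mix 0 = \<sigma>" by (auto simp: mix_def)
    then show ?case by simp
  next
    case (Suc m)
    have m: "m < N" using Suc.prems by simp
    have upd: "mix (Suc m) = (mix m)(m := \<tau> m)" by (auto simp: mix_def fun_eq_iff)
    have "\<bar>f (mix m) - f (mix (Suc m))\<bar> \<le> d m"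
    proof (cases "\<sigma> m = \<tau> m")
      case True
      then have "mix (Suc m) = mix m" by (auto simp: mix_def fun_eq_iff less_Suc_eq)
      then show ?thesis using d by simp
    next
      case False
      then have "{mix m, mix (Suc m)} = {(mix m)(m := 1), (mix m)(m := -1)}"
        using configs_val[OF \<sigma> m] configs_val[OF \<tau> m] unfolding upd
        by (auto simp: mix_def fun_eq_iff)
      moreover have "\<bar>f ((mix m)(m := 1)) - f ((mix m)(m := -1))\<bar> \<le> d m"
        using f m mixc unfolding osc_bound_def by blast
      ultimately show ?thesis by (auto simp: doubleton_eq_iff abs_minus_commute)
    qed
    then show ?case using Suc by (simp add: abs_le_iff)
  qed
  from this[of N] have "\<bar>f \<sigma> - f (mix N)\<bar> \<le> (\<Sum>j<N. d j)" by simp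
  moreover have "mix N = \<tau>"
    using \<sigma> \<tau> by (auto simp: mix_def fun_eq_iff configs_def PiE_def extensional_def)
  ultimately show ?thesis by simp
qed

text \<open>The sum of the oscillations is what contracts: after exchanging the sums over i and j,
  the coefficient of \<open>d i\<close> contains the total number of nodes that i shares with other
  spins, which is at most K.\<close>

lemma flip_sum_pow_osc:
  assumes \<beta>: "0 \<le> \<beta>" and f: "osc_bound f d0" and d0: "\<And>j. 0 \<le> d0 j"
    and deg: "\<And>i. i < N \<Longrightarrow> (\<Sum>j\<in>{..<N} - {i}. real (shared i j)) \<le> K"
    and r: "r = real N - 1 + K * tanh \<beta>"
  shows "\<exists>d. osc_bound ((flip_sum \<beta> N G J ^^ n) f) d \<and> (\<forall>j. 0 \<le> d j) \<and> (\<Sum>j<N. d j) \<le> r ^ n * (\<Sum>j<N. d0 j)"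
\<comment> \<open>The factor r may be negative when there are no spins; all sums are then
  empty.\<close>
proof (cases "N = 0")
  case True
  have "osc_bound g d0" for g unfolding osc_bound_def using True by blast
  then show ?thesis using True d0 by (intro exI[of _ d0]) auto
next
  case False
  have K: "0 \<le> K"
    using deg[of 0] False sum_nonneg[of "{..<N} - {0}" "\<lambda>j. real (shared 0 j)"] by auto
  have th: "0 \<le> tanh \<beta>" using \<beta> by simp
  have r0: "0 \<le> r" using False K th by (auto simp: r)
  show ?thesis
  proof (induction n)
    case 0
    show ?case using f d0 by auto
  next
    case (Suc n)
    then obtain d where d: "osc_bound ((flip_sum \<beta> N G J ^^ n) f) d" "\<And>j. 0 \<le> d j"
        "(\<Sum>j<N. d j) \<le> r ^ n * (\<Sum>j<N. d0 j)" by blast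
    let ?d = "\<lambda>j. \<Sum>i\<in>{..<N} - {j}. d j + shared i j * tanh \<beta> * d i"
    have "osc_bound ((flip_sum \<beta> N G J ^^ Suc n) f) ?d" using flip_sum_osc[OF \<beta> d(1)] by simp
    moreover have "\<forall>j. 0 \<le> ?d j" using d(2) th by (auto intro!: sum_nonneg add_nonneg_nonneg mult_nonneg_nonneg)
    moreover have "(\<Sum>j<N. ?d j) \<le> r * (\<Sum>j<N. d j)"
    proof -
      have "(\<Sum>j<N. ?d j) = (\<Sum>j<N. (real N - 1) * d j) + (\<Sum>j<N. \<Sum>i\<in>{..<N} - {j}. shared i j * tanh \<beta> * d i)"
        by (simp add: sum.distrib of_nat_diff)
      also have "(\<Sum>j<N. \<Sum>i\<in>{..<N} - {j}. shared i j * tanh \<beta> * d i)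
        = (\<Sum>j<N. \<Sum>i<N. if i \<noteq> j then shared i j * tanh \<beta> * d i else 0)"
        by (intro sum.cong refl sum.mono_neutral_cong_left) auto
      also have "\<dots> = (\<Sum>i<N. \<Sum>j<N. if i \<noteq> j then shared i j * tanh \<beta> * d i else 0)"
        by (rule sum.swap)
      also have "\<dots> = (\<Sum>i<N. \<Sum>j\<in>{..<N} - {i}. shared i j * (tanh \<beta> * d i))"
        by (intro sum.cong refl sum.mono_neutral_cong_right) auto
      also have "\<dots> \<le> (\<Sum>i<N. K * (tanh \<beta> * d i))"
        unfolding sum_distrib_right[symmetric] using d(2) th deg
        by (intro sum_mono mult_right_mono) auto
      also have "(\<Sum>j<N. (real N - 1) * d j) + (\<Sum>i<N. K * (tanh \<beta> * d i)) = r * (\<Sum>j<N. d j)"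
        by (simp add: r sum_distrib_left algebra_simps sum.distrib sum_subtractf)
      finally show ?thesis by simp
    qed
    moreover have "r * (\<Sum>j<N. d j) \<le> r ^ Suc n * (\<Sum>j<N. d0 j)"
      using mult_left_mono[OF d(3) r0] by (simp add: mult.assoc)
    ultimately show ?case by (intro exI[of _ ?d]) auto
  qed
qed

section \<open>Exponential decay of the correlation\<close>

lemma gibbs_weight_stationary:
  "(\<Sum>\<sigma>\<in>configs N. gibbs_weight \<beta> N M G J \<sigma> * (flip_sum \<beta> N G J ^^ n) f \<sigma>)
    = N ^ n * (\<Sum>\<sigma>\<in>configs N. gibbs_weight \<beta> N M G J \<sigma> * f \<sigma>)"
  using flip_sum_pow_stationary[of n f]
  by (simp add: gibbs_weight_eq sum_divide_distrib[symmetric])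

text \<open>With g centred at the middle of its range and m the mean spin, |g - c| \<le> D / 2,
  while |\<sigma> i - m| = 1 - m \<sigma> i has mean 1 - m^2 \<le> 1. The factor 1 / 2 matters: the
  spin itself has oscillation 2, so the decay starts from 1.\<close>

lemma covariance_le:
  assumes i: "i < N" and osc: "\<And>\<sigma> \<tau>. \<sigma> \<in> configs N \<Longrightarrow> \<tau> \<in> configs N \<Longrightarrow> \<bar>g \<sigma> - g \<tau>\<bar> \<le> D"
  shows "(\<Sum>\<sigma>\<in>configs N. gibbs_weight \<beta> N M G J \<sigma> * (\<sigma> i * g \<sigma>))
    - (\<Sum>\<sigma>\<in>configs N. gibbs_weight \<beta> N M G J \<sigma> * \<sigma> i) * (\<Sum>\<sigma>\<in>configs N. gibbs_weight \<beta> N M G J \<sigma> * g \<sigma>) \<le> D / 2"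
proof -
  let ?w = "gibbs_weight \<beta> N M G J"
  note fin = finite_configs[of N] and ne = configs_ne[of N] and w1 = sum_gibbs_weight[where ?\<beta> = \<beta> and ?N = N and ?M = M and ?G = G and ?J = J]
  have w0: "0 \<le> ?w \<sigma>" for \<sigma> using gibbs_weight_pos by (rule less_imp_le)
  define m where "m = (\<Sum>\<sigma>\<in>configs N. ?w \<sigma> * \<sigma> i)"
  define hi where "hi = Max (g ` configs N)"
  define lo where "lo = Min (g ` configs N)"
  define c where "c = (hi + lo) / 2"
  have "hi \<in> g ` configs N" "lo \<in> g ` configs N"
    unfolding hi_def lo_def using fin ne by (auto intro!: Max_in Min_in)
  then have hl: "hi - lo \<le> D" using osc by force
  have gc: "\<bar>g \<sigma> - c\<bar> \<le> D / 2" if "\<sigma> \<in> configs N" for \<sigma>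
  proof -
    have "g \<sigma> \<le> hi" "lo \<le> g \<sigma>" unfolding hi_def lo_def using fin that by auto
    then show ?thesis using hl by (auto simp: c_def abs_le_iff field_simps)
  qed
  have m1: "\<bar>m\<bar> \<le> 1"
  proof -
    have "\<bar>m\<bar> \<le> (\<Sum>\<sigma>\<in>configs N. \<bar>?w \<sigma> * \<sigma> i\<bar>)" unfolding m_def by (rule sum_abs)
    also have "\<dots> = (\<Sum>\<sigma>\<in>configs N. ?w \<sigma>)"
      using configs_val i w0 by (intro sum.cong refl) (fastforce simp: abs_mult)
    finally show ?thesis using w1 by simp
  qed
  have "(\<Sum>\<sigma>\<in>configs N. ?w \<sigma> * (\<sigma> i * g \<sigma>)) - m * (\<Sum>\<sigma>\<in>configs N. ?w \<sigma> * g \<sigma>)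
    = (\<Sum>\<sigma>\<in>configs N. ?w \<sigma> * ((\<sigma> i - m) * (g \<sigma> - c)))"
  proof -
    have "(\<Sum>\<sigma>\<in>configs N. ?w \<sigma> * ((\<sigma> i - m) * (g \<sigma> - c)))
      = (\<Sum>\<sigma>\<in>configs N. ?w \<sigma> * (\<sigma> i * g \<sigma>)) - m * (\<Sum>\<sigma>\<in>configs N. ?w \<sigma> * g \<sigma>)
        - c * m + c * m * (\<Sum>\<sigma>\<in>configs N. ?w \<sigma>)"
      unfolding m_def[symmetric]
      by (subst (3) m_def) (simp add: sum_distrib_left algebra_simps sum.distrib sum_subtractf)
    then show ?thesis using w1 by simp
  qed
  also have "\<dots> \<le> (\<Sum>\<sigma>\<in>configs N. ?w \<sigma> * ((1 - m * \<sigma> i) * (D / 2)))"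
  proof (intro sum_mono mult_left_mono w0)
    fix \<sigma> assume s: "\<sigma> \<in> configs N"
    have "\<bar>\<sigma> i - m\<bar> = 1 - m * \<sigma> i" using configs_val[OF s i] m1 by auto
    then have "\<bar>(\<sigma> i - m) * (g \<sigma> - c)\<bar> \<le> (1 - m * \<sigma> i) * (D / 2)"
      unfolding abs_mult using gc[OF s] by (intro mult_mono) auto
    then show "(\<sigma> i - m) * (g \<sigma> - c) \<le> (1 - m * \<sigma> i) * (D / 2)" by linarith
  qed
  also have "\<dots> = (1 - m * m) * (D / 2)"
  proof -
    have "(\<Sum>\<sigma>\<in>configs N. ?w \<sigma> * ((1 - m * \<sigma> i) * (D / 2)))
      = (D / 2) * ((\<Sum>\<sigma>\<in>configs N. ?w \<sigma>) - m * (\<Sum>\<sigma>\<in>configs N. ?w \<sigma> * \<sigma> i))"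
      unfolding sum_distrib_left sum_subtractf[symmetric] by (intro sum.cong refl) (simp add: algebra_simps)
    then show ?thesis using w1 by (simp add: m_def mult.commute)
  qed
  also have "\<dots> \<le> D / 2"
  proof -
    obtain \<sigma> where "\<sigma> \<in> configs N" using ne by blast
    then have "0 \<le> D" using osc[of \<sigma> \<sigma>] by simp
    then show ?thesis using mult_right_mono[of "1 - m * m" 1 "D / 2"] by simp
  qed
  finally show ?thesis by (simp add: m_def)
qed

lemma osc_bound_spin_sign: "osc_bound (spin_sign i) (\<lambda>j. if j = i then 2 else 0)"
  by (auto simp: osc_bound_def spin_sign_def)

text \<open>By stationarity the n-th Poisson term minus its share of the squared mean is the
  covariance of the spin with its n-th iterate, at most r^n. The Poisson sum of r^n is exp (- (N -
  r) t), and N - r = 1 - K tanh \<beta>.\<close>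

lemma correlation_decay:
  assumes \<beta>: "0 \<le> \<beta>" and i: "i < N" and t: "0 \<le> t"
    and deg: "\<And>i. i < N \<Longrightarrow> (\<Sum>j\<in>{..<N} - {i}. real (shared i j)) \<le> K"
  shows "correlation \<beta> N M G J i t \<le> exp (- (1 - K * tanh \<beta>) * t)"
proof -
  let ?w = "gibbs_weight \<beta> N M G J"
  define r where "r = real N - 1 + K * tanh \<beta>"
  define m where "m = (\<Sum>\<sigma>\<in>configs N. ?w \<sigma> * \<sigma> i)"
  define a where "a n = (\<Sum>\<sigma>\<in>configs N. ?w \<sigma> * (\<sigma> i * (flip_sum \<beta> N G J ^^ n) (spin_sign i) \<sigma>))" for n
  let ?p = "\<lambda>n. exp (- (N * t)) * (t ^ n / fact n)"
  have p0: "0 \<le> ?p n" for n using t by simp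
  have an: "a n - real N ^ n * m\<^sup>2 \<le> r ^ n" for n
  proof -
    obtain d where d: "osc_bound ((flip_sum \<beta> N G J ^^ n) (spin_sign i)) d" "\<And>j. 0 \<le> d j"
        "(\<Sum>j<N. d j) \<le> r ^ n * (\<Sum>j<N. if j = i then 2 else 0)"
      using flip_sum_pow_osc[OF \<beta> osc_bound_spin_sign _ deg r_def] by force
    have "(\<Sum>j<N. if j = i then 2 else 0 :: real) = 2" using i by simp
    then have dn: "(\<Sum>j<N. d j) / 2 \<le> r ^ n" using d(3) by simp
    have "(\<Sum>\<sigma>\<in>configs N. ?w \<sigma> * (flip_sum \<beta> N G J ^^ n) (spin_sign i) \<sigma>) = N ^ n * m"
      unfolding gibbs_weight_stationary m_def using spin_sign_configs i by simp
    moreover have "a n - m * (\<Sum>\<sigma>\<in>configs N. ?w \<sigma> * (flip_sum \<beta> N G J ^^ n) (spin_sign i) \<sigma>) \<le> (\<Sum>j<N. d j) / 2"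
      unfolding a_def m_def by (rule covariance_le[OF i osc_bound_total[OF d(1,2)]])
    ultimately show ?thesis using dn by (simp add: power2_eq_square mult_ac)
  qed
  have "(\<lambda>n. ?p n * a n - ?p n * (real N ^ n * m\<^sup>2)) sums (correlation \<beta> N M G J i t + m\<^sup>2 - m\<^sup>2)"
    unfolding a_def m_def by (intro sums_diff correlation_sums[OF i t] sums_poisson)
  then have s1: "(\<lambda>n. ?p n * (a n - real N ^ n * m\<^sup>2)) sums correlation \<beta> N M G J i t"
    by (simp add: right_diff_distrib)
  have s2: "(\<lambda>n. ?p n * r ^ n) sums exp (- (1 - K * tanh \<beta>) * t)"
  proof -
    have "(\<lambda>n. exp (- (N * t)) * ((r * t) ^ n /\<^sub>R fact n)) sums (exp (- (N * t)) * exp (r * t))"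
      by (intro sums_mult exp_converges)
    moreover have "exp (- (N * t)) * exp (r * t) = exp (- (1 - K * tanh \<beta>) * t)"
      by (simp add: mult_exp_exp r_def algebra_simps)
    ultimately show ?thesis by (simp add: power_mult_distrib divide_inverse mult_ac)
  qed
  show ?thesis by (rule sums_le[OF _ s1 s2]) (intro mult_left_mono an p0)
qed

section \<open>A lower bound on the correlations through escape from a ball\<close>

text \<open>Hamming distance, with \<open>spin_sign\<close> on the second argument so that its
  relation to the overlap holds for every \<tau>.\<close>

definition disagree :: "config \<Rightarrow> config \<Rightarrow> nat" where
  "disagree \<sigma> \<tau> = card {i. i < N \<and> \<sigma> i \<noteq> spin_sign i \<tau>}"

lemma disagree_upd: "disagree \<sigma> (\<tau>(i := s)) \<le> disagree \<sigma> \<tau> + 1"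
proof -
  have "{j. j < N \<and> \<sigma> j \<noteq> spin_sign j (\<tau>(i := s))} \<subseteq> insert i {j. j < N \<and> \<sigma> j \<noteq> spin_sign j \<tau>}"
    by (auto simp: spin_sign_def split: if_splits)
  then have "disagree \<sigma> (\<tau>(i := s)) \<le> card (insert i {j. j < N \<and> \<sigma> j \<noteq> spin_sign j \<tau>})"
    unfolding disagree_def by (intro card_mono) auto
  also have "\<dots> \<le> disagree \<sigma> \<tau> + 1"
    unfolding disagree_def by (rule order_trans[OF card_insert_le_m1]) (auto simp: card_insert_if)
  finally show ?thesis .
qed

lemma disagree_self: "\<sigma> \<in> configs N \<Longrightarrow> disagree \<sigma> \<sigma> = 0"
  using spin_sign_configs[of \<sigma> N] by (auto simp: disagree_def)

lemma overlap_eq: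
  assumes "\<sigma> \<in> configs N"
  shows "(\<Sum>i<N. \<sigma> i * spin_sign i \<tau>) = real N - 2 * real (disagree \<sigma> \<tau>)"
proof -
  have "(\<Sum>i<N. \<sigma> i * spin_sign i \<tau>) = (\<Sum>i<N. 1 - 2 * (if \<sigma> i \<noteq> spin_sign i \<tau> then 1 else 0))"
    using configs_val[OF assms] by (intro sum.cong refl) (fastforce simp: spin_sign_def)
  also have "\<dots> = real N - 2 * (\<Sum>i<N. if \<sigma> i \<noteq> spin_sign i \<tau> then 1 else 0)"
    by (simp add: sum_subtractf sum_distrib_left)
  also have "(\<Sum>i<N. if \<sigma> i \<noteq> spin_sign i \<tau> then 1 else 0 :: real) = (\<Sum>i\<in>{i. i < N \<and> \<sigma> i \<noteq> spin_sign i \<tau>}. 1)"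
    by (intro sum.mono_neutral_cong_right) auto
  finally show ?thesis by (simp add: disagree_def)
qed

lemma disagree_le: "disagree \<sigma> \<tau> \<le> N"
  unfolding disagree_def using card_mono[of "{..<N}" "{i. i < N \<and> \<sigma> i \<noteq> spin_sign i \<tau>}"] by auto

definition far :: "nat \<Rightarrow> config \<Rightarrow> config \<Rightarrow> real" where
  "far k \<sigma> \<tau> = (if k < disagree \<sigma> \<tau> then 1 else 0)"

definition shell :: "nat \<Rightarrow> config \<Rightarrow> config \<Rightarrow> real" where
  "shell k \<sigma> \<tau> = (if disagree \<sigma> \<tau> = k then 1 else 0)"

text \<open>One update changes the distance by at most one, so a configuration beyond k arises only
  from one at distance at least k, which is either far already or on the shell.\<close>

lemma flip_sum_far: "flip_sum \<beta> N G J (far k \<sigma>) \<tau> \<le> N * (far k \<sigma> \<tau> + shell k \<sigma> \<tau>)"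
proof -
  have "flip_avg \<beta> G J i (far k \<sigma>) \<tau> \<le> far k \<sigma> \<tau> + shell k \<sigma> \<tau>" for i
  proof (cases "disagree \<sigma> \<tau> < k")
    case True
    then have "far k \<sigma> (\<tau>(i := s)) = 0" for s
      using disagree_upd[of \<sigma> \<tau> i s] by (auto simp: far_def)
    then show ?thesis by (simp add: flip_avg_def far_def shell_def)
  next
    case False
    have "flip_avg \<beta> G J i (far k \<sigma>) \<tau> \<le> flip_avg \<beta> G J i (\<lambda>_. 1) \<tau>"
      by (rule flip_avg_mono) (simp add: far_def)
    also have "\<dots> = 1" by (simp add: flip_avg_def field_simps)
    finally show ?thesis using False by (auto simp: far_def shell_def)
  qed
  then have "flip_sum \<beta> N G J (far k \<sigma>) \<tau> \<le> (\<Sum>i<N. far k \<sigma> \<tau> + shell k \<sigma> \<tau>)"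
    unfolding flip_sum_def by (rule sum_mono)
  then show ?thesis by simp
qed

text \<open>The quotient of the weight of the sphere around \<sigma> by the weight of \<sigma>, with
  the integer radius k in place of the overlap.\<close>

definition shell_ratio :: "nat \<Rightarrow> config \<Rightarrow> real" where
  "shell_ratio k \<sigma> = (\<Sum>\<tau>\<in>configs N. bweight \<tau> * shell k \<sigma> \<tau>) / bweight \<sigma>"

lemma shell_ratio_nonneg: "0 \<le> shell_ratio k \<sigma>"
  unfolding shell_ratio_def using bweight_pos
  by (intro divide_nonneg_nonneg sum_nonneg mult_nonneg_nonneg) (auto simp: shell_def less_imp_le)

text \<open>To be far at step \<open>n\<close> the chain must have visited the shell at an earlier step.\<close>

lemma flip_sum_pow_far_le:
  assumes \<sigma>: "\<sigma> \<in> configs N"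
  shows "(flip_sum \<beta> N G J ^^ n) (far k \<sigma>) \<sigma> \<le> n * N ^ n * shell_ratio k \<sigma>"
proof -
  let ?A = "flip_sum \<beta> N G J"
  \<comment> \<open>Starting from \<sigma> alone, with its own weight, gives less than starting from
    all configurations; for the latter stationarity evaluates the sum.\<close>
  have sh: "(?A ^^ m) (shell k \<sigma>) \<sigma> \<le> N ^ m * shell_ratio k \<sigma>" for m
  proof -
    have "bweight \<sigma> * (?A ^^ m) (shell k \<sigma>) \<sigma> \<le> (\<Sum>\<tau>\<in>configs N. bweight \<tau> * (?A ^^ m) (shell k \<sigma>) \<tau>)"
      by (rule member_le_sum[OF \<sigma>])
        (auto intro!: mult_nonneg_nonneg flip_sum_pow_nonneg less_imp_le[OF bweight_pos] simp: shell_def finite_configs)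
    then show ?thesis
      unfolding flip_sum_pow_stationary shell_ratio_def using bweight_pos[of \<sigma>]
      by (simp add: field_simps)
  qed
  show ?thesis
  proof (induction n)
    case 0
    show ?case using disagree_self[OF \<sigma>] by (simp add: far_def)
  next
    case (Suc n)
    have "(?A ^^ Suc n) (far k \<sigma>) \<sigma> = (?A ^^ n) (?A (far k \<sigma>)) \<sigma>" by (simp add: funpow_swap1)
    also have "\<dots> \<le> (?A ^^ n) (\<lambda>\<tau>. N * (far k \<sigma> \<tau> + shell k \<sigma> \<tau>)) \<sigma>"
      by (rule flip_sum_pow_mono) (rule flip_sum_far)
    also have "\<dots> = N * ((?A ^^ n) (far k \<sigma>) \<sigma> + (?A ^^ n) (shell k \<sigma>) \<sigma>)"
      by (simp add: flip_sum_pow_cmult flip_sum_pow_add)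
    also have "\<dots> \<le> N * (n * N ^ n * shell_ratio k \<sigma> + N ^ n * shell_ratio k \<sigma>)"
      using Suc sh[of n] by (intro mult_left_mono add_mono) auto
    also have "\<dots> = Suc n * N ^ Suc n * shell_ratio k \<sigma>" by (simp add: algebra_simps)
    finally show ?case .
  qed
qed

text \<open>The mean c t of the Poisson number of rings. It converts the escape bound linear in the
  number of steps into one linear in time.\<close>

lemma sums_poisson_mean: "(\<lambda>n. exp (- (c * t)) * (t ^ n / fact n) * (real n * (c :: real) ^ n * x)) sums (c * t * x)"
proof -
  have "(\<lambda>n. c * t * exp (- (c * t)) * x * ((c * t) ^ n /\<^sub>R fact n)) sums (c * t * exp (- (c * t)) * x * exp (c * t))"
    by (intro sums_mult exp_converges)
  moreover have "c * t * exp (- (c * t)) * x * exp (c * t) = c * t * x"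
    using exp_minus_inverse[of "c * t"] by (simp add: mult_ac)
  moreover have "c * t * exp (- (c * t)) * x * ((c * t) ^ n /\<^sub>R fact n)
     = exp (- (c * t)) * (t ^ Suc n / fact (Suc n)) * (real (Suc n) * c ^ Suc n * x)" for n
  proof -
    have "(1 :: real) / fact n = real (Suc n) / fact (Suc n)" by simp
    then show ?thesis by (simp add: power_mult_distrib divide_inverse mult_ac)
  qed
  ultimately have "(\<lambda>n. exp (- (c * t)) * (t ^ Suc n / fact (Suc n)) * (real (Suc n) * c ^ Suc n * x)) sums (c * t * x)"
    by simp
  then show ?thesis by (subst (asm) sums_Suc_iff) simp
qed

text \<open>Summed over i, the correlations are the mean overlap of the initial and final
  configurations minus the mean overlap of two independent ones. The first is at least N - 2 k
  outside the event of being far, whose probability is bounded both by 1 and by the shell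
  ratio.\<close>

lemma sum_correlation_ge:
  fixes t :: real and k :: nat
  assumes t: "0 \<le> t"
  shows "real N - 2 * real k
     - 2 * real N * (\<Sum>\<sigma>\<in>configs N. gibbs_weight \<beta> N M G J \<sigma> * min 1 (real N * t * shell_ratio k \<sigma>))
     - (\<Sum>\<sigma>\<in>configs N. \<Sum>\<tau>\<in>configs N. gibbs_weight \<beta> N M G J \<sigma> * gibbs_weight \<beta> N M G J \<tau> * (real N - 2 * real (disagree \<sigma> \<tau>)))
     \<le> (\<Sum>i<N. correlation \<beta> N M G J i t)"
proof -
  let ?w = "gibbs_weight \<beta> N M G J" and ?A = "flip_sum \<beta> N G J"
  let ?p = "\<lambda>n. exp (- (real N * t)) * (t ^ n / fact n)"
  have w0: "0 \<le> ?w \<sigma>" for \<sigma> using gibbs_weight_pos by (rule less_imp_le)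
  have w1: "(\<Sum>\<sigma>\<in>configs N. ?w \<sigma>) = 1" by (rule sum_gibbs_weight)
  have p0: "0 \<le> ?p n" for n using t by simp
  define m where "m i = (\<Sum>\<sigma>\<in>configs N. ?w \<sigma> * \<sigma> i)" for i
  define P where "P \<sigma> = (\<integral>y. far k \<sigma> (glauber \<beta> N G J t (\<sigma>, y)) \<partial>clock_space N)" for \<sigma>
  have Ps: "(\<lambda>n. ?p n * (?A ^^ n) (far k \<sigma>) \<sigma>) sums P \<sigma>" for \<sigma>
    unfolding P_def by (rule expectation_run[where B = 1]) (use t in \<open>auto simp: far_def\<close>)
  have Ple: "P \<sigma> \<le> min 1 (real N * t * shell_ratio k \<sigma>)" if \<sigma>: "\<sigma> \<in> configs N" for \<sigma>
  proof (rule min.boundedI)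
    have "(?A ^^ n) (far k \<sigma>) \<sigma> \<le> (?A ^^ n) (\<lambda>_. 1) \<sigma>" for n
      by (rule flip_sum_pow_mono) (simp add: far_def)
    then show "P \<sigma> \<le> 1"
      by (intro sums_le[OF _ Ps sums_poisson[of "real N" t 1]] mult_left_mono p0) (simp add: flip_sum_pow_const)
    show "P \<sigma> \<le> real N * t * shell_ratio k \<sigma>"
    proof (intro sums_le[OF _ Ps sums_poisson_mean[of "real N" t "shell_ratio k \<sigma>"]] mult_left_mono p0)
      show "(?A ^^ n) (far k \<sigma>) \<sigma> \<le> real n * real N ^ n * shell_ratio k \<sigma>" for n
        using flip_sum_pow_far_le[OF \<sigma>, of n k] by simp
    qed
  qed
  have mm: "(\<Sum>i<N. (m i)\<^sup>2) = (\<Sum>\<sigma>\<in>configs N. \<Sum>\<tau>\<in>configs N. ?w \<sigma> * ?w \<tau> * (real N - 2 * real (disagree \<sigma> \<tau>)))"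
  proof -
    have "(\<Sum>i<N. (m i)\<^sup>2) = (\<Sum>i<N. \<Sum>\<sigma>\<in>configs N. \<Sum>\<tau>\<in>configs N. ?w \<sigma> * ?w \<tau> * (\<sigma> i * \<tau> i))"
      unfolding m_def power2_eq_square sum_product by (simp add: mult_ac)
    also have "\<dots> = (\<Sum>\<sigma>\<in>configs N. \<Sum>i<N. \<Sum>\<tau>\<in>configs N. ?w \<sigma> * ?w \<tau> * (\<sigma> i * \<tau> i))"
      by (rule sum.swap)
    also have "\<dots> = (\<Sum>\<sigma>\<in>configs N. \<Sum>\<tau>\<in>configs N. \<Sum>i<N. ?w \<sigma> * ?w \<tau> * (\<sigma> i * \<tau> i))"
      by (intro sum.cong refl sum.swap)
    also have "\<dots> = (\<Sum>\<sigma>\<in>configs N. \<Sum>\<tau>\<in>configs N. ?w \<sigma> * ?w \<tau> * (real N - 2 * real (disagree \<sigma> \<tau>)))"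
    proof (intro sum.cong refl)
      fix \<sigma> \<tau> assume "\<sigma> \<in> configs N" "\<tau> \<in> configs N"
      then have "(\<Sum>i<N. \<sigma> i * \<tau> i) = real N - 2 * real (disagree \<sigma> \<tau>)"
        using overlap_eq[of \<sigma> \<tau>] spin_sign_configs[of \<tau> N] by simp
      then show "(\<Sum>i<N. ?w \<sigma> * ?w \<tau> * (\<sigma> i * \<tau> i)) = ?w \<sigma> * ?w \<tau> * (real N - 2 * real (disagree \<sigma> \<tau>))"
        by (simp add: sum_distrib_left[symmetric])
    qed
    finally show ?thesis .
  qed
  let ?f = "\<lambda>\<sigma> \<tau>. \<Sum>i<N. \<sigma> i * spin_sign i \<tau>"
  have lin: "(\<Sum>i\<in>I. \<sigma> i * (?A ^^ n) (spin_sign i) \<sigma>') = (?A ^^ n) (\<lambda>\<tau>. \<Sum>i\<in>I. \<sigma> i * spin_sign i \<tau>) \<sigma>'"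
    if "finite I" for n \<sigma> \<sigma>' and I :: "nat set"
    using that
  proof induction
    case empty
    show ?case using flip_sum_pow_const[of n \<beta> N G J 0] by simp
  qed (simp add: flip_sum_pow_add flip_sum_pow_cmult)
  have "(\<lambda>n. \<Sum>i<N. ?p n * (\<Sum>\<sigma>\<in>configs N. ?w \<sigma> * (\<sigma> i * (?A ^^ n) (spin_sign i) \<sigma>)))
    sums (\<Sum>i<N. correlation \<beta> N M G J i t + (m i)\<^sup>2)"
    unfolding m_def by (intro sums_sum correlation_sums t) auto
  moreover have "(\<Sum>i<N. ?p n * (\<Sum>\<sigma>\<in>configs N. ?w \<sigma> * (\<sigma> i * (?A ^^ n) (spin_sign i) \<sigma>)))
    = (\<Sum>\<sigma>\<in>configs N. ?w \<sigma> * (?p n * (?A ^^ n) (?f \<sigma>) \<sigma>))" for n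
  proof -
    have "(\<Sum>i<N. ?p n * (\<Sum>\<sigma>\<in>configs N. ?w \<sigma> * (\<sigma> i * (?A ^^ n) (spin_sign i) \<sigma>)))
      = ?p n * (\<Sum>\<sigma>\<in>configs N. \<Sum>i<N. ?w \<sigma> * (\<sigma> i * (?A ^^ n) (spin_sign i) \<sigma>))"
      by (subst sum_distrib_left[symmetric]) (subst sum.swap, rule refl)
    also have "\<dots> = ?p n * (\<Sum>\<sigma>\<in>configs N. ?w \<sigma> * (\<Sum>i<N. \<sigma> i * (?A ^^ n) (spin_sign i) \<sigma>))"
      by (simp only: sum_distrib_left)
    also have "\<dots> = (\<Sum>\<sigma>\<in>configs N. ?w \<sigma> * (?p n * (\<Sum>i<N. \<sigma> i * (?A ^^ n) (spin_sign i) \<sigma>)))"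
      by (subst sum_distrib_left) (simp only: mult.left_commute)
    finally show ?thesis using lin by simp
  qed
  ultimately have s1: "(\<lambda>n. \<Sum>\<sigma>\<in>configs N. ?w \<sigma> * (?p n * (?A ^^ n) (?f \<sigma>) \<sigma>))
    sums (\<Sum>i<N. correlation \<beta> N M G J i t + (m i)\<^sup>2)" by simp
  have s2: "(\<lambda>n. \<Sum>\<sigma>\<in>configs N. ?w \<sigma> * (?p n * (real N ^ n * (real N - 2 * real k)) - 2 * real N * (?p n * (?A ^^ n) (far k \<sigma>) \<sigma>)))
    sums (\<Sum>\<sigma>\<in>configs N. ?w \<sigma> * ((real N - 2 * real k) - 2 * real N * P \<sigma>))"
    by (intro sums_sum sums_mult sums_diff sums_poisson Ps)
  have "(\<Sum>\<sigma>\<in>configs N. ?w \<sigma> * ((real N - 2 * real k) - 2 * real N * P \<sigma>)) \<le> (\<Sum>i<N. correlation \<beta> N M G J i t + (m i)\<^sup>2)"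
  proof (rule sums_le[OF _ s2 s1], intro sum_mono mult_left_mono w0)
    fix n \<sigma> assume \<sigma>: "\<sigma> \<in> configs N"
    have "(?A ^^ n) (\<lambda>\<tau>. (real N - 2 * real k) + (- 2 * real N) * far k \<sigma> \<tau>) \<sigma> \<le> (?A ^^ n) (?f \<sigma>) \<sigma>"
    proof (rule flip_sum_pow_mono)
      \<comment> \<open>The overlap is never below - N, so subtracting 2 N covers the far
        case.\<close>
      fix \<tau> show "(real N - 2 * real k) + (- 2 * real N) * far k \<sigma> \<tau> \<le> ?f \<sigma> \<tau>"
        unfolding overlap_eq[OF \<sigma>] using disagree_le[of \<sigma> \<tau>] by (auto simp: far_def)
    qed
    then have "?p n * (real N ^ n * (real N - 2 * real k) + (- 2 * real N) * (?A ^^ n) (far k \<sigma>) \<sigma>) \<le> ?p n * (?A ^^ n) (?f \<sigma>) \<sigma>"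
      unfolding flip_sum_pow_add flip_sum_pow_cmult flip_sum_pow_const by (intro mult_left_mono p0)
    then show "?p n * (real N ^ n * (real N - 2 * real k)) - 2 * real N * (?p n * (?A ^^ n) (far k \<sigma>) \<sigma>) \<le> ?p n * (?A ^^ n) (?f \<sigma>) \<sigma>"
      by (simp add: algebra_simps)
  qed
  moreover have "(\<Sum>\<sigma>\<in>configs N. ?w \<sigma> * ((real N - 2 * real k) - 2 * real N * P \<sigma>))
    = (real N - 2 * real k) * (\<Sum>\<sigma>\<in>configs N. ?w \<sigma>) - 2 * real N * (\<Sum>\<sigma>\<in>configs N. ?w \<sigma> * P \<sigma>)"
    by (simp add: right_diff_distrib sum_subtractf sum_distrib_left mult_ac)
  moreover have "(\<Sum>\<sigma>\<in>configs N. ?w \<sigma> * P \<sigma>) \<le> (\<Sum>\<sigma>\<in>configs N. ?w \<sigma> * min 1 (real N * t * shell_ratio k \<sigma>))"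
    by (intro sum_mono mult_left_mono w0 Ple)
  then have "2 * real N * (\<Sum>\<sigma>\<in>configs N. ?w \<sigma> * P \<sigma>) \<le> 2 * real N * (\<Sum>\<sigma>\<in>configs N. ?w \<sigma> * min 1 (real N * t * shell_ratio k \<sigma>))"
    by (intro mult_left_mono) auto
  ultimately show ?thesis using mm w1 by (simp add: sum.distrib)
qed

end

section \<open>The random factor graph\<close>

lemma num_funs_mult:
  assumes "p dvd N * l"
  shows "num_funs p l N * p = N * l"
  using assms by (simp add: num_funs_def)

lemma config_graph_edge:
  assumes "(i, a) \<in> config_graph p l N \<pi>"
  shows "\<exists>s<N * l. s div l = i \<and> \<pi> s div p = a"
proof -
  have "edge_multiplicity p l N \<pi> i a \<noteq> 0"
    using assms by (intro notI) (simp add: config_graph_def)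
  then have "{s \<in> {..<N * l}. s div l = i \<and> \<pi> s div p = a} \<noteq> {}"
    unfolding edge_multiplicity_def by (metis card.empty)
  then show ?thesis by auto
qed

lemma div_fibre: "0 < l \<Longrightarrow> {s :: nat. s div l = i} = {i * l..<i * l + l}"
  by (auto simp: div_nat_eqI algebra_simps intro: div_nat_eqI dest: dividend_less_times_div)

lemma card_div_fibre: "0 < l \<Longrightarrow> finite {s :: nat. s div l = i} \<and> card {s :: nat. s div l = i} = l"
  by (simp add: div_fibre)

lemma card_var_nbrs_le:
  assumes "0 < l"
  shows "card (var_nbrs (config_graph p l N \<pi>) i) \<le> l"
proof -
  have "var_nbrs (config_graph p l N \<pi>) i \<subseteq> (\<lambda>s. \<pi> s div p) ` {s. s div l = i}"
    using config_graph_edge by (fastforce simp: var_nbrs_def)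
  then show ?thesis
    using card_div_fibre[OF assms, of i] surj_card_le by metis
qed

lemma card_fun_nbrs_le:
  assumes "0 < p" and \<pi>: "\<pi> permutes {..<N * l}"
  shows "card (fun_nbrs (config_graph p l N \<pi>) a) \<le> p"
proof -
  have "fun_nbrs (config_graph p l N \<pi>) a \<subseteq> (\<lambda>s. inv \<pi> s div l) ` {s. s div p = a}"
  proof
    fix i assume "i \<in> fun_nbrs (config_graph p l N \<pi>) a"
    then obtain s where s: "s div l = i" "\<pi> s div p = a"
      using config_graph_edge by (fastforce simp: fun_nbrs_def)
    then have "i = inv \<pi> (\<pi> s) div l" using permutes_inverses(2)[OF \<pi>] by simp
    then show "i \<in> (\<lambda>s. inv \<pi> s div l) ` {s. s div p = a}" using s by blast
  qed
  then show ?thesis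
    using card_div_fibre[OF assms(1), of a] surj_card_le by metis
qed

lemma set_disorder_pmf:
  assumes "(G, J) \<in> set_pmf (disorder_pmf p l N)"
  obtains \<pi> where "\<pi> permutes {..<N * l}" "G = config_graph p l N \<pi>"
    "\<And>a. a < num_funs p l N \<Longrightarrow> J a = 1 \<or> J a = -1"
proof -
  have "finite {\<pi>. \<pi> permutes {..<N * l}}" by (rule finite_permutations) simp
  moreover have "{\<pi>. \<pi> permutes {..<N * l}} \<noteq> {}" using permutes_id by blast
  ultimately have G: "G \<in> config_graph p l N ` {\<pi>. \<pi> permutes {..<N * l}}"
    using assms by (auto simp: disorder_pmf_def graph_pmf_def)
  have "J \<in> set_pmf (couplings_pmf (num_funs p l N))"
    using assms by (auto simp: disorder_pmf_def)
  then have "J a \<in> {-1, 1}" if "a < num_funs p l N" for a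
    using that by (auto simp: couplings_pmf_def set_Pi_pmf PiE_dflt_def)
  then show ?thesis using G that by auto
qed

lemma factor_model_disorder:
  assumes "(G, J) \<in> set_pmf (disorder_pmf p l N)"
  shows "factor_model N (num_funs p l N) G J"
  using set_disorder_pmf[OF assms]
  by (metis (no_types, lifting) config_graph_def factor_model.intro lessThan_iff mem_Collect_eq mem_Sigma_iff split_conv subrelI)

text \<open>Double counting of pairs (j, a): i has at most l function nodes, each with at most p - 1
  further spins. Cancelling multiple edges can only lower these degrees.\<close>

lemma sum_shared_le:
  assumes p: "0 < p" and l: "0 < l" and GJ: "(G, J) \<in> set_pmf (disorder_pmf p l N)" and i: "i < N"
  shows "(\<Sum>j\<in>{..<N} - {i}. real (factor_model.shared G i j)) \<le> real l * (real p - 1)"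
proof -
  obtain \<pi> where \<pi>: "\<pi> permutes {..<N * l}" and G: "G = config_graph p l N \<pi>"
    using set_disorder_pmf[OF GJ] by blast
  interpret factor_model N "num_funs p l N" G J 0 by (rule factor_model_disorder[OF GJ])
  have "(\<Sum>j\<in>{..<N} - {i}. real (shared i j)) = (\<Sum>j\<in>{..<N} - {i}. \<Sum>a\<in>var_nbrs G i. if j \<in> fun_nbrs G a then 1 else 0)"
    unfolding shared_def by (intro sum.cong refl) (simp add: sum.If_cases Int_def)
  also have "\<dots> = (\<Sum>a\<in>var_nbrs G i. \<Sum>j\<in>{..<N} - {i}. if j \<in> fun_nbrs G a then 1 else 0)"
    by (rule sum.swap)
  also have "\<dots> \<le> (\<Sum>a\<in>var_nbrs G i. real p - 1)"
  proof (rule sum_mono)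
    fix a assume "a \<in> var_nbrs G i"
    then have ia: "i \<in> fun_nbrs G a" by (simp add: nbrs_iff)
    have "(\<Sum>j\<in>{..<N} - {i}. if j \<in> fun_nbrs G a then 1 else 0 :: real) = real (card (fun_nbrs G a - {i}))"
    proof -
      have "({..<N} - {i}) \<inter> fun_nbrs G a = fun_nbrs G a - {i}" using fun_nbrs_subset[of a] by auto
      then show ?thesis by (simp add: sum.If_cases)
    qed
    also have "\<dots> = real (card (fun_nbrs G a)) - 1"
    proof -
      have "0 < card (fun_nbrs G a)" using ia by (auto simp: card_gt_0_iff)
      then show ?thesis using ia by (simp add: of_nat_diff)
    qed
    also have "\<dots> \<le> real p - 1" using card_fun_nbrs_le[OF p \<pi>, of a] G by simp
    finally show "(\<Sum>j\<in>{..<N} - {i}. if j \<in> fun_nbrs G a then 1 else 0) \<le> real p - 1" .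
  qed
  also have "\<dots> = real (card (var_nbrs G i)) * (real p - 1)" by simp
  also have "\<dots> \<le> real l * (real p - 1)"
    using card_var_nbrs_le[OF l, of p N \<pi> i] G p by (intro mult_right_mono) auto
  finally show ?thesis .
qed

section \<open>From correlations to correlation times, and fast relaxation\<close>

lemma correlation_time_le:
  assumes "0 \<le> \<tau>" "\<And>t. \<tau> \<le> t \<Longrightarrow> correlation \<beta> N M G J i t \<le> \<epsilon>"
  shows "correlation_time \<beta> N M G J i \<epsilon> \<le> ereal \<tau>"
  unfolding correlation_time_def by (rule Inf_lower) (use assms in auto)

lemma correlation_time_ge:
  assumes "0 \<le> T" "\<epsilon> < correlation \<beta> N M G J i T"
  shows "ereal T \<le> correlation_time \<beta> N M G J i \<epsilon>"
  unfolding correlation_time_def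
proof (rule Inf_greatest, clarify)
  fix \<tau> assume "0 \<le> \<tau>" "\<forall>t\<ge>\<tau>. correlation \<beta> N M G J i t \<le> \<epsilon>"
  then have "\<not> \<tau> \<le> T" using assms by force
  then show "ereal T \<le> ereal \<tau>" by simp
qed

lemma fast_relaxation:
  assumes p: "3 \<le> p" and l: "3 \<le> l" and \<beta>: "0 < \<beta>" and fast: "T_fast p l < 1 / \<beta>"
    and \<kappa>: "\<kappa> = 1 - real l * (real p - 1) * tanh \<beta>"
    and GJ: "(G, J) \<in> set_pmf (disorder_pmf p l N)" and i: "i < N" and \<epsilon>: "\<epsilon> \<in> {0<..<1}"
  shows "correlation_time \<beta> N (num_funs p l N) G J i \<epsilon> \<le> ereal (1 / \<kappa> * ln (1 / (\<kappa> * \<epsilon>)))"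
proof -
  define K where "K = real l * (real p - 1)"
  have "3 * 2 \<le> real l * (real p - 1)" using p l by (intro mult_mono) auto
  then have K: "6 \<le> K" by (simp add: K_def)
  define y where "y = 1 / K"
  have y: "0 < y" "y < 1" using K by (auto simp: y_def)
  have "0 < artanh y"
    using y by (simp add: artanh_def field_simps)
  moreover have "inverse (artanh y) < 1 / \<beta>" using fast by (simp add: T_fast_def y_def K_def)
  ultimately have "\<beta> < artanh y" using \<beta> by (simp add: field_simps)
  \<comment> \<open>artanh is increasing because (1 + y) / (1 - y) is; with artanh (tanh \<beta>) =
    \<beta> the temperature condition becomes \<kappa> > 0.\<close>
  have "tanh \<beta> < y"
  proof (rule ccontr)
    assume "\<not> tanh \<beta> < y"
    moreover have "tanh \<beta> < 1" by (rule tanh_real_lt_1)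
    ultimately have "(1 + y) / (1 - y) \<le> (1 + tanh \<beta>) / (1 - tanh \<beta>)" using y by (intro frac_le) auto
    then have "artanh y \<le> artanh (tanh \<beta>)" using y by (auto simp: artanh_def intro!: divide_right_mono ln_mono)
    then show False using \<open>\<beta> < artanh y\<close> by (simp add: artanh_tanh_real)
  qed
  then have \<kappa>0: "0 < \<kappa>" using K by (simp add: \<kappa> K_def[symmetric] y_def field_simps)
  have th: "0 < tanh \<beta>" using \<beta> by simp
  have "0 < K * tanh \<beta>" using K th by (intro mult_pos_pos) auto
  then have \<kappa>1: "\<kappa> < 1" by (simp add: \<kappa> K_def)
  have ke: "0 < \<kappa> * \<epsilon>" "\<kappa> * \<epsilon> < 1" "\<kappa> * \<epsilon> \<le> \<epsilon>"
    using \<epsilon> \<kappa>0 \<kappa>1 mult_strict_mono[of \<kappa> 1 \<epsilon> 1] by auto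
  interpret factor_model N "num_funs p l N" G J \<beta> by (rule factor_model_disorder[OF GJ])
  define \<tau> where "\<tau> = 1 / \<kappa> * ln (1 / (\<kappa> * \<epsilon>))"
  have \<tau>0: "0 \<le> \<tau>" unfolding \<tau>_def using ke \<kappa>0 by (intro mult_nonneg_nonneg ln_ge_zero) auto
  have "correlation_time \<beta> N (num_funs p l N) G J i \<epsilon> \<le> ereal \<tau>"
  proof (rule correlation_time_le[OF \<tau>0])
    fix t assume t: "\<tau> \<le> t"
    have "correlation \<beta> N (num_funs p l N) G J i t \<le> exp (- (1 - K * tanh \<beta>) * t)"
      by (rule correlation_decay) (use \<beta> i t \<tau>0 p l GJ in \<open>auto simp: K_def intro!: sum_shared_le\<close>)
    also have "\<dots> \<le> exp (- \<kappa> * \<tau>)" using t \<kappa>0 by (simp add: \<kappa> K_def)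
    \<comment> \<open>The exponential bound at \<tau> equals \<kappa> \<epsilon>, which is at most
      \<epsilon> because \<kappa> < 1.\<close>
    also have "- \<kappa> * \<tau> = ln (\<kappa> * \<epsilon>)" using \<kappa>0 ke by (simp add: \<tau>_def ln_div)
    also have "exp (ln (\<kappa> * \<epsilon>)) \<le> \<epsilon>" using ke by simp
    finally show "correlation \<beta> N (num_funs p l N) G J i t \<le> \<epsilon>" .
  qed
  then show ?thesis by (simp add: \<tau>_def)
qed

section \<open>Moments over the disorder\<close>

text \<open>Covers k = 0 and k = n as well, with the convention 0^0 = 1.\<close>

lemma exp_entropy:
  assumes "k \<le> n" "0 < n"
  shows "exp (real n * entropy_fun (real k / real n)) = real n ^ n / (real k ^ k * real (n - k) ^ (n - k))"
proof -
  have e: "exp (- (real j * ln (real j / real n))) = real n ^ j / real j ^ j" for j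
  proof (cases "j = 0")
    case False
    have "exp (- (real j * ln (real j / real n))) = exp (ln (real n / real j)) ^ j"
      using False assms by (simp add: exp_of_nat_mult[symmetric] ln_div right_diff_distrib)
    also have "exp (ln (real n / real j)) = real n / real j" using False assms by simp
    finally show ?thesis by (simp add: power_divide)
  qed simp
  have x: "1 - real k / real n = real (n - k) / real n"
    using assms by (simp add: field_simps of_nat_diff)
  have "real n * entropy_fun (real k / real n)
    = - (real k * ln (real k / real n)) + - (real (n - k) * ln (real (n - k) / real n))"
    unfolding entropy_fun_def x using assms by (simp add: field_simps)
  then have "exp (real n * entropy_fun (real k / real n)) = (real n ^ k / real k ^ k) * (real n ^ (n - k) / real (n - k) ^ (n - k))"
    by (simp only: exp_add e)
  also have "\<dots> = real n ^ n / (real k ^ k * real (n - k) ^ (n - k))"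
    using assms by (simp add: power_add[symmetric])
  finally show ?thesis .
qed

text \<open>Up to the factor n^n these are the probabilities of the binomial law with parameter k /
  n. The ratio of consecutive terms shows that they increase up to j = k and decrease
  afterwards.\<close>

lemma binomial_term_max:
  fixes n k :: nat
  assumes k: "k \<le> n"
  defines "T \<equiv> \<lambda>j. (n choose j) * k ^ j * (n - k) ^ (n - j)"
  assumes j: "j \<le> n"
  shows "T j \<le> T k"
proof (cases "k = n")
  case True
  then show ?thesis using j by (cases "j = n") (auto simp: T_def power_0_left)
next
  case False
  then have nk: "0 < n - k" using k by simp
  have step: "T (Suc j) * (Suc j * (n - k)) = T j * ((n - j) * k)" if "j < n" for j
  proof -
    have e1: "Suc j * (n choose Suc j) = (n choose j) * (n - j)"
      using binomial_absorb_comp[of n j] binomial_absorption[of j "n"] that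
      by (metis Suc_times_binomial_eq binomial_absorb_comp mult.commute Suc_diff_1 binomial_absorption diff_Suc_1 less_imp_Suc_add)
    have e2: "(n - k) ^ (n - j) = (n - k) * (n - k) ^ (n - Suc j)"
      using that by (simp add: Suc_diff_Suc flip: power_Suc)
    have "T (Suc j) * (Suc j * (n - k)) = (Suc j * (n choose Suc j)) * (k * k ^ j) * ((n - k) * (n - k) ^ (n - Suc j))"
      unfolding T_def power_Suc by (simp only: mult_ac)
    also have "\<dots> = T j * ((n - j) * k)"
      unfolding T_def e1 e2 by (simp only: mult_ac)
    finally show ?thesis .
  qed
  have up: "T j \<le> T (Suc j)" if "j < k" for j
  proof -
    have "Suc j * (n - k) \<le> (n - j) * k" using that k
      by (metis Suc_leI diff_le_mono2 less_imp_le_nat mult.commute mult_le_mono)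
    then have "T j * (Suc j * (n - k)) \<le> T j * ((n - j) * k)" by simp
    also have "\<dots> = T (Suc j) * (Suc j * (n - k))" using step[of j] that k by simp
    finally show ?thesis using nk by simp
  qed
  have down: "T (Suc j) \<le> T j" if "k \<le> j" "j < n" for j
  proof -
    have "(n - j) * k \<le> Suc j * (n - k)" using that
      by (metis diff_le_mono2 le_SucI mult.commute mult_le_mono)
    then have "T (Suc j) * (Suc j * (n - k)) \<le> T j * (Suc j * (n - k))" using step[OF that(2)] by simp
    then show ?thesis using nk by simp
  qed
  show ?thesis
  proof (cases "j \<le> k")
    case True
    then show ?thesis
    proof (induction j rule: inc_induct)
      case (step m)
      then show ?case using up[of m] by simp
    qed simp
  next
    case False
    then have "k \<le> j" by simp
    then show ?thesis using j
    proof (induction j rule: dec_induct)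
      case (step m)
      then show ?case using down[of m] by simp
    qed simp
  qed
qed

text \<open>The n + 1 terms of the binomial law with parameter k / n sum to n^n and the k-th is the
  largest, so it lies between n^n / (n + 1) and n^n.\<close>

lemma binomial_entropy_bounds:
  assumes k: "k \<le> n" and n: "0 < n"
  shows "real (n choose k) \<le> exp (real n * entropy_fun (real k / real n))"
    and "exp (real n * entropy_fun (real k / real n)) \<le> real (n + 1) * real (n choose k)"
proof -
  let ?T = "\<lambda>j. (n choose j) * k ^ j * (n - k) ^ (n - j)"
  have sm: "(\<Sum>j\<le>n. ?T j) = n ^ n" using binomial[of k "n - k" n] k by simp
  have pos: "0 < real k ^ k * real (n - k) ^ (n - k)"
    by (cases "k = 0"; cases "k = n") (use k in auto)
  have "?T k \<le> (\<Sum>j\<le>n. ?T j)" using k by (intro member_le_sum) auto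
  then have "?T k \<le> n ^ n" using sm by simp
  then have "real (?T k) \<le> real (n ^ n)" by (simp only: of_nat_le_iff)
  then show "real (n choose k) \<le> exp (real n * entropy_fun (real k / real n))"
    unfolding exp_entropy[OF k n] using pos by (simp add: pos_le_divide_eq mult.assoc)
  have "(\<Sum>j\<le>n. ?T j) \<le> (\<Sum>j\<le>n. ?T k)" by (intro sum_mono binomial_term_max k) simp
  then have "n ^ n \<le> (n + 1) * ?T k" using sm by simp
  then have "real (n ^ n) \<le> real ((n + 1) * ?T k)" by (simp only: of_nat_le_iff)
  then show "exp (real n * entropy_fun (real k / real n)) \<le> real (n + 1) * real (n choose k)"
    unfolding exp_entropy[OF k n] using pos by (simp add: pos_divide_le_eq algebra_simps)
qed

section \<open>Uniform sets of sockets and the generating function of a function node\<close>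

text \<open>The image of a fixed set under a uniform permutation is uniform among sets of its size.
  Composing with a permutation that carries S to D shows that the left sum depends on the size only;
  summing over all S of that size then makes each permutation reindex the same family.\<close>

lemma sum_permutes_image:
  fixes F :: "nat set \<Rightarrow> real"
  assumes D: "D \<subseteq> {..<n}"
  shows "(\<Sum>\<pi> | \<pi> permutes {..<n}. F (\<pi> ` D)) * real (n choose card D)
    = fact n * (\<Sum>S | S \<subseteq> {..<n} \<and> card S = card D. F S)"
proof -
  let ?P = "{\<pi>. \<pi> permutes {..<n}}" and ?S = "{S. S \<subseteq> {..<n} \<and> card S = card D}"
  have finD: "finite D" using D finite_subset by blast
  have same: "(\<Sum>\<pi>\<in>?P. F (\<pi> ` S)) = (\<Sum>\<pi>\<in>?P. F (\<pi> ` D))" if S: "S \<in> ?S" for S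
  proof -
    have "card S = card D" "S \<subseteq> {..<n}" using S by auto
    then obtain g where g: "g permutes {..<n}" "g ` S = D"
    proof -
      have fS: "finite S" using S finite_subset by blast
      obtain f where f: "bij_betw f S D"
        using finite_same_card_bij[OF fS finD] S by auto
      have "card ({..<n} - S) = card ({..<n} - D)"
        using S D fS finD by (simp add: card_Diff_subset)
      then obtain f' where f': "bij_betw f' ({..<n} - S) ({..<n} - D)"
        using finite_same_card_bij[of "{..<n} - S" "{..<n} - D"] by auto
      define g where "g x = (if x \<in> {..<n} then (if x \<in> S then f x else f' x) else x)" for x
      have "bij_betw g S D" using f S by (subst bij_betw_cong[of _ _ f]) (auto simp: g_def)
      moreover have "bij_betw g ({..<n} - S) ({..<n} - D)"
        using f' by (subst bij_betw_cong[of _ _ f']) (auto simp: g_def)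
      ultimately have "bij_betw g (S \<union> ({..<n} - S)) (D \<union> ({..<n} - D))"
        by (rule bij_betw_combine) auto
      moreover have "S \<union> ({..<n} - S) = {..<n}" "D \<union> ({..<n} - D) = {..<n}" using S D by auto
      ultimately have "g permutes {..<n}"
        by (intro bij_imp_permutes) (auto simp: g_def)
      moreover have "g ` S = D" using \<open>bij_betw g S D\<close> by (simp add: bij_betw_def)
      ultimately show ?thesis using that by blast
    qed
    have "(\<pi> \<circ> g) ` S = \<pi> ` D" for \<pi> :: "nat \<Rightarrow> nat" by (metis image_comp g(2))
    then have "(\<Sum>\<pi>\<in>?P. F (\<pi> ` D)) = (\<Sum>\<pi>\<in>?P. F ((\<pi> \<circ> g) ` S))" by (simp only:)
    also have "\<dots> = (\<Sum>\<pi>\<in>?P. F (\<pi> ` S))"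
      by (rule sum.reindex_bij_witness[of _ "\<lambda>\<pi>. \<pi> \<circ> inv g" "\<lambda>\<pi>. \<pi> \<circ> g"])
        (use g permutes_inv_o[OF g(1)] in \<open>auto simp: o_assoc[symmetric] intro: permutes_compose permutes_inv\<close>)
    finally show ?thesis by simp
  qed
  have cS: "card ?S = n choose card D" using n_subsets[of "{..<n}" "card D"] by simp
  have "(\<Sum>\<pi>\<in>?P. F (\<pi> ` D)) * real (n choose card D) = (\<Sum>S\<in>?S. \<Sum>\<pi>\<in>?P. F (\<pi> ` S))"
    using same cS by simp
  also have "\<dots> = (\<Sum>\<pi>\<in>?P. \<Sum>S\<in>?S. F (\<pi> ` S))" by (rule sum.swap)
  also have "\<dots> = (\<Sum>\<pi>\<in>?P. \<Sum>S\<in>?S. F S)"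
  proof (rule sum.cong[OF refl])
    fix \<pi> assume "\<pi> \<in> ?P"
    then have \<pi>: "\<pi> permutes {..<n}" by simp
    show "(\<Sum>S\<in>?S. F (\<pi> ` S)) = (\<Sum>S\<in>?S. F S)"
    proof (rule sum.reindex_bij_witness[of _ "\<lambda>S. inv \<pi> ` S" "\<lambda>S. \<pi> ` S"])
      have *: "\<rho> ` S \<in> ?S" if "\<rho> permutes {..<n}" "S \<in> ?S" for \<rho> S
      proof -
        have "card (\<rho> ` S) = card S" using permutes_inj[OF that(1)] by (intro card_image) (auto intro: inj_on_subset)
        moreover have "\<rho> ` S \<subseteq> {..<n}" using that permutes_image[OF that(1)] by (metis (no_types, lifting) image_mono mem_Collect_eq)
        ultimately show ?thesis using that(2) by simp
      qed
      show "\<pi> ` S \<in> ?S" if "S \<in> ?S" for S using *[OF \<pi> that] .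
      show "inv \<pi> ` S \<in> ?S" if "S \<in> ?S" for S using *[OF permutes_inv[OF \<pi>] that] .
      show "inv \<pi> ` \<pi> ` S = S" "\<pi> ` inv \<pi> ` S = S" for S
        using permutes_inverses[OF \<pi>] by (auto simp: image_image)
    qed simp
  qed
  also have "\<dots> = fact n * (\<Sum>S\<in>?S. F S)"
    using card_permutations[of "{..<n}" n] by simp
  finally show ?thesis .
qed

text \<open>The coupling average at a function node when two configurations differ on k of its
  sockets: the two spin products agree for even k, giving cosh (2 \<beta>), and cancel for odd k,
  giving cosh 0 = 1.\<close>

definition parity_weight :: "real \<Rightarrow> nat \<Rightarrow> real" where
  "parity_weight \<beta> k = (if even k then cosh (2 * \<beta>) else 1)"

text \<open>The generating function over subsets of the p sockets of one function node.
  \<open>check_poly_eq\<close> identifies it with cosh (2 \<beta>) p_+ + p_-; the form with positive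
  coefficients is what monotonicity and convexity arguments use.\<close>

definition check_poly :: "nat \<Rightarrow> real \<Rightarrow> real \<Rightarrow> real" where
  "check_poly p \<beta> z = (\<Sum>k\<le>p. real (p choose k) * parity_weight \<beta> k * z ^ k)"

lemma sum_Pow_card:
  assumes "finite A"
  shows "(\<Sum>T\<in>Pow A. g (card T) :: real) = (\<Sum>k\<le>card A. real (card A choose k) * g k)"
proof -
  have "(\<Sum>T\<in>Pow A. g (card T)) = (\<Sum>k\<in>{..card A}. \<Sum>T\<in>{T \<in> Pow A. card T = k}. g (card T))"
    by (rule sum.group[symmetric]) (use assms in \<open>auto intro: card_mono\<close>)
  also have "\<dots> = (\<Sum>k\<le>card A. real (card A choose k) * g k)"
  proof (rule sum.cong[OF refl])
    fix k
    have "{T \<in> Pow A. card T = k} = {T. T \<subseteq> A \<and> card T = k}" by auto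
    then have "card {T \<in> Pow A. card T = k} = card A choose k" using n_subsets[OF assms, of k] by simp
    then show "(\<Sum>T\<in>{T \<in> Pow A. card T = k}. g (card T)) = real (card A choose k) * g k" by simp
  qed
  finally show ?thesis .
qed

text \<open>Function nodes own disjoint blocks of p sockets, so the sum over all socket sets
  factorises over the blocks.\<close>

lemma sum_blocks:
  fixes z :: real
  shows "(\<Sum>S\<in>Pow {..<M * p}. z ^ card S * (\<Prod>a<M. parity_weight \<beta> (card (S \<inter> {a * p..<a * p + p})))) = check_poly p \<beta> z ^ M"
proof (induction M)
  case (Suc M)
  let ?B = "{M * p..<M * p + p}"
  let ?w = "\<lambda>M S. z ^ card S * (\<Prod>a<M. parity_weight \<beta> (card (S \<inter> {a * p..<a * p + p})))"
  have split: "{..<Suc M * p} = {..<M * p} \<union> ?B" by auto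
  have "(\<Sum>S\<in>Pow {..<Suc M * p}. ?w (Suc M) S) = (\<Sum>(S, T)\<in>Pow {..<M * p} \<times> Pow ?B. ?w (Suc M) (S \<union> T))"
    unfolding split
    by (rule sum.reindex_bij_witness[of _ "\<lambda>(S, T). S \<union> T" "\<lambda>S. (S \<inter> {..<M * p}, S \<inter> ?B)"])
      (auto simp: Int_Un_distrib[symmetric] Int_absorb2)
  also have "\<dots> = (\<Sum>(S, T)\<in>Pow {..<M * p} \<times> Pow ?B. ?w M S * (z ^ card T * parity_weight \<beta> (card T)))"
  proof (rule sum.cong[OF refl], clarify)
    fix S T assume S: "S \<subseteq> {..<M * p}" and T: "T \<subseteq> ?B"
    have fin: "finite S" "finite T" using S T finite_subset by blast+
    have "S \<inter> T = {}" using S T by (auto simp: subset_iff) (meson not_le)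
    then have "card (S \<union> T) = card S + card T" using fin by (simp add: card_Un_disjoint)
    moreover have "(S \<union> T) \<inter> {a * p..<a * p + p} = S \<inter> {a * p..<a * p + p}" if "a < M" for a
    proof -
      have "a * p + p \<le> M * p" using that by (metis Suc_leI add.commute mult_Suc mult_le_mono1)
      then show ?thesis using T by fastforce
    qed
    moreover have "(S \<union> T) \<inter> ?B = T" using S T by fastforce
    ultimately show "?w (Suc M) (S \<union> T) = ?w M S * (z ^ card T * parity_weight \<beta> (card T))"
      by (simp add: power_add)
  qed
  also have "\<dots> = (\<Sum>S\<in>Pow {..<M * p}. ?w M S) * (\<Sum>T\<in>Pow ?B. z ^ card T * parity_weight \<beta> (card T))"
    by (simp add: sum_product sum.cartesian_product)
  also have "(\<Sum>T\<in>Pow ?B. z ^ card T * parity_weight \<beta> (card T)) = check_poly p \<beta> z"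
    by (subst sum_Pow_card) (auto simp: check_poly_def mult_ac)
  finally show ?case by (simp add: Suc mult.commute)
qed simp

text \<open>A coefficient of a polynomial with nonnegative coefficients is at most its value at z
  divided by z^m. The free z is later chosen as the saddle point.\<close>

lemma sum_blocks_card_le:
  fixes z :: real
  assumes z: "0 < z"
  shows "(\<Sum>S | S \<subseteq> {..<M * p} \<and> card S = m. \<Prod>a<M. parity_weight \<beta> (card (S \<inter> {a * p..<a * p + p})))
    \<le> check_poly p \<beta> z ^ M / z ^ m"
proof -
  let ?W = "\<lambda>S. \<Prod>a<M. parity_weight \<beta> (card (S \<inter> {a * p..<a * p + p}))"
  have W: "0 \<le> ?W S" for S
    by (intro prod_nonneg) (auto simp: parity_weight_def intro: less_imp_le cosh_real_pos)
  have "z ^ m * (\<Sum>S | S \<subseteq> {..<M * p} \<and> card S = m. ?W S) = (\<Sum>S | S \<subseteq> {..<M * p} \<and> card S = m. z ^ card S * ?W S)"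
    by (simp add: sum_distrib_left)
  also have "\<dots> \<le> (\<Sum>S\<in>Pow {..<M * p}. z ^ card S * ?W S)"
    using z W by (intro sum_mono2) auto
  also have "\<dots> = check_poly p \<beta> z ^ M" by (rule sum_blocks)
  finally show ?thesis using z by (simp add: pos_le_divide_eq mult.commute)
qed

section \<open>Averages over the couplings\<close>

text \<open>Since even powers of a sign are 1, keeping exactly the edges of odd multiplicity makes
  the product over neighbours equal to the product over sockets. Multiple edges thereby disappear
  from the moment computations.\<close>

lemma prod_fun_nbrs:
  fixes \<xi> :: "nat \<Rightarrow> real"
  assumes a: "a < num_funs p l N" and \<xi>: "\<And>i. i < N \<Longrightarrow> \<xi> i = 1 \<or> \<xi> i = -1"
  shows "(\<Prod>i\<in>fun_nbrs (config_graph p l N \<pi>) a. \<xi> i) = (\<Prod>s\<in>{s \<in> {..<N * l}. \<pi> s div p = a}. \<xi> (s div l))"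
proof -
  let ?S = "{s \<in> {..<N * l}. \<pi> s div p = a}"
  have "(\<Prod>s\<in>?S. \<xi> (s div l)) = (\<Prod>i<N. \<Prod>s\<in>{s \<in> ?S. s div l = i}. \<xi> (s div l))"
    by (rule prod.group[symmetric]) (auto simp: less_mult_imp_div_less)
  also have "\<dots> = (\<Prod>i<N. if odd (edge_multiplicity p l N \<pi> i a) then \<xi> i else 1)"
  proof (rule prod.cong[OF refl])
    fix i assume "i \<in> {..<N}"
    have "{s \<in> ?S. s div l = i} = {s \<in> {..<N * l}. s div l = i \<and> \<pi> s div p = a}" by auto
    then have "(\<Prod>s\<in>{s \<in> ?S. s div l = i}. \<xi> (s div l)) = \<xi> i ^ edge_multiplicity p l N \<pi> i a"
      by (simp add: edge_multiplicity_def)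
    then show "(\<Prod>s\<in>{s \<in> ?S. s div l = i}. \<xi> (s div l)) = (if odd (edge_multiplicity p l N \<pi> i a) then \<xi> i else 1)"
      using \<xi>[of i] \<open>i \<in> {..<N}\<close> by auto
  qed
  also have "\<dots> = (\<Prod>i\<in>fun_nbrs (config_graph p l N \<pi>) a. \<xi> i)"
  proof -
    have "fun_nbrs (config_graph p l N \<pi>) a = {i \<in> {..<N}. odd (edge_multiplicity p l N \<pi> i a)}"
      using a by (auto simp: fun_nbrs_def config_graph_def)
    then show ?thesis by (simp add: prod.If_cases Int_def)
  qed
  finally show ?thesis by simp
qed

lemma finite_set_couplings: "finite (set_pmf (couplings_pmf M))"
proof -
  have "set_pmf (couplings_pmf M) = PiE_dflt {..<M} 0 (\<lambda>_. {-1, 1})"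
    by (simp add: couplings_pmf_def set_Pi_pmf)
  then show ?thesis by (auto intro: finite_PiE_dflt)
qed

lemma integrable_couplings [simp, intro]:
  fixes f :: "(nat \<Rightarrow> real) \<Rightarrow> real"
  shows "integrable (measure_pmf (couplings_pmf M)) f"
  by (rule integrable_measure_pmf_finite[OF finite_set_couplings])

lemma expectation_couplings_prod:
  fixes c :: "nat \<Rightarrow> real"
  shows "measure_pmf.expectation (couplings_pmf M) (\<lambda>J. \<Prod>a<M. exp (J a * c a)) = (\<Prod>a<M. cosh (c a))"
proof -
  have "measure_pmf.expectation (couplings_pmf M) (\<lambda>J. \<Prod>a<M. exp (J a * c a))
    = (\<Prod>a<M. measure_pmf.expectation (pmf_of_set {-1, 1}) (\<lambda>v. exp (v * c a)))"
    unfolding couplings_pmf_def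
    by (rule expectation_prod_Pi_pmf) (auto intro: integrable_measure_pmf_finite)
  also have "\<dots> = (\<Prod>a<M. cosh (c a))"
    by (intro prod.cong refl) (simp add: integral_pmf_of_set cosh_def)
  finally show ?thesis .
qed

lemma exp_energy: "exp (- \<beta> * energy M G J \<sigma>) = (\<Prod>a<M. exp (J a * (\<beta> * (\<Prod>i\<in>fun_nbrs G a. \<sigma> i))))"
proof -
  have "- \<beta> * energy M G J \<sigma> = \<beta> * (\<Sum>a<M. J a * (\<Prod>i\<in>fun_nbrs G a. \<sigma> i))"
    by (simp add: energy_def)
  also have "\<dots> = (\<Sum>a<M. J a * (\<beta> * (\<Prod>i\<in>fun_nbrs G a. \<sigma> i)))"
    by (simp add: sum_distrib_left mult.left_commute)
  finally have "- \<beta> * energy M G J \<sigma> = (\<Sum>a<M. J a * (\<beta> * (\<Prod>i\<in>fun_nbrs G a. \<sigma> i)))" .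
  then show ?thesis by (simp only: exp_sum finite_lessThan)
qed

lemma abs_eq_1_prod:
  fixes f :: "'a \<Rightarrow> real"
  assumes "\<And>i. i \<in> A \<Longrightarrow> f i = 1 \<or> f i = -1"
  shows "prod f A = 1 \<or> prod f A = -1"
  using assms
proof (induction A rule: infinite_finite_induct)
  case (insert x F)
  then have "f x = 1 \<or> f x = -1" "prod f F = 1 \<or> prod f F = -1" by auto
  then show ?case using insert.hyps by auto
qed auto

lemma fun_nbrs_prod_sign:
  assumes "\<sigma> \<in> configs N"
  shows "(\<Prod>i\<in>fun_nbrs (config_graph p l N \<pi>) a. \<sigma> i) = 1 \<or> (\<Prod>i\<in>fun_nbrs (config_graph p l N \<pi>) a. \<sigma> i) = -1"
  by (rule abs_eq_1_prod) (use configs_val[OF assms] in \<open>auto simp: fun_nbrs_def config_graph_def\<close>)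

lemma expectation_weight:
  assumes "\<sigma> \<in> configs N"
  shows "measure_pmf.expectation (couplings_pmf M) (\<lambda>J. exp (- \<beta> * energy M (config_graph p l N \<pi>) J \<sigma>)) = cosh \<beta> ^ M"
proof -
  have "cosh (\<beta> * (\<Prod>i\<in>fun_nbrs (config_graph p l N \<pi>) a. \<sigma> i)) = cosh \<beta>" for a
    using fun_nbrs_prod_sign[OF assms, of p l \<pi> a] by auto
  then show ?thesis by (simp only: exp_energy expectation_couplings_prod) simp
qed

definition sockets_disagree :: "nat \<Rightarrow> nat \<Rightarrow> config \<Rightarrow> config \<Rightarrow> nat set" where
  "sockets_disagree l N \<sigma> \<tau> = {s \<in> {..<N * l}. \<sigma> (s div l) \<noteq> \<tau> (s div l)}"

lemma disagree_configs:
  assumes "\<tau> \<in> configs N"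
  shows "factor_model.disagree N \<sigma> \<tau> = card {i. i < N \<and> \<sigma> i \<noteq> \<tau> i}"
proof -
  interpret factor_model N 0 "{}" "\<lambda>_. 1" 0 by standard auto
  have "{i. i < N \<and> \<sigma> i \<noteq> spin_sign i \<tau>} = {i. i < N \<and> \<sigma> i \<noteq> \<tau> i}" using spin_sign_configs[OF assms] by auto
  then show ?thesis by (simp add: disagree_def)
qed

lemma card_sockets_disagree:
  assumes l: "0 < l" and \<tau>: "\<tau> \<in> configs N"
  shows "card (sockets_disagree l N \<sigma> \<tau>) = l * factor_model.disagree N \<sigma> \<tau>"
proof -
  let ?B = "{i. i < N \<and> \<sigma> i \<noteq> \<tau> i}"
  have eq: "sockets_disagree l N \<sigma> \<tau> = (\<Union>i\<in>?B. {s. s div l = i})"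
    using l by (auto simp: sockets_disagree_def less_mult_imp_div_less)
      (metis div_less_iff_less_mult)
  have "card (\<Union>i\<in>?B. {s :: nat. s div l = i}) = (\<Sum>i\<in>?B. card {s :: nat. s div l = i})"
    by (rule card_UN_disjoint) (use card_div_fibre[OF l] in auto)
  then show ?thesis
    using card_div_fibre[OF l] by (simp add: eq disagree_configs[OF \<tau>])
qed

text \<open>Each socket of a on which the two configurations differ contributes one factor
  -1.\<close>

lemma sign_product_eq:
  assumes a: "a < num_funs p l N" and p: "0 < p" and \<sigma>: "\<sigma> \<in> configs N" and \<tau>: "\<tau> \<in> configs N"
    and \<pi>: "\<pi> permutes {..<N * l}"
  shows "(\<Prod>i\<in>fun_nbrs (config_graph p l N \<pi>) a. \<sigma> i) * (\<Prod>i\<in>fun_nbrs (config_graph p l N \<pi>) a. \<tau> i)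
    = (if even (card (\<pi> ` sockets_disagree l N \<sigma> \<tau> \<inter> {a * p..<a * p + p})) then 1 else -1)"
proof -
  let ?S = "{s \<in> {..<N * l}. \<pi> s div p = a}" and ?D = "sockets_disagree l N \<sigma> \<tau>"
  have "(\<Prod>i\<in>fun_nbrs (config_graph p l N \<pi>) a. \<sigma> i) * (\<Prod>i\<in>fun_nbrs (config_graph p l N \<pi>) a. \<tau> i)
    = (\<Prod>i\<in>fun_nbrs (config_graph p l N \<pi>) a. \<sigma> i * \<tau> i)" by (simp add: prod.distrib)
  also have "\<dots> = (\<Prod>s\<in>?S. \<sigma> (s div l) * \<tau> (s div l))"
    by (rule prod_fun_nbrs[OF a]) (use configs_val[OF \<sigma>] configs_val[OF \<tau>] in fastforce)
  also have "\<dots> = (\<Prod>s\<in>?S. if s \<in> ?D then -1 else 1)"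
  proof (rule prod.cong[OF refl])
    fix s assume "s \<in> ?S"
    then have s: "s < N * l" "s div l < N" by (auto simp: less_mult_imp_div_less)
    then show "\<sigma> (s div l) * \<tau> (s div l) = (if s \<in> ?D then -1 else 1)"
      using configs_val[OF \<sigma> s(2)] configs_val[OF \<tau> s(2)] by (auto simp: sockets_disagree_def)
  qed
  also have "\<dots> = (-1) ^ card (?S \<inter> ?D)" by (simp add: prod.If_cases)
  also have "card (?S \<inter> ?D) = card (\<pi> ` ?D \<inter> {a * p..<a * p + p})"
  proof -
    have "\<pi> ` ?D \<inter> {a * p..<a * p + p} = \<pi> ` (?S \<inter> ?D)"
      unfolding div_fibre[OF p, symmetric] by (auto simp: sockets_disagree_def)
    moreover have "card (\<pi> ` (?S \<inter> ?D)) = card (?S \<inter> ?D)"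
      using permutes_inj[OF \<pi>] by (intro card_image) (auto intro: inj_on_subset)
    ultimately show ?thesis by simp
  qed
  finally show ?thesis by (simp add: minus_one_power_iff)
qed

lemma expectation_weight_pair:
  assumes p: "0 < p" and \<sigma>: "\<sigma> \<in> configs N" and \<tau>: "\<tau> \<in> configs N" and \<pi>: "\<pi> permutes {..<N * l}"
    and M: "M = num_funs p l N"
  shows "measure_pmf.expectation (couplings_pmf M)
      (\<lambda>J. exp (- \<beta> * energy M (config_graph p l N \<pi>) J \<sigma>) * exp (- \<beta> * energy M (config_graph p l N \<pi>) J \<tau>))
    = (\<Prod>a<M. parity_weight \<beta> (card (\<pi> ` sockets_disagree l N \<sigma> \<tau> \<inter> {a * p..<a * p + p})))"
proof -
  let ?G = "config_graph p l N \<pi>"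
  let ?s = "\<lambda>\<sigma> a. \<Prod>i\<in>fun_nbrs ?G a. \<sigma> i"
  have "measure_pmf.expectation (couplings_pmf M) (\<lambda>J. exp (- \<beta> * energy M ?G J \<sigma>) * exp (- \<beta> * energy M ?G J \<tau>))
    = measure_pmf.expectation (couplings_pmf M) (\<lambda>J. \<Prod>a<M. exp (J a * (\<beta> * (?s \<sigma> a + ?s \<tau> a))))"
    by (simp only: exp_energy prod.distrib[symmetric] exp_add[symmetric] distrib_left)
  also have "\<dots> = (\<Prod>a<M. cosh (\<beta> * (?s \<sigma> a + ?s \<tau> a)))" by (rule expectation_couplings_prod)
  also have "\<dots> = (\<Prod>a<M. parity_weight \<beta> (card (\<pi> ` sockets_disagree l N \<sigma> \<tau> \<inter> {a * p..<a * p + p})))"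
  proof (rule prod.cong[OF refl])
    fix a assume "a \<in> {..<M}"
    then have a: "a < num_funs p l N" using M by simp
    show "cosh (\<beta> * (?s \<sigma> a + ?s \<tau> a)) = parity_weight \<beta> (card (\<pi> ` sockets_disagree l N \<sigma> \<tau> \<inter> {a * p..<a * p + p}))"
      using sign_product_eq[OF a p \<sigma> \<tau> \<pi>] fun_nbrs_prod_sign[OF \<sigma>, of p l \<pi> a] fun_nbrs_prod_sign[OF \<tau>, of p l \<pi> a]
      by (auto simp: parity_weight_def mult.commute split: if_splits)
  qed
  finally show ?thesis .
qed

section \<open>Averages over graph and couplings\<close>

definition graph_mean :: "nat \<Rightarrow> nat \<Rightarrow> nat \<Rightarrow> (factor_graph \<Rightarrow> (nat \<Rightarrow> real) \<Rightarrow> real) \<Rightarrow> real" where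
  "graph_mean p l N f = measure_pmf.expectation (disorder_pmf p l N) (\<lambda>(G, J). f G J)"

lemma finite_set_disorder: "finite (set_pmf (disorder_pmf p l N))"
proof -
  have "finite {\<pi>. \<pi> permutes {..<N * l}}" by (rule finite_permutations) simp
  moreover have "{\<pi>. \<pi> permutes {..<N * l}} \<noteq> {}" using permutes_id by blast
  ultimately show ?thesis
    using finite_set_couplings by (simp add: disorder_pmf_def graph_pmf_def)
qed

lemma graph_mean_eq:
  "graph_mean p l N f = (\<Sum>\<pi> | \<pi> permutes {..<N * l}.
      measure_pmf.expectation (couplings_pmf (num_funs p l N)) (\<lambda>J. f (config_graph p l N \<pi>) J)) / fact (N * l)"
proof -
  let ?P = "{\<pi>. \<pi> permutes {..<N * l}}"
  have fin: "finite ?P" by (rule finite_permutations) simp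
  have ne: "?P \<noteq> {}" using permutes_id by blast
  have "disorder_pmf p l N = bind_pmf (pmf_of_set ?P) (\<lambda>\<pi>. map_pmf (Pair (config_graph p l N \<pi>)) (couplings_pmf (num_funs p l N)))"
    unfolding disorder_pmf_def graph_pmf_def pair_pmf_def
    by (simp add: map_pmf_def bind_assoc_pmf bind_return_pmf)
  then have "graph_mean p l N f = (\<Sum>\<pi>\<in>?P. pmf (pmf_of_set ?P) \<pi> *\<^sub>R
      measure_pmf.expectation (map_pmf (Pair (config_graph p l N \<pi>)) (couplings_pmf (num_funs p l N))) (\<lambda>(G, J). f G J))"
    unfolding graph_mean_def
    by (simp only:) (rule pmf_expectation_bind, use fin ne finite_set_couplings in auto)
  also have "\<dots> = (\<Sum>\<pi>\<in>?P. measure_pmf.expectation (couplings_pmf (num_funs p l N)) (\<lambda>J. f (config_graph p l N \<pi>) J) / fact (N * l))"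
    using fin ne card_permutations[of "{..<N * l}" "N * l"] by (intro sum.cong refl) simp
  finally show ?thesis by (simp add: sum_divide_distrib)
qed

lemma integrable_disorder [simp, intro]:
  fixes f :: "factor_graph \<times> (nat \<Rightarrow> real) \<Rightarrow> real"
  shows "integrable (measure_pmf (disorder_pmf p l N)) f"
  by (rule integrable_measure_pmf_finite[OF finite_set_disorder])

lemma graph_mean_sum: "graph_mean p l N (\<lambda>G J. \<Sum>x\<in>A. f x G J) = (\<Sum>x\<in>A. graph_mean p l N (f x))"
  unfolding graph_mean_def case_prod_unfold by (rule Bochner_Integration.integral_sum) auto

text \<open>At a fixed matching, averaging over the couplings leaves a product over blocks that
  depends only on the image of the disagreeing sockets. That image is a uniform set of size l times
  the distance, so the average is a coefficient of the generating function divided by a binomial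
  coefficient.\<close>

lemma graph_mean_pair_le:
  assumes p: "0 < p" and l: "0 < l" and dv: "p dvd N * l" and \<sigma>: "\<sigma> \<in> configs N" and \<tau>: "\<tau> \<in> configs N" and z: "0 < z"
    and M: "M = num_funs p l N"
  shows "graph_mean p l N (\<lambda>G J. exp (- \<beta> * energy M G J \<sigma>) * exp (- \<beta> * energy M G J \<tau>))
    \<le> check_poly p \<beta> z ^ M / z ^ (l * factor_model.disagree N \<sigma> \<tau>) / real (N * l choose (l * factor_model.disagree N \<sigma> \<tau>))"
proof -
  let ?D = "sockets_disagree l N \<sigma> \<tau>" and ?k = "l * factor_model.disagree N \<sigma> \<tau>"
  let ?F = "\<lambda>S. \<Prod>a<M. parity_weight \<beta> (card (S \<inter> {a * p..<a * p + p}))"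
  have card: "card ?D = ?k" by (rule card_sockets_disagree[OF l \<tau>])
  have D: "?D \<subseteq> {..<N * l}" by (auto simp: sockets_disagree_def)
  have Mp: "M * p = N * l" using num_funs_mult[OF dv] M by simp
  have "card ?D \<le> N * l" using card_mono[OF _ D] by simp
  then have ch: "0 < real (N * l choose ?k)" using card by (simp add: zero_less_binomial)
  have "graph_mean p l N (\<lambda>G J. exp (- \<beta> * energy M G J \<sigma>) * exp (- \<beta> * energy M G J \<tau>))
    = (\<Sum>\<pi> | \<pi> permutes {..<N * l}. ?F (\<pi> ` ?D)) / fact (N * l)"
    unfolding graph_mean_eq M[symmetric]
    by (intro arg_cong2[where f = "(/)"] sum.cong refl expectation_weight_pair[OF p \<sigma> \<tau> _ M]) simp
  also have "\<dots> = (\<Sum>S | S \<subseteq> {..<N * l} \<and> card S = ?k. ?F S) / real (N * l choose ?k)"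
  proof -
    have gen: "A / f = B / c" if "A * c = f * B" "c \<noteq> 0" "f \<noteq> 0" for A B c f :: real
      using that by (simp add: field_simps)
    show ?thesis
      by (rule gen[OF sum_permutes_image[OF D, of ?F, unfolded card] less_imp_neq[OF ch, symmetric] fact_nonzero])
  qed
  also have "\<dots> \<le> (check_poly p \<beta> z ^ M / z ^ ?k) / real (N * l choose ?k)"
    using sum_blocks_card_le[OF z, where M = M and p = p and m = ?k and \<beta> = \<beta>] ch Mp by (intro divide_right_mono) auto
  finally show ?thesis .
qed

text \<open>A bound without saddle point, as each parity weight is at most cosh (2 \<beta>). It
  serves the extreme distances 0 and N, where the optimal z would be 0 or infinite.\<close>

lemma graph_mean_pair_le':
  assumes p: "0 < p" and \<sigma>: "\<sigma> \<in> configs N" and \<tau>: "\<tau> \<in> configs N" and M: "M = num_funs p l N"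
  shows "graph_mean p l N (\<lambda>G J. exp (- \<beta> * energy M G J \<sigma>) * exp (- \<beta> * energy M G J \<tau>)) \<le> cosh (2 * \<beta>) ^ M"
proof -
  have le: "(\<Prod>a<M. parity_weight \<beta> (g a)) \<le> cosh (2 * \<beta>) ^ M" for g
  proof -
    have "(\<Prod>a<M. parity_weight \<beta> (g a)) \<le> (\<Prod>a<M. cosh (2 * \<beta>))"
      by (intro prod_mono) (auto simp: parity_weight_def cosh_real_ge_1 less_imp_le)
    then show ?thesis by simp
  qed
  have "graph_mean p l N (\<lambda>G J. exp (- \<beta> * energy M G J \<sigma>) * exp (- \<beta> * energy M G J \<tau>))
    \<le> (\<Sum>\<pi> | \<pi> permutes {..<N * l}. cosh (2 * \<beta>) ^ M) / fact (N * l)"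
    unfolding graph_mean_eq M[symmetric]
    by (intro divide_right_mono sum_mono) (auto simp only: mem_Collect_eq expectation_weight_pair[OF p \<sigma> \<tau> _ M] intro!: le, simp)
  also have "\<dots> = cosh (2 * \<beta>) ^ M" using card_permutations[of "{..<N * l}" "N * l"] by simp
  finally show ?thesis .
qed

lemma card_configs: "card (configs N) = 2 ^ N"
  by (simp add: configs_def card_PiE numeral_2_eq_2)

lemma card_disagree_le:
  assumes "\<sigma> \<in> configs N"
  shows "card {\<tau> \<in> configs N. factor_model.disagree N \<sigma> \<tau> = k} \<le> N choose k"
proof -
  let ?f = "\<lambda>\<tau>. {i. i < N \<and> \<sigma> i \<noteq> \<tau> i}"
  have "inj_on ?f {\<tau> \<in> configs N. factor_model.disagree N \<sigma> \<tau> = k}"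
  proof (rule inj_onI)
    fix \<tau> \<tau>' assume a: "\<tau> \<in> {\<tau> \<in> configs N. factor_model.disagree N \<sigma> \<tau> = k}"
      "\<tau>' \<in> {\<tau> \<in> configs N. factor_model.disagree N \<sigma> \<tau> = k}" "?f \<tau> = ?f \<tau>'"
    show "\<tau> = \<tau>'"
    proof
      fix i show "\<tau> i = \<tau>' i"
      proof (cases "i < N")
        case True
        then have "\<sigma> i \<noteq> \<tau> i \<longleftrightarrow> \<sigma> i \<noteq> \<tau>' i" using a(3) by auto
        then show ?thesis
          using configs_val[OF assms True] configs_val[of \<tau> N i] configs_val[of \<tau>' N i] True a(1,2) by auto
      next
        case False
        then show ?thesis using a(1,2) by (auto simp: configs_def PiE_def extensional_def)
      qed
    qed
  qed
  then have "card {\<tau> \<in> configs N. factor_model.disagree N \<sigma> \<tau> = k} = card (?f ` {\<tau> \<in> configs N. factor_model.disagree N \<sigma> \<tau> = k})"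
    by (rule card_image[symmetric])
  also have "\<dots> \<le> card {B. B \<subseteq> {..<N} \<and> card B = k}"
    by (intro card_mono) (auto simp: disagree_configs)
  also have "\<dots> = N choose k" using n_subsets[of "{..<N}" k] by simp
  finally show ?thesis .
qed

definition pair_sum :: "nat \<Rightarrow> nat \<Rightarrow> real \<Rightarrow> nat \<Rightarrow> factor_graph \<Rightarrow> (nat \<Rightarrow> real) \<Rightarrow> real" where
  "pair_sum N M \<beta> k G J = (\<Sum>\<sigma>\<in>configs N. \<Sum>\<tau> | \<tau> \<in> configs N \<and> factor_model.disagree N \<sigma> \<tau> = k.
      exp (- \<beta> * energy M G J \<sigma>) * exp (- \<beta> * energy M G J \<tau>))"

text \<open>The exponent \<phi>(q; \<beta>) with x = (1 - q) / 2 and an arbitrary trial value z in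
  place of the optimal one.\<close>

definition pair_exponent :: "nat \<Rightarrow> nat \<Rightarrow> real \<Rightarrow> real \<Rightarrow> real \<Rightarrow> real" where
  "pair_exponent p l \<beta> x z = ln 2 - (real l - 1) * entropy_fun x + real l / real p * ln (check_poly p \<beta> z) - real l * x * ln z"

lemma check_poly_pos:
  assumes "0 < z"
  shows "0 < check_poly p \<beta> z"
proof -
  have "0 < (\<Sum>k\<in>{..p}. real (p choose k) * parity_weight \<beta> k * z ^ k)"
  proof (rule sum_pos)
    fix k assume "k \<in> {..p}"
    then show "0 < real (p choose k) * parity_weight \<beta> k * z ^ k"
      using assms by (auto simp: parity_weight_def zero_less_binomial intro!: mult_pos_pos cosh_real_pos)
  qed auto
  then show ?thesis by (simp add: check_poly_def)
qed

text \<open>There are 2^N starting points and at most N choose k partners, and the pair weight is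
  divided by N l choose l k. The entropies combine to - (l - 1) h, and the polynomial factor comes
  from the lower bound on the last binomial coefficient.\<close>

lemma graph_mean_pair_sum_le:
  assumes p: "0 < p" and l: "0 < l" and dv: "p dvd N * l" and z: "0 < z" and k: "k \<le> N" and N: "0 < N"
    and M: "M = num_funs p l N"
  shows "graph_mean p l N (pair_sum N M \<beta> k) \<le> real (N * l + 1) * exp (real N * pair_exponent p l \<beta> (real k / real N) z)"
proof -
  let ?w = "\<lambda>\<sigma> G J. exp (- \<beta> * energy M G J \<sigma>)" and ?f = "check_poly p \<beta> z" and ?h = "entropy_fun (real k / real N)"
  have f: "0 < ?f" by (rule check_poly_pos[OF z])
  have Mp: "M * p = N * l" using num_funs_mult[OF dv] M by simp
  let ?b = "?f ^ M / z ^ (l * k) / real (N * l choose (l * k))"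
  have b0: "0 \<le> ?b" using f z by simp
  have "graph_mean p l N (pair_sum N M \<beta> k)
    = (\<Sum>\<sigma>\<in>configs N. \<Sum>\<tau> | \<tau> \<in> configs N \<and> factor_model.disagree N \<sigma> \<tau> = k. graph_mean p l N (\<lambda>G J. ?w \<sigma> G J * ?w \<tau> G J))"
    unfolding pair_sum_def by (simp only: graph_mean_sum)
  also have "\<dots> \<le> (\<Sum>\<sigma>\<in>configs N. \<Sum>\<tau> | \<tau> \<in> configs N \<and> factor_model.disagree N \<sigma> \<tau> = k. ?b)"
    by (intro sum_mono) (use graph_mean_pair_le[OF p l dv _ _ z M] in fastforce)
  also have "\<dots> \<le> (\<Sum>\<sigma>\<in>configs N. real (N choose k) * ?b)"
  proof (intro sum_mono)
    fix \<sigma> assume "\<sigma> \<in> configs N"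
    then have "real (card {\<tau> \<in> configs N. factor_model.disagree N \<sigma> \<tau> = k}) * ?b \<le> real (N choose k) * ?b"
      by (intro mult_right_mono b0) (simp add: card_disagree_le)
    then show "(\<Sum>\<tau> | \<tau> \<in> configs N \<and> factor_model.disagree N \<sigma> \<tau> = k. ?b) \<le> real (N choose k) * ?b"
      by (simp only: sum_constant)
  qed
  also have "\<dots> = 2 ^ N * real (N choose k) * ?b" by (simp add: card_configs)
  also have "\<dots> \<le> exp (real N * ln 2) * exp (real N * ?h) *
      (real (N * l + 1) * exp (real N * (real l / real p * ln ?f) - real N * (real l * (real k / real N) * ln z) - real (N * l) * ?h))"
  proof (intro mult_mono)
    show "(2 :: real) ^ N \<le> exp (real N * ln 2)" by (simp add: exp_of_nat_mult)
    show "real (N choose k) \<le> exp (real N * ?h)" by (rule binomial_entropy_bounds(1)[OF k N])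
    have "exp (real (N * l) * entropy_fun (real (l * k) / real (N * l))) \<le> real (N * l + 1) * real (N * l choose (l * k))"
      by (rule binomial_entropy_bounds(2)) (use k l N in \<open>auto simp: mult.commute\<close>)
    moreover have "real (l * k) / real (N * l) = real k / real N" using l by simp
    ultimately have ch: "exp (real (N * l) * ?h) \<le> real (N * l + 1) * real (N * l choose (l * k))" by simp
    have "l * k \<le> N * l" using k by simp
    then have chp: "0 < real (N * l choose (l * k))" by (simp add: zero_less_binomial)
    have inv: "1 / real (N * l choose (l * k)) \<le> real (N * l + 1) * exp (- (real (N * l) * ?h))"
      using ch chp by (simp add: exp_minus field_simps)
    have e1: "?f ^ M = exp (real N * (real l / real p * ln ?f))"
    proof -
      have "real M * real p = real N * real l" using Mp by (metis of_nat_mult)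
      then have "real N * (real l / real p * ln ?f) = real M * ln ?f" using p by (simp add: field_simps)
      then show ?thesis using f by (simp add: exp_of_nat_mult)
    qed
    have e2: "z ^ (l * k) = exp (real N * (real l * (real k / real N) * ln z))"
    proof -
      have "real N * (real l * (real k / real N) * ln z) = real (l * k) * ln z" using N by simp
      then show ?thesis using z by (simp only: exp_of_nat_mult exp_ln)
    qed
    have "?b = (?f ^ M / z ^ (l * k)) * (1 / real (N * l choose (l * k)))" by simp
    also have "\<dots> \<le> (?f ^ M / z ^ (l * k)) * (real (N * l + 1) * exp (- (real (N * l) * ?h)))"
      using f z by (intro mult_left_mono inv) auto
    also have "\<dots> = real (N * l + 1) * (exp (real N * (real l / real p * ln ?f)) * exp (- (real N * (real l * (real k / real N) * ln z))) * exp (- (real (N * l) * ?h)))"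
      unfolding e1 e2 by (simp only: exp_minus divide_inverse mult_ac)
    also have "\<dots> = real (N * l + 1) * exp (real N * (real l / real p * ln ?f) - real N * (real l * (real k / real N) * ln z) - real (N * l) * ?h)"
      by (simp only: mult_exp_exp diff_conv_add_uminus)
    finally show "?b \<le> real (N * l + 1) * exp (real N * (real l / real p * ln ?f) - real N * (real l * (real k / real N) * ln z) - real (N * l) * ?h)" .
  qed (use b0 in auto)
  also have "\<dots> = real (N * l + 1) * (exp (real N * ln 2) * exp (real N * ?h) *
      exp (real N * (real l / real p * ln ?f) - real N * (real l * (real k / real N) * ln z) - real (N * l) * ?h))"
    by (simp only: mult_ac)
  also have "\<dots> = real (N * l + 1) * exp (real N * pair_exponent p l \<beta> (real k / real N) z)"
    unfolding mult_exp_exp by (simp add: pair_exponent_def algebra_simps)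
  finally show ?thesis .
qed

lemma exp_phi:
  assumes p: "0 < p" and dv: "p dvd N * l" and M: "M = num_funs p l N"
  shows "exp (real N * phi p l \<beta>) = 2 ^ N * cosh \<beta> ^ M"
proof -
  have "real M * real p = real N * real l" using num_funs_mult[OF dv] M by (metis of_nat_mult)
  then have "real N * phi p l \<beta> = real N * ln 2 + real M * ln (cosh \<beta>)"
    using p by (simp add: phi_def field_simps)
  then show ?thesis by (simp add: exp_add exp_of_nat_mult cosh_real_pos)
qed

lemma graph_mean_pair_sum_le':
  assumes p: "0 < p" and dv: "p dvd N * l" and M: "M = num_funs p l N" and k: "k = 0 \<or> k = N"
  shows "graph_mean p l N (pair_sum N M \<beta> k) \<le> exp (real N * phi p l (2 * \<beta>))"
proof -
  let ?w = "\<lambda>\<sigma> G J. exp (- \<beta> * energy M G J \<sigma>)"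
  have "graph_mean p l N (pair_sum N M \<beta> k)
    = (\<Sum>\<sigma>\<in>configs N. \<Sum>\<tau> | \<tau> \<in> configs N \<and> factor_model.disagree N \<sigma> \<tau> = k. graph_mean p l N (\<lambda>G J. ?w \<sigma> G J * ?w \<tau> G J))"
    unfolding pair_sum_def by (simp only: graph_mean_sum)
  also have "\<dots> \<le> (\<Sum>\<sigma>\<in>configs N. \<Sum>\<tau> | \<tau> \<in> configs N \<and> factor_model.disagree N \<sigma> \<tau> = k. cosh (2 * \<beta>) ^ M)"
    by (intro sum_mono graph_mean_pair_le'[OF p _ _ M]) auto
  also have "\<dots> \<le> (\<Sum>\<sigma>\<in>configs N. 1 * cosh (2 * \<beta>) ^ M)"
  proof (intro sum_mono)
    fix \<sigma> assume "\<sigma> \<in> configs N"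
    then have "card {\<tau> \<in> configs N. factor_model.disagree N \<sigma> \<tau> = k} \<le> 1"
      using card_disagree_le[of \<sigma> N k] k by auto
    then show "(\<Sum>\<tau> | \<tau> \<in> configs N \<and> factor_model.disagree N \<sigma> \<tau> = k. cosh (2 * \<beta>) ^ M) \<le> 1 * cosh (2 * \<beta>) ^ M"
      by (simp add: mult_le_cancel_right1 cosh_real_pos)
  qed
  also have "\<dots> = exp (real N * phi p l (2 * \<beta>))" by (simp add: card_configs exp_phi[OF p dv M])
  finally show ?thesis .
qed

section \<open>The exponents and the characteristic temperatures\<close>

lemma check_poly_eq: "check_poly p \<beta> z = cosh (2 * \<beta>) * p_plus p z + p_minus p z"
proof -
  have a: "(1 + z) ^ p = (\<Sum>k\<le>p. real (p choose k) * z ^ k)"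
    using binomial_ring[of z 1 p] by (simp add: add.commute)
  have b: "(1 - z) ^ p = (\<Sum>k\<le>p. real (p choose k) * (- z) ^ k)"
    using binomial_ring[of "- z" 1 p] by simp
  have "cosh (2 * \<beta>) * p_plus p z + p_minus p z
    = (\<Sum>k\<le>p. cosh (2 * \<beta>) * (real (p choose k) * z ^ k + real (p choose k) * (- z) ^ k) / 2
        + (real (p choose k) * z ^ k - real (p choose k) * (- z) ^ k) / 2)"
    unfolding p_plus_def p_minus_def a b
    by (simp only: sum.distrib sum_subtractf sum_divide_distrib[symmetric] sum_distrib_left[symmetric] times_divide_eq_right)
  also have "\<dots> = (\<Sum>k\<le>p. real (p choose k) * parity_weight \<beta> k * z ^ k)"
    by (intro sum.cong refl) (auto simp: parity_weight_def)
  finally show ?thesis by (simp add: check_poly_def)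
qed

lemma cosh_double': "cosh (2 * \<beta> :: real) = (cosh \<beta>)\<^sup>2 * (1 + (tanh \<beta>)\<^sup>2)" "1 = (cosh \<beta> :: real)\<^sup>2 * (1 - (tanh \<beta>)\<^sup>2)"
proof -
  have "(cosh \<beta>)\<^sup>2 * (tanh \<beta>)\<^sup>2 = (sinh \<beta>)\<^sup>2" by (simp add: tanh_def power_divide)
  then show "cosh (2 * \<beta> :: real) = (cosh \<beta>)\<^sup>2 * (1 + (tanh \<beta>)\<^sup>2)" "1 = (cosh \<beta> :: real)\<^sup>2 * (1 - (tanh \<beta>)\<^sup>2)"
    using cosh_square_eq[of \<beta>] cosh_double[of \<beta>] by (simp_all add: distrib_left right_diff_distrib)
qed

text \<open>Separates \<beta> into the prefactor (cosh \<beta>)^2 and the parameter (tanh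
  \<beta>)^2, which makes the comparison with \<beta> = 0 and the monotonicity in \<beta>
  visible.\<close>

lemma check_poly_closed:
  "check_poly p \<beta> z = (cosh \<beta>)\<^sup>2 * ((1 + z) ^ p + (tanh \<beta>)\<^sup>2 * (1 - z) ^ p)"
proof -
  have "check_poly p \<beta> z = cosh (2 * \<beta>) * p_plus p z + ((cosh \<beta>)\<^sup>2 * (1 - (tanh \<beta>)\<^sup>2)) * p_minus p z"
    unfolding cosh_double'(2)[symmetric] by (simp add: check_poly_eq)
  also have "\<dots> = (cosh \<beta>)\<^sup>2 * ((1 + (tanh \<beta>)\<^sup>2) * p_plus p z + (1 - (tanh \<beta>)\<^sup>2) * p_minus p z)"
    unfolding cosh_double'(1) by (simp add: algebra_simps)
  also have "(1 + (tanh \<beta>)\<^sup>2) * p_plus p z + (1 - (tanh \<beta>)\<^sup>2) * p_minus p z = (1 + z) ^ p + (tanh \<beta>)\<^sup>2 * (1 - z) ^ p"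
    by (simp add: p_plus_def p_minus_def field_simps)
  finally show ?thesis .
qed

section \<open>The saddle point \<open>z_overlap\<close>\<close>

text \<open>The logarithmic derivative z f'(z) / f(z) of \<open>check_poly\<close>, read as the mean
  number of disagreeing sockets of a node under weights proportional to the terms of f. The equation
  defining z_q sets it to p (1 - q) / 2.\<close>

definition mean_degree :: "nat \<Rightarrow> real \<Rightarrow> real \<Rightarrow> real" where
  "mean_degree p \<beta> z = (\<Sum>k\<le>p. real k * (real (p choose k) * parity_weight \<beta> k * z ^ k)) / check_poly p \<beta> z"

lemma parity_weight_ge_1: "1 \<le> parity_weight \<beta> k"
  by (simp add: parity_weight_def cosh_real_ge_1)

lemma coeff_pos: "k \<le> p \<Longrightarrow> 0 < real (p choose k) * parity_weight \<beta> k"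
  using parity_weight_ge_1[of \<beta> k] by (intro mult_pos_pos) (auto simp: zero_less_binomial intro: less_le_trans[OF zero_less_one])

lemma check_poly_ge_1:
  assumes "0 \<le> z" shows "1 \<le> check_poly p \<beta> z" "cosh (2 * \<beta>) \<le> check_poly p \<beta> z"
proof -
  have nn: "0 \<le> real (p choose k) * parity_weight \<beta> k * z ^ k" if "k \<le> p" for k
    using coeff_pos[OF that, of \<beta>] assms by (intro mult_nonneg_nonneg[OF less_imp_le]) auto
  have "real (p choose 0) * parity_weight \<beta> 0 * z ^ 0 \<le> check_poly p \<beta> z"
    unfolding check_poly_def by (rule member_le_sum) (use nn in auto)
  then show "cosh (2 * \<beta>) \<le> check_poly p \<beta> z" by (simp add: parity_weight_def)
  then show "1 \<le> check_poly p \<beta> z" using cosh_real_ge_1[of "2 * \<beta>"] by linarith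
qed

lemma deriv_check_poly:
  assumes "0 \<le> z"
  shows "z * ((cosh (2 * \<beta>) * deriv (p_plus p) z + deriv (p_minus p) z) / (cosh (2 * \<beta>) * p_plus p z + p_minus p z))
    = mean_degree p \<beta> z"
proof -
  have dp: "(p_plus p has_real_derivative (real p * (1 + z) ^ (p - 1) - real p * (1 - z) ^ (p - 1)) / 2) (at z)"
    unfolding p_plus_def[abs_def] by (rule derivative_eq_intros refl | simp)+
  have dm: "(p_minus p has_real_derivative (real p * (1 + z) ^ (p - 1) + real p * (1 - z) ^ (p - 1)) / 2) (at z)"
    unfolding p_minus_def[abs_def] by (rule derivative_eq_intros refl | simp)+
  have "((\<lambda>z. cosh (2 * \<beta>) * p_plus p z + p_minus p z) has_real_derivative
     (cosh (2 * \<beta>) * deriv (p_plus p) z + deriv (p_minus p) z)) (at z)"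
    unfolding DERIV_imp_deriv[OF dp] DERIV_imp_deriv[OF dm] by (intro DERIV_add DERIV_cmult dp dm)
  then have 1: "(check_poly p \<beta> has_real_derivative (cosh (2 * \<beta>) * deriv (p_plus p) z + deriv (p_minus p) z)) (at z)"
    unfolding check_poly_eq[abs_def] .
  have 2: "(check_poly p \<beta> has_real_derivative (\<Sum>k\<le>p. real (p choose k) * parity_weight \<beta> k * (real k * z ^ (k - 1)))) (at z)"
    unfolding check_poly_def[abs_def] by (auto intro!: derivative_eq_intros sum.cong)
  have "z * (cosh (2 * \<beta>) * deriv (p_plus p) z + deriv (p_minus p) z) = (\<Sum>k\<le>p. real k * (real (p choose k) * parity_weight \<beta> k * z ^ k))"
    unfolding DERIV_unique[OF 1 2] sum_distrib_left
  proof (rule sum.cong[OF refl])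
    fix k
    show "z * (real (p choose k) * parity_weight \<beta> k * (real k * z ^ (k - 1))) = real k * (real (p choose k) * parity_weight \<beta> k * z ^ k)"
      by (cases k) auto
  qed
  then show ?thesis unfolding mean_degree_def check_poly_eq[symmetric] by simp
qed

text \<open>The difference is a double sum of terms \<open>(j - k) (z'^j z^k - z^j z'^k)\<close>, none of which is negative.\<close>

lemma mean_degree_strict_mono:
  assumes p: "0 < p" and z: "0 \<le> z" "z < z'"
  shows "mean_degree p \<beta> z < mean_degree p \<beta> z'"
proof -
  let ?c = "\<lambda>k. real (p choose k) * parity_weight \<beta> k"
  let ?f = "check_poly p \<beta>" and ?g = "\<lambda>z. \<Sum>k\<le>p. real k * (?c k * z ^ k)"
  have fp: "0 < ?f z" "0 < ?f z'" using check_poly_ge_1(1)[of z p \<beta>] check_poly_ge_1(1)[of z' p \<beta>] z by auto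
  let ?t = "\<lambda>j k. ?c j * ?c k * ((real j - real k) * (z' ^ j * z ^ k - z ^ j * z' ^ k))"
  have t0: "0 \<le> ?t j k" if "j \<le> p" "k \<le> p" for j k
  proof -
    have main: "0 \<le> (real j - real k) * (z' ^ j * z ^ k - z ^ j * z' ^ k)" if "k \<le> j" for j k
    proof -
      have "z ^ (j - k) \<le> z' ^ (j - k)" using z by (intro power_mono) auto
      then have "z ^ k * z' ^ k * z ^ (j - k) \<le> z ^ k * z' ^ k * z' ^ (j - k)" using z by (intro mult_left_mono) auto
      moreover have "z ^ j = z ^ k * z ^ (j - k)" "z' ^ j = z' ^ k * z' ^ (j - k)" using that by (auto simp: power_add[symmetric])
      ultimately show ?thesis using that by (intro mult_nonneg_nonneg) (auto simp: mult_ac)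
    qed
    have "0 \<le> (real j - real k) * (z' ^ j * z ^ k - z ^ j * z' ^ k)"
    proof (cases "k \<le> j")
      case False
      then show ?thesis using main[of j k] by (simp add: algebra_simps)
    qed (rule main)
    then show ?thesis
      by (intro mult_nonneg_nonneg[OF mult_nonneg_nonneg] less_imp_le[OF coeff_pos] that)
  qed
  have eq: "2 * (?g z' * ?f z - ?g z * ?f z') = (\<Sum>j\<le>p. \<Sum>k\<le>p. ?t j k)"
  proof -
    have e1: "?g a * ?f b = (\<Sum>j\<le>p. \<Sum>k\<le>p. ?c j * ?c k * (real j * (a ^ j * b ^ k)))" for a b
      unfolding check_poly_def sum_product by (intro sum.cong refl) (simp only: mult_ac)
    have e2: "?g a * ?f b = (\<Sum>j\<le>p. \<Sum>k\<le>p. ?c j * ?c k * (real k * (b ^ j * a ^ k)))" for a b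
      unfolding e1 by (subst sum.swap) (intro sum.cong refl, simp only: mult_ac)
    have "2 * (?g z' * ?f z - ?g z * ?f z') = (?g z' * ?f z + ?g z' * ?f z) - (?g z * ?f z' + ?g z * ?f z')" by simp
    also have "\<dots> = (\<Sum>j\<le>p. \<Sum>k\<le>p. ?c j * ?c k * (real j * (z' ^ j * z ^ k)) + ?c j * ?c k * (real k * (z ^ j * z' ^ k))
       - (?c j * ?c k * (real j * (z ^ j * z' ^ k)) + ?c j * ?c k * (real k * (z' ^ j * z ^ k))))"
      unfolding sum_subtractf sum.distrib e1[symmetric] e2[symmetric] ..
    also have "\<dots> = (\<Sum>j\<le>p. \<Sum>k\<le>p. ?t j k)"
      by (intro sum.cong refl) (simp add: algebra_simps)
    finally show ?thesis .
  qed
  have "0 < ?t 1 0" using p z by (intro mult_pos_pos coeff_pos) auto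
  also have "?t 1 0 \<le> (\<Sum>k\<le>p. ?t 1 k)"
    by (rule member_le_sum[of 0 "{..p}" "\<lambda>k. ?t 1 k"]) (use t0[of 1] p in auto)
  also have "\<dots> \<le> (\<Sum>j\<le>p. \<Sum>k\<le>p. ?t j k)"
    by (rule member_le_sum[of 1 "{..p}" "\<lambda>j. \<Sum>k\<le>p. ?t j k"]) (use t0 p in \<open>auto intro!: sum_nonneg\<close>)
  finally have "?g z * ?f z' < ?g z' * ?f z" using eq by simp
  then show ?thesis unfolding mean_degree_def using fp by (simp add: divide_simps)
qed

text \<open>At z = 1 all powers of 1 - z vanish because p - 1 is positive. This identifies the
  saddle point at q = 0.\<close>

lemma mean_degree_1: "2 \<le> p \<Longrightarrow> mean_degree p \<beta> 1 = real p / 2"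
proof -
  assume p: "2 \<le> p"
  have dp: "(p_plus p has_real_derivative (real p * (1 + 1) ^ (p - 1) - real p * (1 - 1) ^ (p - 1)) / 2) (at 1)"
    unfolding p_plus_def[abs_def] by (rule derivative_eq_intros refl | simp)+
  have dm: "(p_minus p has_real_derivative (real p * (1 + 1) ^ (p - 1) + real p * (1 - 1) ^ (p - 1)) / 2) (at 1)"
    unfolding p_minus_def[abs_def] by (rule derivative_eq_intros refl | simp)+
  have pp: "(2 :: real) ^ p = 2 * 2 ^ (p - 1)" using p by (simp flip: power_Suc)
  have c: "0 < cosh (2 * \<beta>) + 1" by (rule add_pos_pos[OF cosh_real_pos zero_less_one])
  have "mean_degree p \<beta> 1 = (cosh (2 * \<beta>) * (real p * 2 ^ (p - 1) / 2) + real p * 2 ^ (p - 1) / 2) / (cosh (2 * \<beta>) * (2 ^ p / 2) + 2 ^ p / 2)"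
    using deriv_check_poly[of 1 \<beta> p] DERIV_imp_deriv[OF dp] DERIV_imp_deriv[OF dm] p
    by (simp add: p_plus_def p_minus_def power_0_left)
  also have "\<dots> = ((cosh (2 * \<beta>) + 1) * 2 ^ (p - 1) * (real p / 2)) / ((cosh (2 * \<beta>) + 1) * 2 ^ (p - 1))"
    unfolding pp by (simp add: algebra_simps)
  also have "\<dots> = real p / 2" using c by simp
  finally show ?thesis .
qed

lemma mean_degree_0: "mean_degree p \<beta> 0 = 0"
  unfolding mean_degree_def by (simp add: sum.neutral power_0_left)

lemma continuous_on_mean_degree: "continuous_on {0..} (mean_degree p \<beta>)"
proof -
  have "check_poly p \<beta> z \<noteq> 0" if "z \<in> {0..}" for z
    using check_poly_ge_1(1)[of z p \<beta>] that by auto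
  then show ?thesis
    unfolding mean_degree_def[abs_def] by (auto simp: check_poly_def intro!: continuous_intros)
qed

text \<open>The leading term of the polynomial dominates. With value 0 at z = 0 and continuity,
  every value in (0, p) is then attained.\<close>

lemma mean_degree_large:
  assumes p: "0 < p" and e: "0 < e"
  shows "\<exists>z>0. real p - e < mean_degree p \<beta> z"
proof -
  let ?c = "\<lambda>k. real (p choose k) * parity_weight \<beta> k"
  define C where "C = (\<Sum>k<p. ?c k)"
  have C0: "0 \<le> C" unfolding C_def using coeff_pos by (intro sum_nonneg) (auto intro: less_imp_le)
  \<comment> \<open>Chosen so that p C < e z: the lower coefficients together weigh less than e
    times the leading power.\<close>
  define z where "z = 1 + p * C / e"
  have z1: "1 \<le> z" using C0 e by (simp add: z_def)
  have f: "z ^ p \<le> check_poly p \<beta> z"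
  proof -
    have "?c p * z ^ p \<le> check_poly p \<beta> z" unfolding check_poly_def
      using z1 coeff_pos[of _ p \<beta>] by (intro member_le_sum) (auto intro!: mult_nonneg_nonneg less_imp_le[OF coeff_pos])
    moreover have "1 * z ^ p \<le> ?c p * z ^ p" using parity_weight_ge_1[of \<beta> p] z1 by (intro mult_right_mono) auto
    ultimately show ?thesis by simp
  qed
  have fp: "0 < check_poly p \<beta> z" using check_poly_ge_1(1)[of z p \<beta>] z1 by simp
  have "p * check_poly p \<beta> z - (\<Sum>k\<le>p. real k * (?c k * z ^ k)) = (\<Sum>k\<le>p. (real p - real k) * (?c k * z ^ k))"
    unfolding check_poly_def by (simp add: sum_distrib_left left_diff_distrib sum_subtractf)
  also have "\<dots> = (\<Sum>k<p. (real p - real k) * (?c k * z ^ k))"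
    by (simp add: lessThan_Suc_atMost[symmetric])
  also have "\<dots> \<le> (\<Sum>k<p. real p * (?c k * z ^ (p - 1)))"
    using z1 by (intro sum_mono mult_mono mult_left_mono power_increasing) (auto intro!: mult_nonneg_nonneg less_imp_le[OF coeff_pos])
  also have "\<dots> = p * C * z ^ (p - 1)" by (simp add: C_def sum_distrib_left sum_distrib_right mult_ac)
  also have "\<dots> < e * z * z ^ (p - 1)"
    using e z1 by (intro mult_strict_right_mono) (auto simp: z_def field_simps)
  also have "\<dots> = e * z ^ p" using p by (simp flip: power_Suc)
  also have "\<dots> \<le> e * check_poly p \<beta> z" using f e by simp
  finally have "real p - e < mean_degree p \<beta> z" unfolding mean_degree_def using fp by (simp add: field_simps)
  then show ?thesis using z1 by (intro exI[of _ z]) auto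
qed

lemma z_overlap:
  assumes p: "0 < p" and q: "-1 < q" "q < 1"
  shows "0 < z_overlap p \<beta> q" "mean_degree p \<beta> (z_overlap p \<beta> q) = real p * ((1 - q) / 2)"
proof -
  let ?v = "real p * ((1 - q) / 2)"
  have v: "0 < ?v" "?v < real p" using p q by auto
  have "0 < real p - ?v" using v by simp
  from mean_degree_large[OF p this, of \<beta>] obtain z1 where z1: "0 < z1" "?v < mean_degree p \<beta> z1"
    by (auto simp only: diff_diff_eq2 add_diff_cancel_left')
  have "\<exists>z\<ge>0. z \<le> z1 \<and> mean_degree p \<beta> z = ?v"
    by (rule IVT') (use v z1 in \<open>auto simp: mean_degree_0 intro: continuous_on_subset[OF continuous_on_mean_degree]\<close>)
  then obtain z where z: "0 \<le> z" "mean_degree p \<beta> z = ?v" by blast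
  have "z_overlap p \<beta> q = z"
    unfolding z_overlap_def
  proof (rule the_equality)
    show "0 \<le> z \<and> z * ((cosh (2 * \<beta>) * deriv (p_plus p) z + deriv (p_minus p) z) / (cosh (2 * \<beta>) * p_plus p z + p_minus p z)) = ?v"
      unfolding deriv_check_poly[OF z(1)] using z by blast
    fix w assume w: "0 \<le> w \<and> w * ((cosh (2 * \<beta>) * deriv (p_plus p) w + deriv (p_minus p) w) / (cosh (2 * \<beta>) * p_plus p w + p_minus p w)) = ?v"
    then have w0: "0 \<le> w" by blast
    have "mean_degree p \<beta> w = ?v" using w unfolding deriv_check_poly[OF w0] by blast
    then show "w = z"
      using mean_degree_strict_mono[OF p, of z w \<beta>] mean_degree_strict_mono[OF p, of w z \<beta>] z w by (cases w z rule: linorder_cases) auto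
  qed
  moreover have "z \<noteq> 0" using z v by (auto simp: mean_degree_0)
  ultimately show "0 < z_overlap p \<beta> q" "mean_degree p \<beta> (z_overlap p \<beta> q) = ?v" using z by auto
qed

text \<open>Convexity of ln f - m ln z in the variable ln z makes its critical point a minimum.
  Concretely, for w = z exp s the terms of f(w) exp (- m s) carry factors exp ((k - m) s) \<ge> 1 +
  (k - m) s, whose linear parts cancel at the saddle point.\<close>

lemma check_poly_min:
  assumes z: "0 < z" "mean_degree p \<beta> z = m" and w: "0 < w"
  shows "ln (check_poly p \<beta> z) - m * ln z \<le> ln (check_poly p \<beta> w) - m * ln w"
proof -
  let ?c = "\<lambda>k. real (p choose k) * parity_weight \<beta> k"
  have f: "0 < check_poly p \<beta> z" "0 < check_poly p \<beta> w" using check_poly_pos z w by auto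
  define s where "s = ln w - ln z"
  have "exp (ln w - ln z) = w / z" using z w by (simp add: exp_diff)
  then have ws: "w = z * exp s" using z by (simp add: s_def)
  have "check_poly p \<beta> z = (\<Sum>k\<le>p. ?c k * z ^ k * (1 + (real k - m) * s))"
  proof -
    have "(\<Sum>k\<le>p. real k * (?c k * z ^ k)) = m * check_poly p \<beta> z"
      using z(2) f unfolding mean_degree_def by (simp add: field_simps)
    then have "(\<Sum>k\<le>p. ?c k * z ^ k) + s * (\<Sum>k\<le>p. real k * (?c k * z ^ k)) - s * m * (\<Sum>k\<le>p. ?c k * z ^ k) = check_poly p \<beta> z"
      by (simp add: check_poly_def)
    then show ?thesis
      by (simp add: sum_distrib_left sum.distrib[symmetric] sum_subtractf[symmetric] algebra_simps)
  qed
  also have "\<dots> \<le> (\<Sum>k\<le>p. ?c k * z ^ k * exp ((real k - m) * s))"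
    using z by (intro sum_mono mult_left_mono mult_nonneg_nonneg[OF less_imp_le[OF coeff_pos]]) (auto simp: exp_ge_add_one_self)
  also have "\<dots> = exp (- m * s) * check_poly p \<beta> w"
    unfolding check_poly_def ws sum_distrib_left
    by (intro sum.cong refl) (simp add: power_mult_distrib exp_of_nat_mult[symmetric] left_diff_distrib exp_diff exp_minus field_simps)
  finally have "ln (check_poly p \<beta> z) \<le> ln (exp (- m * s) * check_poly p \<beta> w)" using f by simp
  also have "\<dots> = - m * s + ln (check_poly p \<beta> w)" using f by (simp add: ln_mult)
  finally show ?thesis by (simp add: s_def algebra_simps)
qed

section \<open>The overlap exponent, its bounds and its end points\<close>

lemma phi_overlap_open_eq:
  "phi_overlap_open p l q \<beta> = pair_exponent p l \<beta> ((1 - q) / 2) (z_overlap p \<beta> q)"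
  by (simp add: phi_overlap_open_def pair_exponent_def check_poly_eq Let_def)

text \<open>\<phi>(q; \<beta>) is a minimum over z, so every explicit trial value bounds it from
  above and the implicit z_q need not be computed.\<close>

lemma phi_overlap_open_le:
  assumes p: "0 < p" and q: "-1 < q" "q < 1" and w: "0 < w"
  shows "phi_overlap_open p l q \<beta> \<le> pair_exponent p l \<beta> ((1 - q) / 2) w"
proof -
  let ?z = "z_overlap p \<beta> q" and ?x = "(1 - q) / 2"
  have "real l / real p * (ln (check_poly p \<beta> ?z) - real p * ?x * ln ?z) \<le> real l / real p * (ln (check_poly p \<beta> w) - real p * ?x * ln w)"
    by (intro mult_left_mono check_poly_min[OF z_overlap[OF p q] w]) auto
  moreover have "real l / real p * (a - real p * ?x * b) = real l / real p * a - real l * ?x * b" for a b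
    using p by (simp add: field_simps)
  ultimately show ?thesis unfolding phi_overlap_open_eq pair_exponent_def by simp
qed

lemma phi_overlap_interior: "-1 < q \<Longrightarrow> q < 1 \<Longrightarrow> phi_overlap p l q \<beta> = phi_overlap_open p l q \<beta>"
  by (simp add: phi_overlap_def)

lemma z_overlap_0:
  assumes "2 \<le> p" shows "z_overlap p \<beta> 0 = 1"
  using z_overlap[of p 0 \<beta>] mean_degree_1[OF assms, of \<beta>] assms
    mean_degree_strict_mono[of p "z_overlap p \<beta> 0" 1 \<beta>] mean_degree_strict_mono[of p 1 "z_overlap p \<beta> 0" \<beta>]
  by (cases "z_overlap p \<beta> 0" "1 :: real" rule: linorder_cases) auto

lemma entropy_half: "entropy_fun (1 / 2) = ln 2"
  by (simp add: entropy_fun_def ln_div)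

lemma phi_overlap_0:
  assumes "2 \<le> p" shows "phi_overlap p l 0 \<beta> = 2 * phi p l \<beta>"
proof -
  have "check_poly p \<beta> 1 = (cosh \<beta>)\<^sup>2 * 2 ^ p" using assms by (simp add: check_poly_closed power_0_left)
  then have "ln (check_poly p \<beta> 1) = 2 * ln (cosh \<beta>) + real p * ln 2"
    using cosh_real_pos[of \<beta>] by (simp add: ln_mult ln_realpow)
  then show ?thesis using assms
    by (simp add: phi_overlap_def phi_overlap_open_eq z_overlap_0 pair_exponent_def entropy_half phi_def field_simps)
qed

lemma z_overlap_le_1:
  assumes p: "2 \<le> p" and q: "0 \<le> q" "q < 1"
  shows "z_overlap p \<beta> q \<le> 1"
proof (rule ccontr)
  assume "\<not> z_overlap p \<beta> q \<le> 1"
  then have "mean_degree p \<beta> 1 < mean_degree p \<beta> (z_overlap p \<beta> q)"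
    using p by (intro mean_degree_strict_mono) auto
  moreover have "real p * ((1 - q) / 2) \<le> real p * (1 / 2)" using q by (intro mult_left_mono) auto
  ultimately show False using z_overlap(2)[of p q \<beta>] mean_degree_1[OF p, of \<beta>] p q by simp
qed

lemma z_overlap_ge_1:
  assumes p: "2 \<le> p" and q: "-1 < q" "q \<le> 0"
  shows "1 \<le> z_overlap p \<beta> q"
proof (rule ccontr)
  assume "\<not> 1 \<le> z_overlap p \<beta> q"
  then have "mean_degree p \<beta> (z_overlap p \<beta> q) < mean_degree p \<beta> 1"
    using p z_overlap(1)[of p q \<beta>] q by (intro mean_degree_strict_mono) auto
  moreover have "real p * (1 / 2) \<le> real p * ((1 - q) / 2)" using q by (intro mult_left_mono) auto
  ultimately show False using z_overlap(2)[of p q \<beta>] mean_degree_1[OF p, of \<beta>] p q by simp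
qed

lemma entropy_le:
  assumes q: "-1 < q" "q < 1"
  shows "entropy_fun ((1 - q) / 2) \<le> ln 2 - q\<^sup>2 / 4"
proof -
  \<comment> \<open>This is ln y \<le> y - 1 at y = 1 / sqrt (2 x), tight at x = 1 / 2. Adding the
    bounds for x and 1 - x leaves sqrt (1 - q) + sqrt (1 + q), whose deficit from 2 is at least q^2
    / 4.\<close>
  have *: "- x * ln x \<le> x * ln 2 + (sqrt (2 * x) - 2 * x)" if x: "0 < x" for x :: real
  proof -
    have "ln (1 / sqrt (2 * x)) \<le> 1 / sqrt (2 * x) - 1" using x by (intro ln_le_minus_one) auto
    moreover have "ln (1 / sqrt (2 * x)) = - (ln (2 * x) / 2)" using x by (simp add: ln_div ln_sqrt)
    moreover have "ln (2 * x) = ln 2 + ln x" using x by (simp add: ln_mult)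
    moreover have "2 * (1 / sqrt (2 * x)) = 2 / sqrt (2 * x)" by simp
    ultimately have "- (ln 2 + ln x) \<le> 2 / sqrt (2 * x) - 2" by linarith
    then have "x * (- (ln 2 + ln x)) \<le> x * (2 / sqrt (2 * x) - 2)" using x by (intro mult_left_mono) auto
    moreover have "x * (2 / sqrt (2 * x)) = sqrt (2 * x)"
      using real_div_sqrt[of "2 * x"] x by (simp add: mult.commute)
    ultimately show ?thesis by (simp add: algebra_simps)
  qed
  let ?x = "(1 - q) / 2"
  have "entropy_fun x \<le> (x * ln 2 + (sqrt (2 * x) - 2 * x)) + ((1 - x) * ln 2 + (sqrt (2 * (1 - x)) - 2 * (1 - x)))"
    if "0 < x" "x < 1" for x
    unfolding entropy_fun_def using *[of x] *[of "1 - x"] that by (simp add: left_diff_distrib)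
  from this[of ?x] have "entropy_fun ?x \<le> (?x * ln 2 + (sqrt (2 * ?x) - 2 * ?x)) + ((1 - ?x) * ln 2 + (sqrt (2 * (1 - ?x)) - 2 * (1 - ?x)))"
    using q by simp
  also have "\<dots> = ln 2 + (sqrt (1 - q) + sqrt (1 + q) - 2)"
  proof -
    have "2 * ?x = 1 - q" "2 * (1 - ?x) = 1 + q" by (simp_all add: field_simps)
    then show ?thesis by (simp only:) (simp add: left_diff_distrib)
  qed
  also have "sqrt (1 - q) + sqrt (1 + q) \<le> 2 - q\<^sup>2 / 4"
  proof (rule power2_le_imp_le)
    have "(1 - q) * (1 + q) \<le> (1 - q\<^sup>2 / 2)\<^sup>2"
      using zero_le_power2[of "q\<^sup>2"] by (simp add: power2_eq_square algebra_simps)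
    moreover have q2: "q\<^sup>2 \<le> 1" using q by (simp add: abs_square_le_1 abs_le_iff)
    ultimately have "sqrt ((1 - q) * (1 + q)) \<le> 1 - q\<^sup>2 / 2" by (intro real_le_lsqrt) auto
    moreover have "(sqrt (1 - q) + sqrt (1 + q))\<^sup>2 = 2 + 2 * sqrt ((1 - q) * (1 + q))"
      using q by (simp add: power2_sum real_sqrt_mult)
    ultimately have "(sqrt (1 - q) + sqrt (1 + q))\<^sup>2 \<le> 4 - q\<^sup>2" by simp
    also have "\<dots> \<le> (2 - q\<^sup>2 / 4)\<^sup>2"
      using zero_le_power2[of "q\<^sup>2"] by (simp add: power2_eq_square algebra_simps)
    finally show "(sqrt (1 - q) + sqrt (1 + q))\<^sup>2 \<le> (2 - q\<^sup>2 / 4)\<^sup>2" .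
    show "0 \<le> 2 - q\<^sup>2 / 4" using q2 by simp
  qed
  finally show ?thesis by simp
qed

lemma entropy_le_ln2: "-1 < q \<Longrightarrow> q < 1 \<Longrightarrow> entropy_fun ((1 - q) / 2) \<le> ln 2"
  using entropy_le[of q] zero_le_power2[of q] by linarith

lemma tanh_square_bounds: "0 \<le> (tanh (\<beta> :: real))\<^sup>2" "(tanh (\<beta> :: real))\<^sup>2 < 1"
proof -
  have "\<bar>tanh \<beta>\<bar> < 1" using tanh_real_lt_1[of \<beta>] tanh_real_gt_neg1[of \<beta>] by (simp add: abs_less_iff)
  then show "(tanh \<beta>)\<^sup>2 < 1" by (simp add: abs_square_less_1)
qed simp

text \<open>The trial value \<open>z = (1 - q) / (1 + q)\<close> is the exact minimiser at \<open>\<beta> = 0\<close>.\<close>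

lemma phi_overlap_open_upper:
  assumes p: "0 < p" and q: "-1 < q" "q < 1"
  shows "phi_overlap_open p l q \<beta> \<le> ln 2 + entropy_fun ((1 - q) / 2)
    + real l / real p * (2 * ln (cosh \<beta>) + ln (1 + (tanh \<beta>)\<^sup>2 * q ^ p))"
proof -
  let ?z = "(1 - q) / (1 + q)" and ?T = "(tanh \<beta>)\<^sup>2"
  have T: "0 \<le> ?T" "?T < 1" using tanh_square_bounds[of \<beta>] by auto
  have "\<bar>?T * q ^ p\<bar> \<le> ?T * 1"
    unfolding abs_mult using T q by (intro mult_mono) (auto simp: power_abs power_le_one)
  then have pos: "0 < 1 + ?T * q ^ p" using T by (auto simp: abs_le_iff)
  have z: "0 < ?z" using q by simp
  have c: "check_poly p \<beta> ?z = (cosh \<beta>)\<^sup>2 * (2 / (1 + q)) ^ p * (1 + ?T * q ^ p)"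
  proof -
    have "1 + ?z = 2 / (1 + q)" "1 - ?z = 2 / (1 + q) * q" using q by (auto simp: field_simps)
    then show ?thesis unfolding check_poly_closed by (simp only: power_mult_distrib) (simp add: algebra_simps)
  qed
  have e1: "ln (check_poly p \<beta> ?z) = 2 * ln (cosh \<beta>) + real p * ln (2 / (1 + q)) + ln (1 + ?T * q ^ p)"
    unfolding c using pos q cosh_real_pos[of \<beta>] by (simp add: ln_mult ln_realpow)
  have e2: "ln (2 / (1 + q)) = - ln ((1 + q) / 2)" using q by (simp add: ln_div)
  have e3: "ln ?z = ln ((1 - q) / 2) - ln ((1 + q) / 2)" using q by (simp add: ln_div)
  have e4: "1 - (1 - q) / 2 = (1 + q) / 2" by (simp add: field_simps)
  have gen: "ln 2 - (L - 1) * (- x * B - y * A) + L / P * (C + P * (- A) + D) - L * x * (B - A)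
      = ln 2 + (- x * B - y * A) + L / P * (C + D)" if "P \<noteq> 0" "y = 1 - x" for L P C D x y A B :: real
    unfolding that(2) using that(1) by (simp add: algebra_simps)
  have "pair_exponent p l \<beta> ((1 - q) / 2) ?z = ln 2 + entropy_fun ((1 - q) / 2)
    + real l / real p * (2 * ln (cosh \<beta>) + ln (1 + ?T * q ^ p))"
    unfolding pair_exponent_def entropy_fun_def e1 e2 e3 e4 by (rule gen) (use p e4 in auto)
  then show ?thesis using phi_overlap_open_le[OF p q z, of l \<beta>] by simp
qed

text \<open>The saddle point is squeezed rather than computed. From below z_q \<le> 1 and f \<ge>
  cosh (2 \<beta>) suffice; from above the trial value z = x = (1 - q) / 2 does, since x ln x tends
  to 0.\<close>

lemma phi_overlap_open_at_1:
  assumes p: "2 \<le> p"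
  shows "((\<lambda>q. phi_overlap_open p l q \<beta>) \<longlongrightarrow> phi p l (2 * \<beta>)) (at_left 1)"
proof (rule tendsto_sandwich)
  let ?x = "\<lambda>q :: real. (1 - q) / 2"
  have xl: "(?x \<longlongrightarrow> 0) (at_left 1)" by real_asymp
  have ent: "((\<lambda>q. entropy_fun (?x q)) \<longlongrightarrow> 0) (at_left 1)" unfolding entropy_fun_def by real_asymp
  have xlog: "((\<lambda>q. ?x q * ln (?x q)) \<longlongrightarrow> 0) (at_left 1)" by real_asymp
  have ev: "eventually (\<lambda>q. 0 < q \<and> q < (1 :: real)) (at_left 1)"
    using eventually_at_left_real[of 0 "1 :: real"] by auto
  show "((\<lambda>q. ln 2 - (real l - 1) * entropy_fun (?x q) + real l / real p * ln (cosh (2 * \<beta>))) \<longlongrightarrow> phi p l (2 * \<beta>)) (at_left 1)"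
    unfolding phi_def by (rule tendsto_eq_intros ent refl | simp)+
  have c0: "check_poly p \<beta> 0 = cosh (2 * \<beta>)"
    by (simp add: check_poly_eq p_plus_def p_minus_def)
  have "((\<lambda>q. check_poly p \<beta> (?x q)) \<longlongrightarrow> check_poly p \<beta> 0) (at_left 1)"
    unfolding check_poly_def by (intro tendsto_intros xl)
  then have lnl: "((\<lambda>q. ln (check_poly p \<beta> (?x q))) \<longlongrightarrow> ln (cosh (2 * \<beta>))) (at_left 1)"
    using c0 cosh_real_pos[of "2 * \<beta>"] by (intro tendsto_ln) auto
  have "((\<lambda>q. ln 2 - (real l - 1) * entropy_fun (?x q) + real l / real p * ln (check_poly p \<beta> (?x q)) - real l * (?x q * ln (?x q)))
     \<longlongrightarrow> ln 2 - (real l - 1) * 0 + real l / real p * ln (cosh (2 * \<beta>)) - real l * 0) (at_left 1)"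
    by (intro tendsto_add tendsto_diff tendsto_mult[OF tendsto_const] tendsto_const ent xlog lnl)
  then show "((\<lambda>q. ln 2 - (real l - 1) * entropy_fun (?x q) + real l / real p * ln (check_poly p \<beta> (?x q)) - real l * (?x q * ln (?x q))) \<longlongrightarrow> phi p l (2 * \<beta>)) (at_left 1)"
    by (simp add: phi_def)
  show "\<forall>\<^sub>F q in at_left 1. phi_overlap_open p l q \<beta> \<le> ln 2 - (real l - 1) * entropy_fun (?x q) + real l / real p * ln (check_poly p \<beta> (?x q)) - real l * (?x q * ln (?x q))"
    using ev
  proof eventually_elim
    case (elim q)
    then show ?case using phi_overlap_open_le[of p q "?x q" l \<beta>] p by (simp add: pair_exponent_def mult.assoc)
  qed
  show "\<forall>\<^sub>F q in at_left 1. ln 2 - (real l - 1) * entropy_fun (?x q) + real l / real p * ln (cosh (2 * \<beta>)) \<le> phi_overlap_open p l q \<beta>"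
    using ev
  proof eventually_elim
    case (elim q)
    let ?z = "z_overlap p \<beta> q"
    have z: "0 < ?z" "?z \<le> 1" using z_overlap(1)[of p q \<beta>] z_overlap_le_1[of p q \<beta>] elim p by auto
    have "ln (cosh (2 * \<beta>)) \<le> ln (check_poly p \<beta> ?z)"
      using check_poly_ge_1(2)[of ?z \<beta> p] z cosh_real_pos[of "2 * \<beta>"] by (intro ln_mono) auto
    then have "real l / real p * ln (cosh (2 * \<beta>)) \<le> real l / real p * ln (check_poly p \<beta> ?z)"
      by (intro mult_left_mono) auto
    moreover have "real l * ?x q * ln ?z \<le> 0" using z elim by (intro mult_nonneg_nonpos) auto
    ultimately show ?case unfolding phi_overlap_open_eq pair_exponent_def by linarith
  qed
qed

text \<open>Mirror image of the end q = 1: now z_q \<ge> 1, the trial value is 1 / y with y = (1 +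
  q) / 2, and the leading coefficient of the polynomial takes the role of the constant one.\<close>

lemma phi_overlap_open_at_minus_1:
  assumes p: "2 \<le> p"
  shows "((\<lambda>q. phi_overlap_open p l q \<beta>) \<longlongrightarrow> ln 2 + real l / real p * ln (parity_weight \<beta> p)) (at_right (-1))"
proof (rule tendsto_sandwich)
  let ?x = "\<lambda>q :: real. (1 - q) / 2" and ?y = "\<lambda>q :: real. (1 + q) / 2"
  let ?c = "\<lambda>k. real (p choose k) * parity_weight \<beta> k"
  \<comment> \<open>The reversed polynomial y^p f(1 / y), which is regular at y = 0.\<close>
  let ?r = "\<lambda>y. \<Sum>k\<le>p. ?c k * y ^ (p - k)"
  have yl: "(?y \<longlongrightarrow> 0) (at_right (-1))" by real_asymp
  have ent: "((\<lambda>q. entropy_fun (?x q)) \<longlongrightarrow> 0) (at_right (-1))" unfolding entropy_fun_def by real_asymp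
  have ylog: "((\<lambda>q. ?y q * ln (?y q)) \<longlongrightarrow> 0) (at_right (-1))" by real_asymp
  have ev: "eventually (\<lambda>q. -1 < q \<and> q < (0 :: real)) (at_right (-1))"
    using eventually_at_right_real[of "-1" "0 :: real"] by auto
  have cp: "0 < parity_weight \<beta> p" using parity_weight_ge_1[of \<beta> p] by simp
  show "((\<lambda>q. ln 2 - (real l - 1) * entropy_fun (?x q) + real l / real p * ln (parity_weight \<beta> p)) \<longlongrightarrow> ln 2 + real l / real p * ln (parity_weight \<beta> p)) (at_right (-1))"
    by (rule tendsto_eq_intros ent refl | simp)+
  have r0: "?r 0 = parity_weight \<beta> p"
  proof -
    have "?r 0 = (\<Sum>k\<in>{p}. ?c k * 0 ^ (p - k))" by (intro sum.mono_neutral_right) (auto simp: power_0_left)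
    then show ?thesis by simp
  qed
  have "((\<lambda>q. ?r (?y q)) \<longlongrightarrow> ?r 0) (at_right (-1))" by (intro tendsto_intros yl)
  then have rl: "((\<lambda>q. ln (?r (?y q))) \<longlongrightarrow> ln (parity_weight \<beta> p)) (at_right (-1))"
    using r0 cp by (intro tendsto_ln) auto
  have "((\<lambda>q. ln 2 - (real l - 1) * entropy_fun (?x q) + real l / real p * ln (?r (?y q)) - real l * (?y q * ln (?y q)))
     \<longlongrightarrow> ln 2 - (real l - 1) * 0 + real l / real p * ln (parity_weight \<beta> p) - real l * 0) (at_right (-1))"
    by (intro tendsto_add tendsto_diff tendsto_mult[OF tendsto_const] tendsto_const ent ylog rl)
  then show "((\<lambda>q. ln 2 - (real l - 1) * entropy_fun (?x q) + real l / real p * ln (?r (?y q)) - real l * (?y q * ln (?y q))) \<longlongrightarrow> ln 2 + real l / real p * ln (parity_weight \<beta> p)) (at_right (-1))"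
    by simp
  show "\<forall>\<^sub>F q in at_right (-1). phi_overlap_open p l q \<beta> \<le> ln 2 - (real l - 1) * entropy_fun (?x q) + real l / real p * ln (?r (?y q)) - real l * (?y q * ln (?y q))"
    using ev
  proof eventually_elim
    case (elim q)
    have y: "0 < ?y q" using elim by simp
    have z: "0 < 1 / ?y q" using y by simp
    have "check_poly p \<beta> (1 / ?y q) * ?y q ^ p = ?r (?y q)"
      unfolding check_poly_def sum_distrib_right
    proof (rule sum.cong[OF refl])
      fix k assume "k \<in> {..p}"
      then have "?y q ^ p = ?y q ^ k * ?y q ^ (p - k)" by (simp add: power_add[symmetric])
      then show "?c k * (1 / ?y q) ^ k * ?y q ^ p = ?c k * ?y q ^ (p - k)" using y by (simp add: power_divide)
    qed
    then have "ln (?r (?y q)) = ln (check_poly p \<beta> (1 / ?y q)) + real p * ln (?y q)"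
      using y check_poly_pos[OF z, of p \<beta>] by (simp add: ln_mult ln_realpow flip: \<open>check_poly p \<beta> (1 / ?y q) * ?y q ^ p = ?r (?y q)\<close>)
    then have e: "ln (check_poly p \<beta> (1 / ?y q)) = ln (?r (?y q)) - real p * ln (?y q)" by simp
    have x: "?x q = 1 - ?y q" by (simp add: field_simps)
    have lz: "ln (1 / ?y q) = - ln (?y q)" using y by (simp add: ln_div)
    have "pair_exponent p l \<beta> (?x q) (1 / ?y q) = ln 2 - (real l - 1) * entropy_fun (?x q)
       + real l / real p * (ln (?r (?y q)) - real p * ln (?y q)) + real l * (1 - ?y q) * ln (?y q)"
      unfolding pair_exponent_def e lz by (simp add: x)
    also have "\<dots> = ln 2 - (real l - 1) * entropy_fun (?x q) + real l / real p * ln (?r (?y q)) - real l * (?y q * ln (?y q))"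
      using p by (simp add: right_diff_distrib left_diff_distrib mult.assoc)
    finally show ?case using phi_overlap_open_le[of p q "1 / ?y q" l \<beta>] p z elim by simp
  qed
  show "\<forall>\<^sub>F q in at_right (-1). ln 2 - (real l - 1) * entropy_fun (?x q) + real l / real p * ln (parity_weight \<beta> p) \<le> phi_overlap_open p l q \<beta>"
    using ev
  proof eventually_elim
    case (elim q)
    let ?z = "z_overlap p \<beta> q"
    have z: "1 \<le> ?z" using z_overlap_ge_1[of p q \<beta>] elim p by auto
    have "?c p * ?z ^ p \<le> check_poly p \<beta> ?z" unfolding check_poly_def
      using z by (intro member_le_sum) (auto intro!: mult_nonneg_nonneg[OF less_imp_le[OF coeff_pos]])
    then have "ln (parity_weight \<beta> p * ?z ^ p) \<le> ln (check_poly p \<beta> ?z)"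
      using z cp by (intro ln_mono) (auto intro!: mult_pos_pos)
    then have "ln (parity_weight \<beta> p) + real p * ln ?z \<le> ln (check_poly p \<beta> ?z)"
      using z cp by (simp add: ln_mult ln_realpow)
    then have "real l / real p * (ln (parity_weight \<beta> p) + real p * ln ?z) \<le> real l / real p * ln (check_poly p \<beta> ?z)"
      by (intro mult_left_mono) auto
    moreover have "real l / real p * (ln (parity_weight \<beta> p) + real p * ln ?z) = real l / real p * ln (parity_weight \<beta> p) + real l * ln ?z"
      using p by (simp add: distrib_left)
    moreover have "real l * ?x q * ln ?z \<le> real l * 1 * ln ?z"
      using z elim by (intro mult_right_mono mult_left_mono) auto
    ultimately show ?case unfolding phi_overlap_open_eq pair_exponent_def by simp
  qed
qed

lemma phi_overlap_1: "2 \<le> p \<Longrightarrow> phi_overlap p l 1 \<beta> = phi p l (2 * \<beta>)"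
  unfolding phi_overlap_def using tendsto_Lim[OF _ phi_overlap_open_at_1] by simp

lemma phi_overlap_minus_1_le:
  assumes p: "2 \<le> p" and le: "\<And>q. -1 < q \<Longrightarrow> q < 1 \<Longrightarrow> phi_overlap_open p l q \<beta> \<le> B"
  shows "phi_overlap p l (-1) \<beta> \<le> B" "phi_overlap p l 1 \<beta> \<le> B"
proof -
  have "phi_overlap p l (-1) \<beta> = ln 2 + real l / real p * ln (parity_weight \<beta> p)"
    unfolding phi_overlap_def using tendsto_Lim[OF _ phi_overlap_open_at_minus_1[OF p]] by simp
  also have "\<dots> \<le> B"
  proof (rule tendsto_upperbound[OF phi_overlap_open_at_minus_1[OF p]])
    show "\<forall>\<^sub>F q in at_right (-1). phi_overlap_open p l q \<beta> \<le> B"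
      using eventually_at_right_real[of "-1" "0 :: real"] by (rule eventually_mono) (auto intro!: le)
  qed simp
  finally show "phi_overlap p l (-1) \<beta> \<le> B" .
  have "phi p l (2 * \<beta>) \<le> B"
  proof (rule tendsto_upperbound[OF phi_overlap_open_at_1[OF p]])
    show "\<forall>\<^sub>F q in at_left 1. phi_overlap_open p l q \<beta> \<le> B"
      using eventually_at_left_real[of 0 "1 :: real"] by (rule eventually_mono) (auto intro!: le)
  qed simp
  then show "phi_overlap p l 1 \<beta> \<le> B" by (simp add: phi_overlap_1[OF p])
qed

text \<open>The entropy loses at least q^2 / 4 away from q = 0, and the threshold on (tanh
  \<beta>)^2 is such that the energy gains at most q^2 / 4, using |q|^p \<le> q^2. It shows that the
  annealed condition holds on some interval.\<close>

lemma phi_overlap_high_temperature: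
  assumes p: "2 \<le> p" and T: "(tanh \<beta>)\<^sup>2 \<le> real p / (4 * real l)" and l: "0 < l" and q: "q \<in> {-1..1}"
  shows "phi_overlap p l q \<beta> \<le> phi_overlap p l 0 \<beta>"
proof -
  have p0: "0 < p" using p by simp
  have main: "phi_overlap_open p l q \<beta> \<le> 2 * phi p l \<beta>" if q: "-1 < q" "q < 1" for q
  proof -
    let ?T = "(tanh \<beta>)\<^sup>2"
    have T1: "0 \<le> ?T" "?T < 1" using tanh_square_bounds[of \<beta>] by auto
    have "\<bar>?T * q ^ p\<bar> \<le> ?T * 1"
      unfolding abs_mult using T1 q by (intro mult_mono) (auto simp: power_abs power_le_one)
    then have pos: "0 < 1 + ?T * q ^ p" using T1 by (auto simp: abs_le_iff)
    have "q ^ p \<le> \<bar>q\<bar> ^ p" by (metis abs_ge_self power_abs)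
    also have "\<dots> \<le> \<bar>q\<bar> ^ 2" using q p by (intro power_decreasing) auto
    finally have qp: "q ^ p \<le> q\<^sup>2" by simp
    have "ln (1 + ?T * q ^ p) \<le> ?T * q ^ p" using ln_add_one_self_le_self2[of "?T * q ^ p"] pos by simp
    also have "\<dots> \<le> real p / (4 * real l) * q\<^sup>2"
      using mult_left_mono[OF qp T1(1)] mult_right_mono[OF T zero_le_power2[of q]] by linarith
    finally have "real l / real p * ln (1 + ?T * q ^ p) \<le> real l / real p * (real p / (4 * real l) * q\<^sup>2)"
      by (intro mult_left_mono) auto
    also have "\<dots> = q\<^sup>2 / 4" using l p by simp
    finally have "real l / real p * ln (1 + ?T * q ^ p) \<le> q\<^sup>2 / 4" .
    moreover have "real l / real p * (2 * ln (cosh \<beta>) + ln (1 + ?T * q ^ p))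
      = 2 * (real l / real p * ln (cosh \<beta>)) + real l / real p * ln (1 + ?T * q ^ p)" by (simp add: distrib_left)
    ultimately show ?thesis
      using phi_overlap_open_upper[OF p0 q, of l \<beta>] entropy_le[OF q] unfolding phi_def distrib_left by linarith
  qed
  consider "q = -1" | "q = 1" | "-1 < q" "q < 1" using q by fastforce
  then show ?thesis
  proof cases
    case 3
    then show ?thesis using main[OF 3] by (simp only: phi_overlap_interior[OF 3] phi_overlap_0[OF p])
  qed (use phi_overlap_minus_1_le[OF p main] in \<open>simp_all add: phi_overlap_0[OF p]\<close>)
qed

section \<open>The annealed temperature\<close>

text \<open>The condition on b only concerns \<beta>' strictly below b, hence is inherited by
  suprema; so the greatest element exists and is the supremum, possibly \<infinity>.\<close>

lemma beta_ann_properties: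
  assumes p: "2 \<le> p" and l: "0 < l"
  shows "0 < beta_ann p l"
    and "0 < \<beta> \<Longrightarrow> ereal \<beta> < beta_ann p l \<Longrightarrow> q \<in> {-1..1} \<Longrightarrow> phi_overlap p l q \<beta> \<le> phi_overlap p l 0 \<beta>"
proof -
  let ?P = "\<lambda>b :: ereal. 0 < b \<and> (\<forall>\<beta>'>0. ereal \<beta>' < b \<longrightarrow> (\<forall>q\<in>{-1..1}. phi_overlap p l q \<beta>' \<le> phi_overlap p l 0 \<beta>'))"
  define s where "s = Sup (Collect ?P)"
  have lim: "((\<lambda>\<beta>. (tanh \<beta>)\<^sup>2) \<longlongrightarrow> (0 :: real)) (at_right 0)" by real_asymp
  have "0 < real p / (4 * real l)" using p l by simp
  then have "eventually (\<lambda>\<beta>. (tanh \<beta>)\<^sup>2 < real p / (4 * real l)) (at_right (0 :: real))"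
    using order_tendstoD(2)[OF lim] by blast
  then obtain b where b: "0 < b" "\<And>\<beta>. 0 < \<beta> \<Longrightarrow> \<beta> < b \<Longrightarrow> (tanh \<beta>)\<^sup>2 < real p / (4 * real l)"
    unfolding eventually_at_right_field by auto
  have Pb: "?P (ereal b)" using b(1) phi_overlap_high_temperature[OF p less_imp_le[OF b(2)] l] by auto
  have "ereal b \<le> s" unfolding s_def using Pb by (intro Sup_upper) blast
  then have s0: "0 < s" using b(1) by (metis ereal_less(2) less_le_trans)
  have Ps: "?P s"
  proof (intro conjI allI impI s0)
    fix \<beta>' :: real assume a: "0 < \<beta>'" "ereal \<beta>' < s"
    then obtain c where "?P c" "ereal \<beta>' < c" unfolding s_def less_Sup_iff by auto
    then show "\<forall>q\<in>{-1..1}. phi_overlap p l q \<beta>' \<le> phi_overlap p l 0 \<beta>'" using a by blast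
  qed
  have "beta_ann p l = s"
    unfolding beta_ann_def
  proof (rule Greatest_equality)
    show "?P s" by (rule Ps)
    show "c \<le> s" if "?P c" for c unfolding s_def using that by (intro Sup_upper) simp
  qed
  then show "0 < beta_ann p l"
    and "0 < \<beta> \<Longrightarrow> ereal \<beta> < beta_ann p l \<Longrightarrow> q \<in> {-1..1} \<Longrightarrow> phi_overlap p l q \<beta> \<le> phi_overlap p l 0 \<beta>"
    using Ps s0 by auto
qed

lemma check_poly_le:
  fixes z :: real
  assumes "0 \<le> z" "z \<le> 1"
  shows "(1 + z) ^ p + (tanh \<beta>)\<^sup>2 * (1 - z) ^ p \<le> 2 ^ p + 1"
proof (rule add_mono)
  show "(1 + z) ^ p \<le> 2 ^ p" using assms by (intro power_mono) auto
  show "(tanh \<beta>)\<^sup>2 * (1 - z) ^ p \<le> 1"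
    by (rule mult_le_one) (use assms tanh_square_bounds[of \<beta>] in \<open>auto intro: power_le_one less_imp_le\<close>)
qed

text \<open>The gap between two inverse temperatures controls the overlap: at positive overlap
  \<open>\<phi>(q; \<beta>) - \<phi>(0; \<beta>)\<close> strictly increases with \<open>\<beta>\<close> because the optimal \<open>z\<close> is below \<open>1\<close>.\<close>

lemma check_poly_gap:
  fixes p :: nat
  assumes \<beta>: "0 < \<beta>" "\<beta> < \<beta>'" and z: "0 \<le> z" "z \<le> w" "w < 1"
  defines "d \<equiv> ((tanh \<beta>')\<^sup>2 - (tanh \<beta>)\<^sup>2) * (1 - w) ^ p / (2 ^ p + 1)"
  shows "0 < d" and "2 * ln (cosh \<beta>') - 2 * ln (cosh \<beta>) + ln (1 + d) \<le> ln (check_poly p \<beta>' z) - ln (check_poly p \<beta> z)"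
proof -
  let ?T = "(tanh \<beta>)\<^sup>2" and ?T' = "(tanh \<beta>')\<^sup>2"
  have tt: "tanh \<beta> < tanh \<beta>'" "0 < tanh \<beta>" using \<beta> by auto
  have TT: "?T < ?T'" using tt by (intro power_strict_mono) auto
  have two: "0 < (2 :: real) ^ p + 1" by (simp add: add_pos_pos)
  show d0: "0 < d" unfolding d_def using TT z two by (intro divide_pos_pos mult_pos_pos) auto
  let ?A = "(1 + z) ^ p + ?T * (1 - z) ^ p" and ?A' = "(1 + z) ^ p + ?T' * (1 - z) ^ p"
  have A: "0 < ?A" "0 < ?A'" using z by (auto intro!: add_pos_nonneg mult_nonneg_nonneg)
  have "?A * (1 + d) \<le> ?A'"
  proof -
    have "?A * d \<le> (2 ^ p + 1) * d" using check_poly_le[of z p \<beta>] z d0 by (intro mult_right_mono) auto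
    also have "\<dots> = (?T' - ?T) * (1 - w) ^ p" using two by (simp add: d_def)
    also have "\<dots> \<le> (?T' - ?T) * (1 - z) ^ p" using TT z by (intro mult_left_mono power_mono) auto
    finally show ?thesis by (simp add: algebra_simps)
  qed
  then have "ln (?A * (1 + d)) \<le> ln ?A'" using A d0 by simp
  then have "ln ?A + ln (1 + d) \<le> ln ?A'" using A d0 by (simp add: ln_mult)
  then show "2 * ln (cosh \<beta>') - 2 * ln (cosh \<beta>) + ln (1 + d) \<le> ln (check_poly p \<beta>' z) - ln (check_poly p \<beta> z)"
    unfolding check_poly_closed using A cosh_real_pos[of \<beta>] cosh_real_pos[of \<beta>'] by (simp add: ln_mult ln_realpow)
qed

text \<open>Pick \<beta>' between \<beta> and the annealed value, where \<phi>(q; \<beta>') \<le> 2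
  \<phi>(\<beta>'). Reusing the saddle point of \<beta>' as trial value at \<beta> gains c over the
  change of 2 \<phi>. The gain is uniform in q \<ge> \<eta>, because these saddle points stay below
  the one at \<eta>, which is less than 1.\<close>

lemma overlap_gap:
  assumes p: "2 \<le> p" and l: "0 < l" and \<beta>: "0 < \<beta>" and ann: "ereal \<beta> < beta_ann p l" and \<eta>: "0 < \<eta>" "\<eta> < 1"
  shows "\<exists>c>0. phi p l (2 * \<beta>) \<le> 2 * phi p l \<beta> - c \<and>
    (\<forall>q. \<eta> \<le> q \<longrightarrow> q < 1 \<longrightarrow> (\<exists>z>0. pair_exponent p l \<beta> ((1 - q) / 2) z \<le> 2 * phi p l \<beta> - c))"
proof -
  obtain \<beta>' where b': "\<beta> < \<beta>'" "ereal \<beta>' < beta_ann p l"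
    using ereal_dense2[OF ann] by auto
  have b'0: "0 < \<beta>'" using \<beta> b' by simp
  have le: "phi_overlap p l q \<beta>' \<le> 2 * phi p l \<beta>'" if "q \<in> {-1..1}" for q
    using beta_ann_properties(2)[OF p l b'0 b'(2) that] by (simp add: phi_overlap_0[OF p])
  define w where "w = z_overlap p \<beta>' \<eta>"
  have w1: "w < 1"
  proof -
    have "w \<le> 1" unfolding w_def using z_overlap_le_1[OF p] \<eta> by simp
    moreover have "w \<noteq> 1"
    proof
      assume "w = 1"
      then have "real p * ((1 - \<eta>) / 2) = real p / 2"
        using z_overlap(2)[of p \<eta> \<beta>'] mean_degree_1[OF p, of \<beta>'] p \<eta> by (simp add: w_def)
      then show False using p \<eta> by simp
    qed
    ultimately show ?thesis by simp
  qed
  define d where "d = ((tanh \<beta>')\<^sup>2 - (tanh \<beta>)\<^sup>2) * (1 - w) ^ p / (2 ^ p + 1)"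
  define c where "c = real l / real p * ln (1 + d)"
  have w0: "0 < w" unfolding w_def using z_overlap(1)[of p \<eta> \<beta>'] p \<eta> by simp
  have d0: "0 < d" unfolding d_def by (rule check_poly_gap(1)[OF \<beta> b'(1) _ order_refl w1]) (use w0 in simp)
  have c0: "0 < c" unfolding c_def using d0 p l by (intro mult_pos_pos ln_gt_zero) auto
  have gap: "real l / real p * ln (check_poly p \<beta> z) \<le> real l / real p * ln (check_poly p \<beta>' z) - (2 * phi p l \<beta>' - 2 * phi p l \<beta>) - c"
    if "0 \<le> z" "z \<le> w" for z
  proof -
    have "real l / real p * (2 * ln (cosh \<beta>') - 2 * ln (cosh \<beta>) + ln (1 + d)) \<le> real l / real p * (ln (check_poly p \<beta>' z) - ln (check_poly p \<beta> z))"
      unfolding d_def using check_poly_gap(2)[OF \<beta> b'(1) that w1, of p] by (intro mult_left_mono) auto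
    then show ?thesis by (simp add: phi_def c_def algebra_simps)
  qed
  show ?thesis
  proof (rule exI[of _ c], intro conjI c0 allI impI)
    \<comment> \<open>The end q = 1 is the case z = 0 of the same gap.\<close>
    have c00: "check_poly p b 0 = cosh (2 * b)" for b
      by (simp add: check_poly_eq p_plus_def p_minus_def)
    have "phi p l (2 * \<beta>') \<le> 2 * phi p l \<beta>'" using le[of 1] by (simp add: phi_overlap_1[OF p])
    then show "phi p l (2 * \<beta>) \<le> 2 * phi p l \<beta> - c"
      using gap[of 0] w0 unfolding c00 by (simp add: phi_def)
    fix q assume q: "\<eta> \<le> q" "q < 1"
    define z where "z = z_overlap p \<beta>' q"
    have z0: "0 < z" unfolding z_def using z_overlap(1)[of p q \<beta>'] p q \<eta> by simp
    have zw: "z \<le> w"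
    proof (rule ccontr)
      assume "\<not> z \<le> w"
      then have "mean_degree p \<beta>' w < mean_degree p \<beta>' z" using w0 p by (intro mean_degree_strict_mono) auto
      moreover have "real p * ((1 - q) / 2) \<le> real p * ((1 - \<eta>) / 2)" using q by (intro mult_left_mono) auto
      ultimately show False using z_overlap(2)[of p q \<beta>'] z_overlap(2)[of p \<eta> \<beta>'] p q \<eta> by (simp add: z_def w_def)
    qed
    have "pair_exponent p l \<beta>' ((1 - q) / 2) z \<le> 2 * phi p l \<beta>'"
      using le[of q] q \<eta> by (simp add: phi_overlap_def phi_overlap_open_eq z_def)
    then have "pair_exponent p l \<beta> ((1 - q) / 2) z \<le> 2 * phi p l \<beta> - c"
      using gap[of z] z0 zw unfolding pair_exponent_def by simp
    then show "\<exists>z>0. pair_exponent p l \<beta> ((1 - q) / 2) z \<le> 2 * phi p l \<beta> - c" using z0 by blast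
  qed
qed

lemma T_ann_less:
  assumes p: "2 \<le> p" and l: "0 < l" and \<beta>: "0 < \<beta>" and T: "T_ann p l < ereal (1 / \<beta>)"
  shows "ereal \<beta> < beta_ann p l"
proof -
  have pos: "0 < beta_ann p l" by (rule beta_ann_properties(1)[OF p l])
  show ?thesis
  proof (cases "beta_ann p l")
    case (real b)
    then have "1 / b < 1 / \<beta>" "0 < b" using T pos by (auto simp: T_ann_def one_ereal_def)
    then show ?thesis using \<beta> real by (simp add: field_simps)
  qed (use pos in auto)
qed

section \<open>The barrier temperature\<close>

lemma convex_ln_cosh: "convex_on UNIV (\<lambda>x :: real. ln (cosh x))"
proof (rule convex_on_realI)
  show "((\<lambda>x. ln (cosh x)) has_real_derivative tanh x) (at x)" for x :: real
    using cosh_real_pos[of x] by (auto intro!: derivative_eq_intros simp: tanh_def)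
qed auto

text \<open>\<beta> is the convex combination of (2 - 1 / \<alpha>) \<beta> and 2 \<beta> with
  weights \<alpha> and 1 - \<alpha>, and ln cosh is convex.\<close>

lemma phi_hat_nonneg:
  assumes \<alpha>: "1 / 2 < \<alpha>" "\<alpha> < 1"
  shows "0 \<le> phi_hat p l \<beta> \<alpha>"
proof -
  have "ln (cosh ((1 - (1 - \<alpha>)) *\<^sub>R ((2 - 1 / \<alpha>) * \<beta>) + (1 - \<alpha>) *\<^sub>R (2 * \<beta>)))
    \<le> (1 - (1 - \<alpha>)) * ln (cosh ((2 - 1 / \<alpha>) * \<beta>)) + (1 - \<alpha>) * ln (cosh (2 * \<beta>))"
    using \<alpha> by (intro convex_onD[OF convex_ln_cosh]) auto
  moreover have "(1 - (1 - \<alpha>)) *\<^sub>R ((2 - 1 / \<alpha>) * \<beta>) + (1 - \<alpha>) *\<^sub>R (2 * \<beta>) = \<beta>"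
    using \<alpha> by (simp add: field_simps)
  ultimately have "ln (cosh \<beta>) \<le> \<alpha> * ln (cosh ((2 - 1 / \<alpha>) * \<beta>)) + (1 - \<alpha>) * ln (cosh (2 * \<beta>))" by simp
  then have le: "real l / real p * ln (cosh \<beta>) \<le> real l / real p * (\<alpha> * ln (cosh ((2 - 1 / \<alpha>) * \<beta>)) + (1 - \<alpha>) * ln (cosh (2 * \<beta>)))"
    by (intro mult_left_mono) auto
  have gen: "\<alpha> * (a + k * b) + (1 - \<alpha>) * (a + k * c) - (a + k * d) = k * (\<alpha> * b + (1 - \<alpha>) * c) - k * d" for a b c d k :: real
    by (simp add: algebra_simps)
  have "phi_hat p l \<beta> \<alpha> = real l / real p * (\<alpha> * ln (cosh ((2 - 1 / \<alpha>) * \<beta>)) + (1 - \<alpha>) * ln (cosh (2 * \<beta>))) - real l / real p * ln (cosh \<beta>)"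
    unfolding phi_hat_def phi_def by (rule gen)
  then show ?thesis using le by simp
qed

lemma U_overlap_1: "U_overlap p l 1 \<beta> = 0"
  by (simp add: U_overlap_def)

text \<open>A real supremum says something only for a bounded set. For 0 < q < 1 the saddle point is
  at most 1, so its logarithm is not positive, and f \<ge> 1; this bounds \<phi>(q; \<beta>) from
  below.\<close>

lemma U_overlap_bdd:
  assumes p: "2 \<le> p" and l: "1 \<le> l"
  shows "bdd_above ((\<lambda>q. U_overlap p l q \<beta>) ` {0<..1})"
proof (rule bdd_aboveI2)
  fix q :: real assume q: "q \<in> {0<..1}"
  show "U_overlap p l q \<beta> \<le> max 0 (phi p l (2 * \<beta>) - (ln 2 - (real l - 1) * ln 2))"
  proof (cases "q = 1")
    case False
    then have q: "0 < q" "q < 1" using q by auto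
    let ?z = "z_overlap p \<beta> q" and ?x = "(1 - q) / 2"
    have z: "0 < ?z" "?z \<le> 1" using z_overlap(1)[of p q \<beta>] z_overlap_le_1[of p q \<beta>] q p by auto
    have "0 \<le> real l / real p * ln (check_poly p \<beta> ?z)"
      using check_poly_ge_1(1)[of ?z p \<beta>] z by (intro mult_nonneg_nonneg) auto
    moreover have "real l * ?x * ln ?z \<le> 0" using z q by (intro mult_nonneg_nonpos) auto
    moreover have "(real l - 1) * entropy_fun ?x \<le> (real l - 1) * ln 2"
      using entropy_le_ln2[of q] q l by (intro mult_left_mono) auto
    ultimately have "ln 2 - (real l - 1) * ln 2 \<le> phi_overlap_open p l q \<beta>"
      unfolding phi_overlap_open_eq pair_exponent_def by linarith
    then show ?thesis using q by (simp add: U_overlap_def phi_overlap_1[OF p]) (simp add: phi_overlap_def)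
  qed (simp add: U_overlap_1)
qed

lemma tanh_le_self: "0 \<le> x \<Longrightarrow> tanh x \<le> (x :: real)"
proof -
  assume x: "0 \<le> x"
  have "(\<lambda>x. x - tanh x) 0 \<le> (\<lambda>x. x - tanh x) x"
  proof (rule DERIV_nonneg_imp_nondecreasing[OF x])
    fix y :: real
    have "((\<lambda>x. x - tanh x) has_real_derivative (1 - (1 - (tanh y)\<^sup>2))) (at y)"
      using cosh_real_pos[of y] by (auto intro!: derivative_eq_intros)
    then show "\<exists>d. ((\<lambda>x. x - tanh x) has_real_derivative d) (at y) \<and> 0 \<le> d" by fastforce
  qed
  then show ?thesis by simp
qed

text \<open>The derivative of y^2 / 2 - ln (cosh y) is y - tanh y \<ge> 0 for y \<ge> 0. It is the
  sub-Gaussian bound for a random sign, used again for the concentration in the couplings.\<close>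

lemma cosh_le_exp_square: "cosh (x :: real) \<le> exp (x\<^sup>2 / 2)"
proof -
  have "ln (cosh y) \<le> y\<^sup>2 / 2" if y: "0 \<le> y" for y :: real
  proof -
    have "(\<lambda>y. y\<^sup>2 / 2 - ln (cosh y)) 0 \<le> (\<lambda>y. y\<^sup>2 / 2 - ln (cosh y)) y"
    proof (rule DERIV_nonneg_imp_nondecreasing[OF y])
      fix x :: real assume x: "0 \<le> x"
      have "((\<lambda>y. y\<^sup>2 / 2 - ln (cosh y)) has_real_derivative (x - tanh x)) (at x)"
        using cosh_real_pos[of x] by (auto intro!: derivative_eq_intros simp: tanh_def)
      then show "\<exists>d. ((\<lambda>y. y\<^sup>2 / 2 - ln (cosh y)) has_real_derivative d) (at x) \<and> 0 \<le> d"
        using tanh_le_self[OF x] by fastforce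
    qed
    then show ?thesis by simp
  qed
  from this[of "\<bar>x\<bar>"] have "ln (cosh x) \<le> x\<^sup>2 / 2" by simp
  then show ?thesis using cosh_real_pos[of x] by (metis exp_le_cancel_iff exp_ln)
qed

text \<open>For \<open>\<beta> \<rightarrow> \<infinity>\<close> the trial value \<open>z = \<surd>x\<close> at small \<open>x = (1 - q) / 2\<close> gives
  \<open>U \<approx> (l / 2 - 1) x log (1 / x) > 0\<close>.\<close>

lemma U_overlap_lower:
  assumes p: "3 \<le> p" and l: "3 \<le> l"
  defines "x \<equiv> exp (- (real l * real p + 2))"
  shows "x - real l / real p * (2 ^ p / cosh (2 * \<beta>)) \<le> U_overlap p l (1 - 2 * x) \<beta>" "0 < x" "x < 1 / 2"
proof -
  show x0: "0 < x" by (simp add: x_def)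
  have "0 \<le> real l * real p" by simp
  then have "x < exp (- 1)" unfolding x_def exp_less_cancel_iff by linarith
  also have "exp (- 1 :: real) \<le> 1 / 2" using exp_ge_add_one_self[of 1] by (simp add: exp_minus field_simps)
  finally show x1: "x < 1 / 2" by simp
  define z where "z = sqrt x"
  define C where "C = cosh (2 * \<beta>)"
  have C: "1 \<le> C" by (simp add: C_def cosh_real_ge_1)
  have z: "0 < z" "z \<le> 1" "z\<^sup>2 = x" using x0 x1 by (auto simp: z_def)
  have lnz: "ln z = ln x / 2" using x0 by (simp add: z_def ln_sqrt)
  have pm: "p_minus p z \<le> 2 ^ p"
  proof -
    have gen: "(a - b) / 2 \<le> c" if "a \<le> c" "0 \<le> b" "0 \<le> c" for a b c :: real using that by simp
    show ?thesis unfolding p_minus_def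
      by (rule gen) (use z in \<open>auto intro!: power_mono\<close>)
  qed
  have pm0: "0 \<le> p_minus p z"
  proof -
    have "(1 - z) ^ p \<le> (1 + z) ^ p" using z by (intro power_mono) auto
    then show ?thesis by (simp add: p_minus_def)
  qed
  have pp: "p_plus p z \<le> exp ((real p)\<^sup>2 * x / 2)"
  proof -
    have "(1 + z) ^ p \<le> exp z ^ p" "(1 - z) ^ p \<le> exp (- z) ^ p"
      using z exp_ge_add_one_self[of z] exp_ge_add_one_self[of "- z"] by (auto intro!: power_mono)
    then have "p_plus p z \<le> cosh (real p * z)"
      unfolding p_plus_def cosh_def by (simp add: exp_of_nat_mult[symmetric])
    also have "\<dots> \<le> exp ((real p * z)\<^sup>2 / 2)" by (rule cosh_le_exp_square)
    finally show ?thesis by (simp add: power_mult_distrib z(3))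
  qed
  have pp1: "1 \<le> p_plus p z"
  proof -
    have "1 + real p * z \<le> (1 + z) ^ p" "1 + real p * (- z) \<le> (1 + - z) ^ p"
      using z Bernoulli_inequality[of z p] Bernoulli_inequality[of "- z" p] by auto
    then show ?thesis by (simp add: p_plus_def)
  qed
  have "check_poly p \<beta> z = C * (p_plus p z + p_minus p z / C)"
    using C by (simp add: check_poly_eq C_def distrib_left)
  then have "ln (check_poly p \<beta> z) = ln C + ln (p_plus p z + p_minus p z / C)"
  proof -
    have "0 < p_plus p z + p_minus p z / C" using pp1 pm0 C by (intro add_pos_nonneg divide_nonneg_nonneg) auto
    then show "check_poly p \<beta> z = C * (p_plus p z + p_minus p z / C) \<Longrightarrow> ?thesis" using C by (simp add: ln_mult)
  qed
  also have "ln (p_plus p z + p_minus p z / C) \<le> ln (p_plus p z) + 2 ^ p / C"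
  proof -
    have "p_plus p z + p_minus p z / C \<le> p_plus p z + p_plus p z * (2 ^ p / C)"
    proof -
      have "p_minus p z / C \<le> 1 * (2 ^ p / C)" using pm C by (simp add: divide_right_mono)
      also have "\<dots> \<le> p_plus p z * (2 ^ p / C)" using pp1 C by (intro mult_right_mono) auto
      finally show ?thesis by simp
    qed
    also have "\<dots> = p_plus p z * (1 + 2 ^ p / C)" by (simp add: distrib_left)
    also have "\<dots> \<le> p_plus p z * exp (2 ^ p / C)" using pp1 by (intro mult_left_mono exp_ge_add_one_self) auto
    finally have "ln (p_plus p z + p_minus p z / C) \<le> ln (p_plus p z * exp (2 ^ p / C))"
      using pp1 pm0 C by (intro ln_mono) (auto intro!: add_pos_nonneg)
    then show ?thesis using pp1 by (simp add: ln_mult)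
  qed
  also have "ln (p_plus p z) \<le> (real p)\<^sup>2 * x / 2"
    using ln_mono[OF pp] pp1 by simp
  finally have lf: "ln (check_poly p \<beta> z) \<le> ln C + ((real p)\<^sup>2 * x / 2 + 2 ^ p / C)" by simp
  have h: "- x * ln x \<le> entropy_fun x"
    using x0 x1 unfolding entropy_fun_def by (simp add: mult_nonneg_nonpos)
  have lx: "ln x = - (real l * real p + 2)" by (simp add: x_def)
  have "phi_overlap_open p l (1 - 2 * x) \<beta> \<le> pair_exponent p l \<beta> x z"
    using phi_overlap_open_le[of p "1 - 2 * x" z l \<beta>] p x0 x1 z by simp
  also have "\<dots> \<le> ln 2 - (real l - 1) * (- x * ln x) + real l / real p * (ln C + ((real p)\<^sup>2 * x / 2 + 2 ^ p / C)) - real l * x * (ln x / 2)"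
  proof -
    have "(real l - 1) * (- x * ln x) \<le> (real l - 1) * entropy_fun x" using h l by (intro mult_left_mono) auto
    moreover have "real l / real p * ln (check_poly p \<beta> z) \<le> real l / real p * (ln C + ((real p)\<^sup>2 * x / 2 + 2 ^ p / C))"
      using lf by (intro mult_left_mono) auto
    ultimately show ?thesis unfolding pair_exponent_def lnz by linarith
  qed
  finally have "phi_overlap_open p l (1 - 2 * x) \<beta> \<le> \<dots>" .
  moreover have "U_overlap p l (1 - 2 * x) \<beta> = ln 2 + real l / real p * ln C - phi_overlap_open p l (1 - 2 * x) \<beta>"
    using p x0 x1 by (simp add: U_overlap_def phi_overlap_1 C_def phi_def) (simp add: phi_overlap_def)
  ultimately have "(real l - 1) * (- x * ln x) - real l / real p * ((real p)\<^sup>2 * x / 2 + 2 ^ p / C) + real l * x * (ln x / 2) \<le> U_overlap p l (1 - 2 * x) \<beta>"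
    by (simp add: distrib_left)
  moreover have "(real l - 1) * (- x * ln x) - real l / real p * ((real p)\<^sup>2 * x / 2 + 2 ^ p / C) + real l * x * (ln x / 2)
    = x * ((real l / 2 - 1) * (real l * real p + 2) - real l * real p / 2) - real l / real p * (2 ^ p / C)"
    unfolding lx using p by (simp add: field_simps power2_eq_square)
  \<comment> \<open>The exponent in the choice of x is made for this: as l / 2 - 1 \<ge> 1 / 2, the
    bracket is at least (l p + 2) / 2 - l p / 2 = 1.\<close>
  moreover have "x * 1 \<le> x * ((real l / 2 - 1) * (real l * real p + 2) - real l * real p / 2)"
  proof (rule mult_left_mono)
    have "(1 / 2) * (real l * real p + 2) \<le> (real l / 2 - 1) * (real l * real p + 2)"
      using l by (intro mult_right_mono) auto
    then show "1 \<le> (real l / 2 - 1) * (real l * real p + 2) - real l * real p / 2" by simp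
  qed (use x0 in simp)
  ultimately show "x - real l / real p * (2 ^ p / cosh (2 * \<beta>)) \<le> U_overlap p l (1 - 2 * x) \<beta>" by (simp add: C_def)
qed

lemma Upsilon_bdd:
  "bdd_above ((\<lambda>\<alpha>. (1 - \<alpha>) * Upsilon0 p l \<beta> - phi_hat p l \<beta> \<alpha>) ` {1/2<..<1})"
proof (rule bdd_aboveI2)
  fix \<alpha> :: real assume a: "\<alpha> \<in> {1/2<..<1}"
  have "(1 - \<alpha>) * Upsilon0 p l \<beta> \<le> (1 - \<alpha>) * \<bar>Upsilon0 p l \<beta>\<bar>" using a by (intro mult_left_mono) auto
  also have "\<dots> \<le> 1 * \<bar>Upsilon0 p l \<beta>\<bar>" using a by (intro mult_right_mono) auto
  finally show "(1 - \<alpha>) * Upsilon0 p l \<beta> - phi_hat p l \<beta> \<alpha> \<le> \<bar>Upsilon0 p l \<beta>\<bar>"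
    using phi_hat_nonneg[of \<alpha> p l \<beta>] a by simp
qed

text \<open>The choice \<alpha> = 3 / 4 suffices. As ln cosh is asymptotically y - ln 2, both the
  linear parts and the constants cancel in \<open>phi_hat\<close>, which tends to 0, while U at the
  overlap 1 - 2 x stays bounded below by nearly x.\<close>

lemma Upsilon_pos_low_temperature:
  assumes p: "3 \<le> p" and l: "3 \<le> l"
  shows "\<exists>b\<ge>0. \<forall>\<beta>>b. 0 < Upsilon p l \<beta>"
proof -
  define x where "x = exp (- (real l * real p + 2))"
  have x0: "0 < x" by (simp add: x_def)
  let ?r = "real l / real p"
  let ?g = "\<lambda>\<beta>. 1 / 4 * (x - ?r * (2 ^ p / cosh (2 * \<beta>))) - ?r * (3 / 4 * ln (cosh (2 / 3 * \<beta>)) + 1 / 4 * ln (cosh (2 * \<beta>)) - ln (cosh \<beta>))"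
  have l1: "((\<lambda>\<beta> :: real. 3 / 4 * ln (cosh (2 / 3 * \<beta>)) + 1 / 4 * ln (cosh (2 * \<beta>)) - ln (cosh \<beta>)) \<longlongrightarrow> 0) at_top"
    unfolding cosh_field_def by real_asymp
  have l2: "((\<lambda>\<beta> :: real. 2 ^ p / cosh (2 * \<beta>)) \<longlongrightarrow> 0) at_top"
    unfolding cosh_field_def by real_asymp
  have "(?g \<longlongrightarrow> 1 / 4 * (x - ?r * 0) - ?r * 0) at_top"
    by (intro tendsto_diff tendsto_mult[OF tendsto_const] tendsto_const l1 l2)
  then have "eventually (\<lambda>\<beta>. 0 < ?g \<beta>) at_top"
    by (rule order_tendstoD(1)) (use x0 in simp)
  then obtain b where b: "\<And>\<beta>. b \<le> \<beta> \<Longrightarrow> 0 < ?g \<beta>" unfolding eventually_at_top_linorder by blast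
  show ?thesis
  proof (intro exI[of _ "max 0 b"] conjI allI impI)
    fix \<beta> assume "max 0 b < \<beta>"
    then have g: "0 < ?g \<beta>" by (intro b) simp
    note U = U_overlap_lower(1)[OF p l, of \<beta>, folded x_def] U_overlap_lower(2,3)[OF p l, folded x_def]
    have "U_overlap p l (1 - 2 * x) \<beta> \<le> Upsilon0 p l \<beta>"
      unfolding Upsilon0_def by (rule cSUP_upper[OF _ U_overlap_bdd]) (use U p l in auto)
    moreover have "phi_hat p l \<beta> (3 / 4) = ?r * (3 / 4 * ln (cosh (2 / 3 * \<beta>)) + 1 / 4 * ln (cosh (2 * \<beta>)) - ln (cosh \<beta>))"
      by (simp add: phi_hat_def phi_def algebra_simps)
    moreover have "1 / 4 * a - c \<le> (1 - 3 / 4) * b - d" if "a \<le> u" "u \<le> b" "d = c" for a b c d u :: real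
      using that by simp
    ultimately have "?g \<beta> \<le> (1 - 3 / 4) * Upsilon0 p l \<beta> - phi_hat p l \<beta> (3 / 4)" using U(1) by blast
    also have "\<dots> \<le> Upsilon p l \<beta>"
      unfolding Upsilon_def by (rule cSUP_upper[OF _ Upsilon_bdd]) auto
    finally show "0 < Upsilon p l \<beta>" by (rule less_le_trans[OF g])
  qed simp
qed

text \<open>The condition on b only concerns \<beta>' strictly above b, hence passes to the infimum,
  which is the least element.\<close>

lemma beta_barr_properties:
  assumes p: "3 \<le> p" and l: "3 \<le> l"
  shows "0 \<le> beta_barr p l" and "beta_barr p l < \<beta> \<Longrightarrow> 0 < Upsilon p l \<beta>"
proof -
  let ?P = "\<lambda>b. 0 \<le> b \<and> (\<forall>\<beta>'>b. 0 < Upsilon p l \<beta>')"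
  define s where "s = Inf (Collect ?P)"
  have ne: "Collect ?P \<noteq> {}" using Upsilon_pos_low_temperature[OF p l] by auto
  have bdd: "bdd_below (Collect ?P)" by (rule bdd_belowI[of _ 0]) simp
  have s0: "0 \<le> s" unfolding s_def by (rule cInf_greatest[OF ne]) simp
  have Ps: "?P s"
  proof (intro conjI s0 allI impI)
    fix \<beta>' assume "s < \<beta>'"
    then obtain b where "?P b" "b < \<beta>'" unfolding s_def using cInf_less_iff[OF ne bdd] by auto
    then show "0 < Upsilon p l \<beta>'" by blast
  qed
  have "beta_barr p l = s"
    unfolding beta_barr_def
  proof (rule Least_equality)
    show "s \<le> b" if "?P b" for b unfolding s_def using that bdd by (intro cInf_lower) simp
  qed (rule Ps)
  then show "0 \<le> beta_barr p l" and "beta_barr p l < \<beta> \<Longrightarrow> 0 < Upsilon p l \<beta>" using Ps by auto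
qed

text \<open>Extracts \<alpha> and q from the two nested suprema. The overlap q = 1 is excluded
  because U vanishes there while \<open>phi_hat\<close> is nonnegative.\<close>

lemma less_T_barr:
  assumes p: "3 \<le> p" and l: "3 \<le> l" and \<beta>: "0 < \<beta>" and T: "ereal (1 / \<beta>) < T_barr p l"
  shows "\<exists>\<alpha> q. 1 / 2 < \<alpha> \<and> \<alpha> < 1 \<and> 0 < q \<and> q < 1 \<and> phi_hat p l \<beta> \<alpha> < (1 - \<alpha>) * (phi p l (2 * \<beta>) - phi_overlap_open p l q \<beta>)"
proof -
  have b0: "0 \<le> beta_barr p l" by (rule beta_barr_properties(1)[OF p l])
  have "beta_barr p l < \<beta>"
  proof (cases "beta_barr p l = 0")
    case False
    then have "1 / \<beta> < 1 / beta_barr p l" using T by (simp add: T_barr_def one_ereal_def)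
    then show ?thesis using \<beta> b0 False by (simp add: field_simps)
  qed (use \<beta> in simp)
  then have U: "0 < Upsilon p l \<beta>" by (rule beta_barr_properties(2)[OF p l])
  obtain \<alpha> where a: "\<alpha> \<in> {1/2<..<1}" "0 < (1 - \<alpha>) * Upsilon0 p l \<beta> - phi_hat p l \<beta> \<alpha>"
  proof (rule ccontr)
    assume "\<not> thesis"
    then have "(1 - \<alpha>) * Upsilon0 p l \<beta> - phi_hat p l \<beta> \<alpha> \<le> 0" if "\<alpha> \<in> {1/2<..<1}" for \<alpha>
      using that \<open>\<And>\<alpha>. \<alpha> \<in> {1/2<..<1} \<Longrightarrow> 0 < (1 - \<alpha>) * Upsilon0 p l \<beta> - phi_hat p l \<beta> \<alpha> \<Longrightarrow> thesis\<close> by force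
    then have "Upsilon p l \<beta> \<le> 0" unfolding Upsilon_def by (intro cSUP_least) auto
    then show False using U by simp
  qed
  define y where "y = phi_hat p l \<beta> \<alpha> / (1 - \<alpha>)"
  have y: "y < Upsilon0 p l \<beta>" using a by (simp add: y_def field_simps)
  have y0: "0 \<le> y" unfolding y_def using phi_hat_nonneg[of \<alpha> p l \<beta>] a by simp
  have "\<exists>q\<in>{0<..1}. y < U_overlap p l q \<beta>"
  proof (rule ccontr)
    assume "\<not> (\<exists>q\<in>{0<..1}. y < U_overlap p l q \<beta>)"
    then have "Upsilon0 p l \<beta> \<le> y" unfolding Upsilon0_def by (intro cSUP_least) (auto simp: not_less)
    then show False using y by simp
  qed
  then obtain q where q: "q \<in> {0<..1}" "y < U_overlap p l q \<beta>" by blast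
  have "q \<noteq> 1" using q y0 by (auto simp: U_overlap_1)
  then have "U_overlap p l q \<beta> = phi p l (2 * \<beta>) - phi_overlap_open p l q \<beta>"
    using q p by (simp add: U_overlap_def phi_overlap_1) (simp add: phi_overlap_def)
  moreover have "phi_hat p l \<beta> \<alpha> < (1 - \<alpha>) * U_overlap p l q \<beta>" using q a by (simp add: y_def field_simps)
  ultimately show ?thesis using a q \<open>q \<noteq> 1\<close> by (intro exI[of _ \<alpha>] exI[of _ q]) auto
qed

section \<open>Lower bound on the partition function\<close>

lemma expectation_couplings_insert:
  fixes F :: "(nat \<Rightarrow> real) \<Rightarrow> real"
  assumes A: "finite A" "x \<notin> A"
  defines "P \<equiv> \<lambda>A. Pi_pmf A 0 (\<lambda>_. pmf_of_set {-1, 1 :: real})"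
  shows "measure_pmf.expectation (P (insert x A)) F
    = measure_pmf.expectation (P A) (\<lambda>J. (F (J(x := 1)) + F (J(x := -1))) / 2)"
proof -
  have finP: "finite (set_pmf (P A))" unfolding P_def using A by (simp add: set_Pi_pmf finite_PiE_dflt)
  have int: "integrable (measure_pmf (P A)) f" for f :: "_ \<Rightarrow> real"
    by (rule integrable_measure_pmf_finite[OF finP])
  have "P (insert x A) = bind_pmf (pmf_of_set {-1, 1 :: real}) (\<lambda>v. map_pmf (\<lambda>J. J(x := v)) (P A))"
    unfolding P_def using A by (simp add: Pi_pmf_insert pair_pmf_def map_pmf_def bind_assoc_pmf bind_return_pmf)
  then have "measure_pmf.expectation (P (insert x A)) F
    = (\<Sum>v\<in>{-1, 1 :: real}. pmf (pmf_of_set {-1, 1}) v *\<^sub>R measure_pmf.expectation (map_pmf (\<lambda>J. J(x := v)) (P A)) F)"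
    by (simp only:) (rule pmf_expectation_bind, use finP in auto)
  also have "\<dots> = measure_pmf.expectation (P A) (\<lambda>J. (F (J(x := 1)) + F (J(x := -1))) / 2)"
    using int by (simp add: add_divide_distrib)
  finally show ?thesis .
qed

text \<open>The bounded differences inequality for random signs, by averaging out one sign at a
  time: with half-difference h this multiplies the exponential by cosh h \<le> exp (h^2 / 2) \<le>
  exp (c^2 / 8), and the averaged function has the same bounded differences.\<close>

lemma mgf_bounded_differences:
  fixes f :: "(nat \<Rightarrow> real) \<Rightarrow> real"
  assumes "finite A" "\<And>J a. a \<in> A \<Longrightarrow> \<bar>f (J(a := 1)) - f (J(a := -1))\<bar> \<le> c"
  defines "P \<equiv> \<lambda>A. Pi_pmf A 0 (\<lambda>_. pmf_of_set {-1, 1 :: real})"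
  shows "measure_pmf.expectation (P A) (\<lambda>J. exp (f J)) \<le> exp (measure_pmf.expectation (P A) f + c\<^sup>2 * card A / 8)"
  using assms(1,2)
proof (induction A arbitrary: f rule: finite_induct)
  case empty
  then show ?case by (simp add: P_def)
next
  case (insert x A)
  have finP: "finite (set_pmf (P A))" unfolding P_def using insert by (simp add: set_Pi_pmf finite_PiE_dflt)
  have int: "integrable (measure_pmf (P A)) g" for g :: "_ \<Rightarrow> real"
    by (rule integrable_measure_pmf_finite[OF finP])
  define g where "g J = (f (J(x := 1)) + f (J(x := -1))) / 2" for J
  have gl: "\<bar>g (J(a := 1)) - g (J(a := -1))\<bar> \<le> c" if a: "a \<in> A" for J a
  proof -
    have ax: "a \<noteq> x" using a insert.hyps by auto
    have "\<bar>f ((J(x := s))(a := 1)) - f ((J(x := s))(a := -1))\<bar> \<le> c" for s by (rule insert.prems) (use a in simp)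
    then have "\<bar>f (J(a := 1, x := s)) - f (J(a := -1, x := s))\<bar> \<le> c" for s
      by (simp only: fun_upd_twist[OF ax])
    from this[of 1] this[of "-1"] show ?thesis unfolding g_def by (simp add: abs_le_iff field_simps)
  qed
  have "measure_pmf.expectation (P (insert x A)) (\<lambda>J. exp (f J))
    = measure_pmf.expectation (P A) (\<lambda>J. (exp (f (J(x := 1))) + exp (f (J(x := -1)))) / 2)"
    unfolding P_def by (rule expectation_couplings_insert) (use insert in auto)
  also have "\<dots> \<le> measure_pmf.expectation (P A) (\<lambda>J. exp (g J) * exp (c\<^sup>2 / 8))"
  proof (rule integral_mono[OF int int])
    fix J
    define h where "h = (f (J(x := 1)) - f (J(x := -1))) / 2"
    have e: "f (J(x := 1)) = g J + h" "f (J(x := -1)) = g J - h" by (simp_all add: g_def h_def field_simps)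
    have "\<bar>f (J(x := 1)) - f (J(x := -1))\<bar> \<le> c" by (rule insert.prems) simp
    moreover have "2 * h = f (J(x := 1)) - f (J(x := -1))" by (simp add: h_def)
    ultimately have "\<bar>2 * h\<bar> \<le> c" by simp
    then have "(2 * h)\<^sup>2 \<le> c\<^sup>2" by (metis abs_le_square_iff abs_of_nonneg abs_ge_zero order_trans)
    then have hc: "h\<^sup>2 / 2 \<le> c\<^sup>2 / 8" by (simp add: power_mult_distrib)
    have "(exp (f (J(x := 1))) + exp (f (J(x := -1)))) / 2 = exp (g J) * cosh h"
      unfolding e by (simp add: cosh_def exp_add exp_diff exp_minus field_simps)
    also have "\<dots> \<le> exp (g J) * exp (h\<^sup>2 / 2)" by (intro mult_left_mono cosh_le_exp_square) auto
    also have "\<dots> \<le> exp (g J) * exp (c\<^sup>2 / 8)" using hc by simp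
    finally show "(exp (f (J(x := 1))) + exp (f (J(x := -1)))) / 2 \<le> exp (g J) * exp (c\<^sup>2 / 8)" .
  qed
  also have "\<dots> = measure_pmf.expectation (P A) (\<lambda>J. exp (g J)) * exp (c\<^sup>2 / 8)" by simp
  also have "\<dots> \<le> exp (measure_pmf.expectation (P A) g + c\<^sup>2 * card A / 8) * exp (c\<^sup>2 / 8)"
    by (intro mult_right_mono insert.IH gl) auto
  also have "measure_pmf.expectation (P A) g = measure_pmf.expectation (P (insert x A)) f"
    unfolding g_def P_def by (rule expectation_couplings_insert[symmetric]) (use insert in auto)
  finally show ?case using insert.hyps by (simp add: mult_exp_exp algebra_simps add_divide_distrib)
qed

lemma mgf_couplings:
  fixes f :: "(nat \<Rightarrow> real) \<Rightarrow> real"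
  assumes "\<And>J a. a < M \<Longrightarrow> \<bar>f (J(a := 1)) - f (J(a := -1))\<bar> \<le> c"
  shows "measure_pmf.expectation (couplings_pmf M) (\<lambda>J. exp (\<theta> * f J))
    \<le> exp (\<theta> * measure_pmf.expectation (couplings_pmf M) f + (\<theta> * c)\<^sup>2 * M / 8)"
proof -
  have "\<bar>\<theta> * f (J(a := 1)) - \<theta> * f (J(a := -1))\<bar> \<le> \<bar>\<theta>\<bar> * c" if "a \<in> {..<M}" for J a
    using mult_left_mono[OF assms[of a J], of "\<bar>\<theta>\<bar>"] that by (simp add: abs_mult[symmetric] right_diff_distrib)
  from mgf_bounded_differences[OF finite_lessThan this]
  show ?thesis by (simp add: couplings_pmf_def power_mult_distrib)
qed

lemma markov_pmf:
  fixes f :: "'a \<Rightarrow> real"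
  assumes fin: "finite (set_pmf P)" and a: "0 < a" and f: "\<And>x. x \<in> set_pmf P \<Longrightarrow> 0 \<le> f x"
    and B: "\<And>x. x \<in> set_pmf P \<Longrightarrow> x \<in> B \<Longrightarrow> a \<le> f x"
  shows "measure_pmf.prob P B \<le> measure_pmf.expectation P f / a"
proof -
  have int: "integrable (measure_pmf P) g" for g :: "_ \<Rightarrow> real"
    by (rule integrable_measure_pmf_finite[OF fin])
  have "measure_pmf.prob P B = measure_pmf.expectation P (indicator B)" by simp
  also have "\<dots> \<le> measure_pmf.expectation P (\<lambda>x. f x / a)"
    by (rule integral_mono_AE[OF int int]) (use a f B in \<open>auto simp: AE_measure_pmf_iff indicator_def\<close>)
  finally show ?thesis by simp
qed

lemma chernoff_couplings:
  fixes f :: "(nat \<Rightarrow> real) \<Rightarrow> real"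
  assumes f: "\<And>J a. a < M \<Longrightarrow> \<bar>f (J(a := 1)) - f (J(a := -1))\<bar> \<le> c" and \<theta>: "0 \<le> \<theta>"
  shows "measure_pmf.prob (couplings_pmf M) {J. measure_pmf.expectation (couplings_pmf M) f + s \<le> f J} \<le> exp ((\<theta> * c)\<^sup>2 * M / 8 - \<theta> * s)"
    and "measure_pmf.prob (couplings_pmf M) {J. f J \<le> measure_pmf.expectation (couplings_pmf M) f - s} \<le> exp ((\<theta> * c)\<^sup>2 * M / 8 - \<theta> * s)"
proof -
  let ?E = "measure_pmf.expectation (couplings_pmf M)"
  have "measure_pmf.prob (couplings_pmf M) {J. ?E f + s \<le> f J} \<le> ?E (\<lambda>J. exp (\<theta> * f J)) / exp (\<theta> * (?E f + s))"
    by (rule markov_pmf[OF finite_set_couplings]) (use \<theta> in \<open>auto intro: mult_left_mono\<close>)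
  also have "\<dots> \<le> exp (\<theta> * ?E f + (\<theta> * c)\<^sup>2 * M / 8) / exp (\<theta> * (?E f + s))"
    by (intro divide_right_mono mgf_couplings f) auto
  also have "\<dots> = exp ((\<theta> * c)\<^sup>2 * M / 8 - \<theta> * s)" by (simp add: exp_diff[symmetric] algebra_simps)
  finally show "measure_pmf.prob (couplings_pmf M) {J. ?E f + s \<le> f J} \<le> exp ((\<theta> * c)\<^sup>2 * M / 8 - \<theta> * s)" .
  have "measure_pmf.prob (couplings_pmf M) {J. f J \<le> ?E f - s} \<le> ?E (\<lambda>J. exp (- \<theta> * f J)) / exp (- \<theta> * (?E f - s))"
    by (rule markov_pmf[OF finite_set_couplings]) (use \<theta> in \<open>auto intro: mult_left_mono\<close>)
  also have "\<dots> \<le> exp (- \<theta> * ?E f + (- \<theta> * c)\<^sup>2 * M / 8) / exp (- \<theta> * (?E f - s))"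
    by (intro divide_right_mono mgf_couplings f) auto
  also have "\<dots> = exp ((\<theta> * c)\<^sup>2 * M / 8 - \<theta> * s)" by (simp add: exp_diff[symmetric] algebra_simps)
  finally show "measure_pmf.prob (couplings_pmf M) {J. f J \<le> ?E f - s} \<le> exp ((\<theta> * c)\<^sup>2 * M / 8 - \<theta> * s)" .
qed

text \<open>Integrates the pointwise bound X \<le> m / 2 + X^2 / (4 R m) + R m 1(X \<ge> m / 2), in
  which the case X \<ge> m / 2 is the inequality of arithmetic and geometric means. The first two
  terms use up 3 m / 4 of the mean.\<close>

lemma paley_zygmund:
  fixes X :: "'a \<Rightarrow> real"
  assumes fin: "finite (set_pmf P)" and m: "0 < m" "measure_pmf.expectation P X = m"
    and R: "0 < R" "measure_pmf.expectation P (\<lambda>x. (X x)\<^sup>2) \<le> R * m\<^sup>2"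
  shows "1 / (4 * R) \<le> measure_pmf.prob P {x. m / 2 \<le> X x}"
proof -
  have int: "integrable (measure_pmf P) g" for g :: "_ \<Rightarrow> real"
    by (rule integrable_measure_pmf_finite[OF fin])
  let ?B = "{x. m / 2 \<le> X x}"
  have "m \<le> measure_pmf.expectation P (\<lambda>x. m / 2 + (1 / (4 * R * m)) * (X x)\<^sup>2 + R * m * indicator ?B x)"
    unfolding m(2)[symmetric]
  proof (rule integral_mono[OF int int])
    fix x
    show "X x \<le> measure_pmf.expectation P X / 2 + 1 / (4 * R * measure_pmf.expectation P X) * (X x)\<^sup>2
        + R * measure_pmf.expectation P X * indicator {x. measure_pmf.expectation P X / 2 \<le> X x} x"
    proof (cases "m / 2 \<le> X x")
      case True
      have "0 \<le> (X x / (2 * R * m) - 1)\<^sup>2 * (R * m)" using R m by (intro mult_nonneg_nonneg) auto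
      also have "\<dots> = 1 / (4 * R * m) * (X x)\<^sup>2 + R * m - X x"
        using R(1) m(1) by (simp add: power2_eq_square field_simps)
      finally show ?thesis using True m by simp
    next
      case False
      then show ?thesis using R m by (simp add: add_increasing2)
    qed
  qed
  also have "\<dots> = m / 2 + (1 / (4 * R * m)) * measure_pmf.expectation P (\<lambda>x. (X x)\<^sup>2) + R * m * measure_pmf.prob P ?B"
    using int by simp
  also have "\<dots> \<le> m / 2 + (1 / (4 * R * m)) * (R * m\<^sup>2) + R * m * measure_pmf.prob P ?B"
    using R m by (intro add_mono mult_left_mono) auto
  also have "(1 / (4 * R * m)) * (R * m\<^sup>2) = m / 4" using R(1) m(1) by (simp add: power2_eq_square field_simps)
  finally have "m / 4 \<le> R * m * measure_pmf.prob P ?B" by simp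
  then show ?thesis using R(1) m(1) by (simp add: field_simps)
qed

section \<open>The partition function with high probability\<close>

text \<open>Flipping one coupling changes the weight of each configuration by a factor between exp
  (- 2 \<beta>) and exp (2 \<beta>).\<close>

lemma ln_partition_lipschitz:
  assumes \<beta>: "0 \<le> \<beta>" and a: "a < M"
  shows "\<bar>ln (partition_function \<beta> N M (config_graph p l N \<pi>) (J(a := 1))) - ln (partition_function \<beta> N M (config_graph p l N \<pi>) (J(a := -1)))\<bar> \<le> 2 * \<beta>"
proof -
  let ?G = "config_graph p l N \<pi>"
  let ?w = "\<lambda>J \<sigma>. exp (- \<beta> * energy M ?G J \<sigma>)" and ?Z = "partition_function \<beta> N M ?G"
  have step: "?w (J(a := s)) \<sigma> \<le> exp (2 * \<beta>) * ?w (J(a := - s)) \<sigma>" if s: "s = 1 \<or> s = -1" and \<sigma>: "\<sigma> \<in> configs N" for s \<sigma>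
  proof -
    let ?c = "\<lambda>b. \<beta> * (\<Prod>i\<in>fun_nbrs ?G b. \<sigma> i)"
    have split: "?w (J(a := s)) \<sigma> = exp (s * ?c a) * (\<Prod>b\<in>{..<M} - {a}. exp (J b * ?c b))" for s
      unfolding exp_energy using a by (subst prod.remove[of _ a]) auto
    have "\<bar>\<Prod>i\<in>fun_nbrs ?G a. \<sigma> i\<bar> = 1" using fun_nbrs_prod_sign[OF \<sigma>, of p l \<pi> a] by auto
    then have "s * ?c a \<le> 2 * \<beta> + (- s) * ?c a" using s \<beta> by (auto simp: abs_if split: if_splits)
    then have "exp (s * ?c a) \<le> exp (2 * \<beta>) * exp (- s * ?c a)" by (simp add: mult_exp_exp)
    then show ?thesis unfolding split mult.assoc[symmetric] by (intro mult_right_mono prod_nonneg) auto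
  qed
  have Z: "ln (?Z (J(a := s))) \<le> 2 * \<beta> + ln (?Z (J(a := - s)))" if s: "s = 1 \<or> s = -1" for s
  proof -
    have "?Z (J(a := s)) \<le> exp (2 * \<beta>) * ?Z (J(a := - s))"
      unfolding partition_function_def sum_distrib_left by (intro sum_mono step[OF s])
    then have "ln (?Z (J(a := s))) \<le> ln (exp (2 * \<beta>) * ?Z (J(a := - s)))"
      by (intro ln_mono partition_function_pos)
    then show ?thesis using partition_function_pos[of \<beta> N M ?G "J(a := - s)"] by (simp add: ln_mult)
  qed
  show ?thesis using Z[of 1] Z[of "-1"] by (simp add: abs_le_iff)
qed

text \<open>The mean over the couplings is the same for every graph, so concentration is required in
  the couplings only, with the graph held fixed.\<close>

lemma expectation_partition:
  assumes p: "0 < p" and dv: "p dvd N * l" and M: "M = num_funs p l N"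
  shows "measure_pmf.expectation (couplings_pmf M) (\<lambda>J. partition_function \<beta> N M (config_graph p l N \<pi>) J) = exp (real N * phi p l \<beta>)"
proof -
  let ?w = "\<lambda>J \<sigma>. exp (- \<beta> * energy M (config_graph p l N \<pi>) J \<sigma>)"
  have "measure_pmf.expectation (couplings_pmf M) (\<lambda>J. \<Sum>\<sigma>\<in>configs N. ?w J \<sigma>)
    = (\<Sum>\<sigma>\<in>configs N. measure_pmf.expectation (couplings_pmf M) (\<lambda>J. ?w J \<sigma>))"
    by (rule Bochner_Integration.integral_sum) auto
  also have "\<dots> = (\<Sum>\<sigma>\<in>configs N. cosh \<beta> ^ M)" by (intro sum.cong refl expectation_weight)
  finally show ?thesis unfolding partition_function_def exp_phi[OF p dv M] by (simp add: card_configs)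
qed

text \<open>Paley--Zygmund shows that \<open>Z\<close> is close to its mean with probability at least \<open>1 / (4 R)\<close>;
  concentration of \<open>log Z\<close> in the couplings turns this into an exponentially small failure probability.\<close>

lemma partition_lower_tail:
  assumes p: "0 < p" and l: "0 < l" and dv: "p dvd N * l" and M: "M = num_funs p l N" and \<beta>: "0 < \<beta>" and \<delta>: "0 < \<delta>"
    and r: "r = real p * \<delta>\<^sup>2 / (2 * \<beta>\<^sup>2 * real l)" and N: "ln 2 \<le> \<delta> * real N" and R: "0 < R" "4 * R * exp (- r * real N) < 1"
    and second: "measure_pmf.expectation (couplings_pmf M) (\<lambda>J. (partition_function \<beta> N M (config_graph p l N \<pi>) J)\<^sup>2) \<le> R * exp (2 * real N * phi p l \<beta>)"
  shows "measure_pmf.prob (couplings_pmf M) {J. partition_function \<beta> N M (config_graph p l N \<pi>) J < exp (real N * (phi p l \<beta> - 3 * \<delta>))} \<le> exp (- r * real N)"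
proof -
  let ?Z = "partition_function \<beta> N M (config_graph p l N \<pi>)"
  let ?f = "\<lambda>J. ln (?Z J)" and ?P = "couplings_pmf M"
  have Zp: "0 < ?Z J" for J by (rule partition_function_pos)
  define E where "E = measure_pmf.expectation ?P ?f"
  \<comment> \<open>The minimiser of the quadratic exponent \<theta>^2 \<beta>^2 M / 2 - \<theta>
    \<delta> N, using M = N l / p; the minimum is - r N.\<close>
  define \<theta> where "\<theta> = real p * \<delta> / (\<beta>\<^sup>2 * real l)"
  have \<theta>0: "0 \<le> \<theta>" unfolding \<theta>_def using \<delta> by simp
  have Mp: "real M * real p = real N * real l" using num_funs_mult[OF dv] M by (metis of_nat_mult)
  have rate: "(\<theta> * (2 * \<beta>))\<^sup>2 * M / 8 - \<theta> * (\<delta> * N) = - r * real N"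
  proof -
    have "real M = real N * real l / real p" using Mp p by (simp add: field_simps)
    then show ?thesis using p l \<beta> by (simp add: \<theta>_def r power2_eq_square field_simps)
  qed
  have lip: "\<bar>?f (J(a := 1)) - ?f (J(a := -1))\<bar> \<le> 2 * \<beta>" if "a < M" for J a
    using ln_partition_lipschitz[OF _ that] \<beta> by simp
  note up = chernoff_couplings(1)[of M ?f, OF lip \<theta>0, of "\<delta> * N", unfolded rate, folded E_def]
  note lo = chernoff_couplings(2)[of M ?f, OF lip \<theta>0, of "\<delta> * N", unfolded rate, folded E_def]
  have "1 / (4 * R) \<le> measure_pmf.prob ?P {J. exp (real N * phi p l \<beta>) / 2 \<le> ?Z J}"
    by (rule paley_zygmund[OF finite_set_couplings _ expectation_partition[OF p dv M] R(1)])
      (use second in \<open>simp_all add: exp_of_nat_mult[symmetric] power2_eq_square mult_exp_exp mult.assoc\<close>)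
  moreover have "exp (- r * real N) < 1 / (4 * R)" using R by (simp add: field_simps)
  ultimately have pz: "exp (- r * real N) < measure_pmf.prob ?P {J. exp (real N * phi p l \<beta>) / 2 \<le> ?Z J}" by linarith
  \<comment> \<open>Otherwise the event from the second moment would lie inside the upper deviation
    event of ln Z, whose probability is smaller.\<close>
  have Elow: "real N * phi p l \<beta> - ln 2 < E + \<delta> * N"
  proof (rule ccontr)
    assume n: "\<not> real N * phi p l \<beta> - ln 2 < E + \<delta> * N"
    have "{J. exp (real N * phi p l \<beta>) / 2 \<le> ?Z J} \<subseteq> {J. E + \<delta> * N \<le> ?f J}"
    proof
      fix J assume "J \<in> {J. exp (real N * phi p l \<beta>) / 2 \<le> ?Z J}"
      then have "ln (exp (real N * phi p l \<beta>) / 2) \<le> ?f J" by (intro ln_mono) auto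
      then show "J \<in> {J. E + \<delta> * N \<le> ?f J}" using n by (simp add: ln_div)
    qed
    then have "measure_pmf.prob ?P {J. exp (real N * phi p l \<beta>) / 2 \<le> ?Z J} \<le> measure_pmf.prob ?P {J. E + \<delta> * N \<le> ?f J}"
      by (intro measure_pmf.finite_measure_mono) auto
    then show False using pz up by linarith
  qed
  \<comment> \<open>The three \<delta> pay for the distance of the mean of ln Z below the second
    moment level, for ln 2, and for the lower deviation.\<close>
  have "{J. ?Z J < exp (real N * (phi p l \<beta> - 3 * \<delta>))} \<subseteq> {J. ?f J \<le> E - \<delta> * N}"
  proof
    fix J assume "J \<in> {J. ?Z J < exp (real N * (phi p l \<beta> - 3 * \<delta>))}"
    then have "?f J \<le> ln (exp (real N * (phi p l \<beta> - 3 * \<delta>)))" using Zp[of J] by (intro ln_mono) auto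
    then have "?f J \<le> real N * (phi p l \<beta> - 3 * \<delta>)" by simp
    then show "J \<in> {J. ?f J \<le> E - \<delta> * N}" using Elow N by (simp add: algebra_simps)
  qed
  then have "measure_pmf.prob ?P {J. ?Z J < exp (real N * (phi p l \<beta> - 3 * \<delta>))} \<le> measure_pmf.prob ?P {J. ?f J \<le> E - \<delta> * N}"
    by (intro measure_pmf.finite_measure_mono) auto
  then show ?thesis using lo by linarith
qed

lemma disorder_prob_eq:
  "measure_pmf.prob (disorder_pmf p l N) {(G, J). Q G J} = (\<Sum>\<pi> | \<pi> permutes {..<N * l}.
     measure_pmf.prob (couplings_pmf (num_funs p l N)) {J. Q (config_graph p l N \<pi>) J}) / fact (N * l)"
proof -
  have "measure_pmf.prob (disorder_pmf p l N) {(G, J). Q G J} = measure_pmf.expectation (disorder_pmf p l N) (indicator {(G, J). Q G J})"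
    by simp
  also have "(indicator {(G, J). Q G J} :: _ \<Rightarrow> real) = (\<lambda>(G, J). indicator {J. Q G J} J)"
    by (auto simp: indicator_def)
  also have "measure_pmf.expectation (disorder_pmf p l N) \<dots> = graph_mean p l N (\<lambda>G J. indicator {J. Q G J} J)"
    by (simp add: graph_mean_def)
  finally show ?thesis by (simp add: graph_mean_eq)
qed

lemma partition_square:
  "(partition_function \<beta> N M G J)\<^sup>2 = (\<Sum>k\<le>N. pair_sum N M \<beta> k G J)"
proof -
  interpret factor_model N 0 "{}" "\<lambda>_. 1" 0 by standard auto
  let ?w = "\<lambda>\<sigma>. exp (- \<beta> * energy M G J \<sigma>)"
  have "(partition_function \<beta> N M G J)\<^sup>2 = (\<Sum>\<sigma>\<in>configs N. \<Sum>\<tau>\<in>configs N. ?w \<sigma> * ?w \<tau>)"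
    unfolding partition_function_def power2_eq_square sum_product ..
  also have "\<dots> = (\<Sum>\<sigma>\<in>configs N. \<Sum>k\<le>N. \<Sum>\<tau> | \<tau> \<in> configs N \<and> disagree \<sigma> \<tau> = k. ?w \<sigma> * ?w \<tau>)"
    by (intro sum.cong refl sum.group[symmetric]) (use disagree_le finite_configs in auto)
  also have "\<dots> = (\<Sum>k\<le>N. pair_sum N M \<beta> k G J)"
    unfolding pair_sum_def by (rule sum.swap)
  finally show ?thesis .
qed

text \<open>The second moment is controlled only on average over the graphs. The extra factor N in R
  makes graphs with a larger conditional second moment have probability at most 1 / N, by Markov;
  all other graphs fall under \<open>partition_lower_tail\<close>.\<close>

lemma partition_lower_whp:
  assumes p: "2 \<le> p" and l: "0 < l" and dv: "p dvd N * l" and M: "M = num_funs p l N" and \<beta>: "0 < \<beta>" and \<delta>: "0 < \<delta>"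
    and ann: "ereal \<beta> < beta_ann p l"
    and r: "r = real p * \<delta>\<^sup>2 / (2 * \<beta>\<^sup>2 * real l)" and N: "ln 2 \<le> \<delta> * real N" "0 < N"
    and R: "R = real N * ((real N + 1) * (real (N * l) + 1))" "4 * R * exp (- r * real N) < 1"
  shows "measure_pmf.prob (disorder_pmf p l N) {(G, J). partition_function \<beta> N M G J < exp (real N * (phi p l \<beta> - 3 * \<delta>))}
    \<le> exp (- r * real N) + 1 / real N"
proof -
  let ?B = "exp (2 * real N * phi p l \<beta>)" and ?Z = "partition_function \<beta> N M"
  let ?E = "\<lambda>\<pi>. measure_pmf.expectation (couplings_pmf M) (\<lambda>J. (?Z (config_graph p l N \<pi>) J)\<^sup>2)"
  have p0: "0 < p" using p by simp
  have R0: "0 < R" unfolding R(1) using N by (intro mult_pos_pos add_nonneg_pos) auto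
  have le: "phi_overlap p l q \<beta> \<le> 2 * phi p l \<beta>" if "q \<in> {-1..1}" for q
    using beta_ann_properties(2)[OF p l \<beta> ann that] by (simp add: phi_overlap_0[OF p])
  \<comment> \<open>Interior distances use the annealed condition at their overlap; the extreme ones
    use its case q = 1, which says \<phi>(2 \<beta>) \<le> 2 \<phi>(\<beta>).\<close>
  have pk: "graph_mean p l N (pair_sum N M \<beta> k) \<le> (real (N * l) + 1) * ?B" if k: "k \<le> N" for k
  proof (cases "k = 0 \<or> k = N")
    case True
    have "graph_mean p l N (pair_sum N M \<beta> k) \<le> exp (real N * phi p l (2 * \<beta>))"
      by (rule graph_mean_pair_sum_le'[OF p0 dv M True])
    also have "\<dots> \<le> 1 * ?B"
    proof -
      have "phi p l (2 * \<beta>) \<le> 2 * phi p l \<beta>" using le[of 1] by (simp add: phi_overlap_1[OF p])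
      from mult_left_mono[OF this, of "real N"] show ?thesis by (simp add: mult_ac)
    qed
    also have "\<dots> \<le> (real (N * l) + 1) * ?B" by (intro mult_right_mono) auto
    finally show ?thesis .
  next
    case False
    define q where "q = 1 - 2 * (real k / real N)"
    have q: "-1 < q" "q < 1" using False k N by (auto simp: q_def field_simps)
    have x: "(1 - q) / 2 = real k / real N" by (simp add: q_def)
    have "graph_mean p l N (pair_sum N M \<beta> k) \<le> real (N * l + 1) * exp (real N * pair_exponent p l \<beta> (real k / real N) (z_overlap p \<beta> q))"
      by (rule graph_mean_pair_sum_le[OF p0 l dv _ k N(2) M]) (rule z_overlap(1)[OF p0 q])
    also have "pair_exponent p l \<beta> (real k / real N) (z_overlap p \<beta> q) = phi_overlap p l q \<beta>"
      using q by (simp add: phi_overlap_interior phi_overlap_open_eq x)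
    also have "real (N * l + 1) * exp (real N * phi_overlap p l q \<beta>) \<le> real (N * l + 1) * ?B"
    proof -
      have "phi_overlap p l q \<beta> \<le> 2 * phi p l \<beta>" using le[of q] q by simp
      from mult_left_mono[OF this, of "real N"] have "real N * phi_overlap p l q \<beta> \<le> 2 * real N * phi p l \<beta>" by simp
      then show ?thesis by (intro mult_left_mono) auto
    qed
    finally show ?thesis by (simp add: add.commute)
  qed
  have "graph_mean p l N (\<lambda>G J. (?Z G J)\<^sup>2) = (\<Sum>k\<le>N. graph_mean p l N (pair_sum N M \<beta> k))"
    unfolding partition_square by (rule graph_mean_sum)
  also have "\<dots> \<le> (\<Sum>k\<le>N. (real (N * l) + 1) * ?B)" by (intro sum_mono pk) auto
  also have "\<dots> = R * ?B / N" using N R by simp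
  finally have mean: "(\<Sum>\<pi> | \<pi> permutes {..<N * l}. ?E \<pi>) / fact (N * l) \<le> R * ?B / N"
    by (simp add: graph_mean_eq M)
  have single: "measure_pmf.prob (couplings_pmf M) {J. ?Z (config_graph p l N \<pi>) J < exp (real N * (phi p l \<beta> - 3 * \<delta>))}
    \<le> exp (- r * real N) + ?E \<pi> / (R * ?B)" for \<pi>
  proof (cases "?E \<pi> \<le> R * ?B")
    case True
    have "measure_pmf.prob (couplings_pmf M) {J. ?Z (config_graph p l N \<pi>) J < exp (real N * (phi p l \<beta> - 3 * \<delta>))} \<le> exp (- r * real N)"
      by (rule partition_lower_tail[OF p0 l dv M \<beta> \<delta> r N(1) R0 R(2) True])
    moreover have "0 \<le> ?E \<pi> / (R * ?B)" using R0 by (intro divide_nonneg_nonneg integral_nonneg) auto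
    ultimately show ?thesis by linarith
  next
    case False
    then have "1 \<le> ?E \<pi> / (R * ?B)" using R0 by (simp add: pos_le_divide_eq)
    then show ?thesis using measure_pmf.prob_le_1[of "couplings_pmf M" "{J. ?Z (config_graph p l N \<pi>) J < exp (real N * (phi p l \<beta> - 3 * \<delta>))}"]
      by (smt (verit) exp_ge_zero)
  qed
  have "measure_pmf.prob (disorder_pmf p l N) {(G, J). ?Z G J < exp (real N * (phi p l \<beta> - 3 * \<delta>))}
    \<le> (\<Sum>\<pi> | \<pi> permutes {..<N * l}. exp (- r * real N) + ?E \<pi> / (R * ?B)) / fact (N * l)"
    unfolding disorder_prob_eq M[symmetric] by (intro divide_right_mono sum_mono single) auto
  also have "\<dots> = exp (- r * real N) + ((\<Sum>\<pi> | \<pi> permutes {..<N * l}. ?E \<pi>) / fact (N * l)) / (R * ?B)"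
    using card_permutations[of "{..<N * l}" "N * l"]
    by (simp add: sum.distrib add_divide_distrib sum_divide_distrib[symmetric])
  also have "\<dots> \<le> exp (- r * real N) + (R * ?B / N) / (R * ?B)"
    using R0 by (intro add_left_mono divide_right_mono mean) auto
  also have "(R * ?B / N) / (R * ?B) = 1 / N" using R0 by simp
  finally show ?thesis by simp
qed

section \<open>Slow relaxation\<close>

lemma graph_mean_mono:
  assumes "\<And>G J. (G, J) \<in> set_pmf (disorder_pmf p l N) \<Longrightarrow> f G J \<le> g G J"
  shows "graph_mean p l N f \<le> graph_mean p l N g"
  unfolding graph_mean_def
  by (rule integral_mono_AE[OF integrable_disorder integrable_disorder]) (use assms in \<open>auto simp: AE_measure_pmf_iff\<close>)

lemma graph_mean_linear:
  "graph_mean p l N (\<lambda>G J. a * f G J + b * g G J) = a * graph_mean p l N f + b * graph_mean p l N g"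
  unfolding graph_mean_def case_prod_unfold
  by (subst Bochner_Integration.integral_add) auto

section \<open>Mean escape rate and mean overlap\<close>

text \<open>The Gibbs mean of the (1 - \<alpha>)-th power of the shell ratio, without its
  denominator Z.\<close>

definition tilted_sum :: "nat \<Rightarrow> nat \<Rightarrow> real \<Rightarrow> nat \<Rightarrow> real \<Rightarrow> factor_graph \<Rightarrow> (nat \<Rightarrow> real) \<Rightarrow> real" where
  "tilted_sum N M \<beta> k \<alpha> G J = (\<Sum>\<sigma>\<in>configs N. exp (- \<beta> * energy M G J \<sigma>) * factor_model.shell_ratio N M G J \<beta> k \<sigma> powr (1 - \<alpha>))"

text \<open>Hoelder's inequality in pointwise form. With U and V fixed in advance the right-hand
  side is linear in u and v, so sums over configurations and means over the disorder pass through
  it.\<close>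

lemma weighted_am_gm:
  fixes u v U V \<alpha> :: real
  assumes "0 \<le> u" "0 < v" "0 < U" "0 < V" "0 < \<alpha>" "\<alpha> < 1"
  shows "u powr (1 - \<alpha>) * v powr \<alpha> \<le> U powr (1 - \<alpha>) * V powr \<alpha> * ((1 - \<alpha>) / U * u + \<alpha> / V * v)"
proof (cases "u = 0")
  case True
  then show ?thesis using assms by simp
next
  case False
  then have "(u / U) powr (1 - \<alpha>) * (v / V) powr \<alpha> \<le> (1 - \<alpha>) * (u / U) + \<alpha> * (v / V)"
    using assms by (intro Youngs_inequality_0) auto
  then have "U powr (1 - \<alpha>) * V powr \<alpha> * ((u / U) powr (1 - \<alpha>) * (v / V) powr \<alpha>) \<le> U powr (1 - \<alpha>) * V powr \<alpha> * ((1 - \<alpha>) * (u / U) + \<alpha> * (v / V))"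
    using assms by (intro mult_left_mono) auto
  moreover have "U powr (1 - \<alpha>) * V powr \<alpha> * ((u / U) powr (1 - \<alpha>) * (v / V) powr \<alpha>) = u powr (1 - \<alpha>) * v powr \<alpha>"
    using assms by (simp add: powr_divide)
  ultimately show ?thesis by simp
qed

lemma shell_sum_eq:
  assumes "factor_model N M G J"
  shows "pair_sum N M \<beta> k G J = (\<Sum>\<sigma>\<in>configs N. (exp (- \<beta> * energy M G J \<sigma>))\<^sup>2 * factor_model.shell_ratio N M G J \<beta> k \<sigma>)"
proof -
  interpret factor_model N M G J \<beta> by (rule assms)
  show ?thesis unfolding pair_sum_def
  proof (rule sum.cong[OF refl])
    fix \<sigma>
    have "(\<Sum>\<tau>\<in>configs N. bweight \<tau> * shell k \<sigma> \<tau>) = (\<Sum>\<tau> | \<tau> \<in> configs N \<and> disagree \<sigma> \<tau> = k. bweight \<tau>)"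
      unfolding shell_def by (rule sum.mono_neutral_cong_right) (auto simp: finite_configs)
    then have "bweight \<sigma> ^ 2 * shell_ratio k \<sigma> = bweight \<sigma> * (\<Sum>\<tau> | \<tau> \<in> configs N \<and> disagree \<sigma> \<tau> = k. bweight \<tau>)"
      using bweight_pos[of \<sigma>] by (simp add: shell_ratio_def power2_eq_square)
    then show "(\<Sum>\<tau> | \<tau> \<in> configs N \<and> disagree \<sigma> \<tau> = k. exp (- \<beta> * energy M G J \<sigma>) * exp (- \<beta> * energy M G J \<tau>))
      = (exp (- \<beta> * energy M G J \<sigma>))\<^sup>2 * shell_ratio k \<sigma>"
      by (simp add: bweight_def sum_distrib_left)
  qed
qed

text \<open>Hoelder's inequality between the pair sum at \<open>\<beta>\<close> and the partition function at \<open>(2 - 1 / \<alpha>) \<beta>\<close>.\<close>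

lemma graph_mean_tilted_sum_le:
  assumes p: "0 < p" and dv: "p dvd N * l" and M: "M = num_funs p l N" and \<alpha>: "0 < \<alpha>" "\<alpha> < 1"
    and U: "0 < U" "graph_mean p l N (pair_sum N M \<beta> k) \<le> U"
  shows "graph_mean p l N (tilted_sum N M \<beta> k \<alpha>) \<le> U powr (1 - \<alpha>) * exp (\<alpha> * (real N * phi p l ((2 - 1 / \<alpha>) * \<beta>)))"
proof -
  define V where "V = exp (real N * phi p l ((2 - 1 / \<alpha>) * \<beta>))"
  have V: "0 < V" by (simp add: V_def)
  let ?b = "(2 - 1 / \<alpha>) * \<beta>"
  have meanV: "graph_mean p l N (partition_function ?b N M) = V"
    using card_permutations[of "{..<N * l}" "N * l"]
    by (simp add: graph_mean_eq M[symmetric] expectation_partition[OF p dv M] V_def)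
  let ?C = "U powr (1 - \<alpha>) * V powr \<alpha>"
  have "graph_mean p l N (tilted_sum N M \<beta> k \<alpha>)
    \<le> graph_mean p l N (\<lambda>G J. (?C * ((1 - \<alpha>) / U)) * pair_sum N M \<beta> k G J + (?C * (\<alpha> / V)) * partition_function ?b N M G J)"
  proof (rule graph_mean_mono)
    fix G J assume GJ: "(G, J) \<in> set_pmf (disorder_pmf p l N)"
    have fm: "factor_model N M G J" using factor_model_disorder[OF GJ] M by simp
    interpret factor_model N M G J \<beta> by (rule fm)
    have "tilted_sum N M \<beta> k \<alpha> G J \<le> (\<Sum>\<sigma>\<in>configs N. ?C * ((1 - \<alpha>) / U * ((bweight \<sigma>)\<^sup>2 * shell_ratio k \<sigma>) + \<alpha> / V * exp (- ?b * energy M G J \<sigma>)))"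
      unfolding tilted_sum_def
    proof (rule sum_mono)
      fix \<sigma> assume "\<sigma> \<in> configs N"
      have s0: "0 \<le> shell_ratio k \<sigma>" by (rule shell_ratio_nonneg)
      let ?e = "- \<beta> * energy M G J \<sigma>"
      \<comment> \<open>The exponents of the Boltzmann weight add up to 2 (1 - \<alpha>) + (2
        \<alpha> - 1) = 1.\<close>
      have "((bweight \<sigma>)\<^sup>2 * shell_ratio k \<sigma>) powr (1 - \<alpha>) * exp (- ?b * energy M G J \<sigma>) powr \<alpha> = exp ?e * shell_ratio k \<sigma> powr (1 - \<alpha>)"
      proof -
        have "((bweight \<sigma>)\<^sup>2) powr (1 - \<alpha>) = exp (2 * ?e * (1 - \<alpha>))"
          unfolding bweight_def by (simp add: powr_def power2_eq_square mult_exp_exp algebra_simps)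
        moreover have "exp (- ?b * energy M G J \<sigma>) powr \<alpha> = exp ((2 * \<alpha> - 1) * ?e)"
          using \<alpha> by (simp add: powr_def field_simps)
        ultimately have "((bweight \<sigma>)\<^sup>2) powr (1 - \<alpha>) * exp (- ?b * energy M G J \<sigma>) powr \<alpha> = exp ?e"
          by (simp add: mult_exp_exp algebra_simps)
        then show ?thesis using s0 by (simp add: powr_mult mult_ac)
      qed
      then show "exp ?e * shell_ratio k \<sigma> powr (1 - \<alpha>) \<le> ?C * ((1 - \<alpha>) / U * ((bweight \<sigma>)\<^sup>2 * shell_ratio k \<sigma>) + \<alpha> / V * exp (- ?b * energy M G J \<sigma>))"
        using weighted_am_gm[of "(bweight \<sigma>)\<^sup>2 * shell_ratio k \<sigma>" "exp (- ?b * energy M G J \<sigma>)" U V \<alpha>] s0 U V \<alpha> by simp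
    qed
    also have "\<dots> = (?C * ((1 - \<alpha>) / U)) * pair_sum N M \<beta> k G J + (?C * (\<alpha> / V)) * partition_function ?b N M G J"
      unfolding shell_sum_eq[OF fm] partition_function_def bweight_def
      by (simp only: distrib_left sum.distrib sum_distrib_left mult.assoc)
    finally show "tilted_sum N M \<beta> k \<alpha> G J \<le> \<dots>" .
  qed
  also have "\<dots> = (?C * ((1 - \<alpha>) / U)) * graph_mean p l N (pair_sum N M \<beta> k) + (?C * (\<alpha> / V)) * V"
    by (simp only: graph_mean_linear meanV)
  also have "\<dots> \<le> (?C * ((1 - \<alpha>) / U)) * U + (?C * (\<alpha> / V)) * V"
    using U \<alpha> by (intro add_right_mono mult_left_mono) auto
  also have "\<dots> = ?C" using U V by (simp add: field_simps)
  also have "V powr \<alpha> = exp (\<alpha> * (real N * phi p l ?b))" by (simp add: V_def powr_def)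
  finally show ?thesis .
qed

lemma prob_disorder_markov:
  assumes a: "0 < a" and f: "\<And>G J. (G, J) \<in> set_pmf (disorder_pmf p l N) \<Longrightarrow> 0 \<le> f G J" and m: "graph_mean p l N f \<le> m"
  shows "measure_pmf.prob (disorder_pmf p l N) {(G, J). a < f G J} \<le> m / a"
proof -
  have "measure_pmf.prob (disorder_pmf p l N) {(G, J). a < f G J} \<le> measure_pmf.expectation (disorder_pmf p l N) (\<lambda>(G, J). f G J) / a"
    by (rule markov_pmf[OF finite_set_disorder a]) (use f in auto)
  also have "\<dots> \<le> m / a" using m a by (intro divide_right_mono) (auto simp: graph_mean_def)
  finally show ?thesis .
qed

text \<open>One-sided, since an upper bound on the mean overlap has to exclude positive overlaps
  only.\<close>

definition overlap_tail :: "nat \<Rightarrow> nat \<Rightarrow> real \<Rightarrow> real \<Rightarrow> factor_graph \<Rightarrow> (nat \<Rightarrow> real) \<Rightarrow> real" where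
  "overlap_tail N M \<beta> \<eta> G J = (\<Sum>k | k \<le> N \<and> \<eta> * real N \<le> real N - 2 * real k. pair_sum N M \<beta> k G J)"

lemma pair_sum_nonneg: "0 \<le> pair_sum N M \<beta> k G J"
  unfolding pair_sum_def by (intro sum_nonneg) auto

lemma graph_mean_overlap_tail_le:
  assumes p: "0 < p" and l: "0 < l" and dv: "p dvd N * l" and M: "M = num_funs p l N" and N: "0 < N" and \<eta>: "0 < \<eta>" and c: "0 < c"
    and g0: "phi p l (2 * \<beta>) \<le> 2 * phi p l \<beta> - c"
    and g: "\<And>q. \<eta> \<le> q \<Longrightarrow> q < 1 \<Longrightarrow> \<exists>z>0. pair_exponent p l \<beta> ((1 - q) / 2) z \<le> 2 * phi p l \<beta> - c"
  shows "graph_mean p l N (overlap_tail N M \<beta> \<eta>) \<le> (real N + 1) * ((real (N * l) + 1) * exp (real N * (2 * phi p l \<beta> - c)))"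
proof -
  let ?K = "{k. k \<le> N \<and> \<eta> * real N \<le> real N - 2 * real k}" and ?B = "exp (real N * (2 * phi p l \<beta> - c))"
  have pk: "graph_mean p l N (pair_sum N M \<beta> k) \<le> (real (N * l) + 1) * ?B" if k: "k \<in> ?K" for k
  proof (cases "k = 0")
    case True
    have "graph_mean p l N (pair_sum N M \<beta> k) \<le> exp (real N * phi p l (2 * \<beta>))"
      by (rule graph_mean_pair_sum_le'[OF p dv M]) (use True in simp)
    also have "\<dots> \<le> 1 * ?B" using mult_left_mono[OF g0, of "real N"] by simp
    also have "\<dots> \<le> (real (N * l) + 1) * ?B" by (intro mult_right_mono) auto
    finally show ?thesis .
  next
    case False
    define q where "q = 1 - 2 * (real k / real N)"
    have q: "\<eta> \<le> q" "q < 1" using False k N by (auto simp: q_def field_simps)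
    have x: "(1 - q) / 2 = real k / real N" by (simp add: q_def)
    obtain z where z: "0 < z" "pair_exponent p l \<beta> (real k / real N) z \<le> 2 * phi p l \<beta> - c"
      using g[OF q] unfolding x by blast
    have "graph_mean p l N (pair_sum N M \<beta> k) \<le> real (N * l + 1) * exp (real N * pair_exponent p l \<beta> (real k / real N) z)"
      by (rule graph_mean_pair_sum_le[OF p l dv z(1) _ N M]) (use k in simp)
    also have "\<dots> \<le> real (N * l + 1) * ?B" using z(2) by (intro mult_left_mono) (auto intro: mult_left_mono)
    finally show ?thesis by (simp add: add.commute)
  qed
  have "graph_mean p l N (overlap_tail N M \<beta> \<eta>) = (\<Sum>k\<in>?K. graph_mean p l N (pair_sum N M \<beta> k))"
    unfolding overlap_tail_def by (rule graph_mean_sum)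
  also have "\<dots> \<le> (\<Sum>k\<in>?K. (real (N * l) + 1) * ?B)" by (intro sum_mono pk)
  also have "\<dots> = real (card ?K) * ((real (N * l) + 1) * ?B)" by simp
  also have "\<dots> \<le> (real N + 1) * ((real (N * l) + 1) * ?B)"
  proof (rule mult_right_mono)
    have "card ?K \<le> card {..N}" by (intro card_mono) auto
    then show "real (card ?K) \<le> real N + 1" by simp
  qed simp
  finally show ?thesis .
qed

section \<open>Counting slow spins on a fixed sample\<close>

context factor_model
begin

lemma correlation_le_1:
  assumes i: "i < N" and t: "0 \<le> t"
  shows "correlation \<beta> N M G J i t \<le> 1"
proof -
  let ?w = "gibbs_weight \<beta> N M G J" and ?A = "flip_sum \<beta> N G J"
  have w0: "0 \<le> ?w \<sigma>" for \<sigma> using gibbs_weight_pos by (rule less_imp_le)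
  have "(\<Sum>\<sigma>\<in>configs N. ?w \<sigma> * (\<sigma> i * (?A ^^ n) (spin_sign i) \<sigma>)) \<le> real N ^ n * 1" for n
  proof -
    have "(\<Sum>\<sigma>\<in>configs N. ?w \<sigma> * (\<sigma> i * (?A ^^ n) (spin_sign i) \<sigma>)) \<le> (\<Sum>\<sigma>\<in>configs N. ?w \<sigma> * real N ^ n)"
    proof (intro sum_mono mult_left_mono w0)
      fix \<sigma> assume s: "\<sigma> \<in> configs N"
      have "(?A ^^ n) (spin_sign i) \<sigma> \<le> (?A ^^ n) (\<lambda>_. 1) \<sigma>" "(?A ^^ n) (\<lambda>_. -1) \<sigma> \<le> (?A ^^ n) (spin_sign i) \<sigma>"
        by (rule flip_sum_pow_mono; simp add: spin_sign_def)+
      then show "\<sigma> i * (?A ^^ n) (spin_sign i) \<sigma> \<le> real N ^ n"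
        using configs_val[OF s i] by (auto simp: flip_sum_pow_const)
    qed
    also have "\<dots> = real N ^ n" by (simp add: sum_distrib_right[symmetric] sum_gibbs_weight)
    finally show ?thesis by simp
  qed
  then have "correlation \<beta> N M G J i t + (\<Sum>\<sigma>\<in>configs N. ?w \<sigma> * \<sigma> i)\<^sup>2 \<le> 1"
    by (intro sums_le[OF _ correlation_sums[OF i t] sums_poisson[of "real N" t 1]] mult_left_mono) (use t in auto)
  then show ?thesis using zero_le_power2[of "\<Sum>\<sigma>\<in>configs N. ?w \<sigma> * \<sigma> i"] by linarith
qed

text \<open>Each correlation is at most 1, so a sum of at least N q forces at least N (q -
  \<epsilon>) of them above \<epsilon>; a correlation above \<epsilon> at time t keeps the
  correlation time from being smaller than t.\<close>

lemma card_slow_ge: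
  assumes t: "0 \<le> t" and S: "real N * q \<le> (\<Sum>i<N. correlation \<beta> N M G J i t)" and \<epsilon>: "0 < \<epsilon>"
  shows "real N * (q - \<epsilon>) \<le> real (card {i. i < N \<and> ereal t \<le> correlation_time \<beta> N M G J i \<epsilon>})"
proof -
  let ?S = "{i. i < N \<and> \<epsilon> < correlation \<beta> N M G J i t}"
  have "(\<Sum>i<N. correlation \<beta> N M G J i t) \<le> (\<Sum>i<N. (if i \<in> ?S then 1 else 0) + \<epsilon>)"
    using correlation_le_1[OF _ t] \<epsilon> by (intro sum_mono) (auto simp: add_increasing2 intro: add_increasing2)
  also have "\<dots> = real (card ?S) + real N * \<epsilon>"
  proof -
    have "(\<Sum>i<N. if i \<in> ?S then 1 else 0 :: real) = (\<Sum>i\<in>?S. 1)"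
      by (intro sum.mono_neutral_cong_right) auto
    then show ?thesis by (simp only: sum.distrib) simp
  qed
  finally have "real N * (q - \<epsilon>) \<le> real (card ?S)" using S by (simp add: right_diff_distrib)
  also have "card ?S \<le> card {i. i < N \<and> ereal t \<le> correlation_time \<beta> N M G J i \<epsilon>}"
    by (intro card_mono) (auto intro: correlation_time_ge[OF t])
  finally show ?thesis by simp
qed

lemma escape_le:
  assumes t: "0 \<le> t" and \<alpha>: "0 < \<alpha>" "\<alpha> < 1"
  shows "(\<Sum>\<sigma>\<in>configs N. gibbs_weight \<beta> N M G J \<sigma> * min 1 (real N * t * shell_ratio k \<sigma>))
    \<le> (real N * t) powr (1 - \<alpha>) * tilted_sum N M \<beta> k \<alpha> G J / part"
proof -
  have min_le: "min 1 y \<le> y powr (1 - \<alpha>)" if "0 \<le> y" for y :: real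
  proof (cases "y \<le> 1")
    case True
    show ?thesis
    proof (cases "y = 0")
      case False
      then have "y powr 1 \<le> y powr (1 - \<alpha>)" using True that \<alpha> by (intro powr_mono') auto
      then show ?thesis using True that by simp
    qed simp
  next
    case False
    then have "1 \<le> y powr (1 - \<alpha>)" using \<alpha> by (intro ge_one_powr_ge_zero) auto
    then show ?thesis using False by simp
  qed
  have "(\<Sum>\<sigma>\<in>configs N. gibbs_weight \<beta> N M G J \<sigma> * min 1 (real N * t * shell_ratio k \<sigma>))
    \<le> (\<Sum>\<sigma>\<in>configs N. gibbs_weight \<beta> N M G J \<sigma> * ((real N * t) powr (1 - \<alpha>) * shell_ratio k \<sigma> powr (1 - \<alpha>)))"
  proof (intro sum_mono mult_left_mono less_imp_le[OF gibbs_weight_pos])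
    fix \<sigma>
    show "min 1 (real N * t * shell_ratio k \<sigma>) \<le> (real N * t) powr (1 - \<alpha>) * shell_ratio k \<sigma> powr (1 - \<alpha>)"
      using min_le[of "real N * t * shell_ratio k \<sigma>"] t shell_ratio_nonneg[of k \<sigma>] by (simp add: powr_mult)
  qed
  also have "\<dots> = (real N * t) powr (1 - \<alpha>) * tilted_sum N M \<beta> k \<alpha> G J / part"
    unfolding gibbs_weight_eq tilted_sum_def bweight_def sum_distrib_left sum_divide_distrib
    by (intro sum.cong refl) (simp add: mult_ac)
  finally show ?thesis .
qed

text \<open>The overlap is below \<eta> N except on the pairs counted by
  \<open>overlap_tail\<close>, where it is at most N.\<close>

lemma mean_overlap_le:
  assumes \<eta>: "0 \<le> \<eta>"
  shows "(\<Sum>\<sigma>\<in>configs N. \<Sum>\<tau>\<in>configs N. gibbs_weight \<beta> N M G J \<sigma> * gibbs_weight \<beta> N M G J \<tau> * (real N - 2 * real (disagree \<sigma> \<tau>)))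
    \<le> \<eta> * real N + real N * (overlap_tail N M \<beta> \<eta> G J / part\<^sup>2)"
proof -
  let ?w = "gibbs_weight \<beta> N M G J"
  have w0: "0 \<le> ?w \<sigma>" for \<sigma> using gibbs_weight_pos by (rule less_imp_le)
  let ?I = "\<lambda>\<sigma> \<tau>. if \<eta> * real N \<le> real N - 2 * real (disagree \<sigma> \<tau>) then 1 else 0 :: real"
  have "(\<Sum>\<sigma>\<in>configs N. \<Sum>\<tau>\<in>configs N. ?w \<sigma> * ?w \<tau> * (real N - 2 * real (disagree \<sigma> \<tau>)))
    \<le> (\<Sum>\<sigma>\<in>configs N. \<Sum>\<tau>\<in>configs N. ?w \<sigma> * ?w \<tau> * (\<eta> * real N + real N * ?I \<sigma> \<tau>))"
    using \<eta> by (intro sum_mono mult_left_mono mult_nonneg_nonneg w0) (auto simp: add_increasing)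
  also have "\<dots> = \<eta> * real N * ((\<Sum>\<sigma>\<in>configs N. ?w \<sigma>) * (\<Sum>\<tau>\<in>configs N. ?w \<tau>))
     + real N * (\<Sum>\<sigma>\<in>configs N. \<Sum>\<tau>\<in>configs N. ?w \<sigma> * ?w \<tau> * ?I \<sigma> \<tau>)"
  proof -
    have prod: "(\<Sum>\<sigma>\<in>configs N. ?w \<sigma>) * (\<Sum>\<tau>\<in>configs N. ?w \<tau>) = (\<Sum>\<sigma>\<in>configs N. \<Sum>\<tau>\<in>configs N. ?w \<sigma> * ?w \<tau>)"
      by (rule sum_product)
    show ?thesis
      unfolding prod unfolding sum_distrib_left unfolding sum.distrib[symmetric]
      by (intro sum.cong refl) (simp only: distrib_left mult_ac)
  qed
  also have "(\<Sum>\<sigma>\<in>configs N. \<Sum>\<tau>\<in>configs N. ?w \<sigma> * ?w \<tau> * ?I \<sigma> \<tau>) = overlap_tail N M \<beta> \<eta> G J / part\<^sup>2"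
  proof -
    let ?K = "{k. k \<le> N \<and> \<eta> * real N \<le> real N - 2 * real k}"
    have "overlap_tail N M \<beta> \<eta> G J = (\<Sum>\<sigma>\<in>configs N. \<Sum>k\<in>?K. \<Sum>\<tau> | \<tau> \<in> configs N \<and> disagree \<sigma> \<tau> = k. bweight \<sigma> * bweight \<tau>)"
      unfolding overlap_tail_def pair_sum_def bweight_def by (rule sum.swap)
    also have "\<dots> = (\<Sum>\<sigma>\<in>configs N. \<Sum>\<tau>\<in>configs N. bweight \<sigma> * bweight \<tau> * ?I \<sigma> \<tau>)"
    proof (rule sum.cong[OF refl])
      fix \<sigma>
      let ?T = "{\<tau> \<in> configs N. \<eta> * real N \<le> real N - 2 * real (disagree \<sigma> \<tau>)}"
      have "(\<Sum>k\<in>?K. \<Sum>\<tau> | \<tau> \<in> configs N \<and> disagree \<sigma> \<tau> = k. bweight \<sigma> * bweight \<tau>)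
        = (\<Sum>k\<in>?K. \<Sum>\<tau>\<in>{\<tau> \<in> ?T. disagree \<sigma> \<tau> = k}. bweight \<sigma> * bweight \<tau>)"
        by (intro sum.cong refl) auto
      also have "\<dots> = (\<Sum>\<tau>\<in>?T. bweight \<sigma> * bweight \<tau>)"
        by (rule sum.group) (auto simp: finite_configs disagree_le)
      also have "\<dots> = (\<Sum>\<tau>\<in>configs N. bweight \<sigma> * bweight \<tau> * ?I \<sigma> \<tau>)"
        by (rule sum.mono_neutral_cong_left) (auto simp: finite_configs)
      finally show "(\<Sum>k\<in>?K. \<Sum>\<tau> | \<tau> \<in> configs N \<and> disagree \<sigma> \<tau> = k. bweight \<sigma> * bweight \<tau>)
        = (\<Sum>\<tau>\<in>configs N. bweight \<sigma> * bweight \<tau> * ?I \<sigma> \<tau>)" .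
    qed
    finally have ot: "overlap_tail N M \<beta> \<eta> G J = (\<Sum>\<sigma>\<in>configs N. \<Sum>\<tau>\<in>configs N. bweight \<sigma> * bweight \<tau> * ?I \<sigma> \<tau>)" .
    show ?thesis unfolding ot sum_divide_distrib gibbs_weight_eq
      by (intro sum.cong refl) (simp add: power2_eq_square)
  qed
  finally show ?thesis by (simp add: sum_gibbs_weight)
qed

lemma sum_correlation_lower:
  assumes t: "0 \<le> t" and \<alpha>: "0 < \<alpha>" "\<alpha> < 1" and q: "0 < q" and k: "real N * q \<le> real N - 2 * real k" and Z: "Z \<le> part" "0 < Z"
    and Y: "tilted_sum N M \<beta> k \<alpha> G J * (real N * t) powr (1 - \<alpha>) \<le> q / 16 * Z"
    and W: "overlap_tail N M \<beta> (q / 2) G J \<le> q / 8 * Z\<^sup>2"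
  shows "real N * (q / 4) \<le> (\<Sum>i<N. correlation \<beta> N M G J i t)"
proof -
  have "(real N * t) powr (1 - \<alpha>) * tilted_sum N M \<beta> k \<alpha> G J / part \<le> (q / 16 * Z) / part"
    using Y part_pos by (intro divide_right_mono) (auto simp: mult.commute)
  also have "\<dots> \<le> q / 16" using Z q part_pos by (simp add: pos_divide_le_eq)
  finally have e: "(\<Sum>\<sigma>\<in>configs N. gibbs_weight \<beta> N M G J \<sigma> * min 1 (real N * t * shell_ratio k \<sigma>)) \<le> q / 16"
    using escape_le[OF t \<alpha>, of k] by linarith
  have "overlap_tail N M \<beta> (q / 2) G J / part\<^sup>2 \<le> (q / 8 * Z\<^sup>2) / part\<^sup>2"
    using W by (intro divide_right_mono) auto
  also have "\<dots> \<le> q / 8"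
  proof -
    have "Z\<^sup>2 \<le> part\<^sup>2" using Z by (intro power_mono) auto
    then show ?thesis using q part_pos by (simp add: pos_divide_le_eq)
  qed
  finally have w: "real N * (overlap_tail N M \<beta> (q / 2) G J / part\<^sup>2) \<le> real N * (q / 8)" by (intro mult_left_mono) auto
  have y: "2 * real N * (\<Sum>\<sigma>\<in>configs N. gibbs_weight \<beta> N M G J \<sigma> * min 1 (real N * t * shell_ratio k \<sigma>)) \<le> 2 * real N * (q / 16)"
    using e by (intro mult_left_mono) auto
  have q2: "0 \<le> q / 2" using q by simp
  \<comment> \<open>The budget: of the overlap q on the shell, q / 8 is lost to escape and q / 2 + q
    / 8 to the overlap of independent configurations, leaving q / 4.\<close>
  have lin: "real N * (q / 4) \<le> C" if "n - b - v \<le> C" "v \<le> q / 2 * real N + w" "w \<le> real N * (q / 8)" "b \<le> 2 * real N * (q / 16)"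
    "real N * q \<le> n" for n b v w C :: real
    using that by (simp add: field_simps)
  show ?thesis using lin[OF _ mean_overlap_le[OF q2] w y k] sum_correlation_ge[OF t, of k] by simp
qed

end

section \<open>Slow relaxation with high probability\<close>

text \<open>The shell radius is an integer, so its overlap only approaches q. The trial value z
  stays fixed at the saddle point of q, so that continuity in x is enough.\<close>

lemma tendsto_pair_exponent:
  assumes x: "0 < x" "x < 1"
  shows "(\<lambda>N. pair_exponent p l \<beta> (real (nat \<lfloor>x * real N\<rfloor>) / real N) z) \<longlonglongrightarrow> pair_exponent p l \<beta> x z"
proof -
  have lim: "(\<lambda>N. real (nat \<lfloor>x * real N\<rfloor>) / real N) \<longlonglongrightarrow> x"
    using x by real_asymp
  show ?thesis unfolding pair_exponent_def entropy_fun_def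
    by (intro tendsto_intros lim) (use x in auto)
qed

text \<open>Outside three events the deterministic bound \<open>sum_correlation_lower\<close>
  applies: Z too small (\<open>B1\<close>), escape sum too large (\<open>B2\<close>), too much
  weight on pairs of positive overlap (\<open>B3\<close>). The first comes from the lower tail of Z,
  the other two from Markov's inequality.\<close>

lemma prob_slow_ge:
  assumes p: "3 \<le> p" and l: "3 \<le> l" and \<beta>: "0 < \<beta>" and ann: "ereal \<beta> < beta_ann p l"
    and dv: "p dvd N * l" and M: "M = num_funs p l N" and N: "0 < N"
    and \<alpha>: "1 / 2 < \<alpha>" "\<alpha> < 1" and q: "0 < q" "q < 1" and k: "k = nat \<lfloor>(1 - q) / 2 * real N\<rfloor>"
    and \<Delta>: "\<Delta> = (1 - \<alpha>) * (phi p l (2 * \<beta>) - S) - phi_hat p l \<beta> \<alpha>" "0 < \<Delta>"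
    and z: "0 < z" and S: "pair_exponent p l \<beta> (real k / real N) z \<le> S + \<Delta> / 4"
    and c: "0 < c" and g0: "phi p l (2 * \<beta>) \<le> 2 * phi p l \<beta> - c"
    and g: "\<And>r. q / 2 \<le> r \<Longrightarrow> r < 1 \<Longrightarrow> \<exists>z>0. pair_exponent p l \<beta> ((1 - r) / 2) z \<le> 2 * phi p l \<beta> - c"
    and \<delta>: "0 < \<delta>" "3 * \<delta> \<le> \<Delta> / 8" "6 * \<delta> \<le> c / 2"
    and r: "r = real p * \<delta>\<^sup>2 / (2 * \<beta>\<^sup>2 * real l)" and N2: "ln 2 \<le> \<delta> * real N"
    and R: "R = real N * ((real N + 1) * (real (N * l) + 1))" "4 * R * exp (- r * real N) < 1"
    and t: "0 \<le> t" "t \<le> exp (real N * \<Delta>)" and \<epsilon>: "0 < \<epsilon>"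
  shows "measure_pmf.prob (disorder_pmf p l N)
      {(G, J). real N * (q / 4 - \<epsilon>) \<le> real (card {i. i < N \<and> ereal t \<le> correlation_time \<beta> N M G J i \<epsilon>})}
    \<ge> 1 - (exp (- r * real N) + 1 / real N + 16 / q * (real N * (real (N * l) + 1)) * exp (- real N * \<Delta> / 4)
        + 8 / q * ((real N + 1) * (real (N * l) + 1)) * exp (- real N * c / 2))"
proof -
  let ?P = "disorder_pmf p l N"
  define Z where "Z = exp (real N * (phi p l \<beta> - 3 * \<delta>))"
  define w where "w = (real N * t) powr (1 - \<alpha>)"
  define A where "A = {(G, J). real N * (q / 4 - \<epsilon>) \<le> real (card {i. i < N \<and> ereal t \<le> correlation_time \<beta> N M G J i \<epsilon>})}"
  define B1 where "B1 = {(G, J). partition_function \<beta> N M G J < Z}"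
  define B2 where "B2 = {(G, J). q / 16 * Z < tilted_sum N M \<beta> k \<alpha> G J * w}"
  define B3 where "B3 = {(G, J). q / 8 * Z\<^sup>2 < overlap_tail N M \<beta> (q / 2) G J}"
  have Z0: "0 < Z" by (simp add: Z_def)
  have kle: "real k \<le> (1 - q) / 2 * real N" using q unfolding k by (intro of_nat_floor) auto
  have kN: "k \<le> N"
  proof -
    have "(1 - q) / 2 * real N \<le> 1 * real N" using q by (intro mult_right_mono) auto
    then show ?thesis using kle by linarith
  qed
  have kq: "real N * q \<le> real N - 2 * real k" using kle by (simp add: field_simps)
  have b1: "measure_pmf.prob ?P B1 \<le> exp (- r * real N) + 1 / real N"
    unfolding B1_def Z_def by (rule partition_lower_whp[OF _ _ dv M \<beta> \<delta>(1) ann r N2 N R]) (use p l in auto)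
  have b2: "measure_pmf.prob ?P B2 \<le> 16 / q * (real N * (real (N * l) + 1)) * exp (- real N * \<Delta> / 4)"
  proof -
    define U where "U = (real (N * l) + 1) * exp (real N * (S + \<Delta> / 4))"
    have U0: "0 < U" by (simp add: U_def add_nonneg_pos)
    have "graph_mean p l N (pair_sum N M \<beta> k) \<le> real (N * l + 1) * exp (real N * pair_exponent p l \<beta> (real k / real N) z)"
      by (rule graph_mean_pair_sum_le[OF _ _ dv z kN N M]) (use p l in auto)
    also have "\<dots> \<le> real (N * l + 1) * exp (real N * (S + \<Delta> / 4))" using S by (intro mult_left_mono iffD2[OF exp_le_cancel_iff]) auto
    finally have "graph_mean p l N (pair_sum N M \<beta> k) \<le> U" by (simp add: U_def add.commute)
    then have "graph_mean p l N (tilted_sum N M \<beta> k \<alpha>) \<le> U powr (1 - \<alpha>) * exp (\<alpha> * (real N * phi p l ((2 - 1 / \<alpha>) * \<beta>)))"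
      using graph_mean_tilted_sum_le[OF _ dv M _ \<alpha>(2) U0] p \<alpha> by auto
    also have "\<dots> \<le> (real (N * l) + 1) * exp (real N * ((1 - \<alpha>) * (S + \<Delta> / 4))) * exp (\<alpha> * (real N * phi p l ((2 - 1 / \<alpha>) * \<beta>)))"
    proof (intro mult_right_mono)
      have "U powr (1 - \<alpha>) = (real (N * l) + 1) powr (1 - \<alpha>) * exp (real N * ((1 - \<alpha>) * (S + \<Delta> / 4)))"
        unfolding U_def by (subst powr_mult) (auto simp: powr_def[of "exp _"] mult_ac)
      also have "\<dots> \<le> (real (N * l) + 1) * exp (real N * ((1 - \<alpha>) * (S + \<Delta> / 4)))"
        using powr_mono[of "1 - \<alpha>" 1 "real (N * l) + 1"] \<alpha> by (intro mult_right_mono) auto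
      finally show "U powr (1 - \<alpha>) \<le> (real (N * l) + 1) * exp (real N * ((1 - \<alpha>) * (S + \<Delta> / 4)))" .
    qed auto
    \<comment> \<open>The terms with \<phi>(2 \<beta>) cancel in \<Delta>, which equals
      \<phi>(\<beta>) - (1 - \<alpha>) S - \<alpha> \<phi>((2 - 1 / \<alpha>) \<beta>).\<close>
    also have "\<dots> = (real (N * l) + 1) * exp (real N * (phi p l \<beta> - \<Delta> + (1 - \<alpha>) * \<Delta> / 4))"
      unfolding \<Delta>(1) phi_hat_def mult.assoc exp_add[symmetric] by (simp add: algebra_simps)
    also have "\<dots> \<le> (real (N * l) + 1) * exp (real N * (phi p l \<beta> - \<Delta> + \<Delta> / 8))"
    proof -
      have "(1 - \<alpha>) * \<Delta> \<le> 1 / 2 * \<Delta>" using \<alpha> \<Delta>(2) by (intro mult_right_mono) auto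
      then show ?thesis by (intro mult_left_mono iffD2[OF exp_le_cancel_iff]) auto
    qed
    finally have T: "graph_mean p l N (tilted_sum N M \<beta> k \<alpha>) \<le> (real (N * l) + 1) * exp (real N * (phi p l \<beta> - \<Delta> + \<Delta> / 8))" .
    have w: "w \<le> real N * exp (real N * (\<Delta> / 2))"
    proof -
      have "real N powr (1 - \<alpha>) \<le> real N" using powr_mono[of "1 - \<alpha>" 1 "real N"] \<alpha> N by auto
      moreover have "t powr (1 - \<alpha>) \<le> exp (real N * \<Delta>) powr (1 - \<alpha>)"
        using t \<alpha> by (intro powr_mono2) auto
      moreover have "exp (real N * \<Delta>) powr (1 - \<alpha>) \<le> exp (real N * (\<Delta> / 2))"
      proof -
        have "(1 - \<alpha>) * (real N * \<Delta>) \<le> 1 / 2 * (real N * \<Delta>)" using \<alpha> \<Delta>(2) by (intro mult_right_mono) auto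
        then show ?thesis by (simp add: powr_def)
      qed
      ultimately show ?thesis unfolding w_def using t(1) by (subst powr_mult) (auto intro!: mult_mono)
    qed
    let ?f = "\<lambda>G J. tilted_sum N M \<beta> k \<alpha> G J * w"
    have w0: "0 \<le> w" by (simp add: w_def)
    have "graph_mean p l N ?f = w * graph_mean p l N (tilted_sum N M \<beta> k \<alpha>)"
      unfolding graph_mean_def case_prod_unfold by simp
    also have "\<dots> \<le> (real N * exp (real N * (\<Delta> / 2))) * ((real (N * l) + 1) * exp (real N * (phi p l \<beta> - \<Delta> + \<Delta> / 8)))"
      using w T w0 by (intro mult_mono') (auto simp: graph_mean_def tilted_sum_def intro!: Bochner_Integration.integral_nonneg sum_nonneg)
    finally have m: "graph_mean p l N ?f \<le> (real N * exp (real N * (\<Delta> / 2))) * ((real (N * l) + 1) * exp (real N * (phi p l \<beta> - \<Delta> + \<Delta> / 8)))" .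
    have f0: "0 \<le> ?f G J" for G J
      using w0 unfolding tilted_sum_def by (intro mult_nonneg_nonneg sum_nonneg) auto
    have "measure_pmf.prob ?P B2 \<le> (real N * exp (real N * (\<Delta> / 2))) * ((real (N * l) + 1) * exp (real N * (phi p l \<beta> - \<Delta> + \<Delta> / 8))) / (q / 16 * Z)"
      unfolding B2_def using prob_disorder_markov[OF _ f0 m, of "q / 16 * Z"] q Z0 by auto
    also have "\<dots> = 16 / q * (real N * (real (N * l) + 1)) * exp (real N * (\<Delta> / 2) + real N * (phi p l \<beta> - \<Delta> + \<Delta> / 8) - real N * (phi p l \<beta> - 3 * \<delta>))"
      unfolding Z_def exp_add exp_diff by (simp add: field_simps)
    \<comment> \<open>The exponents per spin: \<Delta> / 2 from the time, since 1 - \<alpha> < 1 /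
      2; - \<Delta> + \<Delta> / 8 from the mean of the escape sum; at most \<Delta> / 8 from the
      lower bound on Z.\<close>
    also have "\<dots> \<le> 16 / q * (real N * (real (N * l) + 1)) * exp (- real N * \<Delta> / 4)"
    proof -
      have "real N * (3 * \<delta>) \<le> real N * (\<Delta> / 8)" using \<delta> by (intro mult_left_mono) auto
      then have "real N * (\<Delta> / 2) + real N * (phi p l \<beta> - \<Delta> + \<Delta> / 8) - real N * (phi p l \<beta> - 3 * \<delta>) \<le> - real N * \<Delta> / 4"
        by (simp add: algebra_simps)
      then show ?thesis using q by (intro mult_left_mono) auto
    qed
    finally show ?thesis .
  qed
  have b3: "measure_pmf.prob ?P B3 \<le> 8 / q * ((real N + 1) * (real (N * l) + 1)) * exp (- real N * c / 2)"
  proof -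
    have m: "graph_mean p l N (overlap_tail N M \<beta> (q / 2)) \<le> (real N + 1) * ((real (N * l) + 1) * exp (real N * (2 * phi p l \<beta> - c)))"
      by (rule graph_mean_overlap_tail_le[OF _ _ dv M N _ c g0 g]) (use p l q in auto)
    have "measure_pmf.prob ?P B3 \<le> (real N + 1) * ((real (N * l) + 1) * exp (real N * (2 * phi p l \<beta> - c))) / (q / 8 * Z\<^sup>2)"
      unfolding B3_def by (rule prob_disorder_markov[OF _ _ m])
        (use q Z0 in \<open>auto simp: overlap_tail_def intro!: sum_nonneg pair_sum_nonneg\<close>)
    also have "\<dots> = 8 / q * ((real N + 1) * (real (N * l) + 1)) * exp (real N * (2 * phi p l \<beta> - c) - (real N * (phi p l \<beta> - 3 * \<delta>) + real N * (phi p l \<beta> - 3 * \<delta>)))"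
      unfolding Z_def exp_add exp_diff power2_eq_square by (simp add: field_simps)
    \<comment> \<open>Z enters squared, so its bound costs 6 \<delta>, at most half of the gap
      c.\<close>
    also have "\<dots> \<le> 8 / q * ((real N + 1) * (real (N * l) + 1)) * exp (- real N * c / 2)"
    proof -
      have "real N * (6 * \<delta>) \<le> real N * (c / 2)" using \<delta> by (intro mult_left_mono) auto
      then have "real N * (2 * phi p l \<beta> - c) - (real N * (phi p l \<beta> - 3 * \<delta>) + real N * (phi p l \<beta> - 3 * \<delta>)) \<le> - real N * c / 2"
        by (simp add: algebra_simps)
      then show ?thesis using q by (intro mult_left_mono) auto
    qed
    finally show ?thesis .
  qed
  have sub: "- A \<inter> set_pmf ?P \<subseteq> B1 \<union> (B2 \<union> B3)"
  proof (rule subsetI, rule ccontr)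
    fix x assume x: "x \<in> - A \<inter> set_pmf ?P" "x \<notin> B1 \<union> (B2 \<union> B3)"
    obtain G J where [simp]: "x = (G, J)" by (cases x)
    interpret factor_model N M G J \<beta> unfolding M by (rule factor_model_disorder) (use x in auto)
    have "real N * (q / 4) \<le> (\<Sum>i<N. correlation \<beta> N M G J i t)"
      by (rule sum_correlation_lower[of t \<alpha> q k Z])
        (use x t \<alpha> q kq Z0 in \<open>auto simp: B1_def B2_def B3_def part_def w_def\<close>)
    then have "real N * (q / 4 - \<epsilon>) \<le> real (card {i. i < N \<and> ereal t \<le> correlation_time \<beta> N M G J i \<epsilon>})"
      by (rule card_slow_ge[OF t(1) _ \<epsilon>])
    then show False using x by (simp add: A_def)
  qed
  have "measure_pmf.prob ?P (- A) = measure_pmf.prob ?P (- A \<inter> set_pmf ?P)" by (simp add: measure_Int_set_pmf)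
  also have "\<dots> \<le> measure_pmf.prob ?P (B1 \<union> (B2 \<union> B3))"
    by (rule measure_pmf.finite_measure_mono[OF sub]) simp
  also have "\<dots> \<le> measure_pmf.prob ?P B1 + (measure_pmf.prob ?P B2 + measure_pmf.prob ?P B3)"
    by (intro order_trans[OF measure_Un_le] add_mono order_refl) auto
  finally have "measure_pmf.prob ?P (- A) \<le> measure_pmf.prob ?P B1 + (measure_pmf.prob ?P B2 + measure_pmf.prob ?P B3)" .
  moreover have "measure_pmf.prob ?P (- A) = 1 - measure_pmf.prob ?P A"
    using measure_pmf.prob_compl[of A ?P] by (simp add: Compl_eq_Diff_UNIV)
  ultimately show ?thesis using b1 b2 b3 unfolding A_def by linarith
qed

text \<open>The constants are \<open>\<Upsilon>\<close> = \<Delta>, the gain at the chosen \<alpha>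
  and q, and \<open>qstar\<close> = q / 4. The bound is proved at rate \<Delta> and fraction q / 4 -
  \<epsilon>; a positive \<delta> weakens both.\<close>

lemma slow_relaxation:
  assumes p: "3 \<le> p" and l: "3 \<le> l" and \<beta>: "0 < \<beta>"
    and ann: "T_ann p l < ereal (1 / \<beta>)" and barr: "ereal (1 / \<beta>) < T_barr p l"
  shows "\<exists>qstar > 0. \<exists>\<Upsilon> > 0. \<forall>\<epsilon>\<in>{0<..<1}. \<forall>\<delta>\<in>{0<..<1/4}.
    with_high_prob p l (\<lambda>N G J.
      real (card {i. i < N \<and> ereal (exp (real N * (\<Upsilon> - \<delta>))) \<le> correlation_time \<beta> N (num_funs p l N) G J i \<epsilon>})
      \<ge> real N * (qstar - \<delta> - \<epsilon>))"
proof -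
  have ann': "ereal \<beta> < beta_ann p l" by (rule T_ann_less[OF _ _ \<beta> ann]) (use p l in auto)
  obtain \<alpha> q where \<alpha>: "1 / 2 < \<alpha>" "\<alpha> < 1" and q: "0 < q" "q < 1"
    and gain: "phi_hat p l \<beta> \<alpha> < (1 - \<alpha>) * (phi p l (2 * \<beta>) - phi_overlap_open p l q \<beta>)"
    using less_T_barr[OF p l \<beta> barr] by blast
  define S where "S = phi_overlap_open p l q \<beta>"
  define \<Delta> where "\<Delta> = (1 - \<alpha>) * (phi p l (2 * \<beta>) - S) - phi_hat p l \<beta> \<alpha>"
  have \<Delta>: "0 < \<Delta>" using gain by (simp add: \<Delta>_def S_def)
  define z where "z = z_overlap p \<beta> q"
  have z: "0 < z" unfolding z_def by (rule z_overlap) (use p q in auto)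
  obtain c where c: "0 < c" "phi p l (2 * \<beta>) \<le> 2 * phi p l \<beta> - c"
    and g: "\<And>r. q / 2 \<le> r \<Longrightarrow> r < 1 \<Longrightarrow> \<exists>z>0. pair_exponent p l \<beta> ((1 - r) / 2) z \<le> 2 * phi p l \<beta> - c"
    using overlap_gap[OF _ _ \<beta> ann', of "q / 2"] p l q by auto
  \<comment> \<open>The accuracy of the lower bound on Z, small enough for both Markov estimates. It
    is fixed here and unrelated to the \<delta> of the statement.\<close>
  define d where "d = min (\<Delta> / 24) (c / 12)"
  have d: "0 < d" "3 * d \<le> \<Delta> / 8" "6 * d \<le> c / 2" using \<Delta> c by (auto simp: d_def)
  define r where "r = real p * d\<^sup>2 / (2 * \<beta>\<^sup>2 * real l)"
  have r: "0 < r" using p l \<beta> d by (simp add: r_def)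
  define R where "R = (\<lambda>N. real N * ((real N + 1) * (real (N * l) + 1)))"
  define k where "k = (\<lambda>N. nat \<lfloor>(1 - q) / 2 * real N\<rfloor>)"
  define err where "err = (\<lambda>N. exp (- r * real N) + 1 / real N + 16 / q * (real N * (real (N * l) + 1)) * exp (- real N * \<Delta> / 4)
        + 8 / q * ((real N + 1) * (real (N * l) + 1)) * exp (- real N * c / 2))"
  have err: "(\<lambda>N. 1 - err N) \<longlonglongrightarrow> 1"
  proof -
    have "err \<longlonglongrightarrow> 0" unfolding err_def of_nat_mult using r \<Delta> c q l by real_asymp
    from tendsto_diff[OF tendsto_const this] show ?thesis by simp
  qed
  have "eventually (\<lambda>N. pair_exponent p l \<beta> (real (k N) / real N) z < S + \<Delta> / 4) sequentially"
    unfolding k_def by (rule order_tendstoD[OF tendsto_pair_exponent])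
      (use q \<Delta> in \<open>auto simp: S_def z_def phi_overlap_open_eq\<close>)
  moreover have "eventually (\<lambda>N. 4 * R N * exp (- r * real N) < 1) sequentially"
  proof -
    have "(\<lambda>N. 4 * R N * exp (- r * real N)) \<longlonglongrightarrow> 0"
      unfolding R_def of_nat_mult using r l by real_asymp
    then show ?thesis by (rule order_tendstoD) simp
  qed
  moreover have "eventually (\<lambda>N. ln 2 \<le> d * real N) sequentially" using d by real_asymp
  moreover note eventually_gt_at_top[of "0 :: nat"]
  ultimately have good: "eventually (\<lambda>N. pair_exponent p l \<beta> (real (k N) / real N) z \<le> S + \<Delta> / 4 \<and>
      4 * R N * exp (- r * real N) < 1 \<and> ln 2 \<le> d * real N \<and> 0 < N) sequentially"
    by eventually_elim auto
  have "with_high_prob p l (\<lambda>N G J.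
      real (card {i. i < N \<and> ereal (exp (real N * (\<Delta> - \<delta>))) \<le> correlation_time \<beta> N (num_funs p l N) G J i \<epsilon>})
      \<ge> real N * (q / 4 - \<delta> - \<epsilon>))" if \<epsilon>: "\<epsilon> \<in> {0<..<1}" and \<delta>: "\<delta> \<in> {0<..<1/4}" for \<epsilon> \<delta>
    unfolding with_high_prob_def
  proof (rule tendsto_sandwich[where h = "\<lambda>_. 1"])
    show "((\<lambda>N. 1 - err N) \<longlongrightarrow> 1) (inf sequentially (principal {N. p dvd N * l}))"
      by (rule filterlim_mono[OF err]) auto
    show "eventually (\<lambda>N. 1 - err N \<le> measure_pmf.prob (disorder_pmf p l N) {(G, J).
      real (card {i. i < N \<and> ereal (exp (real N * (\<Delta> - \<delta>))) \<le> correlation_time \<beta> N (num_funs p l N) G J i \<epsilon>})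
      \<ge> real N * (q / 4 - \<delta> - \<epsilon>)}) (inf sequentially (principal {N. p dvd N * l}))"
      unfolding eventually_inf_principal using good
    proof eventually_elim
      case (elim N)
      show ?case
      proof
        assume "N \<in> {N. p dvd N * l}"
        then have dv: "p dvd N * l" by simp
        let ?c = "\<lambda>G J. real (card {i. i < N \<and> ereal (exp (real N * (\<Delta> - \<delta>))) \<le> correlation_time \<beta> N (num_funs p l N) G J i \<epsilon>})"
        have "1 - err N \<le> measure_pmf.prob (disorder_pmf p l N) {(G, J). real N * (q / 4 - \<epsilon>) \<le> ?c G J}"
          unfolding err_def
          by (rule prob_slow_ge[OF p l \<beta> ann' dv refl _ \<alpha> q k_def[THEN fun_cong] \<Delta>_def \<Delta> z _ c g d r_def _ R_def[THEN fun_cong]])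
            (use elim \<epsilon> \<delta> in \<open>auto intro!: mult_left_mono\<close>)
        also have "\<dots> \<le> measure_pmf.prob (disorder_pmf p l N) {(G, J). real N * (q / 4 - \<delta> - \<epsilon>) \<le> ?c G J}"
        proof (rule measure_pmf.finite_measure_mono)
          have "real N * (q / 4 - \<delta> - \<epsilon>) \<le> real N * (q / 4 - \<epsilon>)" using \<delta> by (intro mult_left_mono) auto
          then show "{(G, J). real N * (q / 4 - \<epsilon>) \<le> ?c G J} \<subseteq> {(G, J). real N * (q / 4 - \<delta> - \<epsilon>) \<le> ?c G J}" by auto
        qed simp
        finally show "1 - err N \<le> measure_pmf.prob (disorder_pmf p l N) {(G, J). real N * (q / 4 - \<delta> - \<epsilon>) \<le> ?c G J}" .
      qed
    qed
  qed (auto intro!: always_eventually simp: case_prod_unfold)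
  then show ?thesis using \<Delta> q by (intro exI[of _ "q / 4"] exI[of _ \<Delta>] conjI ballI) auto
qed

theorem proposition2:
  fixes p l :: nat and \<beta> T :: real
  assumes "3 \<le> p" and "3 \<le> l" and "0 < \<beta>" and "T = 1 / \<beta>"
  shows "(T_fast p l < T \<longrightarrow>
            (let \<kappa> = 1 - real l * (real p - 1) * tanh \<beta> in
             \<forall>N. p dvd N * l \<longrightarrow> (\<forall>(G, J) \<in> set_pmf (disorder_pmf p l N).
               \<forall>i<N. \<forall>\<epsilon>\<in>{0<..<1}.
                 correlation_time \<beta> N (num_funs p l N) G J i \<epsilon> \<le> ereal (1 / \<kappa> * ln (1 / (\<kappa> * \<epsilon>))))))
       \<and> (T_ann p l < ereal T \<and> ereal T < T_barr p l \<longrightarrow>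
            (\<exists>qstar > 0. \<exists>\<Upsilon> > 0. \<forall>\<epsilon>\<in>{0<..<1}. \<forall>\<delta>\<in>{0<..<1/4}.
               with_high_prob p l (\<lambda>N G J.
                 real (card {i. i < N \<and>
                   ereal (exp (real N * (\<Upsilon> - \<delta>))) \<le> correlation_time \<beta> N (num_funs p l N) G J i \<epsilon>})
                 \<ge> real N * (qstar - \<delta> - \<epsilon>))))"
  using fast_relaxation[OF assms(1-3) _ refl] slow_relaxation[OF assms(1-3)] unfolding assms(4) Let_def by blast

end
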